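(* Let $\rho=\rho(T)>0$ be a function of $T$ such that $\rho\to 0$ as $T\to\infty$ but $\rho\gg T^{-\delta}$ for all $\delta>0$ (i.e. for every $\delta>0$ there is $c_\delta>0$ with $\rho(T)\ge c_\delta T^{-\delta}$ for all sufficiently large $T$). Put $\sigma^2=16\rho\log\frac1\rho$, $\sigma>0$. Then for any interval $\mathcal A\subset\mathbb R$, $$\lim_{T\to\infty}\frac1T\operatorname{meas}\left\{t\in[T,2T]\ :\ \frac{S(t,\rho)}{\sigma}\in\mathcal A\right\}=\frac1{\sqrt{2\pi}}\int_{\mathcal A}e^{-x^2/2}\,dx .$$
   Context: For $t>0$, $N(t)$ is the number of points of $\mathbb Z^2$ in the disk of radius $t$ centered at the origin, i.e. $N(t)=\#\{\vec n\in\mathbb Z^2: |\vec n|\le t\}$. For $t,\rho>0$, $$S(t,\rho):=\frac{N(t+\rho)-N(t)-\pi(2t\rho+\rho^2)}{\sqrt t}.$$ $\operatorname{meas}$ denotes Lebesgue measure. The width $\rho=\rho(T)$ and $\sigma=\sigma(T)$ depend only on $T$, and are constant as $t$ varies in $[T,2T]$. *)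

theory Defs
  imports "HOL-Analysis.Analysis"
begin

text \<open>The norm on \<^typ>\<open>real \<times> real\<close> is the Euclidean one, and the set counted is
  always finite.\<close>

definition lattice_count :: "real \<Rightarrow> nat" where
  "lattice_count t = card {n :: int \<times> int. norm (real_of_int (fst n), real_of_int (snd n)) \<le> t}"

definition annulus_remainder :: "real \<Rightarrow> real \<Rightarrow> real" where
  "annulus_remainder t \<rho> =
     (real (lattice_count (t + \<rho>)) - real (lattice_count t) - pi * (2 * t * \<rho> + \<rho>\<^sup>2)) / sqrt t"

end

theory Submission
 imports Defs
  "HOL-Probability.Probability"
  "HOL-Complex_Analysis.Complex_Analysis"
  "HOL-Real_Asymp.Real_Asymp"
  "HOL-Number_Theory.Number_Theory"
  "HOL-Computational_Algebra.Squarefree"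
  "HOL-Library.Real_Mod"
begin

text \<open>
 Smoothing with a Fejer kernel does not change the lattice point count off a set of \<open>t\<close> of bounded
 measure, and expresses it through the Fourier transform of the disc. Hence \<open>S(t, \<rho>)\<close> is, up to
 \<open>O(T powr (- 1/2))\<close>, the real part of a finite sum of \<open>c n * cis (2 * pi * sqrt n * t)\<close>, where
 \<open>c n\<close> is essentially the number \<open>r(n)\<close> of representations of \<open>n\<close> as a sum of two squares times
 \<open>n powr (- 3/4) * sin (pi * sqrt n * \<rho>)\<close>. By the asymptotics \<open>4 x ln x\<close> of the partial sums of
 \<open>r(n)\<^sup>2\<close>, the mean square is \<open>\<sigma>\<^sup>2\<close> and is concentrated on \<open>n\<close> of size \<open>\<rho> powr (- 2)\<close>, a tiny power of
 \<open>T\<close>. The roots of distinct squarefree numbers are linearly independent over the rationals, in a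
 quantitative form, so for these \<open>n\<close> the moments over \<open>[T, 2T]\<close> agree with those of a model with
 one independent phase for each squarefree part. No squarefree part dominates, so the model is
 asymptotically Gaussian, and the continuity theorem of Levy applies.\<close>

section \<open>Integer combinations of square roots\<close>

text \<open>Two requirements pull in opposite directions. Resonances are controlled only among
  indices n all of whose powers are o(T), while removing the smoothing error takes a kernel of
  degree about T^8. They are reconciled by a window N/K < n <= K N with N = \<open>\<rho>\<close>
  powr (- 2), for which the lower bound on \<open>\<rho>\<close> gives N^j = o(T) for every j.
  Inside it moments of every order are compared with the model; outside it only a mean square O(1 /
  sqrt K) is estimated, so K grows after T. Numbers with a small squarefree part, whose blocks might
  be too large, are also moved into this discarded part. The exceptional set is bounded because the
  count jumps only at radii sqrt m with m = O(T^2), each removed with a neighbourhood of length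
  O(T^(-2)). As for the constant 16: in terms of N it reads \<open>\<sigma>\<close>^2 = 8 ln N /
  sqrt N, and the variance of the window then tends to the integral of sin(pi sqrt y)^2 y^(-3/2)
  over [1/K, K] divided by pi^2, where the integral over the half line is pi^2. The Gaussian mean
  square rests on an elementary identity: r(n)^2 is a Dirichlet convolution with r as one factor,
  read off from pairs of Gaussian integers of equal norm.\<close>

fun sqrt_ring :: "nat list \<Rightarrow> real \<Rightarrow> real \<Rightarrow> bool" where
 "sqrt_ring [] A x \<longleftrightarrow> (\<exists>z::int. x = of_int z \<and> \<bar>x\<bar> \<le> A)"
| "sqrt_ring (q # qs) A x \<longleftrightarrow>
   (\<exists>u v. sqrt_ring qs A u \<and> sqrt_ring qs A v \<and> x = u + v * sqrt (real q))"

lemma sqrt_ring_nonneg: "sqrt_ring qs A x \<Longrightarrow> 0 \<le> A"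
 by (induction qs arbitrary: x) auto

lemma sqrt_ring_mono: "sqrt_ring qs A x \<Longrightarrow> A \<le> B \<Longrightarrow> sqrt_ring qs B x"
proof (induction qs arbitrary: x)
 case Nil then show ?case by auto
next
 case (Cons q qs)
 from Cons.prems obtain u v where "sqrt_ring qs A u" "sqrt_ring qs A v" "x = u + v * sqrt (real q)"
  by auto
 with Cons.IH Cons.prems(2) show ?case unfolding sqrt_ring.simps by blast
qed

lemma sqrt_ring_of_int: "\<bar>of_int z\<bar> \<le> A \<Longrightarrow> sqrt_ring qs A (of_int z)"
proof (induction qs arbitrary: z)
 case Nil then show ?case by auto
next
 case (Cons q qs)
 have "sqrt_ring qs A (of_int z)" using Cons by blast
 moreover have "sqrt_ring qs A (of_int 0)" using Cons by (intro Cons.IH) auto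
 ultimately show ?case unfolding sqrt_ring.simps
  by (intro exI[of _ "of_int z"] exI[of _ "of_int 0"]) auto
qed

lemma sqrt_ring_add: "sqrt_ring qs A x \<Longrightarrow> sqrt_ring qs B y \<Longrightarrow> sqrt_ring qs (A + B) (x + y)"
proof (induction qs arbitrary: x y)
 case Nil
 then obtain a b :: int where "x = of_int a" "\<bar>x\<bar> \<le> A" "y = of_int b" "\<bar>y\<bar> \<le> B" by auto
 then show ?case by (auto intro!: exI[of _ "a + b"])
next
 case (Cons q qs)
 from Cons.prems obtain u v u' v' where *: "sqrt_ring qs A u" "sqrt_ring qs A v"
   "x = u + v * sqrt (real q)" "sqrt_ring qs B u'" "sqrt_ring qs B v'" "y = u' + v' * sqrt (real q)"
  by auto
 have "sqrt_ring qs (A + B) (u + u')" "sqrt_ring qs (A + B) (v + v')" using Cons.IH * by auto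
 moreover have "x + y = (u + u') + (v + v') * sqrt (real q)" using * by (simp add: algebra_simps)
 ultimately show ?case by auto
qed

lemma sqrt_ring_of_int_mult:
 "sqrt_ring qs A x \<Longrightarrow> \<bar>of_int k\<bar> \<le> B \<Longrightarrow> sqrt_ring qs (B * A) (of_int k * x)"
proof (induction qs arbitrary: x)
 case Nil
 then obtain a :: int where "x = of_int a" "\<bar>x\<bar> \<le> A" by auto
 moreover have "\<bar>of_int k * x\<bar> \<le> B * A" using Nil calculation
  unfolding abs_mult by (intro mult_mono) auto
 ultimately show ?case by (auto intro!: exI[of _ "k * a"])
next
 case (Cons q qs)
 from Cons.prems obtain u v where *: "sqrt_ring qs A u" "sqrt_ring qs A v" "x = u + v * sqrt (real q)"
  by auto
 have "sqrt_ring qs (B * A) (of_int k * u)" "sqrt_ring qs (B * A) (of_int k * v)"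
  using Cons.IH Cons.prems * by auto
 moreover have "of_int k * x = of_int k * u + (of_int k * v) * sqrt (real q)"
  using * by (simp add: algebra_simps)
 ultimately show ?case by auto
qed

text \<open>\<open>sqrt_ring qs A\<close> collects the elements of the ring generated by the listed
  roots that admit some expansion into integer coefficients of size at most \<open>A\<close>. Being
  a predicate on reals, it tolerates dependent roots, for which expansions are not unique. In a
  product the two parts are u u' + q v v' and u v' + v u', so each root multiplies the coefficient
  bound by 1 + M.\<close>

lemma sqrt_ring_mult:
 assumes "sqrt_ring qs A x" "sqrt_ring qs B y" "\<forall>q\<in>set qs. real q \<le> M" "1 \<le> M"
 shows "sqrt_ring qs ((1 + M) ^ length qs * A * B) (x * y)"
 using assms
proof (induction qs arbitrary: x y)
 case Nil
 then obtain a b :: int where "x = of_int a" "\<bar>x\<bar> \<le> A" "y = of_int b" "\<bar>y\<bar> \<le> B" by auto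
 moreover have "\<bar>x * y\<bar> \<le> A * B" using calculation unfolding abs_mult by (intro mult_mono) auto
 ultimately show ?case by (auto intro!: exI[of _ "a * b"])
next
 case (Cons q qs)
 from Cons.prems obtain u v u' v' where *: "sqrt_ring qs A u" "sqrt_ring qs A v"
   "x = u + v * sqrt (real q)" "sqrt_ring qs B u'" "sqrt_ring qs B v'" "y = u' + v' * sqrt (real q)"
  by auto
 define C where "C = (1 + M) ^ length qs * A * B"
 have C0: "0 \<le> C" unfolding C_def using sqrt_ring_nonneg Cons.prems by auto
 have m: "sqrt_ring qs C (a * b)" if "sqrt_ring qs A a" "sqrt_ring qs B b" for a b
  unfolding C_def using Cons.IH that Cons.prems by auto
 have q: "\<bar>real_of_int (int q)\<bar> \<le> M" using Cons.prems by auto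
 have 1: "sqrt_ring qs (C + M * C) (u * u' + of_int (int q) * (v * v'))"
  by (intro sqrt_ring_add sqrt_ring_of_int_mult m * q)
 have "sqrt_ring qs (C + C) (u * v' + v * u')"
  by (intro sqrt_ring_add m *)
 moreover have "C + C \<le> C + M * C" using C0 Cons.prems(4) mult_right_mono[of 1 M C] by auto
 ultimately have 2: "sqrt_ring qs (C + M * C) (u * v' + v * u')" using sqrt_ring_mono by blast
 have 3: "x * y = (u * u' + of_int (int q) * (v * v')) + (u * v' + v * u') * sqrt (real q)"
  unfolding * by (simp add: algebra_simps)
 have 4: "(1 + M) ^ length (q # qs) * A * B = C + M * C" unfolding C_def by (simp add: algebra_simps)
 show ?case unfolding 4 unfolding sqrt_ring.simps using 1 2 3 by blast
qed

lemma sqrt_ring_upper: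
 assumes "sqrt_ring qs A x" "\<forall>q\<in>set qs. real q \<le> M" "1 \<le> M"
 shows "\<bar>x\<bar> \<le> A * (1 + M) ^ length qs"
 using assms
proof (induction qs arbitrary: x)
 case Nil then show ?case by auto
next
 case (Cons q qs)
 from Cons.prems obtain u v where *: "sqrt_ring qs A u" "sqrt_ring qs A v" "x = u + v * sqrt (real q)"
  by auto
 have u: "\<bar>u\<bar> \<le> A * (1 + M) ^ length qs" "\<bar>v\<bar> \<le> A * (1 + M) ^ length qs"
  using Cons * by auto
 have "sqrt (real q) \<le> sqrt (M ^ 2)" using Cons.prems
  by (intro real_sqrt_le_mono) (auto intro: order_trans[of _ M] simp: self_le_power)
 then have s: "sqrt (real q) \<le> M" using Cons.prems by simp
 have "\<bar>x\<bar> \<le> \<bar>u\<bar> + \<bar>v\<bar> * sqrt (real q)" using * by (simp add: abs_mult order_trans[OF abs_triangle_ineq])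
 also have "\<dots> \<le> A * (1 + M) ^ length qs + (A * (1 + M) ^ length qs) * M"
  using u s by (intro add_mono mult_mono) (auto intro: order_trans[OF abs_ge_zero])
 also have "\<dots> = A * (1 + M) ^ length (q # qs)" by (simp add: algebra_simps)
 finally show ?case .
qed

text \<open>Multiplying by the conjugate removes one square root at a time; a vanishing conjugate forces
 \<open>x = 2 u\<close>. So no linear independence is needed for this bound.\<close>

lemma sqrt_ring_lower:
 "\<exists>E. \<forall>qs A M x. length qs = k \<longrightarrow> sqrt_ring qs A x \<longrightarrow> (\<forall>q\<in>set qs. real q \<le> M) \<longrightarrow> 1 \<le> M
   \<longrightarrow> 1 \<le> A \<longrightarrow> x \<noteq> 0 \<longrightarrow> 1 \<le> \<bar>x\<bar> * (A * (1 + M)) ^ E"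
proof (induction k)
 case 0
 show ?case by (rule exI[of _ 0]) auto
next
 case (Suc k)
 then obtain E where E: "\<And>qs A M x. length qs = k \<Longrightarrow> sqrt_ring qs A x \<Longrightarrow> (\<forall>q\<in>set qs. real q \<le> M)
   \<Longrightarrow> 1 \<le> M \<Longrightarrow> 1 \<le> A \<Longrightarrow> x \<noteq> 0 \<Longrightarrow> 1 \<le> \<bar>x\<bar> * (A * (1 + M)) ^ E" by blast
 show ?case
 proof (intro exI[of _ "(k + 2) * E + (k + 1)"] allI impI)
  \<comment> \<open>The exponent has two sources: the norm x x' lies in the smaller ring with
    coefficients controlled by W^(k + 2), to which the induction hypothesis applies, and the
    conjugate itself is at most W^(k + 1).\<close>
  fix qs' A M x
  assume len: "length qs' = Suc k" and sr: "sqrt_ring qs' A x" and le: "\<forall>q\<in>set qs'. real q \<le> M"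
   and M: "1 \<le> M" and A: "1 \<le> A" and x: "x \<noteq> (0::real)"
  obtain q qs where qs': "qs' = q # qs" and lq: "length qs = k" using len by (cases qs') auto
  from sr qs' obtain u v where *: "sqrt_ring qs A u" "sqrt_ring qs A v" "x = u + v * sqrt (real q)"
   by auto
  have le': "\<forall>q\<in>set qs. real q \<le> M" and qM: "real q \<le> M" using le qs' by auto
  define W where "W = A * (1 + M)"
  have W1: "1 \<le> W" unfolding W_def using A M by (intro mult_ge1_I) auto
  define x' where "x' = u - v * sqrt (real q)"
  show "1 \<le> \<bar>x\<bar> * (A * (1 + M)) ^ ((k + 2) * E + (k + 1))"
  proof (cases "x' = 0")
   case True
   then have "x = 2 * u" using * by (simp add: x'_def)
   then have "1 \<le> \<bar>u\<bar> * W ^ E" unfolding W_def using E[OF lq *(1) le' M A] x by auto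
   also have "\<dots> \<le> \<bar>x\<bar> * W ^ ((k + 2) * E + (k + 1))"
    using \<open>x = 2 * u\<close> W1 by (intro mult_mono power_increasing) auto
   finally show ?thesis unfolding W_def .
  next
   case False
   define B where "B = (1 + M) ^ length qs * A * A"
   have B0: "0 \<le> B" unfolding B_def using A M by auto
   have m: "sqrt_ring qs B (a * b)" if "sqrt_ring qs A a" "sqrt_ring qs A b" for a b
    unfolding B_def using sqrt_ring_mult[OF that le' M] .
   have "sqrt_ring qs (B + M * B) (u * u + of_int (- int q) * (v * v))"
    using qM by (intro sqrt_ring_add sqrt_ring_of_int_mult m *) auto
   moreover have "u * u + of_int (- int q) * (v * v) = x * x'"
    unfolding * x'_def by (simp add: algebra_simps)
   ultimately have s: "sqrt_ring qs (B + M * B) (x * x')" by simp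
   have BW: "(B + M * B) * (1 + M) \<le> W ^ (k + 2)"
   proof -
    have "(B + M * B) * (1 + M) = A ^ 2 * (1 + M) ^ (k + 2)"
     unfolding B_def lq by (simp add: algebra_simps power2_eq_square)
    also have "\<dots> \<le> A ^ (k + 2) * (1 + M) ^ (k + 2)" using A M
     by (intro mult_right_mono power_increasing) auto
    finally show ?thesis unfolding W_def power_mult_distrib .
   qed
   have "1 \<le> B" unfolding B_def using A M
    by (intro mult_ge1_I one_le_power) auto
   then have "1 \<le> B + M * B" using M B0 by (simp add: add_increasing2)
   then have "1 \<le> \<bar>x * x'\<bar> * ((B + M * B) * (1 + M)) ^ E"
    using E[OF lq s le' M] x False by auto
   also have "\<dots> \<le> \<bar>x * x'\<bar> * (W ^ (k + 2)) ^ E" using BW B0 M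
    by (intro mult_left_mono power_mono) auto
   finally have 1: "1 \<le> \<bar>x\<bar> * \<bar>x'\<bar> * W ^ ((k + 2) * E)" unfolding abs_mult power_mult .
   have "sqrt_ring (q # qs) A x'"
    unfolding sqrt_ring.simps x'_def
    using * sqrt_ring_of_int_mult[OF *(2), of "-1" 1] by (intro exI[of _ u] exI[of _ "-v"], auto)
   then have "\<bar>x'\<bar> \<le> A * (1 + M) ^ (k + 1)" using sqrt_ring_upper[of "q # qs" A x' M] le qs' M lq by auto
   also have "\<dots> \<le> A ^ (k + 1) * (1 + M) ^ (k + 1)" using A M
    by (intro mult_right_mono self_le_power) auto
   finally have "\<bar>x'\<bar> \<le> W ^ (k + 1)" unfolding W_def power_mult_distrib .
   then have "\<bar>x\<bar> * \<bar>x'\<bar> * W ^ ((k + 2) * E) \<le> \<bar>x\<bar> * W ^ (k + 1) * W ^ ((k + 2) * E)"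
    using W1 by (intro mult_right_mono mult_left_mono) auto
   with 1 have "1 \<le> \<bar>x\<bar> * W ^ ((k + 2) * E + (k + 1))" by (simp add: power_add mult_ac)
   then show ?thesis unfolding W_def .
  qed
 qed
qed

lemma sqrt_ring_sum:
 assumes "\<forall>i<j. \<bar>e i\<bar> \<le> (1::int)"
 shows "sqrt_ring (map n (rev [0..<j])) 1 (\<Sum>i<j. of_int (e i) * sqrt (real (n i)))"
 using assms
proof (induction j)
 case 0 then show ?case by (auto intro!: exI[of _ 0])
next
 case (Suc j)
 have "sqrt_ring (map n (rev [0..<j])) 1 (\<Sum>i<j. of_int (e i) * sqrt (real (n i)))"
  using Suc by auto
 moreover have "sqrt_ring (map n (rev [0..<j])) 1 (of_int (e j))"
 proof (rule sqrt_ring_of_int)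
  have "\<bar>e j\<bar> \<le> 1" using Suc.prems by simp
  then show "\<bar>real_of_int (e j)\<bar> \<le> 1" by linarith
 qed
 ultimately show ?case by auto
qed

text \<open>The exponent depends on the number of terms alone. Hence a nonzero frequency coming from
  a monomial of degree j is at least a fixed negative power of 1 + M, uniformly in the numbers under
  the roots; this quantitative form is what bounds the oscillating integrals below.\<close>

lemma sum_sqrt_lower:
 fixes j :: nat
 shows
 "\<exists>E. \<forall>M e n. 1 \<le> M \<longrightarrow> (\<forall>i<j. \<bar>e i\<bar> \<le> (1::int)) \<longrightarrow> (\<forall>i<j. real (n i) \<le> M) \<longrightarrow>
   (\<Sum>i<j. of_int (e i) * sqrt (real (n i))) \<noteq> 0 \<longrightarrow>
   1 \<le> \<bar>\<Sum>i<j. of_int (e i) * sqrt (real (n i))\<bar> * (1 + M) ^ E"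
proof -
 obtain E where E: "\<And>qs A M x. length qs = j \<Longrightarrow> sqrt_ring qs A x \<Longrightarrow> (\<forall>q\<in>set qs. real q \<le> M)
   \<Longrightarrow> 1 \<le> M \<Longrightarrow> 1 \<le> A \<Longrightarrow> x \<noteq> 0 \<Longrightarrow> 1 \<le> \<bar>x\<bar> * (A * (1 + M)) ^ E" using sqrt_ring_lower by blast
 show ?thesis
  using E[OF _ sqrt_ring_sum] by (intro exI[of _ E]) auto
qed

subsection \<open>Linear independence of the roots of squarefree numbers\<close>

fun sqrt_field :: "nat list \<Rightarrow> real set" where
 "sqrt_field [] = \<rat>"
| "sqrt_field (p # ps) = {u + v * sqrt (real p) | u v. u \<in> sqrt_field ps \<and> v \<in> sqrt_field ps}"

lemma sqrt_field_Cons: "x \<in> sqrt_field (p # ps) \<longleftrightarrow>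
  (\<exists>u v. u \<in> sqrt_field ps \<and> v \<in> sqrt_field ps \<and> x = u + v * sqrt (real p))"
 by auto

lemma Rats_sqrt_field: "x \<in> \<rat> \<Longrightarrow> x \<in> sqrt_field ps"
proof (induction ps arbitrary: x)
 case (Cons p ps)
 have "(0::real) \<in> sqrt_field ps" using Cons.IH by auto
 with Cons show ?case unfolding sqrt_field_Cons by (intro exI[of _ x] exI[of _ 0]) auto
qed auto

lemma sqrt_field_subset: "x \<in> sqrt_field ps \<Longrightarrow> x \<in> sqrt_field (p # ps)"
 unfolding sqrt_field_Cons using Rats_sqrt_field[of 0 ps] by (intro exI[of _ x] exI[of _ 0]) auto

lemma sqrt_field_add: "x \<in> sqrt_field ps \<Longrightarrow> y \<in> sqrt_field ps \<Longrightarrow> x + y \<in> sqrt_field ps"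
proof (induction ps arbitrary: x y)
 case (Cons p ps)
 then obtain u v u' v' where "u \<in> sqrt_field ps" "v \<in> sqrt_field ps" "x = u + v * sqrt (real p)"
  "u' \<in> sqrt_field ps" "v' \<in> sqrt_field ps" "y = u' + v' * sqrt (real p)"
  unfolding sqrt_field_Cons by blast
 then show ?case unfolding sqrt_field_Cons using Cons.IH
  by (intro exI[of _ "u + u'"] exI[of _ "v + v'"]) (auto simp: algebra_simps)
qed auto

lemma sqrt_field_mult: "x \<in> sqrt_field ps \<Longrightarrow> y \<in> sqrt_field ps \<Longrightarrow> x * y \<in> sqrt_field ps"
proof (induction ps arbitrary: x y)
 case (Cons p ps)
 then obtain u v u' v' where *: "u \<in> sqrt_field ps" "v \<in> sqrt_field ps" "x = u + v * sqrt (real p)"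
  "u' \<in> sqrt_field ps" "v' \<in> sqrt_field ps" "y = u' + v' * sqrt (real p)"
  unfolding sqrt_field_Cons by blast
 have p: "real p \<in> sqrt_field ps" by (rule Rats_sqrt_field) auto
 have "u * u' + real p * (v * v') \<in> sqrt_field ps" "u * v' + v * u' \<in> sqrt_field ps"
  using * p Cons.IH by (auto intro!: sqrt_field_add)
 moreover have "x * y = (u * u' + real p * (v * v')) + (u * v' + v * u') * sqrt (real p)"
  unfolding * by (simp add: algebra_simps)
 ultimately show ?case unfolding sqrt_field_Cons by blast
qed auto

lemma sqrt_field_uminus: "x \<in> sqrt_field ps \<Longrightarrow> - x \<in> sqrt_field ps"
 using sqrt_field_mult[of "-1" ps x] Rats_sqrt_field[of "-1" ps] by simp

lemma sqrt_field_diff: "x \<in> sqrt_field ps \<Longrightarrow> y \<in> sqrt_field ps \<Longrightarrow> x - y \<in> sqrt_field ps"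
 using sqrt_field_add[of x ps "-y"] sqrt_field_uminus[of y ps] by simp

text \<open>Rationalise with the conjugate. If the norm D vanishes then x is 0 or 2 u, which covers
  the case that the new root already lies in the smaller field.\<close>

lemma sqrt_field_inverse: "x \<in> sqrt_field ps \<Longrightarrow> inverse x \<in> sqrt_field ps"
proof (induction ps arbitrary: x)
 case (Cons p ps)
 then obtain u v where *: "u \<in> sqrt_field ps" "v \<in> sqrt_field ps" "x = u + v * sqrt (real p)"
  unfolding sqrt_field_Cons by blast
 have p: "real p \<in> sqrt_field ps" by (rule Rats_sqrt_field) auto
 define D where "D = u * u - real p * (v * v)"
 have D: "D = x * (u - v * sqrt (real p))" unfolding D_def * by (simp add: algebra_simps)
 have Df: "inverse D \<in> sqrt_field ps" unfolding D_def
  using * p by (intro Cons.IH sqrt_field_diff sqrt_field_mult)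
 show ?case
 proof (cases "D = 0")
  case True
  then have "x = 0 \<or> x = 2 * u" using D * by auto
  then show ?thesis
  proof
   assume "x = 0" then show ?thesis using Rats_sqrt_field[of 0 "p # ps"] by simp
  next
   assume x: "x = 2 * u"
   have "2 * u \<in> sqrt_field ps" using * Rats_sqrt_field[of 2 ps] by (intro sqrt_field_mult) auto
   then show ?thesis unfolding x using Cons.IH sqrt_field_subset by blast
  qed
 next
  case False
  then have "inverse x = u * inverse D + (- (v * inverse D)) * sqrt (real p)"
  proof -
   have x0: "x \<noteq> 0" using False D by auto
   have "u * inverse D + (- (v * inverse D)) * sqrt (real p) = (u - v * sqrt (real p)) * inverse D"
    by (simp add: algebra_simps)
   also have "\<dots> = inverse x" using False D x0 by simp
   finally show ?thesis by simp
  qed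
  moreover have "u * inverse D \<in> sqrt_field ps" "- (v * inverse D) \<in> sqrt_field ps"
   using * Df by (auto intro!: sqrt_field_mult sqrt_field_uminus simp del: mult_minus_left)
  ultimately show ?thesis unfolding sqrt_field_Cons by blast
 qed
qed auto

lemma sqrt_nat_Rats:
 assumes "sqrt (real m) \<in> \<rat>" shows "\<exists>r. m = r ^ 2"
proof -
 obtain a b :: nat where b: "b \<noteq> 0" and ab: "\<bar>sqrt (real m)\<bar> = real a / real b"
  using Rats_abs_nat_div_natE[OF assms] by metis
 then have "sqrt (real m) * real b = real a" by (simp add: field_simps)
 then have "(sqrt (real m) * real b) ^ 2 = real a ^ 2" by simp
 then have "real (m * b ^ 2) = real (a ^ 2)" by (simp add: power_mult_distrib)
 then have e: "m * b ^ 2 = a ^ 2" by (simp only: of_nat_eq_iff)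
 then have "b ^ 2 dvd a ^ 2" by (metis dvd_triv_right)
 then have "b dvd a" by simp
 then obtain r where "a = b * r" by (rule dvdE)
 with e b have "m = r ^ 2" by (simp add: power_mult_distrib)
 then show ?thesis ..
qed

text \<open>A root enters the field only for the obvious reason. Write sqrt m = u + v sqrt p. If one
  of u, v is zero, the induction hypothesis applies to m or to m p. If neither is, squaring
  expresses sqrt p in the smaller field; the induction hypothesis for p itself then makes p divide a
  product of the other primes.\<close>

lemma sqrt_in_sqrt_field:
 assumes "distinct ps" "\<forall>p\<in>set ps. prime p" "sqrt (real m) \<in> sqrt_field ps" "0 < m"
 shows "\<exists>S r. S \<subseteq> set ps \<and> m * \<Prod>S = r ^ 2"
 using assms
proof (induction ps arbitrary: m)
 case Nil
 then show ?case using sqrt_nat_Rats[of m] by auto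
next
 case (Cons p ps)
 then obtain u v where *: "u \<in> sqrt_field ps" "v \<in> sqrt_field ps" "sqrt (real m) = u + v * sqrt (real p)"
  unfolding sqrt_field_Cons by blast
 have pp: "prime p" using Cons.prems by auto
 then have p0: "0 < p" by (simp add: prime_gt_0_nat)
 have pf: "real p \<in> sqrt_field ps" "real m \<in> sqrt_field ps" "2 \<in> sqrt_field ps"
  by (auto intro: Rats_sqrt_field)
 consider "v = 0" | "u = 0" | "u \<noteq> 0" "v \<noteq> 0" by blast
 then show ?case
 proof cases
  case 1
  then have "sqrt (real m) \<in> sqrt_field ps" using * by simp
  then obtain S r where "S \<subseteq> set ps" "m * \<Prod>S = r ^ 2"
   using Cons.IH[of m] Cons.prems(1,2,4) by (metis distinct.simps(2) list.set_intros(2))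
  then show ?thesis by (intro exI[of _ S] exI[of _ r]) auto
 next
  case 2
  then have "sqrt (real (m * p)) = v * real p" using * by (simp add: real_sqrt_mult)
  also have "\<dots> \<in> sqrt_field ps" using * pf sqrt_field_mult by blast
  finally obtain S r where S: "S \<subseteq> set ps" "(m * p) * \<Prod>S = r ^ 2"
   using Cons.IH[of "m * p"] Cons.prems(1,2,4) p0
   by (metis distinct.simps(2) list.set_intros(2) mult_pos_pos)
  have "p \<notin> S" "finite S" using S Cons.prems finite_subset by auto
  then have "m * \<Prod>(insert p S) = r ^ 2" using S by (simp add: mult_ac)
  then show ?thesis using S by (intro exI[of _ "insert p S"]) auto
 next
  case 3
  have "real m = (u + v * sqrt (real p)) ^ 2" using *(3)[symmetric] by simp
  also have "\<dots> = u * u + real p * (v * v) + 2 * u * v * sqrt (real p)"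
   by (simp add: power2_eq_square algebra_simps)
  finally have "sqrt (real p) = (real m - (u * u + real p * (v * v))) * inverse (2 * u * v)"
   using 3 by (simp add: field_simps)
  also have "\<dots> \<in> sqrt_field ps" using * pf
   by (intro sqrt_field_mult sqrt_field_inverse sqrt_field_diff sqrt_field_add)
  finally obtain S r where S: "S \<subseteq> set ps" "p * \<Prod>S = r ^ 2"
   using Cons.IH[of p] Cons.prems(1,2) p0 by (metis distinct.simps(2) list.set_intros(2))
  have "p dvd r ^ 2" using S by (metis dvd_triv_left)
  then have "p dvd r" using pp prime_dvd_power by blast
  then have "p * p dvd p * \<Prod>S" using S by (simp add: power2_eq_square mult_dvd_mono)
  then have "p dvd \<Prod>S" using p0 by simp
  moreover have "finite S" using S finite_subset by blast
  ultimately obtain s where "s \<in> S" "p dvd s" using pp prime_dvd_prod_iff[of S p "\<lambda>x. x"] by auto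
  moreover have "prime s" using S \<open>s \<in> S\<close> Cons.prems by auto
  ultimately have "p \<in> S" using pp primes_dvd_imp_eq by metis
  then show ?thesis using S Cons.prems by auto
 qed
qed

lemma squarefree_sqrt_in_sqrt_field:
 "distinct ps \<Longrightarrow> \<forall>p\<in>set ps. prime p \<Longrightarrow> squarefree q \<Longrightarrow> 0 < q \<Longrightarrow> prime_factors q \<subseteq> set ps
  \<Longrightarrow> sqrt (real q) \<in> sqrt_field ps"
proof (induction ps arbitrary: q)
 case Nil
 then have "q = 1" using prime_factor_nat[of q] by (auto simp: prime_factors_dvd)
 then show ?case by auto
next
 case (Cons p ps)
 show ?case
 proof (cases "p dvd q")
  case True
  then obtain q' where q': "q = p * q'" by auto
  have sf: "squarefree q'" using Cons.prems q' squarefree_mono by (metis dvd_triv_right)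
  have "\<not> p dvd q'"
  proof
   assume "p dvd q'"
   then have "p ^ 2 dvd q" using q' by (simp add: power2_eq_square mult_dvd_mono)
   then have "is_unit p" using Cons.prems(3) unfolding squarefree_def by blast
   then show False using Cons.prems by (auto simp: not_prime_unit)
  qed
  moreover have "prime_factors q' \<subseteq> prime_factors q" using q' Cons.prems
   by (intro dvd_prime_factors) auto
  ultimately have "prime_factors q' \<subseteq> set ps" using Cons.prems by (auto simp: prime_factors_dvd)
  then have "sqrt (real q') \<in> sqrt_field ps" using Cons sf q' by (intro Cons.IH) auto
  moreover have "sqrt (real q) = 0 + sqrt (real q') * sqrt (real p)"
   by (simp add: q' real_sqrt_mult)
  ultimately show ?thesis unfolding sqrt_field_Cons using Rats_sqrt_field[OF Rats_0, of ps] by blast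
 next
  case False
  then have "prime_factors q \<subseteq> set ps" using Cons.prems by (auto simp: prime_factors_dvd)
  then show ?thesis using Cons by (intro sqrt_field_subset Cons.IH) auto
 qed
qed

lemma squarefree_div_prime:
 assumes "squarefree q" "prime p" "p dvd (q::nat)" "0 < q"
 shows "squarefree (q div p)" "\<not> p dvd q div p" "0 < q div p" "q = p * (q div p)"
proof -
 show e: "q = p * (q div p)" using assms by simp
 show "squarefree (q div p)" using assms e squarefree_mono by (metis dvd_triv_right)
 show "0 < q div p" using e assms(4) by (metis mult_0_right neq0_conv)
 show "\<not> p dvd q div p"
 proof
  assume "p dvd q div p"
  then have "p ^ 2 dvd q" using e by (metis mult_dvd_mono dvd_refl power2_eq_square)
  then have "is_unit p" using assms unfolding squarefree_def by blast
  then show False using assms by (auto simp: not_prime_unit)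
 qed
qed

text \<open>Sorting the terms by divisibility by p turns the relation into u + v sqrt p = 0 with u
  and v in the field of the remaining primes. There sqrt p is missing, so v = 0 and u = 0, and these
  are relations with one prime fewer.\<close>

lemma sqrt_lin_indep_aux:
 fixes a :: "nat \<Rightarrow> real"
 assumes "distinct ps" "\<forall>p\<in>set ps. prime p" "finite Q"
  "\<forall>q\<in>Q. squarefree q \<and> 0 < q \<and> prime_factors q \<subseteq> set ps" "\<forall>q\<in>Q. a q \<in> \<rat>"
  "(\<Sum>q\<in>Q. a q * sqrt (real q)) = 0"
 shows "\<forall>q\<in>Q. a q = 0"
 using assms
proof (induction ps arbitrary: Q a)
 case Nil
 have "q = 1" if "q \<in> Q" for q
 proof -
  have "prime_factors q = {}" "0 < q" using Nil.prems that by auto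
  then show ?thesis using prime_factor_nat[of q] by (auto simp: prime_factors_dvd)
 qed
 then have "Q \<subseteq> {1}" by auto
 then have "Q = {} \<or> Q = {1}" by auto
 then show ?case using Nil.prems by auto
next
 case (Cons p ps)
 have pp: "prime p" using Cons.prems by auto
 then have p0: "0 < p" by (simp add: prime_gt_0_nat)
 define Q0 where "Q0 = {q\<in>Q. \<not> p dvd q}"
 define Q1 where "Q1 = {q\<in>Q. p dvd q}"
 define R where "R = (\<lambda>q. q div p) ` Q1"
 define u where "u = (\<Sum>q\<in>Q0. a q * sqrt (real q))"
 define v where "v = (\<Sum>q\<in>R. a (p * q) * sqrt (real q))"
 have fin: "finite Q0" "finite Q1" "finite R" using Cons.prems by (auto simp: Q0_def Q1_def R_def)
 have Q1: "squarefree (q div p)" "\<not> p dvd q div p" "0 < q div p" "q = p * (q div p)" if "q \<in> Q1" for q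
  using squarefree_div_prime[of q p] that Cons.prems(4) pp by (auto simp: Q1_def)
 have inj: "inj_on (\<lambda>q. q div p) Q1" using Q1(4) by (intro inj_onI) metis
 have v: "v * sqrt (real p) = (\<Sum>q\<in>Q1. a q * sqrt (real q))"
 proof -
  have "v = (\<Sum>q\<in>Q1. a (p * (q div p)) * sqrt (real (q div p)))"
   unfolding v_def R_def using inj by (simp add: sum.reindex)
  then have "v * sqrt (real p) = (\<Sum>q\<in>Q1. a (p * (q div p)) * sqrt (real (q div p)) * sqrt (real p))"
   by (simp add: sum_distrib_right)
  also have "\<dots> = (\<Sum>q\<in>Q1. a q * sqrt (real q))"
  proof (rule sum.cong[OF refl])
   fix q assume "q \<in> Q1"
   note e = Q1(4)[OF this]
   have "sqrt (real q) = sqrt (real (p * (q div p)))" using e by simp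
   also have "\<dots> = sqrt (real p) * sqrt (real (q div p))" by (simp only: of_nat_mult real_sqrt_mult)
   finally show "a (p * (q div p)) * sqrt (real (q div p)) * sqrt (real p) = a q * sqrt (real q)"
    using e by simp
  qed
  finally show ?thesis .
 qed
 have Q0p: "\<forall>q\<in>Q0. squarefree q \<and> 0 < q \<and> prime_factors q \<subseteq> set ps"
 proof
  fix q assume q: "q \<in> Q0"
  then have "squarefree q \<and> 0 < q \<and> prime_factors q \<subseteq> set (p # ps)" "\<not> p dvd q"
   using Cons.prems(4) by (auto simp: Q0_def)
  then show "squarefree q \<and> 0 < q \<and> prime_factors q \<subseteq> set ps" by (auto simp: prime_factors_dvd)
 qed
 have Rp: "\<forall>q\<in>R. squarefree q \<and> 0 < q \<and> prime_factors q \<subseteq> set ps"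
 proof
  fix r assume "r \<in> R"
  then obtain q where q: "q \<in> Q1" "r = q div p" by (auto simp: R_def)
  have "0 < q" using q Cons.prems(4) by (auto simp: Q1_def)
  moreover have "r dvd q" using Q1(4)[OF q(1)] q(2) by (metis dvd_triv_right)
  ultimately have "prime_factors r \<subseteq> prime_factors q" by (intro dvd_prime_factors) auto
  moreover have "prime_factors q \<subseteq> insert p (set ps)" using q Cons.prems(4) by (auto simp: Q1_def)
  moreover have "p \<notin> prime_factors r" using Q1[OF q(1)] q by (auto simp: prime_factors_dvd)
  ultimately show "squarefree r \<and> 0 < r \<and> prime_factors r \<subseteq> set ps" using Q1[OF q(1)] q by auto
 qed
 have ra: "\<forall>q\<in>R. a (p * q) \<in> \<rat>"
 proof
  fix r assume "r \<in> R"
  then obtain q where q: "q \<in> Q1" "r = q div p" by (auto simp: R_def)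
  then have "p * r = q" using Q1(4) by metis
  then show "a (p * r) \<in> \<rat>" using q Cons.prems(5) by (simp add: Q1_def)
 qed
 have sf: "(\<Sum>q\<in>S. b q * sqrt (real q)) \<in> sqrt_field ps"
  if "finite S" "\<forall>q\<in>S. squarefree q \<and> 0 < q \<and> prime_factors q \<subseteq> set ps" "\<forall>q\<in>S. b q \<in> \<rat>" for S b
  using that
 proof (induction S)
  case empty show ?case using Rats_sqrt_field[of 0 ps] by simp
 next
  case (insert x S)
  have "b x * sqrt (real x) \<in> sqrt_field ps" using insert.prems Cons.prems
   by (intro sqrt_field_mult Rats_sqrt_field squarefree_sqrt_in_sqrt_field) auto
  then show ?case using insert sqrt_field_add by auto
 qed
 have uf: "u \<in> sqrt_field ps" unfolding u_def using fin Q0p Cons.prems(5)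
  by (intro sf) (auto simp: Q0_def)
 have vf: "v \<in> sqrt_field ps" unfolding v_def using sf[of R "\<lambda>q. a (p * q)"] fin Rp ra by simp
 have "(\<Sum>q\<in>Q. a q * sqrt (real q)) = (\<Sum>q\<in>Q0 \<union> Q1. a q * sqrt (real q))"
  by (rule sum.cong) (auto simp: Q0_def Q1_def)
 also have "\<dots> = u + v * sqrt (real p)" unfolding v u_def using fin
  by (intro sum.union_disjoint) (auto simp: Q0_def Q1_def)
 finally have uv: "u + v * sqrt (real p) = 0" using Cons.prems(6) by simp
 have v0: "v = 0"
 proof (rule ccontr)
  assume "v \<noteq> 0"
  then have "sqrt (real p) = (- u) * inverse v" using uv by (simp add: field_simps)
  also have "\<dots> \<in> sqrt_field ps" using uf vf sqrt_field_mult sqrt_field_uminus sqrt_field_inverse by blast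
  finally obtain S r where S: "S \<subseteq> set ps" "p * \<Prod>S = r ^ 2"
   using sqrt_in_sqrt_field[of ps p] Cons.prems p0 by auto
  have "p dvd r ^ 2" using S by (metis dvd_triv_left)
  then have "p dvd r" using pp prime_dvd_power by blast
  then have "p * p dvd p * \<Prod>S" using S by (simp add: power2_eq_square mult_dvd_mono)
  then have "p dvd \<Prod>S" using p0 by simp
  moreover have "finite S" using S finite_subset by blast
  ultimately obtain s where "s \<in> S" "p dvd s" using pp prime_dvd_prod_iff[of S p "\<lambda>x. x"] by auto
  moreover have "prime s" using S \<open>s \<in> S\<close> Cons.prems by auto
  ultimately have "p \<in> S" using pp primes_dvd_imp_eq by metis
  then show False using S Cons.prems by auto
 qed
 then have u0: "u = 0" using uv by simp
 have ps: "distinct ps" "\<forall>p\<in>set ps. prime p" using Cons.prems(1,2) by auto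
 have Q0a: "\<forall>q\<in>Q0. a q \<in> \<rat>" using Cons.prems(5) by (simp add: Q0_def)
 have "\<forall>q\<in>Q0. a q = 0" using Cons.IH[OF ps fin(1) Q0p Q0a u0[unfolded u_def]] .
 moreover have "\<forall>q\<in>R. a (p * q) = 0"
  using Cons.IH[OF ps fin(3) Rp, of "\<lambda>q. a (p * q)"] ra v0[unfolded v_def] by blast
 then have "\<forall>q\<in>Q1. a q = 0" using Q1(4) unfolding R_def by (metis image_eqI)
 ultimately show ?case unfolding Q0_def Q1_def by blast
qed

lemma sqrt_lin_indep:
 fixes a :: "nat \<Rightarrow> real"
 assumes "finite Q" "\<And>q. q \<in> Q \<Longrightarrow> squarefree q \<and> 0 < q" "\<And>q. q \<in> Q \<Longrightarrow> a q \<in> \<rat>"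
  "(\<Sum>q\<in>Q. a q * sqrt (real q)) = 0" "q \<in> Q"
 shows "a q = 0"
proof -
 define P where "P = (\<Union>q\<in>Q. prime_factors q)"
 have "finite P" unfolding P_def using assms by auto
 then obtain ps where ps: "set ps = P" "distinct ps" using finite_distinct_list by blast
 have "\<forall>q\<in>Q. a q = 0"
  by (rule sqrt_lin_indep_aux[OF ps(2)]) (use assms ps in \<open>auto simp: P_def\<close>)
 then show ?thesis using assms by blast
qed

text \<open>Since sqrt n is \<open>square_part n\<close> times the root of
  \<open>squarefree_part n\<close>, each inner sum is the coefficient of one squarefree root. The
  right hand side is literally the condition that the phases of the model cancel, so true
  frequencies and model phases resonate together.\<close>

lemma sum_sqrt_eq_0_iff:
 fixes e :: "nat \<Rightarrow> int" and n :: "nat \<Rightarrow> nat"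
 assumes "\<And>i. i < j \<Longrightarrow> 0 < n i"
 shows "(\<Sum>i<j. of_int (e i) * sqrt (real (n i))) = 0 \<longleftrightarrow>
  (\<forall>q. (\<Sum>i | i < j \<and> squarefree_part (n i) = q. e i * int (square_part (n i))) = 0)"
proof -
 define Q where "Q = (\<lambda>i. squarefree_part (n i)) ` {..<j}"
 define s where "s q = (\<Sum>i | i < j \<and> squarefree_part (n i) = q. e i * int (square_part (n i)))" for q
 have fin: "finite Q" by (simp add: Q_def)
 have "(\<Sum>i<j. of_int (e i) * sqrt (real (n i))) =
   (\<Sum>q\<in>Q. \<Sum>i | i \<in> {..<j} \<and> squarefree_part (n i) = q. of_int (e i) * sqrt (real (n i)))"
  unfolding Q_def by (rule sum.image_gen) simp
 also have "\<dots> = (\<Sum>q\<in>Q. of_int (s q) * sqrt (real q))"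
 proof (rule sum.cong[OF refl])
  fix q assume "q \<in> Q"
  have "sqrt (real (n i)) = real (square_part (n i)) * sqrt (real (squarefree_part (n i)))" for i
  proof -
   have "real (n i) = real (squarefree_part (n i) * square_part (n i) ^ 2)"
    using squarefree_decompose[of "n i"] by simp
   then show ?thesis by (simp add: real_sqrt_mult)
  qed
  then show "(\<Sum>i | i \<in> {..<j} \<and> squarefree_part (n i) = q. of_int (e i) * sqrt (real (n i))) =
    of_int (s q) * sqrt (real q)"
   unfolding s_def of_int_sum sum_distrib_right by (intro sum.cong) auto
 qed
 finally have eq: "(\<Sum>i<j. of_int (e i) * sqrt (real (n i))) = (\<Sum>q\<in>Q. of_int (s q) * sqrt (real q))" .
 have sQ: "s q = 0" if "q \<notin> Q" for q
 proof -
  have "{i. i < j \<and> squarefree_part (n i) = q} = {}" using that by (auto simp: Q_def)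
  then show ?thesis unfolding s_def by (metis sum.empty)
 qed
 show ?thesis
 proof
  assume "(\<Sum>i<j. of_int (e i) * sqrt (real (n i))) = 0"
  then have "(\<Sum>q\<in>Q. of_int (s q) * sqrt (real q)) = 0" using eq by simp
  then have "real_of_int (s q) = 0" if "q \<in> Q" for q
   by (intro sqrt_lin_indep[OF fin, of "\<lambda>q. real_of_int (s q)"])
    (use that in \<open>auto simp: Q_def intro!: Nat.gr0I\<close>)
  then have "s q = 0" for q using sQ by (cases "q \<in> Q") auto
  then show "\<forall>q. (\<Sum>i | i < j \<and> squarefree_part (n i) = q. e i * int (square_part (n i))) = 0"
   by (simp add: s_def)
 next
  assume "\<forall>q. (\<Sum>i | i < j \<and> squarefree_part (n i) = q. e i * int (square_part (n i))) = 0"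
  then have "s q = 0" for q by (simp add: s_def)
  then show "(\<Sum>i<j. of_int (e i) * sqrt (real (n i))) = 0" using eq by simp
 qed
qed

section \<open>Sums of two squares\<close>

text \<open>Gaussian integers are stored as integer pairs, which keeps norms and divisibility in
  \<open>int\<close>; the embedding into the complex field turns identities between products and
  conjugates into field algebra.\<close>

definition gi :: "int \<times> int \<Rightarrow> complex" where
 "gi z = Complex (of_int (fst z)) (of_int (snd z))"

definition gm :: "int \<times> int \<Rightarrow> int \<times> int \<Rightarrow> int \<times> int" where
 "gm z w = (fst z * fst w - snd z * snd w, fst z * snd w + snd z * fst w)"

definition gc :: "int \<times> int \<Rightarrow> int \<times> int" where "gc z = (fst z, - snd z)"

definition gnorm :: "int \<times> int \<Rightarrow> int" where "gnorm z = (fst z)\<^sup>2 + (snd z)\<^sup>2"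

definition grot :: "bool \<Rightarrow> int \<times> int \<Rightarrow> int \<times> int" where
 "grot j z = (if j then (- snd z, fst z) else z)"

text \<open>These are the Gaussian integers coprime to their conjugates: a common factor of the
  coordinates divides both, and so does 1 + i when the coordinate sum, that is the norm, is
  even.\<close>

definition prim_odd :: "(int \<times> int) set" where
 "prim_odd = {z. coprime (fst z) (snd z) \<and> odd (fst z + snd z)}"

definition r2 :: "nat \<Rightarrow> nat" where "r2 n = card {z. gnorm z = int n}"

lemma gi_eq_iff [simp]: "gi z = gi w \<longleftrightarrow> z = w"
 by (auto simp: gi_def complex_eq_iff prod_eq_iff)

lemma gi_eq_0_iff [simp]: "gi z = 0 \<longleftrightarrow> z = 0"
 by (auto simp: gi_def complex_eq_iff prod_eq_iff)

lemma gi_gm: "gi (gm z w) = gi z * gi w"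
 by (simp add: gi_def gm_def complex_eq_iff)

lemma gi_gc: "gi (gc z) = cnj (gi z)"
 by (simp add: gi_def gc_def complex_eq_iff)

lemma gi_plus: "gi (z + w) = gi z + gi w"
 by (simp add: gi_def complex_eq_iff)

lemma gi_uminus: "gi (- z) = - gi z"
 by (simp add: gi_def complex_eq_iff)

lemma gi_grot: "gi (grot j z) = (if j then \<i> else 1) * gi z"
 by (simp add: gi_def grot_def complex_eq_iff)

lemma gi_mult_cnj: "gi z * cnj (gi z) = of_int (gnorm z)"
 by (simp add: gi_def gnorm_def complex_eq_iff power2_eq_square)

lemma gnorm_gm: "gnorm (gm z w) = gnorm z * gnorm w"
 by (simp add: gnorm_def gm_def power2_eq_square algebra_simps)

lemma gnorm_gc [simp]: "gnorm (gc z) = gnorm z"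
 by (simp add: gnorm_def gc_def)

lemma gnorm_grot [simp]: "gnorm (grot j z) = gnorm z"
 by (simp add: gnorm_def grot_def)

lemma gnorm_uminus [simp]: "gnorm (- z) = gnorm z"
 by (simp add: gnorm_def)

lemma gnorm_nonneg [simp]: "0 \<le> gnorm z"
 by (simp add: gnorm_def)

lemma gnorm_eq_0_iff [simp]: "gnorm z = 0 \<longleftrightarrow> z = 0"
 by (simp add: gnorm_def sum_power2_eq_zero_iff prod_eq_iff)

lemma gnorm_0 [simp]: "gnorm 0 = 0"
 by simp

lemma finite_gnorm_le: "finite {z. gnorm z \<le> n}"
proof (rule finite_subset)
 show "{z. gnorm z \<le> n} \<subseteq> {- n..n} \<times> {- n..n}"
 proof
  fix z assume z: "z \<in> {z. gnorm z \<le> n}"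
  have a: "\<bar>x\<bar> \<le> x\<^sup>2" for x :: int
  proof (cases "x = 0")
   case False
   then have "\<bar>x\<bar> * 1 \<le> \<bar>x\<bar> * \<bar>x\<bar>" by (intro mult_left_mono) auto
   then show ?thesis by (simp add: power2_eq_square)
  qed auto
  have "\<bar>fst z\<bar> \<le> n" "\<bar>snd z\<bar> \<le> n" using z a[of "fst z"] a[of "snd z"]
   zero_le_power2[of "fst z"] zero_le_power2[of "snd z"] unfolding gnorm_def mem_Collect_eq
   by linarith+
  then show "z \<in> {- n..n} \<times> {- n..n}" by (auto simp: mem_Times_iff)
 qed
qed auto

lemma finite_gnorm_eq [simp]: "finite {z. gnorm z = n}"
 by (rule finite_subset[OF _ finite_gnorm_le[of n]]) auto

lemma odd_gnorm_prim_odd: "z \<in> prim_odd \<Longrightarrow> odd (gnorm z)"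
 by (auto simp: prim_odd_def gnorm_def)

lemma gnorm_prim_odd_pos: "z \<in> prim_odd \<Longrightarrow> 0 < gnorm z"
proof -
 assume "z \<in> prim_odd"
 then have "gnorm z \<noteq> 0" using odd_gnorm_prim_odd[of z] by (metis even_zero)
 then show ?thesis using gnorm_nonneg[of z] by linarith
qed

section \<open>Pairs of Gaussian integers of equal norm\<close>

text \<open>Since 2 and the odd norm lie in the ideal generated by
 \<open>\<alpha>\<close> and its conjugate, that ideal is everything.\<close>

lemma prim_odd_bezout:
 assumes "a \<in> prim_odd"
 shows "\<exists>u v. gi u * gi a + gi v * cnj (gi a) = 1"
proof -
 obtain p q where a: "a = (p, q)" by (cases a)
 have co: "coprime p q" using assms a by (auto simp: prim_odd_def)
 then obtain s t where st: "s * p + t * q = 1" by (metis bezout_int coprime_imp_gcd_eq_1)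
 obtain k where k: "gnorm a = 2 * k + 1" using odd_gnorm_prim_odd[OF assms] by (auto elim: oddE)
 have 2: "2 = gi (s, - t) * gi a + gi (s, t) * cnj (gi a)"
 proof -
  have "real_of_int (s * p + t * q) = 1" using st by simp
  then show ?thesis by (simp add: a gi_def complex_eq_iff algebra_simps)
 qed
 have "1 = of_int (gnorm a) - of_int k * (2::complex)" using k by simp
 also have "\<dots> = gi a * cnj (gi a) - of_int k * (gi (s, - t) * gi a + gi (s, t) * cnj (gi a))"
  unfolding gi_mult_cnj 2[symmetric] ..
 also have "\<dots> = (of_int (- k) * gi (s, - t)) * gi a + (gi a + of_int (- k) * gi (s, t)) * cnj (gi a)"
  by (simp add: algebra_simps)
 also have "of_int (- k) * gi (s, - t) = gi (- k * s, k * t)" by (simp add: gi_def complex_eq_iff)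
 also have "gi a + of_int (- k) * gi (s, t) = gi (a + (- k * s, - k * t))"
  by (simp add: gi_def complex_eq_iff)
 finally show ?thesis by metis
qed

text \<open>Hilbert 90: a quotient \<open>\<zeta> = z / w\<close> of absolute value 1 is \<open>(1 + \<zeta>) / cnj (1 + \<zeta>)\<close>.\<close>

lemma same_gnorm_direction:
 assumes "gnorm z = gnorm w" "gnorm w \<noteq> 0"
 shows "\<exists>a\<in>prim_odd. \<exists>j. gi z * cnj (gi a) = (if j then \<i> else 1) * gi w * gi a"
proof -
 \<comment> \<open>This is 1 + z / w multiplied by the norm of w, hence a Gaussian integer with the
   same direction.\<close>
 define e where "e = gm z (gc w) + (gnorm w, 0)"
 have ge: "gi e = gi z * cnj (gi w) + of_int (gnorm w)"
  by (simp add: e_def gi_plus gi_gm gi_gc) (simp add: gi_def complex_eq_iff)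
 have ze: "gi z * cnj (gi e) = gi w * gi e"
  unfolding ge using gi_mult_cnj[of z] gi_mult_cnj[of w] assms
  by (simp add: algebra_simps)
 show ?thesis
 proof (cases "e = 0")
  \<comment> \<open>Here z = - w and 1 + z / w vanishes, so it gives no direction; the quotient of i
    by its conjugate, which is -1, serves instead.\<close>
  case True
  then have "gi z * cnj (gi w) + gi w * cnj (gi w) = 0" using ge gi_mult_cnj[of w]
   by (metis gi_eq_0_iff)
  then have "(gi z + gi w) * cnj (gi w) = 0" by (simp add: algebra_simps)
  moreover have "cnj (gi w) \<noteq> 0" using assms by auto
  ultimately have zw: "gi z = - gi w" by (simp add: add_eq_0_iff2)
  show ?thesis
  proof (intro bexI exI)
   show "gi z * cnj (gi (0, 1)) = (if False then \<i> else 1) * gi w * gi (0, 1)"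
    unfolding zw by (simp add: gi_def complex_eq_iff)
   show "(0, 1) \<in> prim_odd" by (simp add: prim_odd_def)
  qed
 next
  case False
  define d where "d = gcd (fst e) (snd e)"
  have d0: "d \<noteq> 0" using False by (auto simp: d_def prod_eq_iff)
  define a b where "a = fst e div d" and "b = snd e div d"
  have ab: "fst e = d * a" "snd e = d * b" by (auto simp: a_def b_def d_def)
  have co: "coprime a b" unfolding a_def b_def d_def using False
   by (intro div_gcd_coprime) (auto simp: prod_eq_iff)
  have gab: "gi e = of_int d * gi (a, b)" using ab by (simp add: gi_def complex_eq_iff)
  have z: "gi z * cnj (gi (a, b)) = gi w * gi (a, b)"
   using ze d0 unfolding gab by simp
  show ?thesis
  proof (cases "odd (a + b)")
   case True
   show ?thesis
   proof (intro bexI exI)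
    show "gi z * cnj (gi (a, b)) = (if False then \<i> else 1) * gi w * gi (a, b)" using z by simp
    show "(a, b) \<in> prim_odd" using True co by (simp add: prim_odd_def)
   qed
  next
   case False
   then obtain p where p: "a + b = 2 * p" by (meson evenE)
   define q where "q = b - p"
   have apq: "a = p - q" "b = p + q" using p by (auto simp: q_def)
   have "coprime p q"
   proof (rule coprimeI)
    fix c assume "c dvd p" "c dvd q"
    then have "c dvd a" "c dvd b" unfolding apq by auto
    then show "is_unit c" using co by (meson coprime_common_divisor)
   qed
   moreover have "odd (p + q)"
   proof
    assume "even (p + q)"
    then have "even a" "even b" unfolding apq by auto
    then show False using co by (meson coprime_common_divisor odd_one)
   qed
   ultimately have pq: "(p, q) \<in> prim_odd" by (simp add: prim_odd_def)
   \<comment> \<open>An even coordinate sum means divisibility by 1 + i. Cancelling that factor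
     leaves (1 + i) / (1 - i) = i, which is why the statement carries the Boolean
     \<open>j\<close>.\<close>
   have g: "gi (a, b) = (1 + \<i>) * gi (p, q)" unfolding apq by (simp add: gi_def complex_eq_iff)
   have "gi z * ((1 - \<i>) * cnj (gi (p, q))) = gi w * ((1 + \<i>) * gi (p, q))"
    using z unfolding g by simp
   then have "(1 + \<i>) * (gi z * ((1 - \<i>) * cnj (gi (p, q)))) = (1 + \<i>) * (gi w * ((1 + \<i>) * gi (p, q)))"
    by simp
   then have "2 * (gi z * cnj (gi (p, q))) = 2 * (\<i> * gi w * gi (p, q))"
    by (simp add: algebra_simps)
   then have "gi z * cnj (gi (p, q)) = (if True then \<i> else 1) * gi w * gi (p, q)" by simp
   then show ?thesis using pq by blast
  qed
 qed
qed

text \<open>As z times the conjugate of a equals w a up to the factor 1 or i, and a is coprime to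
  its conjugate, a divides z and the conjugate of a divides w, with a common cofactor g. The Bezout
  coefficients give g explicitly, so unique factorisation is avoided.\<close>

lemma same_gnorm_rep:
 assumes "gnorm z = gnorm w" "gnorm w \<noteq> 0"
 shows "\<exists>a\<in>prim_odd. \<exists>j g. z = grot j (gm a g) \<and> w = gm (gc a) g"
proof -
 obtain a j where a: "a \<in> prim_odd" and eq: "gi z * cnj (gi a) = (if j then \<i> else 1) * gi w * gi a"
  using same_gnorm_direction[OF assms] by blast
 define c :: complex where "c = (if j then \<i> else 1)"
 define k :: "int \<times> int" where "k = (if j then (0, - 1) else (1, 0))"
 have k: "gi k * c = 1" by (simp add: k_def c_def gi_def complex_eq_iff)
 obtain u v where uv: "gi u * gi a + gi v * cnj (gi a) = 1" using prim_odd_bezout[OF a] by blast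
 define g where "g = gm (gm u k) z + gm v w"
 have a0: "gi a \<noteq> 0" using gnorm_prim_odd_pos[OF a] by auto
 have wa: "gi w * gi a = gi k * gi z * cnj (gi a)"
 proof -
  have "gi k * gi z * cnj (gi a) = gi k * (c * gi w * gi a)" using eq by (simp add: c_def mult_ac)
  also have "\<dots> = (gi k * c) * (gi w * gi a)" by (simp add: mult_ac)
  finally show ?thesis using k by simp
 qed
 have "gi w = gi w * (gi u * gi a + gi v * cnj (gi a))" using uv by simp
 also have "\<dots> = gi u * (gi w * gi a) + gi w * gi v * cnj (gi a)" by (simp add: algebra_simps)
 also have "\<dots> = cnj (gi a) * gi g" unfolding wa g_def gi_plus gi_gm by (simp add: algebra_simps)
 finally have w: "gi w = cnj (gi a) * gi g" .
 have "gi z * cnj (gi a) = (c * gi a * gi g) * cnj (gi a)" unfolding eq w c_def by (simp add: mult_ac)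
 then have "gi z = c * (gi a * gi g)" using a0 by simp
 then have "gi z = gi (grot j (gm a g))" by (simp add: gi_grot gi_gm c_def)
 moreover have "gi w = gi (gm (gc a) g)" using w by (simp add: gi_gm gi_gc)
 ultimately show ?thesis using a unfolding gi_eq_iff by blast
qed

lemma coprime_parallel:
 fixes a b c d :: int
 assumes "coprime a b" "coprime c d" "a * d = c * b"
 shows "(c, d) = (a, b) \<or> (c, d) = - (a, b)"
proof -
 have "a dvd c * b" using assms(3) by (metis dvd_triv_left)
 then have 1: "a dvd c" using assms(1) by (simp add: coprime_dvd_mult_left_iff)
 have "c dvd a * d" using assms(3) by (metis dvd_triv_left)
 then have 2: "c dvd a" using assms(2) by (simp add: coprime_dvd_mult_left_iff)
 have "\<bar>a\<bar> = \<bar>c\<bar>" using 1 2 zdvd_antisym_abs by blast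
 then consider "c = a" "a \<noteq> 0" | "c = - a" "a \<noteq> 0" | "a = 0" "c = 0" by linarith
 then show ?thesis
 proof cases
  case 1 then show ?thesis using assms(3) by auto
 next
  case 2
  then have "a * (d + b) = 0" using assms(3) by (simp add: algebra_simps)
  then show ?thesis using 2 by (simp add: add_eq_0_iff2)
 next
  case 3
  then have "\<bar>b\<bar> = 1" "\<bar>d\<bar> = 1" using assms by auto
  then show ?thesis using 3 by (auto simp: abs_if split: if_splits)
 qed
qed

text \<open>Eliminating g and h shows that s, the product of a with the conjugate of b, equals its
  own conjugate up to 1, i or -i. A factor other than 1 would put s on a diagonal and make its norm
  even, against oddness. So s is real, a and b are parallel, and primitivity makes them equal up to
  sign.\<close>

lemma same_gnorm_rep_unique:
 assumes a: "a \<in> prim_odd" "b \<in> prim_odd" and g: "g \<noteq> 0"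
  and e1: "grot j (gm a g) = grot k (gm b h)" and e2: "gm (gc a) g = gm (gc b) h"
 shows "k = j \<and> ((b, h) = (a, g) \<or> (b, h) = (- a, - g))"
proof -
 define c :: "bool \<Rightarrow> complex" where "c j = (if j then \<i> else 1)" for j
 have E1: "c j * (gi a * gi g) = c k * (gi b * gi h)"
  using e1 unfolding gi_eq_iff[symmetric] gi_grot gi_gm c_def .
 have E2: "cnj (gi a) * gi g = cnj (gi b) * gi h"
  using e2 unfolding gi_eq_iff[symmetric] gi_gc gi_gm .
 have b0: "gi b \<noteq> 0" "gi a \<noteq> 0"
  using gnorm_prim_odd_pos[OF a(1)] gnorm_prim_odd_pos[OF a(2)] by auto
 have "(c j * (gi a * cnj (gi b))) * gi g = (c j * (gi a * gi g)) * cnj (gi b)" by (simp add: mult_ac)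
 also have "\<dots> = c k * gi b * (cnj (gi b) * gi h)" unfolding E1 by (simp add: mult_ac)
 also have "\<dots> = (c k * cnj (gi a * cnj (gi b))) * gi g" unfolding E2[symmetric] by (simp add: mult_ac)
 finally have main: "c j * (gi a * cnj (gi b)) = c k * cnj (gi a * cnj (gi b))"
  using g by (metis mult_right_cancel gi_eq_0_iff)
 define s where "s = gm a (gc b)"
 have gs: "gi a * cnj (gi b) = gi s" by (simp add: s_def gi_gm gi_gc)
 have odd: "odd (gnorm s)" using odd_gnorm_prim_odd a by (simp add: s_def gnorm_gm)
 have jk: "k = j"
 proof (rule ccontr)
  assume "k \<noteq> j"
  then have "\<i> * gi s = cnj (gi s) \<or> gi s = \<i> * cnj (gi s)"
   using main unfolding gs c_def by (cases j; cases k; simp)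
  then have "fst s = - snd s \<or> fst s = snd s"
  proof
   assume "\<i> * gi s = cnj (gi s)"
   from arg_cong[OF this, of Re] show ?thesis by (simp add: gi_def)
  next
   assume "gi s = \<i> * cnj (gi s)"
   from arg_cong[OF this, of Re] show ?thesis by (simp add: gi_def)
  qed
  then have "gnorm s = 2 * (snd s)\<^sup>2" by (auto simp: gnorm_def)
  then show False using odd by simp
 qed
 moreover have "c j \<noteq> 0" by (simp add: c_def)
 ultimately have "gi s = cnj (gi s)" using main unfolding gs by simp
 from arg_cong[OF this, of Im] have "snd s = 0" by (simp add: gi_def)
 then have "fst a * snd b = fst b * snd a" by (simp add: s_def gm_def gc_def mult_ac)
 then have "(fst b, snd b) = (fst a, snd a) \<or> (fst b, snd b) = - (fst a, snd a)"
  using a by (intro coprime_parallel) (auto simp: prim_odd_def)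
 then have "b = a \<or> b = - a" by simp
 then show ?thesis
 proof
  assume ba: "b = a"
  then have "gi h = gi g" using E2 b0 by simp
  then show ?thesis using ba jk by simp
 next
  assume ba: "b = - a"
  then have "cnj (gi a) * gi h = cnj (gi a) * (- gi g)" using E2 by (simp add: gi_uminus)
  then have "gi h = - gi g" using b0 by (metis mult_cancel_left complex_cnj_zero_iff)
  then have "h = - g" using gi_eq_iff[of h "- g"] by (simp add: gi_uminus)
  then show ?thesis using ba jk by simp
 qed
qed

definition g2 :: "nat \<Rightarrow> nat" where "g2 n = card {z \<in> prim_odd. gnorm z = int n}"

lemma finite_prim_odd_gnorm [simp]: "finite {z \<in> prim_odd. gnorm z = n}"
 by (rule finite_subset[OF _ finite_gnorm_eq[of n]]) auto

lemma card_factor_pairs: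
 assumes "0 < n"
 shows "card {(a, g). a \<in> prim_odd \<and> gnorm a * gnorm g = int n} = (\<Sum>c | c dvd n. g2 c * r2 (n div c))"
proof -
 let ?S = "\<lambda>c. {z \<in> prim_odd. gnorm z = int c} \<times> {z. gnorm z = int (n div c)}"
 have "{(a, g). a \<in> prim_odd \<and> gnorm a * gnorm g = int n} = (\<Union>c\<in>{c. c dvd n}. ?S c)"
 proof (intro equalityI subsetI)
  fix x assume "x \<in> {(a, g). a \<in> prim_odd \<and> gnorm a * gnorm g = int n}"
  then obtain a g where x: "x = (a, g)" "a \<in> prim_odd" "gnorm a * gnorm g = int n" by auto
  define c where "c = nat (gnorm a)"
  have c: "gnorm a = int c" by (simp add: c_def)
  have g: "gnorm g = int (nat (gnorm g))" by simp
  have "int c * int (nat (gnorm g)) = int n" using x c by simp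
  then have n: "n = c * nat (gnorm g)" by (metis of_nat_eq_iff of_nat_mult)
  moreover have "0 < c" using assms n by (cases c) auto
  ultimately have "gnorm g = int (n div c)" by simp
  then show "x \<in> (\<Union>c\<in>{c. c dvd n}. ?S c)" using n x c by (intro UN_I[of c]) auto
 next
  fix x assume "x \<in> (\<Union>c\<in>{c. c dvd n}. ?S c)"
  then obtain c where "c dvd n" "x \<in> ?S c" by auto
  then show "x \<in> {(a, g). a \<in> prim_odd \<and> gnorm a * gnorm g = int n}"
   by (auto simp flip: of_nat_mult)
 qed
 moreover have "card (\<Union>c\<in>{c. c dvd n}. ?S c) = (\<Sum>c | c dvd n. card (?S c))"
  using assms by (intro card_UN_disjoint) auto
 ultimately show ?thesis by (simp add: card_cartesian_product g2_def r2_def)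
qed

text \<open>Both sides count pairs of Gaussian integers of norm n. The triples (j, a, g) parametrise
  these pairs two to one, because (a, g) and (- a, - g) give the same pair; the two values of j
  compensate exactly. The gain is that the square of r becomes a convolution in which one factor is
  r itself, whose partial sums are known from the circle problem.\<close>

theorem r2_square:
 assumes n: "0 < n"
 shows "(r2 n)\<^sup>2 = (\<Sum>c | c dvd n. g2 c * r2 (n div c))"
proof -
 define P where "P = {z. gnorm z = int n} \<times> {z. gnorm z = int n}"
 define F where "F = {(a, g). a \<in> prim_odd \<and> gnorm a * gnorm g = int n}"
 define f where "f = (\<lambda>(j, a, g). (grot j (gm a g), gm (gc a) g))"
 define D where "D = (UNIV :: bool set) \<times> F"
 have finF: "finite F"
 proof (rule finite_subset)
  show "F \<subseteq> {z. gnorm z \<le> int n} \<times> {z. gnorm z \<le> int n}"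
  proof
   fix x assume "x \<in> F"
   then obtain a g where x: "x = (a, g)" "gnorm a * gnorm g = int n" by (auto simp: F_def)
   have "gnorm a \<noteq> 0" "gnorm g \<noteq> 0" using x n by auto
   then have "1 \<le> gnorm a" "1 \<le> gnorm g" using gnorm_nonneg[of a] gnorm_nonneg[of g] by linarith+
   then have "gnorm a * 1 \<le> gnorm a * gnorm g" "1 * gnorm g \<le> gnorm a * gnorm g"
    by (intro mult_left_mono mult_right_mono; simp)+
   then show "x \<in> {z. gnorm z \<le> int n} \<times> {z. gnorm z \<le> int n}" using x by auto
  qed
 qed (simp add: finite_gnorm_le)
 have fD: "f ` D = P"
 proof (intro equalityI subsetI)
  fix x assume "x \<in> f ` D"
  then show "x \<in> P" by (auto simp: f_def D_def F_def P_def gnorm_gm)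
 next
  fix x assume "x \<in> P"
  then obtain z w where x: "x = (z, w)" "gnorm z = int n" "gnorm w = int n" by (auto simp: P_def)
  then have "gnorm z = gnorm w" "gnorm w \<noteq> 0" using n by (auto simp del: gnorm_eq_0_iff)
  from same_gnorm_rep[OF this]
  obtain a j g where a: "a \<in> prim_odd" "z = grot j (gm a g)" "w = gm (gc a) g" by blast
  have "(j, a, g) \<in> D" using a x by (simp add: D_def F_def gnorm_gm)
  moreover have "f (j, a, g) = x" using a x by (simp add: f_def)
  ultimately show "x \<in> f ` D" by (metis imageI)
 qed
 have fib: "card {t \<in> D. f t = y} = 2" if "y \<in> P" for y
 proof -
  from that fD obtain t where "t \<in> D" "y = f t" by blast
  then obtain j a g where t: "t = (j, a, g)" "a \<in> prim_odd" "gnorm a * gnorm g = int n"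
   by (auto simp: D_def F_def)
  have g0: "g \<noteq> 0" using t n by auto
  have ma: "- a \<in> prim_odd" using t by (auto simp: prim_odd_def)
  have m1: "gm (- a) (- g) = gm a g" "gm (gc (- a)) (- g) = gm (gc a) g"
   by (auto simp: gm_def gc_def)
  have "{t \<in> D. f t = y} = {(j, a, g), (j, - a, - g)}"
  proof (intro equalityI subsetI)
   fix s assume s: "s \<in> {t \<in> D. f t = y}"
   then obtain k b h where s': "s = (k, b, h)" "b \<in> prim_odd" by (auto simp: D_def F_def)
   have "f t = f s" using s \<open>y = f t\<close> by simp
   then have "grot j (gm a g) = grot k (gm b h)" "gm (gc a) g = gm (gc b) h"
    by (auto simp: f_def s' t)
   from same_gnorm_rep_unique[OF t(2) s'(2) g0 this] show "s \<in> {(j, a, g), (j, - a, - g)}"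
    unfolding s' by auto
  next
   fix s assume "s \<in> {(j, a, g), (j, - a, - g)}"
   then show "s \<in> {t \<in> D. f t = y}" using t ma m1 \<open>y = f t\<close> by (auto simp: f_def D_def F_def)
  qed
  moreover have "g \<noteq> - g" using g0 by (auto simp: prod_eq_iff)
  ultimately show ?thesis by auto
 qed
 have finD: "finite D" using finF by (simp add: D_def)
 have "card D = (\<Sum>y\<in>f ` D. card {t \<in> D. f t = y})"
  unfolding card_eq_sum by (rule sum.image_gen[OF finD])
 also have "\<dots> = 2 * card P" unfolding fD using fib by simp
 finally have "card D = 2 * card P" .
 moreover have "card D = 2 * card F" by (simp add: D_def card_cartesian_product)
 moreover have "card P = (r2 n)\<^sup>2" by (simp add: P_def card_cartesian_product r2_def power2_eq_square)
 ultimately show ?thesis using card_factor_pairs[OF n] by (simp add: F_def)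
qed

subsection \<open>The divisor bound\<close>

definition dcount :: "nat \<Rightarrow> nat" where "dcount n = card {d. d dvd n}"

lemma dcount_prime_power_mult:
 assumes "prime p" "0 < m"
 shows "dcount (p ^ a * m) \<le> (a + 1) * dcount m"
proof -
 have "{d. d dvd p ^ a * m} \<subseteq> (\<lambda>(i, e). p ^ i * e) ` ({..a} \<times> {d. d dvd m})"
 proof
  fix d assume "d \<in> {d. d dvd p ^ a * m}"
  then obtain b c where d: "d = b * c" "b dvd p ^ a" "c dvd m" using division_decomp by blast
  then obtain i where "i \<le> a" "b = p ^ i" using assms divides_primepow_nat by blast
  then show "d \<in> (\<lambda>(i, e). p ^ i * e) ` ({..a} \<times> {d. d dvd m})" using d by force
 qed
 then have "dcount (p ^ a * m) \<le> card ((\<lambda>(i, e). p ^ i * e) ` ({..a} \<times> {d. d dvd m}))"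
  unfolding dcount_def using assms by (intro card_mono) auto
 also have "\<dots> \<le> card ({..a} \<times> {d. d dvd m})" using assms by (intro card_image_le) auto
 finally show ?thesis by (simp add: card_cartesian_product dcount_def)
qed

text \<open>Strip off one prime power p^a at a time; the divisor count grows by the factor a + 1.
  For p >= 2^(1/e) this is at most 2^a <= p^(a e) at no cost. For the finitely many smaller primes
  the constant C = 1 + 1 / (e ln 2) is paid once per prime, as 1 + a e ln 2 <= 2^(a e).\<close>

lemma dcount_bound:
 assumes e: "0 < (e::real)"
 shows "\<exists>C\<ge>1. \<forall>n\<ge>1. real (dcount n) \<le> C * real n powr e"
proof -
 define C where "C = 1 + 1 / (e * ln 2)"
 define P where "P = {p. prime p \<and> real p < 2 powr (1 / e)}"
 have C1: "1 \<le> C" using e by (simp add: C_def)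
 have finP: "finite P"
 proof (rule finite_subset)
  show "P \<subseteq> {..nat \<lceil>2 powr (1 / e)\<rceil>}" by (auto simp: P_def) linarith
 qed auto
 have Ca: "real a + 1 \<le> C * 2 powr (a * e)" for a :: nat
 proof -
  have "1 + a * e * ln 2 \<le> exp (a * e * ln 2)" by (rule exp_ge_add_one_self)
  also have "\<dots> = 2 powr (a * e)" by (simp add: powr_def mult_ac)
  finally have 1: "1 + a * e * ln 2 \<le> 2 powr (a * e)" .
  have "real a + 1 \<le> C * (1 + a * e * ln 2)" using e
   by (simp add: C_def field_simps)
  also have "\<dots> \<le> C * 2 powr (a * e)" using 1 C1 by (intro mult_left_mono) auto
  finally show ?thesis .
 qed
 have main: "real (dcount n) \<le> C ^ card {p\<in>P. p dvd n} * real n powr e" if "1 \<le> n" for n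
  using that
 proof (induction n rule: less_induct)
  case (less n)
  show ?case
  proof (cases "n = 1")
   case True
   have "1 * 1 \<le> C ^ card {p\<in>P. p dvd n} * real n powr e"
    using True C1 by (intro mult_mono one_le_power) auto
   then show ?thesis using True by (simp add: dcount_def)
  next
   case False
   then obtain p where p: "prime p" "p dvd n" using prime_factor_nat by blast
   define a where "a = multiplicity p n"
   have "n \<noteq> 0" "\<not> is_unit p" using less.prems p by (auto simp: not_prime_unit)
   then obtain m where m: "n = p ^ a * m" "\<not> p dvd m" unfolding a_def
    by (metis multiplicity_decompose')
   have a1: "1 \<le> a" using m p by (cases a) auto
   have p2: "2 \<le> p" using p prime_ge_2_nat by blast
   have m0: "1 \<le> m" using less.prems m by (cases m) auto
   have "p ^ 1 \<le> p ^ a" using p2 a1 by (intro power_increasing) auto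
   then have "1 * m < p ^ a * m" using p2 m0 by (intro mult_strict_right_mono) auto
   then have mn: "m < n" using m by simp
   define k where "k j = card {p\<in>P. p dvd j}" for j
   have IH: "real (dcount m) \<le> C ^ k m * real m powr e" unfolding k_def using less.IH mn m0 by blast
   have key: "(real a + 1) * C ^ k m \<le> C ^ k n * real p powr (a * e)"
   proof (cases "p \<in> P")
    case True
    have "card (insert p {p\<in>P. p dvd m}) \<le> k n" unfolding k_def using True finP p m
     by (intro card_mono) auto
    moreover have "card (insert p {p\<in>P. p dvd m}) = k m + 1" unfolding k_def using m finP by auto
    ultimately have "C * C ^ k m \<le> C ^ k n" using C1 power_increasing[of "k m + 1" "k n" C] by simp
    moreover have "real a + 1 \<le> C * real p powr (a * e)"
    proof -
     have "(2::real) powr (a * e) \<le> real p powr (a * e)" using p2 e by (intro powr_mono2) auto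
     then have "C * 2 powr (a * e) \<le> C * real p powr (a * e)" using C1 by (intro mult_left_mono) auto
     then show ?thesis using Ca[of a] by linarith
    qed
    ultimately have "(real a + 1) * C ^ k m \<le> (C * real p powr (a * e)) * C ^ k m"
     "(C * C ^ k m) * real p powr (a * e) \<le> C ^ k n * real p powr (a * e)"
     using C1 by (intro mult_right_mono; simp)+
    then show ?thesis by (simp add: mult_ac)
   next
    case False
    then have "2 powr (1 / e) \<le> real p" using p by (simp add: P_def)
    then have "(2 powr (1 / e)) powr (a * e) \<le> real p powr (a * e)" using e by (intro powr_mono2) auto
    then have "2 powr (real a) \<le> real p powr (a * e)" using e by (simp add: powr_powr)
    moreover have "real a + 1 \<le> 2 powr (real a)"
    proof -
     have "a + 1 \<le> 2 ^ a" by (induction a) auto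
     then have "real (a + 1) \<le> real (2 ^ a)" by (simp only: of_nat_le_iff)
     then show ?thesis by (simp add: powr_realpow)
    qed
    moreover have "C ^ k m \<le> C ^ k n" unfolding k_def using finP m C1
     by (intro power_increasing card_mono) auto
    ultimately have "(real a + 1) * C ^ k m \<le> real p powr (a * e) * C ^ k n"
     using C1 by (intro mult_mono) auto
    then show ?thesis by (simp add: mult_ac)
   qed
   have "real (dcount n) \<le> real ((a + 1) * dcount m)"
    using dcount_prime_power_mult[of p m a] p m0 m unfolding of_nat_le_iff by auto
   also have "\<dots> = (real a + 1) * real (dcount m)" by (simp add: algebra_simps)
   also have "\<dots> \<le> (real a + 1) * (C ^ k m * real m powr e)" using IH by (intro mult_left_mono) auto
   also have "\<dots> = ((real a + 1) * C ^ k m) * real m powr e" by simp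
   also have "\<dots> \<le> (C ^ k n * real p powr (a * e)) * real m powr e"
    using key by (intro mult_right_mono) auto
   also have "real p powr (a * e) = (real p powr real a) powr e" by (rule powr_powr[symmetric])
   also have "real p powr real a = real p ^ a" using p2 by (intro powr_realpow) auto
   also have "C ^ k n * (real p ^ a) powr e * real m powr e = C ^ k n * real n powr e"
    unfolding m(1) by (simp add: powr_mult)
   finally show ?thesis by (simp add: k_def)
  qed
 qed
 show ?thesis
 proof (intro exI[of _ "C ^ card P"] conjI allI impI)
  show "1 \<le> C ^ card P" using C1 by simp
  fix n :: nat assume n: "1 \<le> n"
  have "C ^ card {p\<in>P. p dvd n} \<le> C ^ card P" using C1 finP
   by (intro power_increasing card_mono) auto
  then have "C ^ card {p\<in>P. p dvd n} * real n powr e \<le> C ^ card P * real n powr e"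
   by (intro mult_right_mono) auto
  then show "real (dcount n) \<le> C ^ card P * real n powr e" using main[OF n] by linarith
 qed
qed

section \<open>Representations as a sum of two squares bounded by divisors\<close>

lemma dvd_of_coprime_mult:
 fixes c d x y :: int
 assumes "coprime x y" "c dvd x * d" "c dvd y * d" shows "c dvd d"
proof -
 obtain u v where "u * x + v * y = 1" using assms(1) by (metis bezout_int coprime_imp_gcd_eq_1)
 then have "d = u * (x * d) + v * (y * d)" by (metis distrib_right mult.assoc mult.left_neutral)
 then show ?thesis using assms by (metis dvd_add dvd_mult)
qed

text \<open>If the conjugates of a and b both divide the primitive z and both have norm c, then c
  divides a z and b z, hence s z, where s is a times the conjugate of b. Primitivity of z makes c
  divide s, and since s has norm c^2 the quotient is one of the four units.\<close>

lemma card_prim_odd_divisors: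
 assumes z: "coprime (fst z) (snd z)" and c: "0 < c"
 shows "card {a \<in> prim_odd. gnorm a = c \<and> (\<exists>g. z = gm (gc a) g)} \<le> 4" (is "card ?A \<le> 4")
proof (cases "?A = {}")
 case False
 then obtain b where b: "b \<in> ?A" by blast
 have div: "c dvd fst (gm a z) \<and> c dvd snd (gm a z)" if "a \<in> ?A" for a
 proof -
  from that obtain g where g: "gnorm a = c" "z = gm (gc a) g" by auto
  have "gi (gm a z) = (gi a * cnj (gi a)) * gi g" unfolding g(2) by (simp add: gi_gm gi_gc)
  also have "\<dots> = gi (c * fst g, c * snd g)"
   unfolding gi_mult_cnj g(1) by (simp add: gi_def complex_eq_iff)
  finally have "gm a z = (c * fst g, c * snd g)" by simp
  then show ?thesis by simp
 qed
 have "a \<in> {b, - b, grot True b, - grot True b}" if a: "a \<in> ?A" for a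
 proof -
  define s where "s = gm a (gc b)"
  note da = div[OF a] and db = div[OF b]
  define x y where "x = fst z" and "y = snd z"
  define a1 a2 b1 b2 where "a1 = fst a" and "a2 = snd a" and "b1 = fst b" and "b2 = snd b"
  note defs = x_def y_def a1_def a2_def b1_def b2_def
  have d: "c dvd a1 * x - a2 * y" "c dvd a1 * y + a2 * x" "c dvd b1 * x - b2 * y" "c dvd b1 * y + b2 * x"
   using da db by (auto simp: gm_def defs)
  have s: "fst s = a1 * b1 + a2 * b2" "snd s = a2 * b1 - a1 * b2"
   by (auto simp: s_def gm_def gc_def defs)
  have e: "x * fst s = b1 * (a1 * x - a2 * y) + a2 * (b1 * y + b2 * x)"
   "y * fst s = b1 * (a1 * y + a2 * x) - a2 * (b1 * x - b2 * y)"
   "x * snd s = a2 * (b1 * x - b2 * y) - b2 * (a1 * x - a2 * y)"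
   "y * snd s = a2 * (b1 * y + b2 * x) - b2 * (a1 * y + a2 * x)"
   unfolding s by (auto simp: algebra_simps)
  have cx: "c dvd x * fst s" "c dvd y * fst s" "c dvd x * snd s" "c dvd y * snd s"
   unfolding e by (intro dvd_add dvd_diff dvd_mult d)+
  have co: "coprime x y" using z by (simp add: x_def y_def)
  have "c dvd fst s" "c dvd snd s"
   using dvd_of_coprime_mult[OF co cx(1,2)] dvd_of_coprime_mult[OF co cx(3,4)] .
  then obtain p q where pq: "fst s = c * p" "snd s = c * q" by (meson dvdE)
  have gn: "gnorm s = c * c" using a b by (simp add: s_def gnorm_gm)
  then have "c * c * (p\<^sup>2 + q\<^sup>2) = c * c * 1"
   unfolding gnorm_def pq by (simp add: power2_eq_square algebra_simps)
  then have pq1: "p\<^sup>2 + q\<^sup>2 = 1" using c by simp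
  have "p\<^sup>2 \<le> 1" "q\<^sup>2 \<le> 1" using pq1 zero_le_power2[of p] zero_le_power2[of q] by linarith+
  then have "\<bar>p\<bar> \<le> 1" "\<bar>q\<bar> \<le> 1" by (simp_all add: abs_square_le_1)
  then have "p \<in> {-1, 0, 1}" "q \<in> {-1, 0, 1}" by auto
  then have pq2: "(p, q) \<in> {(1, 0), (- 1, 0), (0, 1), (0, - 1)}" using pq1 by auto
  have "gi a * of_int c = gi a * (gi b * cnj (gi b))" using b by (simp add: gi_mult_cnj)
  also have "\<dots> = gi s * gi b" by (simp add: s_def gi_gm gi_gc)
  also have "gi s = of_int c * gi (p, q)" using pq by (simp add: gi_def complex_eq_iff)
  finally have "gi a = gi (gm (p, q) b)" using c by (simp add: gi_gm)
  then have "a = gm (p, q) b" by simp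
  moreover have "p = 1 \<and> q = 0 \<or> p = - 1 \<and> q = 0 \<or> p = 0 \<and> q = 1 \<or> p = 0 \<and> q = - 1"
   using pq2 by simp
  ultimately have "a = b \<or> a = - b \<or> a = grot True b \<or> a = - grot True b"
   by (elim disjE conjE) (simp_all add: gm_def grot_def prod_eq_iff)
  then show ?thesis by simp
 qed
 then have "?A \<subseteq> set [b, - b, grot True b, - grot True b]" by auto
 then have "card ?A \<le> card (set [b, - b, grot True b, - grot True b])" by (intro card_mono) auto
 also have "\<dots> \<le> 4" by (rule order_trans[OF card_length]) auto
 finally show ?thesis .
next
 case True
 then show ?thesis by (metis card.empty zero_le)
qed

text \<open>With one primitive representation z fixed, every other w of the same norm is determined
  by a pair (j, a): the equation z = conj(a) g then fixes g. The norm of a divides n, and each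
  divisor admits at most four a; with the two values of j this gives the factor 8.\<close>

lemma r2_le_of_primitive:
 assumes z: "coprime (fst z) (snd z)" "gnorm z = int n" and n: "0 < n"
 shows "r2 n \<le> 8 * dcount n"
proof -
 define A where "A c = {a \<in> prim_odd. gnorm a = int c \<and> (\<exists>g. z = gm (gc a) g)}" for c
 define B where "B = (UNIV :: bool set) \<times> (\<Union>c\<in>{c. c dvd n}. A c)"
 have finA: "finite (A c)" for c
  by (rule finite_subset[OF _ finite_gnorm_eq[of "int c"]]) (auto simp: A_def)
 have ex: "\<exists>j a g. a \<in> prim_odd \<and> w = grot j (gm a g) \<and> z = gm (gc a) g" if "gnorm w = int n" for w
 proof -
  have "gnorm w = gnorm z" "gnorm z \<noteq> 0" using that z n by (simp_all del: gnorm_eq_0_iff)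
  then show ?thesis using same_gnorm_rep[of w z] by blast
 qed
 define f where "f w = (SOME ja. \<exists>g. snd ja \<in> prim_odd \<and> w = grot (fst ja) (gm (snd ja) g)
   \<and> z = gm (gc (snd ja)) g)" for w
 have f: "\<exists>g. snd (f w) \<in> prim_odd \<and> w = grot (fst (f w)) (gm (snd (f w)) g) \<and> z = gm (gc (snd (f w))) g"
  if "gnorm w = int n" for w
  unfolding f_def by (rule someI_ex) (use ex[OF that] in auto)
 have "inj_on f {w. gnorm w = int n}"
 proof (rule inj_onI)
  fix w w' assume w: "w \<in> {w. gnorm w = int n}" "w' \<in> {w. gnorm w = int n}" and eq: "f w = f w'"
  obtain g where g: "snd (f w) \<in> prim_odd" "w = grot (fst (f w)) (gm (snd (f w)) g)" "z = gm (gc (snd (f w))) g"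
   using f w by blast
  obtain h where h: "w' = grot (fst (f w)) (gm (snd (f w)) h)" "z = gm (gc (snd (f w))) h"
   using f[of w'] w eq by auto
  have "gi (gc (snd (f w))) * gi g = gi (gc (snd (f w))) * gi h"
   using g(3) h(2) by (simp flip: gi_gm)
  moreover have "gi (gc (snd (f w))) \<noteq> 0" using gnorm_prim_odd_pos[OF g(1)] by (auto simp: gi_gc)
  ultimately have "g = h" by simp
  then show "w = w'" using g h by simp
 qed
 moreover have "f ` {w. gnorm w = int n} \<subseteq> B"
 proof
  fix y assume "y \<in> f ` {w. gnorm w = int n}"
  then obtain w where w: "gnorm w = int n" "y = f w" by auto
  then obtain g where g: "snd y \<in> prim_odd" "z = gm (gc (snd y)) g" using f[of w] by auto
  define c where "c = nat (gnorm (snd y))"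
  have c: "gnorm (snd y) = int c" by (simp add: c_def)
  have "int n = int c * gnorm g" using g z c by (simp add: gnorm_gm)
  then have "int c dvd int n" by simp
  then have "c dvd n" by simp
  moreover have "snd y \<in> A c" using g c by (simp only: A_def) blast
  ultimately show "y \<in> B" unfolding B_def mem_Times_iff by blast
 qed
 moreover have "finite B" unfolding B_def using finA n by auto
 ultimately have "r2 n \<le> card B" unfolding r2_def by (metis card_inj_on_le)
 also have "card B = 2 * card (\<Union>c\<in>{c. c dvd n}. A c)" by (simp add: B_def card_cartesian_product)
 also have "card (\<Union>c\<in>{c. c dvd n}. A c) \<le> (\<Sum>c | c dvd n. card (A c))"
  using n by (intro card_UN_le) auto
 also have "\<dots> \<le> (\<Sum>c | c dvd n. 4)"
 proof (rule sum_mono)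
  fix c assume "c \<in> {c. c dvd n}"
  then have "0 < int c" using n by (auto intro: Nat.gr0I)
  then show "card (A c) \<le> 4" unfolding A_def using card_prim_odd_divisors[OF z(1)] by blast
 qed
 finally show ?thesis by (simp add: dcount_def)
qed

text \<open>Representations are sorted by the gcd k of their coordinates; dividing by k makes them
  primitive. The square of the divisor count is a crude bound, but below it matters only as
  n^\<epsilon>.\<close>

lemma r2_le_dcount:
 assumes n: "0 < n"
 shows "r2 n \<le> 8 * (dcount n)\<^sup>2"
proof -
 define T where "T k = {z. coprime (fst z) (snd z) \<and> (int k)\<^sup>2 * gnorm z = int n}" for k
 define I where "I k = (\<lambda>z. (int k * fst z, int k * snd z)) ` T k" for k
 have T: "finite (T k) \<and> card (T k) \<le> 8 * dcount n" if "k dvd n" for k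
 proof (cases "T k = {}")
  case False
  then obtain z where z: "coprime (fst z) (snd z)" "(int k)\<^sup>2 * gnorm z = int n" by (auto simp: T_def)
  define m where "m = nat (gnorm z)"
  have m: "gnorm z = int m" by (simp add: m_def)
  have "int (k\<^sup>2 * m) = int n" using z m by simp
  then have kn: "n = k\<^sup>2 * m" by (simp only: of_nat_eq_iff)
  have m0: "0 < m" "0 < k" using kn n by (auto intro: Nat.gr0I)
  have sub: "T k \<subseteq> {z. gnorm z = int m}"
  proof
   fix w assume "w \<in> T k"
   then have "(int k)\<^sup>2 * gnorm w = (int k)\<^sup>2 * gnorm z" using z by (simp add: T_def)
   then show "w \<in> {z. gnorm z = int m}" using m m0 by simp
  qed
  then have "card (T k) \<le> r2 m" unfolding r2_def by (intro card_mono) auto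
  also have "\<dots> \<le> 8 * dcount m" using r2_le_of_primitive[OF z(1) m m0(1)] .
  also have "dcount m \<le> dcount n" unfolding dcount_def kn using n kn
   by (intro card_mono) auto
  finally show ?thesis using finite_subset[OF sub] by simp
 qed auto
 have "{z. gnorm z = int n} \<subseteq> (\<Union>k\<in>{k. k dvd n}. I k)"
 proof
  fix z assume "z \<in> {z. gnorm z = int n}"
  then have z: "gnorm z = int n" by simp
  define d where "d = gcd (fst z) (snd z)"
  define k where "k = nat d"
  have z0: "z \<noteq> 0" using z n by auto
  have d: "d = int k" by (simp add: k_def d_def)
  define w where "w = (fst z div d, snd z div d)"
  have zw: "z = (int k * fst w, int k * snd w)"
   by (auto simp: w_def d[symmetric] prod_eq_iff) (auto simp: d_def)
  have "coprime (fst w) (snd w)" unfolding w_def d_def using z0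
   by (simp, intro div_gcd_coprime) (auto simp: prod_eq_iff)
  moreover have e: "(int k)\<^sup>2 * gnorm w = int n"
   using z by (subst (asm) zw) (simp add: gnorm_def power2_eq_square algebra_simps)
  ultimately have "w \<in> T k" by (simp add: T_def)
  moreover have "int k dvd int n" using e by (metis dvd_triv_left dvd_mult2 power2_eq_square mult.assoc)
  then have "k dvd n" by simp
  ultimately show "z \<in> (\<Union>k\<in>{k. k dvd n}. I k)" unfolding I_def using zw by blast
 qed
 then have "r2 n \<le> card (\<Union>k\<in>{k. k dvd n}. I k)" unfolding r2_def using T n
  by (intro card_mono) (auto simp: I_def)
 also have "\<dots> \<le> (\<Sum>k | k dvd n. card (I k))" using n by (intro card_UN_le) auto
 also have "\<dots> \<le> (\<Sum>k | k dvd n. 8 * dcount n)"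
  unfolding I_def using T by (intro sum_mono order_trans[OF card_image_le]) auto
 also have "\<dots> = 8 * (dcount n)\<^sup>2" by (simp add: dcount_def power2_eq_square)
 finally show ?thesis .
qed

lemma r2_bound:
 assumes "0 < (e::real)"
 shows "\<exists>C\<ge>1. \<forall>n\<ge>1. real (r2 n) \<le> C * real n powr e"
proof -
 have "0 < e / 2" using assms by simp
 from dcount_bound[OF this] obtain C where
  C: "1 \<le> C" "\<And>n. 1 \<le> n \<Longrightarrow> real (dcount n) \<le> C * real n powr (e / 2)"
  by blast
 show ?thesis
 proof (intro exI[of _ "8 * C\<^sup>2"] conjI allI impI)
  show "1 \<le> 8 * C\<^sup>2" using C(1) one_le_power[of C 2] by linarith
  fix n :: nat assume n: "1 \<le> n"
  have "real (r2 n) \<le> real (8 * (dcount n)\<^sup>2)" using r2_le_dcount[of n] n unfolding of_nat_le_iff by auto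
  also have "\<dots> = 8 * (real (dcount n))\<^sup>2" by simp
  also have "\<dots> \<le> 8 * (C * real n powr (e / 2))\<^sup>2" using C(2)[OF n] by (intro mult_left_mono power_mono) auto
  also have "\<dots> = 8 * C\<^sup>2 * real n powr e"
   using n by (simp add: power_mult_distrib power2_eq_square powr_add[symmetric])
  finally show "real (r2 n) \<le> 8 * C\<^sup>2 * real n powr e" .
 qed
qed

subsection \<open>Lattice points in a disc\<close>

definition disc_count :: "real \<Rightarrow> nat" where
 "disc_count x = card {z. real_of_int (gnorm z) \<le> x}"

lemma gnorm_le_real_iff: "0 \<le> x \<Longrightarrow> real_of_int (gnorm z) \<le> x \<longleftrightarrow> gnorm z \<le> int (nat \<lfloor>x\<rfloor>)"
 by (simp add: le_floor_iff)

lemma finite_disc [simp]: "finite {z. real_of_int (gnorm z) \<le> x}"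
 by (rule finite_subset[OF _ finite_gnorm_le[of "\<lfloor>x\<rfloor>"]]) (auto simp: le_floor_iff)

definition emb :: "int \<times> int \<Rightarrow> real \<times> real" where "emb z = (of_int (fst z), of_int (snd z))"

lemma norm_emb: "norm (emb z) = sqrt (real_of_int (gnorm z))"
 by (simp add: emb_def norm_Pair gnorm_def)

text \<open>The number 3/4 is a rational upper bound for half the diagonal of the unit
  square.\<close>

lemma norm_pair_half:
 fixes p :: "real \<times> real"
 assumes "\<bar>fst p\<bar> \<le> 1 / 2" "\<bar>snd p\<bar> \<le> 1 / 2"
 shows "norm p \<le> 3 / 4"
proof -
 have "(fst p)\<^sup>2 \<le> (1 / 2)\<^sup>2" "(snd p)\<^sup>2 \<le> (1 / 2)\<^sup>2"
  using assms by (metis abs_le_square_iff abs_of_nonneg zero_le_divide_1_iff zero_le_numeral)+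
 then have "(fst p)\<^sup>2 + (snd p)\<^sup>2 \<le> (3 / 4)\<^sup>2" by (simp add: power2_eq_square)
 then have "sqrt ((fst p)\<^sup>2 + (snd p)\<^sup>2) \<le> sqrt ((3 / 4)\<^sup>2)" by (rule real_sqrt_le_mono)
 then show ?thesis by (simp add: norm_prod_def)
qed

lemma measure_cball_plane: "0 \<le> r \<Longrightarrow> measure lborel (cball (0::real \<times> real) r) = pi * r\<^sup>2"
 using content_cball[of r "0 :: real \<times> real"] by (simp add: unit_ball_vol_2 power2_eq_square)

lemma measure_cell:
 "measure lborel (cbox (emb z - (1/2, 1/2)) (emb z + (1/2, 1/2))) = 1"
 "measure lborel (box (emb z - (1/2, 1/2)) (emb z + (1/2, 1/2))) = 1"
proof -
 show 1: "measure lborel (cbox (emb z - (1/2, 1/2)) (emb z + (1/2, 1/2))) = 1"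
  by (simp add: emb_def content_Pair)
 show "measure lborel (box (emb z - (1/2, 1/2)) (emb z + (1/2, 1/2))) = 1"
  using 1 unfolding measure_def emeasure_lborel_box_eq emeasure_lborel_cbox_eq .
qed

text \<open>Gauss's argument with unit squares around lattice points: the closed squares cover the
  disc of radius r - 3/4, the open ones are disjoint and stay inside radius r + 3/4. Closed squares
  serve the covering, open squares the disjointness.\<close>

lemma disc_count_gauss:
 assumes x: "1 \<le> x"
 shows "\<bar>real (disc_count x) - pi * x\<bar> \<le> 8 * sqrt x"
proof -
 define r where "r = sqrt x"
 have r1: "1 \<le> r" and r2: "r\<^sup>2 = x" using x by (auto simp: r_def)
 define S where "S = {z. real_of_int (gnorm z) \<le> x}"
 have S: "z \<in> S \<longleftrightarrow> norm (emb z) \<le> r" for z by (simp add: S_def norm_emb r_def)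
 have finS: "finite S" by (simp add: S_def)
 define Q where "Q z = cbox (emb z - (1/2, 1/2)) (emb z + (1/2, 1/2))" for z
 define B where "B z = box (emb z - (1/2, 1/2)) (emb z + (1/2, 1/2))" for z
 have mQ: "measure lborel (Q z) = 1" "measure lborel (B z) = 1" for z
  unfolding Q_def B_def using measure_cell by auto
 have inB: "p \<in> B z \<longleftrightarrow> \<bar>fst p - of_int (fst z)\<bar> < 1 / 2 \<and> \<bar>snd p - of_int (snd z)\<bar> < 1 / 2" for p z
 proof -
  obtain a b where p: "p = (a, b)" by (cases p)
  have "(a, b) \<in> B z \<longleftrightarrow> a \<in> box (of_int (fst z) - 1/2) (of_int (fst z) + 1/2) \<and>
    b \<in> box (of_int (snd z) - 1/2) (of_int (snd z) + (1/2::real))"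
   unfolding B_def emb_def box_prod by simp
  moreover have "x \<in> box (c - 1/2) (c + 1/2) \<longleftrightarrow> \<bar>x - c\<bar> < 1 / 2" for x c :: real
   unfolding box_real greaterThanLessThan_iff abs_less_iff
   by (intro iffI conjI; elim conjE; linarith)
  ultimately show ?thesis unfolding p fst_conv snd_conv by blast
 qed
 have "measure lborel (cball (0::real \<times> real) (r - 3 / 4)) \<le> measure lborel (\<Union>z\<in>S. Q z)"
 proof (rule measure_mono_fmeasurable)
  show "(\<Union>z\<in>S. Q z) \<in> fmeasurable lborel"
   using finS by (intro fmeasurable.finite_UN) (simp_all add: Q_def fmeasurable_cbox)
  show "cball 0 (r - 3 / 4) \<subseteq> (\<Union>z\<in>S. Q z)"
  proof
   fix p :: "real \<times> real" assume p: "p \<in> cball 0 (r - 3 / 4)"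
   define z where "z = (round (fst p), round (snd p))"
   have d: "\<bar>fst p - of_int (fst z)\<bar> \<le> 1 / 2" "\<bar>snd p - of_int (snd z)\<bar> \<le> 1 / 2"
    using of_int_round_abs_le[of "fst p"] of_int_round_abs_le[of "snd p"]
    by (auto simp: z_def abs_minus_commute)
   have "norm (p - emb z) \<le> 3 / 4" using d by (intro norm_pair_half) (auto simp: emb_def)
   then have "norm (emb z) \<le> r" using p norm_triangle_ineq2[of "emb z" p]
    by (simp add: norm_minus_commute)
   then have "z \<in> S" using S by simp
   moreover have "x \<in> cbox (c - 1/2) (c + 1/2) \<longleftrightarrow> \<bar>x - c\<bar> \<le> 1 / 2" for x c :: real
    unfolding cbox_interval atLeastAtMost_iff abs_le_iff
    by (intro iffI conjI; elim conjE; linarith)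
   then have "p \<in> Q z" unfolding Q_def using d
    by (cases p) (simp only: emb_def diff_Pair add_Pair cbox_Pair_iff fst_conv snd_conv simp_thms)
   ultimately show "p \<in> (\<Union>z\<in>S. Q z)" by blast
  qed
 qed auto
 also have "\<dots> \<le> (\<Sum>z\<in>S. measure lborel (Q z))"
  using finS by (intro measure_UNION_le) (auto simp: Q_def)
 also have "\<dots> = real (card S)" by (simp add: mQ)
 finally have lower: "pi * (r - 3 / 4)\<^sup>2 \<le> real (card S)" using r1 by (simp add: measure_cball_plane)
 have "real (card S) = (\<Sum>z\<in>S. measure lborel (B z))" by (simp add: mQ)
 also have "\<dots> = measure lborel (\<Union>z\<in>S. B z)"
 proof (rule measure_finite_Union[symmetric])
  show "disjoint_family_on B S"
  proof (unfold disjoint_family_on_def, intro ballI impI equalityI subsetI)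
   fix z w p assume zw: "z \<noteq> w" and p: "p \<in> B z \<inter> B w"
   have "\<bar>real_of_int (fst z) - of_int (fst w)\<bar> < 1" "\<bar>real_of_int (snd z) - of_int (snd w)\<bar> < 1"
    using p unfolding Int_iff inB by linarith+
   then have "z = w" by (auto simp: prod_eq_iff)
   then show "p \<in> {}" using zw by simp
  qed auto
 qed (use finS in \<open>auto simp: B_def emeasure_lborel_box_eq\<close>)
 also have "\<dots> \<le> measure lborel (cball (0::real \<times> real) (r + 3 / 4))"
 proof (rule measure_mono_fmeasurable)
  show "(\<Union>z\<in>S. B z) \<subseteq> cball 0 (r + 3 / 4)"
  proof
   fix p assume "p \<in> (\<Union>z\<in>S. B z)"
   then obtain z where z: "norm (emb z) \<le> r" "p \<in> B z" using S by blast
   have "norm (p - emb z) \<le> 3 / 4" using z(2) unfolding inB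
    by (intro norm_pair_half) (auto simp: emb_def)
   then have "norm p \<le> r + 3 / 4" using z(1) norm_triangle_ineq2[of p "emb z"] by linarith
   then show "p \<in> cball 0 (r + 3 / 4)" by simp
  qed
  show "(\<Union>z\<in>S. B z) \<in> sets lborel" using finS by (auto simp: B_def)
  show "cball 0 (r + 3 / 4) \<in> fmeasurable lborel"
   using r1 by (simp add: fmeasurable_def emeasure_cball)
 qed
 also have "\<dots> = pi * (r + 3 / 4)\<^sup>2" using r1 by (simp add: measure_cball_plane)
 finally have upper: "real (card S) \<le> pi * (r + 3 / 4)\<^sup>2" .
 have "pi * (r + 3 / 4)\<^sup>2 - pi * x = pi * (3 / 2 * r + 9 / 16)" "pi * x - pi * (r - 3 / 4)\<^sup>2 = pi * (3 / 2 * r - 9 / 16)"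
  unfolding r2[symmetric] by (simp_all add: power2_eq_square algebra_simps)
 moreover have "pi * (3 / 2 * r + 9 / 16) \<le> pi * (5 / 2 * r)" "pi * (3 / 2 * r - 9 / 16) \<le> pi * (5 / 2 * r)"
  using r1 by (intro mult_left_mono; simp)+
 moreover have "pi * (5 / 2 * r) \<le> 3.2 * (5 / 2 * r)"
  using pi_approx r1 by (intro mult_right_mono) auto
 ultimately have "\<bar>real (card S) - pi * x\<bar> \<le> 8 * r" using lower upper by linarith
 then show ?thesis by (simp add: S_def r_def disc_count_def)
qed

lemma card_gnorm_le_sum:
 "card {z. P z \<and> gnorm z \<le> int n} = (\<Sum>k\<le>n. card {z. P z \<and> gnorm z = int k})"
proof -
 have "{z. P z \<and> gnorm z \<le> int n} = (\<Union>k\<in>{..n}. {z. P z \<and> gnorm z = int k})"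
 proof (intro equalityI subsetI)
  fix z assume z: "z \<in> {z. P z \<and> gnorm z \<le> int n}"
  have "gnorm z = int (nat (gnorm z))" by simp
  moreover have "nat (gnorm z) \<le> n" using z by (simp add: nat_le_iff)
  ultimately show "z \<in> (\<Union>k\<in>{..n}. {z. P z \<and> gnorm z = int k})" using z by blast
 qed auto
 also have "card \<dots> = (\<Sum>k\<le>n. card {z. P z \<and> gnorm z = int k})"
  by (intro card_UN_disjoint) (auto intro: finite_subset[OF _ finite_gnorm_eq])
 finally show ?thesis .
qed

lemma r2_0: "r2 0 = 1"
proof -
 have "{z. gnorm z = int 0} = {0}" by auto
 then show ?thesis by (simp add: r2_def)
qed

lemma sum_r2: "real (\<Sum>k=1..n. r2 k) = real (disc_count (real n)) - 1"
proof -
 have "disc_count (real n) = card {z. True \<and> gnorm z \<le> int n}"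
  unfolding disc_count_def by (subst gnorm_le_real_iff) auto
 also have "\<dots> = (\<Sum>k\<le>n. r2 k)" unfolding card_gnorm_le_sum by (simp add: r2_def)
 also have "{..n} = insert 0 {1..n}" by auto
 finally show ?thesis by (simp add: r2_0)
qed

lemma sum_r2_div:
 assumes "1 \<le> c" "c \<le> n"
 shows "\<bar>real (\<Sum>k=1..n div c. r2 k) - pi * (real n / real c)\<bar> \<le> 9 * sqrt (real n / real c)"
proof -
 define y where "y = real n / real c"
 have y: "1 \<le> y" using assms by (simp add: y_def)
 have fl: "nat \<lfloor>y\<rfloor> = n div c" unfolding y_def by (simp add: floor_divide_of_nat_eq)
 have "disc_count y = disc_count (real (n div c))"
  unfolding disc_count_def using y fl by (simp add: gnorm_le_real_iff)
 then have "real (\<Sum>k=1..n div c. r2 k) = real (disc_count y) - 1" using sum_r2[of "n div c"] by simp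
 moreover have "1 \<le> sqrt y" using y by simp
 ultimately show ?thesis using disc_count_gauss[OF y] unfolding y_def[symmetric] by linarith
qed

lemma sum_r2_le: "real (\<Sum>k=1..n. r2 k) \<le> 13 * real n"
proof (cases "n = 0")
 case False
 then have "\<bar>real (\<Sum>k=1..n div 1. r2 k) - pi * (real n / real 1)\<bar> \<le> 9 * sqrt (real n / real 1)"
  by (intro sum_r2_div) auto
 moreover have "sqrt (real n) \<le> sqrt ((real n)\<^sup>2)" using False
  by (intro real_sqrt_le_mono) (simp add: power2_eq_square)
 moreover have "pi * real n \<le> 4 * real n" using pi_approx by (intro mult_right_mono) auto
 ultimately show ?thesis by simp
qed auto

section \<open>Lattice points with odd coordinate sum\<close>

definition odd_count :: "nat \<Rightarrow> nat" where
 "odd_count n = card {z. odd (fst z + snd z) \<and> gnorm z = int n}"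

text \<open>The points with even coordinate sum are the multiples of \<open>1 + \<i>\<close>.\<close>

lemma sum_odd_count:
 assumes "1 \<le> n"
 shows "\<bar>real (\<Sum>k=1..n. odd_count k) - pi / 2 * real n\<bar> \<le> 16 * sqrt (real n)"
proof -
 define E where "E = {z. even (fst z + snd z) \<and> gnorm z \<le> int n}"
 define D where "D = {z. odd (fst z + snd z) \<and> gnorm z \<le> int n}"
 have fin: "finite E" "finite D"
  using finite_subset[OF _ finite_gnorm_le[of "int n"]] by (auto simp: E_def D_def)
 have "E = gm (1, 1) ` {z. real_of_int (gnorm z) \<le> real n / 2}"
 proof (intro equalityI subsetI)
  fix z assume z: "z \<in> E"
  then obtain p where p: "fst z + snd z = 2 * p" unfolding E_def by (metis (lifting) evenE mem_Collect_eq)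
  have zz: "z = gm (1, 1) (p, snd z - p)" using p by (auto simp: gm_def prod_eq_iff)
  have "2 * gnorm (p, snd z - p) \<le> int n"
   using z by (subst (asm) zz) (simp add: E_def gnorm_gm, simp add: gnorm_def)
  then have "2 * real_of_int (gnorm (p, snd z - p)) \<le> real n" by linarith
  then show "z \<in> gm (1, 1) ` {z. real_of_int (gnorm z) \<le> real n / 2}" using zz by auto
 next
  fix z assume "z \<in> gm (1, 1) ` {z. real_of_int (gnorm z) \<le> real n / 2}"
  then obtain w where w: "z = gm (1, 1) w" "real_of_int (gnorm w) \<le> real n / 2" by auto
  have "gnorm z = 2 * gnorm w" unfolding w gnorm_gm by (simp add: gnorm_def)
  moreover have "even (fst z + snd z)" unfolding w gm_def by simp
  ultimately show "z \<in> E" unfolding E_def using w(2) by simp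
 qed
 moreover have "inj (gm (1, 1))" by (rule injI) (auto simp: gm_def prod_eq_iff)
 ultimately have cE: "card E = disc_count (real n / 2)"
  unfolding disc_count_def by (simp add: card_image inj_on_subset)
 have "disc_count (real n) = card (E \<union> D)"
  unfolding disc_count_def by (rule arg_cong[of _ _ card]) (auto simp: E_def D_def gnorm_le_real_iff)
 also have "\<dots> = card E + card D" using fin by (intro card_Un_disjoint) (auto simp: E_def D_def)
 finally have cD: "real (card D) = real (disc_count (real n)) - real (disc_count (real n / 2))"
  using cE by simp
 have "card D = (\<Sum>k\<le>n. odd_count k)" unfolding D_def card_gnorm_le_sum by (simp add: odd_count_def)
 also have "{..n} = insert 0 {1..n}" by auto
 also have "{z. odd (fst z + snd z) \<and> gnorm z = int 0} = {}" by auto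
 then have "odd_count 0 = 0" unfolding odd_count_def by (metis card.empty)
 then have "(\<Sum>k\<in>insert 0 {1..n}. odd_count k) = (\<Sum>k=1..n. odd_count k)" by simp
 finally have D: "card D = (\<Sum>k=1..n. odd_count k)" .
 have 1: "\<bar>real (disc_count (real n)) - pi * real n\<bar> \<le> 8 * sqrt (real n)"
  using assms by (intro disc_count_gauss) auto
 have 2: "\<bar>real (disc_count (real n / 2)) - pi * (real n / 2)\<bar> \<le> 8 * sqrt (real n)"
 proof (cases "2 \<le> n")
  case True
  then have "\<bar>real (disc_count (real n / 2)) - pi * (real n / 2)\<bar> \<le> 8 * sqrt (real n / 2)"
   by (intro disc_count_gauss) auto
  also have "sqrt (real n / 2) \<le> sqrt (real n)" by (intro real_sqrt_le_mono) auto
  finally show ?thesis by simp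
 next
  case False
  then have n: "n = 1" using assms by simp
  have "{z. real_of_int (gnorm z) \<le> real n / 2} = {0}"
  proof (intro equalityI subsetI)
   fix z assume "z \<in> {z. real_of_int (gnorm z) \<le> real n / 2}"
   then have "gnorm z \<le> 0" using n by simp
   then have "gnorm z = 0" using gnorm_nonneg[of z] by linarith
   then show "z \<in> {0}" by simp
  qed auto
  then have "disc_count (real n / 2) = 1" unfolding disc_count_def by simp
  then show ?thesis using n pi_approx by (simp add: abs_le_iff)
 qed
 show ?thesis using 1 2 cD D by (simp add: abs_le_iff)
qed

subsection \<open>Partial summation\<close>

lemma inverse_sqrt_diff:
 assumes "1 \<le> n"
 shows "1 / (sqrt (real n) * real (Suc n)) \<le> 2 * (1 / sqrt (real n) - 1 / sqrt (real (Suc n)))"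
proof -
 define a b where "a = sqrt (real n)" and "b = sqrt (real (Suc n))"
 have a: "0 < a" "a \<le> b" "b * b = real (Suc n)" "b * b - a * a = 1" using assms by (auto simp: a_def b_def)
 have b0: "0 < b" using a by linarith
 have "(b - a) * (b + a) = 1" using a(4) by (simp add: algebra_simps)
 then have "1 \<le> (b - a) * (2 * b)" using a(1,2) mult_left_mono[of "b + a" "2 * b" "b - a"] by linarith
 then have "1 / (a * (b * b)) \<le> ((b - a) * (2 * b)) / (a * (b * b))" using a b0 by (intro divide_right_mono) auto
 also have "\<dots> = 2 * (1 / a - 1 / b)"
 proof -
  have "2 * (1 / a - 1 / b) = 2 * ((b - a) / (a * b))" using a(1) b0 by (simp add: diff_frac_eq)
  then show ?thesis using b0 by simp
 qed
 finally show ?thesis unfolding a(3) unfolding a_def b_def .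
qed

text \<open>Abel summation in inductive form. After removing the mean c, the weighted sum minus E n
  / n changes at each step by E n (1 / n - 1 / (n + 1)), which is O(1 / (sqrt n (n + 1))) and
  telescopes; the mean itself contributes c times a harmonic number.\<close>

lemma partial_sum_inverse:
 fixes f :: "nat \<Rightarrow> real"
 assumes F: "\<And>n. 1 \<le> n \<Longrightarrow> \<bar>(\<Sum>k=1..n. f k) - c * real n\<bar> \<le> C * sqrt (real n)"
 shows "\<exists>D\<ge>0. \<forall>n\<ge>1. \<bar>(\<Sum>k=1..n. f k / real k) - c * ln (real n)\<bar> \<le> D"
proof -
 define E where "E n = (\<Sum>k=1..n. f k) - c * real n" for n
 define e where "e k = f k - c" for k
 have E: "E n = (\<Sum>k=1..n. e k)" for n by (simp add: E_def e_def sum_subtractf)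
 have C0: "0 \<le> C" using F[of 1] by simp
 have main: "\<bar>(\<Sum>k=1..n. e k / real k) - E n / real n\<bar> \<le> 2 * C * (1 - 1 / sqrt (real n))" if "1 \<le> n" for n
  using that
 proof (induction n rule: dec_induct)
  case base then show ?case by (simp add: E)
 next
  case (step n)
  have n: "0 < real n" using step by auto
  have "(\<Sum>k=1..Suc n. e k / real k) - E (Suc n) / real (Suc n) =
    ((\<Sum>k=1..n. e k / real k) - E n / real n) + E n * (1 / real n - 1 / real (Suc n))"
   by (simp add: E add_divide_distrib algebra_simps)
  moreover have "\<bar>E n * (1 / real n - 1 / real (Suc n))\<bar> \<le> 2 * C * (1 / sqrt (real n) - 1 / sqrt (real (Suc n)))"
  proof -
   have "1 / real n - 1 / real (Suc n) = 1 / (real n * real (Suc n))" using n by (simp add: field_simps)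
   then have "\<bar>E n * (1 / real n - 1 / real (Suc n))\<bar> = \<bar>E n\<bar> * (1 / (real n * real (Suc n)))"
    by (simp add: abs_mult)
   also have "\<dots> \<le> (C * sqrt (real n)) * (1 / (real n * real (Suc n)))"
    using F[of n] step by (intro mult_right_mono) (auto simp: E_def)
   also have "\<dots> = C * (1 / (sqrt (real n) * real (Suc n)))"
   proof -
    have "sqrt (real n) / real n = 1 / sqrt (real n)" using n
     by (metis real_div_sqrt less_imp_le inverse_divide inverse_eq_divide)
    moreover have "(C * sqrt (real n)) * (1 / (real n * real (Suc n))) = C * (sqrt (real n) / real n) * (1 / real (Suc n))"
     by simp
    ultimately show ?thesis by simp
   qed
   also have "\<dots> \<le> C * (2 * (1 / sqrt (real n) - 1 / sqrt (real (Suc n))))"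
    using C0 step by (intro mult_left_mono inverse_sqrt_diff) auto
   finally show ?thesis by (simp add: mult_ac)
  qed
  ultimately show ?case using step.IH by (simp add: algebra_simps)
 qed
 have bnd: "\<bar>(\<Sum>k=1..n. e k / real k)\<bar> \<le> 3 * C" if n: "1 \<le> n" for n
 proof -
  have "\<bar>E n / real n\<bar> \<le> C * sqrt (real n) / real n" using F[OF n] unfolding E_def[symmetric] abs_divide
   by (simp add: divide_right_mono)
  also have "\<dots> \<le> C"
  proof -
   have "sqrt (real n) \<le> sqrt (real n * real n)" using n by (intro real_sqrt_le_mono) auto
   then have "sqrt (real n) \<le> real n" by simp
   then have "C * sqrt (real n) \<le> C * real n" using C0 by (intro mult_left_mono) auto
   then show ?thesis using n by (simp add: divide_le_eq)
  qed
  finally have "\<bar>E n / real n\<bar> \<le> C" .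
  moreover have "2 * C * (1 - 1 / sqrt (real n)) \<le> 2 * C * 1" using C0 by (intro mult_left_mono) auto
  ultimately show ?thesis using main[OF n] by linarith
 qed
 have harm_bnd: "\<bar>harm n - ln (real n)\<bar> \<le> 1" if n: "1 \<le> n" for n
 proof -
  have "harm (Suc (n - 1)) - ln (real (Suc (n - 1))) \<le> harm (Suc 0) - ln (real (Suc 0))"
   using decseq_harm_diff_ln by (rule decseqD) simp
  then have "harm n - ln (real n) \<le> 1" using n by (simp add: harm_def)
  moreover have "ln (real n) \<le> ln (real n + 1)" using n by simp
  ultimately show ?thesis using ln_le_harm[of n] by simp
 qed
 show ?thesis
 proof (intro exI[of _ "3 * C + \<bar>c\<bar>"] conjI allI impI)
  show "0 \<le> 3 * C + \<bar>c\<bar>" using C0 by simp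
  fix n :: nat assume n: "1 \<le> n"
  have "(\<Sum>k=1..n. f k / real k) = (\<Sum>k=1..n. e k / real k) + c * harm n"
  proof -
   have "(\<Sum>k=1..n. f k / real k) = (\<Sum>k=1..n. e k / real k + c * inverse (real k))"
    by (rule sum.cong) (auto simp: e_def diff_divide_distrib inverse_eq_divide)
   then show ?thesis by (simp add: harm_def sum.distrib sum_distrib_left)
  qed
  then have "(\<Sum>k=1..n. f k / real k) - c * ln (real n) = (\<Sum>k=1..n. e k / real k) + c * (harm n - ln (real n))"
   by (simp add: algebra_simps)
  moreover have "\<bar>c * (harm n - ln (real n))\<bar> \<le> \<bar>c\<bar>"
   using harm_bnd[OF n] unfolding abs_mult by (simp add: mult_left_le)
  ultimately show "\<bar>(\<Sum>k=1..n. f k / real k) - c * ln (real n)\<bar> \<le> 3 * C + \<bar>c\<bar>"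
   using bnd[OF n] by linarith
 qed
qed

lemma partial_sum_inverse_sqrt:
 fixes f :: "nat \<Rightarrow> real"
 assumes F: "\<And>k. k \<le> n \<Longrightarrow> (\<Sum>j=1..k. f j) \<le> A * real k" and A: "0 \<le> A"
 shows "(\<Sum>k=1..n. f k / sqrt (real k)) \<le> 2 * A * sqrt (real n)"
proof -
 define S where "S n = (\<Sum>k=1..n. f k)" for n
 have "(\<Sum>k=1..m. f k / sqrt (real k)) \<le> S m / sqrt (real m) + A * sqrt (real m)" if "m \<le> n" for m
  using that
 proof (induction m)
  case 0 then show ?case by (simp add: S_def)
 next
  case (Suc m)
  define a b where "a = sqrt (real m)" and "b = sqrt (real (Suc m))"
  have a: "0 \<le> a" "a \<le> b" "b * b - a * a = 1" "0 < b" "a * a = real m" by (auto simp: a_def b_def)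
  have "(\<Sum>k=1..Suc m. f k / sqrt (real k)) \<le> S m / a + A * a + f (Suc m) / b"
   using Suc by (simp add: a_def b_def)
  moreover have "S (Suc m) / b = S m / b + f (Suc m) / b" by (simp add: S_def add_divide_distrib)
  moreover have "S m / a \<le> S m / b + A * (b - a)"
  proof (cases "m = 0")
   case True then show ?thesis using a A by (simp add: S_def)
  next
   case False
   then have a0: "0 < a" by (simp add: a_def)
   have "S m / a - S m / b = S m * ((b - a) / (a * b))" using a0 a by (simp add: field_simps)
   also have "\<dots> \<le> (A * (a * a)) * ((b - a) / (a * b))"
    using F[of m] Suc.prems a a0 unfolding S_def[symmetric] by (intro mult_right_mono) auto
   also have "\<dots> = A * (b - a) * (a / b)" using a0 a by (simp add: field_simps)
   also have "\<dots> \<le> A * (b - a) * 1" using a A by (intro mult_left_mono) auto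
   finally show ?thesis by simp
  qed
  ultimately show ?case unfolding a_def[symmetric] b_def[symmetric] by (simp add: algebra_simps)
 qed
 from this[of n] have "(\<Sum>k=1..n. f k / sqrt (real k)) \<le> S n / sqrt (real n) + A * sqrt (real n)" by simp
 moreover have "S n / sqrt (real n) \<le> A * sqrt (real n)"
 proof (cases "n = 0")
  case False
  have "S n / sqrt (real n) \<le> (A * (sqrt (real n) * sqrt (real n))) / sqrt (real n)"
   using F[of n] unfolding S_def[symmetric] by (intro divide_right_mono) auto
  also have "\<dots> = A * sqrt (real n)" using False by (simp del: real_sqrt_mult_self)
  finally show ?thesis .
 qed (auto simp: S_def)
 ultimately show ?thesis unfolding S_def[symmetric] by simp
qed

subsection \<open>The mean square of the number of representations\<close>

text \<open>Divide a point by the gcd k of its coordinates: k is odd because the coordinate sum is,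
  and the quotient lies in \<open>prim_odd\<close>. The range {1..X} for k does not depend on n,
  which allows the order of summation to be exchanged later.\<close>

lemma odd_count_eq_sum_g2:
 assumes n: "1 \<le> n" "n \<le> X"
 shows "odd_count n = (\<Sum>k | k \<in> {1..X} \<and> odd k \<and> k\<^sup>2 dvd n. g2 (n div k\<^sup>2))"
proof -
 define K where "K = {k \<in> {1..X}. odd k \<and> k\<^sup>2 dvd n}"
 define W where "W k = {z \<in> prim_odd. gnorm z = int (n div k\<^sup>2)}" for k
 define Z where "Z = {z. odd (fst z + snd z) \<and> gnorm z = int n}"
 define f where "f = (\<lambda>(k, w). (int k * fst w, int k * snd w))"
 have gk: "gnorm (int k * a, int k * b) = int (k\<^sup>2) * gnorm (a, b)" for k a b
  by (simp add: gnorm_def power2_eq_square algebra_simps)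
 have "bij_betw f (Sigma K W) Z"
 proof (rule bij_betwI')
  fix x y assume x: "x \<in> Sigma K W" and y: "y \<in> Sigma K W"
  show "(f x = f y) = (x = y)"
  proof
   assume eq: "f x = f y"
   obtain k w l v where xy: "x = (k, w)" "y = (l, v)" by (cases x, cases y) auto
   have kl: "1 \<le> k" "1 \<le> l" using x y xy by (auto simp: K_def)
   have cop: "gcd (fst w) (snd w) = 1" "gcd (fst v) (snd v) = 1"
    using x y xy by (auto simp: W_def prim_odd_def coprime_iff_gcd_eq_1)
   have e: "int k * fst w = int l * fst v" "int k * snd w = int l * snd v" using eq xy by (auto simp: f_def)
   have "gcd (int k * fst w) (int k * snd w) = int k" "gcd (int l * fst v) (int l * snd v) = int l"
    using cop by (simp_all add: gcd_mult_distrib_int[symmetric])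
   then have "int k = int l" using e by simp
   then show "x = y" using e kl xy by (auto simp: prod_eq_iff)
  qed auto
 next
  fix x assume x: "x \<in> Sigma K W"
  obtain k w where xx: "x = (k, w)" by (cases x) auto
  have k: "odd k" "k\<^sup>2 dvd n" and w: "odd (fst w + snd w)" "gnorm w = int (n div k\<^sup>2)"
   using x xx by (auto simp: K_def W_def prim_odd_def)
  have "gnorm (f x) = int (k\<^sup>2) * int (n div k\<^sup>2)" using w(2) gk[of k "fst w" "snd w"] by (simp add: f_def xx)
  also have "\<dots> = int n" using k(2) unfolding of_nat_mult[symmetric] by simp
  finally have "gnorm (f x) = int n" .
  moreover have "odd (fst (f x) + snd (f x))" using k(1) w(1) by (simp add: f_def xx)
  ultimately show "f x \<in> Z" by (simp add: Z_def)
 next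
  fix z assume "z \<in> Z"
  then have z: "odd (fst z + snd z)" "gnorm z = int n" by (auto simp: Z_def)
  define k where "k = nat (gcd (fst z) (snd z))"
  have k: "int k = gcd (fst z) (snd z)" by (simp add: k_def)
  have z0: "z \<noteq> 0" using z n by auto
  define w where "w = (fst z div int k, snd z div int k)"
  have zw: "z = (int k * fst w, int k * snd w)" unfolding w_def by (auto simp: k prod_eq_iff)
  have cop: "coprime (fst w) (snd w)" unfolding w_def k using z0
   by (simp, intro div_gcd_coprime) (auto simp: prod_eq_iff)
  have e: "int (k\<^sup>2) * gnorm w = int n" using z(2) gk[of k "fst w" "snd w"] zw by simp
  then have "int (k\<^sup>2) dvd int n" by (metis dvd_triv_left)
  then have kn: "k\<^sup>2 dvd n" by (simp only: int_dvd_int_iff)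
  have k0: "1 \<le> k" using kn n by (cases k) auto
  have "k \<le> k\<^sup>2" by (simp add: power2_eq_square)
  also have "\<dots> \<le> n" using kn n by (intro dvd_imp_le) auto
  finally have kX: "k \<le> X" using n by simp
  have "odd (int k * (fst w + snd w))" using z(1) by (subst (asm) (1 2) zw) (simp add: algebra_simps)
  then have odd: "odd k" "odd (fst w + snd w)" by auto
  have "gnorm w = int (n div k\<^sup>2)"
  proof -
   have "int n = int (k\<^sup>2) * int (n div k\<^sup>2)" using kn unfolding of_nat_mult[symmetric] by simp
   then have "int (k\<^sup>2) * gnorm w = int (k\<^sup>2) * int (n div k\<^sup>2)" using e by simp
   then show ?thesis using k0 by simp
  qed
  then have "(k, w) \<in> Sigma K W" using kn k0 kX odd cop by (simp add: K_def W_def prim_odd_def)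
  moreover have "z = f (k, w)" using zw by (simp add: f_def)
  ultimately show "\<exists>x\<in>Sigma K W. z = f x" by blast
 qed
 then have "card Z = card (Sigma K W)" by (metis bij_betw_same_card)
 also have "\<dots> = (\<Sum>k\<in>K. card (W k))" by (intro card_SigmaI) (auto simp: K_def W_def)
 finally show ?thesis unfolding Z_def odd_count_def K_def W_def g2_def .
qed

lemma sum_dvd_swap:
 fixes h :: "nat \<Rightarrow> nat \<Rightarrow> real"
 assumes K: "\<And>k. k \<in> K \<Longrightarrow> 1 \<le> d k" and "finite K"
 shows "(\<Sum>n=1..X. \<Sum>k | k \<in> K \<and> d k dvd n. h k (n div d k)) = (\<Sum>k\<in>K. \<Sum>m=1..X div d k. h k m)"
proof -
 have "(\<Sum>n=1..X. \<Sum>k | k \<in> K \<and> d k dvd n. h k (n div d k)) =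
   (\<Sum>k\<in>K. \<Sum>n | n \<in> {1..X} \<and> d k dvd n. h k (n div d k))"
  by (rule sum.swap_restrict) (use assms in auto)
 also have "\<dots> = (\<Sum>k\<in>K. \<Sum>m=1..X div d k. h k m)"
 proof (rule sum.cong[OF refl])
  fix k assume "k \<in> K"
  then have d: "1 \<le> d k" using K by simp
  show "(\<Sum>n | n \<in> {1..X} \<and> d k dvd n. h k (n div d k)) = (\<Sum>m=1..X div d k. h k m)"
  proof (rule sum.reindex_bij_witness[of _ "\<lambda>m. d k * m" "\<lambda>n. n div d k"])
   fix n assume "n \<in> {n \<in> {1..X}. d k dvd n}"
   then have n: "1 \<le> n" "n \<le> X" "d k dvd n" by auto
   then have "n div d k \<noteq> 0" using d by (metis dvd_mult_div_cancel mult_0_right not_one_le_zero)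
   then show "n div d k \<in> {1..X div d k}" using n by (auto simp: div_le_mono)
  next
   fix m assume m: "m \<in> {1..X div d k}"
   then have "d k * m \<le> X" using d by (metis atLeastAtMost_iff div_times_less_eq_dividend le_trans mult.commute mult_le_mono2)
   then show "d k * m \<in> {n \<in> {1..X}. d k dvd n}" using m d by auto
  qed (use d in auto)
 qed
 finally show ?thesis .
qed

definition odd_log_sum :: "nat \<Rightarrow> real" where
 "odd_log_sum n = (\<Sum>k=1..n. real (odd_count k) / real k)"

definition g2_log_sum :: "nat \<Rightarrow> real" where
 "g2_log_sum n = (\<Sum>k=1..n. real (g2 k) / real k)"

lemma odd_log_sum_eq:
 "odd_log_sum X = (\<Sum>k | k \<in> {1..X} \<and> odd k. g2_log_sum (X div k\<^sup>2) / (real k)\<^sup>2)"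
proof -
 have "odd_log_sum X = (\<Sum>n=1..X. \<Sum>k | k \<in> {k \<in> {1..X}. odd k} \<and> k\<^sup>2 dvd n.
   (\<lambda>k m. real (g2 m) / (real k)\<^sup>2 / real m) k (n div k\<^sup>2))"
  unfolding odd_log_sum_def
 proof (rule sum.cong[OF refl])
  fix n assume n: "n \<in> {1..X}"
  have "real (odd_count n) / real n = (\<Sum>k | k \<in> {1..X} \<and> odd k \<and> k\<^sup>2 dvd n. real (g2 (n div k\<^sup>2)) / real n)"
   using n by (subst odd_count_eq_sum_g2[of n X]) (auto simp: sum_divide_distrib)
  also have "\<dots> = (\<Sum>k | k \<in> {k \<in> {1..X}. odd k} \<and> k\<^sup>2 dvd n. real (g2 (n div k\<^sup>2)) / (real k)\<^sup>2 / real (n div k\<^sup>2))"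
  proof (rule sum.cong)
   fix k assume "k \<in> {k \<in> {k \<in> {1..X}. odd k}. k\<^sup>2 dvd n}"
   then have "n = k\<^sup>2 * (n div k\<^sup>2)" by simp
   then have "real n = (real k)\<^sup>2 * real (n div k\<^sup>2)" by (metis of_nat_mult of_nat_power)
   then show "real (g2 (n div k\<^sup>2)) / real n = real (g2 (n div k\<^sup>2)) / (real k)\<^sup>2 / real (n div k\<^sup>2)" by simp
  qed auto
  finally show "real (odd_count n) / real n = (\<Sum>k | k \<in> {k \<in> {1..X}. odd k} \<and> k\<^sup>2 dvd n.
    (\<lambda>k m. real (g2 m) / (real k)\<^sup>2 / real m) k (n div k\<^sup>2))" by simp
 qed
 also have "\<dots> = (\<Sum>k\<in>{k \<in> {1..X}. odd k}. \<Sum>m=1..X div k\<^sup>2. real (g2 m) / (real k)\<^sup>2 / real m)"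
  by (rule sum_dvd_swap) auto
 finally show ?thesis by (simp add: g2_log_sum_def sum_divide_distrib field_simps)
qed

lemma g2_le_odd_count: "g2 n \<le> odd_count n"
 unfolding g2_def odd_count_def
 by (intro card_mono finite_subset[OF _ finite_gnorm_eq[of "int n"]]) (auto simp: prim_odd_def)

lemma g2_le_r2: "g2 n \<le> r2 n"
 unfolding g2_def r2_def by (intro card_mono) auto

lemma odd_log_sum_asymp: "\<exists>D\<ge>0. \<forall>n\<ge>1. \<bar>odd_log_sum n - pi / 2 * ln (real n)\<bar> \<le> D"
 unfolding odd_log_sum_def by (rule partial_sum_inverse) (use sum_odd_count in simp)

lemma sums_odd_squares: "(\<lambda>n. if odd n then 1 / (real n)\<^sup>2 else 0) sums (pi\<^sup>2 / 8)"
proof -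
 have S: "(\<lambda>n. 1 / (real n)\<^sup>2) sums (pi\<^sup>2 / 6)"
  using inverse_squares_sums sums_Suc_iff[of "\<lambda>n. 1 / (real n)\<^sup>2" "pi\<^sup>2 / 6"] by simp
 have "(\<lambda>n. 1 / (real (2 * n))\<^sup>2) sums ((1 / 4) * (pi\<^sup>2 / 6))"
 proof -
  have eq: "(\<lambda>n. 1 / (real (2 * n))\<^sup>2) = (\<lambda>n. (1 / 4) * (1 / (real n)\<^sup>2))"
   by (rule ext) (simp add: power2_eq_square)
  show ?thesis unfolding eq by (rule sums_mult[OF S])
 qed
 note even = this
 have "summable (\<lambda>n. 1 / (real (2 * n + 1))\<^sup>2)"
 proof (rule summable_comparison_test_ev)
  show "\<forall>\<^sub>F n in sequentially. norm (1 / (real (2 * n + 1))\<^sup>2) \<le> 1 / (real n)\<^sup>2"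
   using eventually_gt_at_top[of 0] by eventually_elim (auto intro!: divide_left_mono power_mono)
  show "summable (\<lambda>n. 1 / (real n)\<^sup>2)" using S by (simp add: sums_iff)
 qed
 then obtain a where a: "(\<lambda>n. 1 / (real (2 * n + 1))\<^sup>2) sums a" by (auto simp: summable_def)
 have "(\<lambda>n. if even n then 1 / (real (2 * (n div 2)))\<^sup>2 else 1 / (real (2 * ((n - 1) div 2) + 1))\<^sup>2)
   sums (a + (1 / 4) * (pi\<^sup>2 / 6))" by (rule sums_if[OF a even])
 also have "(\<lambda>n. if even n then 1 / (real (2 * (n div 2)))\<^sup>2 else 1 / (real (2 * ((n - 1) div 2) + 1))\<^sup>2)
   = (\<lambda>n. 1 / (real n)\<^sup>2)"
  by (rule ext) (auto elim!: oddE)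
 finally have "a + (1 / 4) * (pi\<^sup>2 / 6) = pi\<^sup>2 / 6" using S sums_unique2 by blast
 then have a8: "a = pi\<^sup>2 / 8" by simp
 have "(\<lambda>n. if even n then 0 else 1 / (real (2 * ((n - 1) div 2) + 1))\<^sup>2) sums a"
  by (rule sums_if'[OF a])
 also have "(\<lambda>n. if even n then 0 else 1 / (real (2 * ((n - 1) div 2) + 1))\<^sup>2)
   = (\<lambda>n. if odd n then 1 / (real n)\<^sup>2 else 0)"
  by (rule ext) (auto elim!: oddE)
 finally show ?thesis using a8 by simp
qed

definition odd_square_sum :: "nat \<Rightarrow> real" where
 "odd_square_sum X = (\<Sum>k | k \<in> {1..X} \<and> odd k. 1 / (real k)\<^sup>2)"

lemma odd_square_sum_tendsto: "odd_square_sum \<longlonglongrightarrow> pi\<^sup>2 / 8"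
proof -
 have "(\<lambda>n. \<Sum>k\<le>n. if odd k then 1 / (real k)\<^sup>2 else 0) \<longlonglongrightarrow> pi\<^sup>2 / 8"
  using sums_odd_squares by (simp add: sums_def_le)
 moreover have "(\<Sum>k\<le>n. if odd k then 1 / (real k)\<^sup>2 else 0) = odd_square_sum n" for n
 proof -
  have "(\<Sum>k\<le>n. if odd k then 1 / (real k)\<^sup>2 else 0) = (\<Sum>k | k \<in> {..n} \<and> odd k. 1 / (real k)\<^sup>2)"
   by (rule sum.inter_filter[symmetric]) simp
  also have "{k. k \<in> {..n} \<and> odd k} = {k. k \<in> {1..n} \<and> odd k}" by (auto intro: Suc_leI odd_pos)
  finally show ?thesis by (simp add: odd_square_sum_def)
 qed
 ultimately show ?thesis by simp
qed

lemma ln_le_sqrt: "0 < x \<Longrightarrow> ln x \<le> 2 * sqrt x"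
 using ln_le_minus_one[of "sqrt x"] by (simp add: ln_sqrt)

lemma g2_log_sum_le: "g2_log_sum n \<le> odd_log_sum n"
 unfolding g2_log_sum_def odd_log_sum_def using g2_le_odd_count
 by (intro sum_mono divide_right_mono) auto

lemma g2_log_sum_diff_le: "m \<le> n \<Longrightarrow> g2_log_sum n - g2_log_sum m \<le> odd_log_sum n - odd_log_sum m"
 "m \<le> n \<Longrightarrow> g2_log_sum m \<le> g2_log_sum n"
proof -
 assume mn: "m \<le> n"
 have split: "(\<Sum>k=1..n. f k) - (\<Sum>k=1..m. f k) = (\<Sum>k\<in>{m<..n}. f k)" for f :: "nat \<Rightarrow> real"
 proof -
  have "{1..n} = {1..m} \<union> {m<..n}" using mn by auto
  then have "(\<Sum>k=1..n. f k) = (\<Sum>k=1..m. f k) + (\<Sum>k\<in>{m<..n}. f k)"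
   by (simp only: sum.union_disjoint[symmetric] finite_atLeastAtMost finite_greaterThanAtMost)
    (subst sum.union_disjoint[symmetric], auto)
  then show ?thesis by simp
 qed
 show "g2_log_sum n - g2_log_sum m \<le> odd_log_sum n - odd_log_sum m"
  unfolding g2_log_sum_def odd_log_sum_def split using g2_le_odd_count
  by (intro sum_mono divide_right_mono) auto
 have "0 \<le> (\<Sum>k\<in>{m<..n}. real (g2 k) / real k)" by (intro sum_nonneg) auto
 then show "g2_log_sum m \<le> g2_log_sum n" using split[of "\<lambda>k. real (g2 k) / real k"] by (simp add: g2_log_sum_def)
qed

text \<open>Replacing \<open>g2_log_sum (X div k\<^sup>2)\<close> by \<open>g2_log_sum X\<close> costs only \<open>O(log k)\<close>,
 which is summable against \<open>1 / k\<^sup>2\<close>. This takes the place of Moebius inversion.\<close>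

lemma g2_log_sum_asymp:
 "\<exists>D. \<forall>X\<ge>1. \<bar>g2_log_sum X * odd_square_sum X - pi / 2 * ln (real X)\<bar> \<le> D"
proof -
 obtain D where D: "0 \<le> D" "\<And>n. 1 \<le> n \<Longrightarrow> \<bar>odd_log_sum n - pi / 2 * ln (real n)\<bar> \<le> D"
  using odd_log_sum_asymp by blast
 have summ: "summable (\<lambda>k. real k powr (- 3 / 2))" by (subst summable_real_powr_iff) simp
 \<comment> \<open>3 pi comes from pi/2 times ln(2 k^2) <= 6 sqrt k, and 2 D from two uses of the
   asymptotics of \<open>odd_log_sum\<close>. The generous factor sqrt k still leaves the summable
   k^(-3/2) after division by k^2.\<close>
 define c where "c = 3 * pi + 2 * D"
 have c0: "0 \<le> c" using D by (simp add: c_def)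
 have key: "g2_log_sum X - g2_log_sum (X div k\<^sup>2) \<le> c * sqrt (real k)" if k: "1 \<le> k" "1 \<le> X" for k X
 proof -
  define Y where "Y = X div k\<^sup>2"
  have YX: "Y \<le> X" by (simp add: Y_def)
  have XY: "X < (Y + 1) * k\<^sup>2" unfolding Y_def using k dividend_less_div_times[of "k\<^sup>2" X] by simp
  have l2: "pi / 2 * ln (2 * (real k)\<^sup>2) \<le> 3 * pi * sqrt (real k)"
  proof -
   have "ln (2 * (real k)\<^sup>2) = ln 2 + 2 * ln (real k)" using k by (simp add: ln_mult ln_realpow)
   also have "\<dots> \<le> 1 + 2 * (2 * sqrt (real k))" using ln_le_sqrt[of "real k"] k ln2_le_25_over_36
    by (intro add_mono mult_left_mono) auto
   also have "1 \<le> sqrt (real k)" using k by simp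
   finally have "ln (2 * (real k)\<^sup>2) \<le> 6 * sqrt (real k)"
    using real_sqrt_ge_zero[of "real k"] by linarith
   then have "pi / 2 * ln (2 * (real k)\<^sup>2) \<le> pi / 2 * (6 * sqrt (real k))"
    by (rule mult_left_mono) simp
   then show ?thesis by simp
  qed
  have D2: "2 * D \<le> 2 * D * sqrt (real k)" using D(1) k real_sqrt_ge_one[of "real k"]
   mult_left_mono[of 1 "sqrt (real k)" "2 * D"] by simp
  have cs: "c * sqrt (real k) = 3 * pi * sqrt (real k) + 2 * D * sqrt (real k)"
   by (simp add: c_def algebra_simps)
  show ?thesis
  proof (cases "Y = 0")
   case True
   have "g2_log_sum X - g2_log_sum Y \<le> odd_log_sum X" using True g2_log_sum_le[of X]
    by (simp add: g2_log_sum_def)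
   also have "\<dots> \<le> pi / 2 * ln (real X) + D" using D(2)[of X] k by linarith
   also have "ln (real X) \<le> ln (2 * (real k)\<^sup>2)"
   proof -
    have "X \<le> k\<^sup>2" using XY True by simp
    then have "real X \<le> (real k)\<^sup>2" by (metis of_nat_le_iff of_nat_power)
    then have "real X \<le> 2 * (real k)\<^sup>2" using zero_le_power2[of "real k"] by linarith
    then show ?thesis using k by (subst ln_le_cancel_iff) auto
   qed
   finally have "g2_log_sum X - g2_log_sum Y \<le> pi / 2 * ln (2 * (real k)\<^sup>2) + D" by simp
   then show ?thesis unfolding Y_def[symmetric] cs using l2 D2 D(1) by linarith
  next
   case False
   have "g2_log_sum X - g2_log_sum Y \<le> odd_log_sum X - odd_log_sum Y" using YX by (rule g2_log_sum_diff_le)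
   also have "\<dots> \<le> pi / 2 * (ln (real X) - ln (real Y)) + 2 * D"
    using D(2)[of X] D(2)[of Y] k False by (simp add: abs_le_iff algebra_simps)
   also have "ln (real X) - ln (real Y) \<le> ln (2 * (real k)\<^sup>2)"
   proof -
    have "X \<le> (2 * Y) * k\<^sup>2" using XY False
     by (metis (no_types, lifting) One_nat_def Suc_leI add_mono_thms_linordered_semiring(2) le_trans less_imp_le mult_2 mult_le_mono1 neq0_conv)
    then have "real X \<le> real ((2 * Y) * k\<^sup>2)" by (simp only: of_nat_le_iff)
    then have "ln (real X) \<le> ln (real Y * (2 * (real k)\<^sup>2))" using k by (simp add: mult_ac)
    also have "\<dots> = ln (real Y) + ln (2 * (real k)\<^sup>2)" using k False by (simp add: ln_mult)
    finally show ?thesis by simp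
   qed
   finally have "g2_log_sum X - g2_log_sum Y \<le> pi / 2 * ln (2 * (real k)\<^sup>2) + 2 * D" by simp
   then show ?thesis unfolding Y_def[symmetric] cs using l2 D2 by linarith
  qed
 qed
 define B where "B = c * (\<Sum>k. real k powr (- 3 / 2))"
 show ?thesis
 proof (intro exI[of _ "B + D"] allI impI)
  fix X :: nat assume X: "1 \<le> X"
  define K where "K = {k. k \<in> {1..X} \<and> odd k}"
  have finK: "finite K" by (simp add: K_def)
  define d where "d = g2_log_sum X * odd_square_sum X - odd_log_sum X"
  have d: "d = (\<Sum>k\<in>K. (g2_log_sum X - g2_log_sum (X div k\<^sup>2)) / (real k)\<^sup>2)"
   unfolding d_def odd_square_sum_def odd_log_sum_eq K_def[symmetric]
   by (simp add: sum_distrib_left sum_subtractf[symmetric] diff_divide_distrib)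
  have "0 \<le> d" unfolding d
  proof (intro sum_nonneg divide_nonneg_nonneg)
   fix k show "0 \<le> g2_log_sum X - g2_log_sum (X div k\<^sup>2)"
    using g2_log_sum_diff_le(2)[of "X div k\<^sup>2" X] by simp
  qed auto
  moreover have "d \<le> B"
  proof -
   have "d \<le> (\<Sum>k\<in>K. c * real k powr (- 3 / 2))" unfolding d
   proof (rule sum_mono)
    fix k assume "k \<in> K"
    then have k: "1 \<le> k" by (simp add: K_def)
    have "(g2_log_sum X - g2_log_sum (X div k\<^sup>2)) / (real k)\<^sup>2 \<le> c * sqrt (real k) / (real k)\<^sup>2"
     using key[OF k X] by (rule divide_right_mono) simp
    also have "\<dots> = c * real k powr (- 3 / 2)"
    proof -
     have "real k powr (- 3 / 2) = real k powr (1 / 2 - 2)" by simp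
     also have "\<dots> = sqrt (real k) / (real k)\<^sup>2" unfolding powr_diff using k by (simp add: powr_half_sqrt)
     finally show ?thesis by simp
    qed
    finally show "(g2_log_sum X - g2_log_sum (X div k\<^sup>2)) / (real k)\<^sup>2 \<le> c * real k powr (- 3 / 2)" .
   qed
   also have "\<dots> = c * (\<Sum>k\<in>K. real k powr (- 3 / 2))" by (simp add: sum_distrib_left)
   also have "\<dots> \<le> B" unfolding B_def using summ finK c0
    by (intro mult_left_mono sum_le_suminf) auto
   finally show ?thesis .
  qed
  moreover have "\<bar>odd_log_sum X - pi / 2 * ln (real X)\<bar> \<le> D" using D X by simp
  ultimately show "\<bar>g2_log_sum X * odd_square_sum X - pi / 2 * ln (real X)\<bar> \<le> B + D"
   unfolding d_def by linarith
 qed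
qed

text \<open>The limit is (pi / 2) / (pi^2 / 8): the density of points with odd coordinate sum,
  divided by the sum of 1 / k^2 over odd k that accounts for imprimitive points.\<close>

lemma g2_log_sum_tendsto: "(\<lambda>n. g2_log_sum n / ln (real n)) \<longlonglongrightarrow> 4 / pi"
proof -
 obtain D where D: "\<And>X. 1 \<le> X \<Longrightarrow> \<bar>g2_log_sum X * odd_square_sum X - pi / 2 * ln (real X)\<bar> \<le> D"
  using g2_log_sum_asymp by blast
 have lim0: "(\<lambda>X. (g2_log_sum X * odd_square_sum X - pi / 2 * ln (real X)) / ln (real X)) \<longlonglongrightarrow> 0"
 proof (rule Lim_null_comparison)
  show "(\<lambda>X. D / ln (real X)) \<longlonglongrightarrow> 0" by real_asymp
  show "\<forall>\<^sub>F X in sequentially. norm ((g2_log_sum X * odd_square_sum X - pi / 2 * ln (real X)) / ln (real X)) \<le> D / ln (real X)"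
   using eventually_gt_at_top[of 1]
  proof eventually_elim
   case (elim X)
   then have "0 < ln (real X)" by simp
   then show ?case using D[of X] elim by (simp add: divide_right_mono abs_divide)
  qed
 qed
 have "(\<lambda>X. ((g2_log_sum X * odd_square_sum X - pi / 2 * ln (real X)) / ln (real X) + pi / 2) / odd_square_sum X)
   \<longlonglongrightarrow> (0 + pi / 2) / (pi\<^sup>2 / 8)"
  by (intro tendsto_intros lim0 odd_square_sum_tendsto) auto
 also have "(0 + pi / 2) / (pi\<^sup>2 / 8) = 4 / pi" by (simp add: power2_eq_square)
 finally show ?thesis
 proof (rule Lim_transform_eventually)
  have "\<forall>\<^sub>F X in sequentially. 0 < odd_square_sum X"
   by (rule order_tendstoD(1)[OF odd_square_sum_tendsto]) simp
  then show "\<forall>\<^sub>F X in sequentially. ((g2_log_sum X * odd_square_sum X - pi / 2 * ln (real X)) / ln (real X) + pi / 2) / odd_square_sum X = g2_log_sum X / ln (real X)"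
   using eventually_gt_at_top[of 1]
  proof eventually_elim
   case (elim X)
   then have "0 < ln (real X)" by simp
   then show ?case using elim by (simp add: field_simps)
  qed
 qed
qed

section \<open>Partial sums of the squared representation numbers\<close>

definition r2_square_sum :: "nat \<Rightarrow> real" where
 "r2_square_sum n = (\<Sum>k=1..n. (real (r2 k))\<^sup>2)"

text \<open>In the convolution the inner sums of r are replaced by pi X / c with error 9 sqrt(X / c)
  from the circle problem. The errors are summed against \<open>g2\<close> with the bound 2 * 13
  sqrt X, and 9 * 26 = 234. The error O(X) is smaller than the main term by a logarithm, which is
  all that is needed.\<close>

lemma r2_square_sum_approx:
 "\<bar>r2_square_sum X - pi * real X * g2_log_sum X\<bar> \<le> 234 * real X"
proof -
 have "r2_square_sum X = (\<Sum>n=1..X. \<Sum>c | c \<in> {1..X} \<and> c dvd n. (\<lambda>c m. real (g2 c) * real (r2 m)) c (n div c))"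
  unfolding r2_square_sum_def
 proof (rule sum.cong[OF refl])
  fix n assume n: "n \<in> {1..X}"
  have "{c. c dvd n} = {c. c \<in> {1..X} \<and> c dvd n}"
  proof (intro equalityI subsetI)
   fix c assume c: "c \<in> {c. c dvd n}"
   then have "c \<le> n" "c \<noteq> 0" using n by (auto intro: dvd_imp_le)
   then show "c \<in> {c. c \<in> {1..X} \<and> c dvd n}" using c n by auto
  qed auto
  moreover have "(real (r2 n))\<^sup>2 = real (\<Sum>c | c dvd n. g2 c * r2 (n div c))"
   using r2_square[of n] n by (metis One_nat_def Suc_le_lessD atLeastAtMost_iff of_nat_power)
  ultimately show "(real (r2 n))\<^sup>2 = (\<Sum>c | c \<in> {1..X} \<and> c dvd n. (\<lambda>c m. real (g2 c) * real (r2 m)) c (n div c))"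
   by simp
 qed
 also have "\<dots> = (\<Sum>c\<in>{1..X}. \<Sum>m=1..X div c. real (g2 c) * real (r2 m))"
  by (rule sum_dvd_swap) auto
 also have "\<dots> = (\<Sum>c=1..X. real (g2 c) * real (\<Sum>m=1..X div c. r2 m))"
  by (simp add: sum_distrib_left)
 finally have "r2_square_sum X - pi * real X * g2_log_sum X =
   (\<Sum>c=1..X. real (g2 c) * (real (\<Sum>m=1..X div c. r2 m) - pi * (real X / real c)))"
  by (simp add: g2_log_sum_def sum_distrib_left sum_subtractf algebra_simps)
 also have "\<bar>\<dots>\<bar> \<le> (\<Sum>c=1..X. \<bar>real (g2 c) * (real (\<Sum>m=1..X div c. r2 m) - pi * (real X / real c))\<bar>)"
  by (rule sum_abs)
 also have "\<dots> \<le> (\<Sum>c=1..X. real (g2 c) * (9 * sqrt (real X / real c)))"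
 proof (rule sum_mono)
  fix c assume "c \<in> {1..X}"
  then show "\<bar>real (g2 c) * (real (\<Sum>m=1..X div c. r2 m) - pi * (real X / real c))\<bar> \<le> real (g2 c) * (9 * sqrt (real X / real c))"
   unfolding abs_mult using sum_r2_div[of c X] by (intro mult_mono) auto
 qed
 also have "\<dots> = 9 * sqrt (real X) * (\<Sum>c=1..X. real (g2 c) / sqrt (real c))"
  by (simp add: sum_distrib_left real_sqrt_divide mult_ac)
 also have "\<dots> \<le> 9 * sqrt (real X) * (2 * 13 * sqrt (real X))"
 proof (intro mult_left_mono partial_sum_inverse_sqrt)
  fix k
  have "(\<Sum>j=1..k. real (g2 j)) \<le> real (\<Sum>j=1..k. r2 j)" using g2_le_r2 by (simp add: sum_mono)
  then show "(\<Sum>j=1..k. real (g2 j)) \<le> 13 * real k" using sum_r2_le[of k] by linarith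
 qed auto
 finally show ?thesis by simp
qed

theorem r2_square_sum_asymp: "(\<lambda>n. r2_square_sum n / (real n * ln (real n))) \<longlonglongrightarrow> 4"
proof -
 have lim0: "(\<lambda>X. (r2_square_sum X - pi * real X * g2_log_sum X) / (real X * ln (real X))) \<longlonglongrightarrow> 0"
 proof (rule Lim_null_comparison)
  show "(\<lambda>X. 234 / ln (real X)) \<longlonglongrightarrow> 0" by real_asymp
  show "\<forall>\<^sub>F X in sequentially. norm ((r2_square_sum X - pi * real X * g2_log_sum X) / (real X * ln (real X))) \<le> 234 / ln (real X)"
   using eventually_gt_at_top[of 1]
  proof eventually_elim
   case (elim X)
   then have l: "0 < ln (real X)" "0 < real X" by auto
   have "norm ((r2_square_sum X - pi * real X * g2_log_sum X) / (real X * ln (real X)))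
     = \<bar>r2_square_sum X - pi * real X * g2_log_sum X\<bar> / (real X * ln (real X))"
    using l by (simp add: abs_mult)
   also have "\<dots> \<le> (234 * real X) / (real X * ln (real X))"
    using r2_square_sum_approx[of X] l by (intro divide_right_mono) auto
   finally show ?case using l by simp
  qed
 qed
 have "(\<lambda>X. (r2_square_sum X - pi * real X * g2_log_sum X) / (real X * ln (real X)) + pi * (g2_log_sum X / ln (real X)))
   \<longlonglongrightarrow> 0 + pi * (4 / pi)"
  by (intro tendsto_intros lim0 g2_log_sum_tendsto)
 also have "0 + pi * (4 / pi) = 4" by simp
 finally show ?thesis
 proof (rule Lim_transform_eventually)
  show "\<forall>\<^sub>F X in sequentially. (r2_square_sum X - pi * real X * g2_log_sum X) / (real X * ln (real X)) + pi * (g2_log_sum X / ln (real X)) = r2_square_sum X / (real X * ln (real X))"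
   using eventually_gt_at_top[of 1]
  proof eventually_elim
   case (elim X)
   then have "0 < ln (real X)" "0 < real X" by auto
   then show ?case by (simp add: field_simps)
  qed
 qed
qed

lemma r2_square_sum_le: "\<exists>C\<ge>1. \<forall>n. r2_square_sum n \<le> C * real n * (1 + ln (real n))"
proof -
 obtain D where D: "0 \<le> D" "\<And>n. 1 \<le> n \<Longrightarrow> \<bar>odd_log_sum n - pi / 2 * ln (real n)\<bar> \<le> D"
  using odd_log_sum_asymp by blast
 define C where "C = 234 + 4 * D + 8"
 show ?thesis
 proof (intro exI[of _ C] conjI allI)
  show "1 \<le> C" using D by (simp add: C_def)
  fix n :: nat
  show "r2_square_sum n \<le> C * real n * (1 + ln (real n))"
  proof (cases "n = 0")
   case True then show ?thesis by (simp add: r2_square_sum_def)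
  next
   case False
   then have l0: "0 \<le> ln (real n)" by simp
   have "g2_log_sum n \<le> 2 * ln (real n) + D"
   proof -
    have "g2_log_sum n \<le> pi / 2 * ln (real n) + D" using g2_log_sum_le[of n] D(2)[of n] False by linarith
    moreover have "pi / 2 * ln (real n) \<le> 2 * ln (real n)" using l0 pi_less_4 by (intro mult_right_mono) auto
    ultimately show ?thesis by linarith
   qed
   then have "pi * real n * g2_log_sum n \<le> 4 * real n * (2 * ln (real n) + D)"
   proof -
    assume a: "g2_log_sum n \<le> 2 * ln (real n) + D"
    have "0 \<le> g2_log_sum n" unfolding g2_log_sum_def by (intro sum_nonneg) auto
    then show ?thesis using a pi_less_4 by (intro mult_mono) auto
   qed
   then have "r2_square_sum n \<le> 234 * real n + 4 * real n * (2 * ln (real n) + D)"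
    using r2_square_sum_approx[of n] by linarith
   also have "\<dots> = real n * (234 + 4 * D + 8 * ln (real n))" by (simp add: algebra_simps)
   also have "\<dots> \<le> real n * (C * (1 + ln (real n)))"
   proof (rule mult_left_mono)
    have "0 \<le> (234 + 4 * D) * ln (real n)" using D(1) l0 by (intro mult_nonneg_nonneg) auto
    then show "234 + 4 * D + 8 * ln (real n) \<le> C * (1 + ln (real n))"
     by (simp add: C_def algebra_simps)
   qed auto
   finally show ?thesis by (simp add: mult_ac)
  qed
 qed
qed

subsection \<open>Weighted sums of squared representation numbers\<close>

lemma r2_square_low_sum:
 "\<exists>C\<ge>0. \<forall>X\<ge>1. (\<Sum>n=1..X. (real (r2 n))\<^sup>2 / sqrt (real n)) \<le> C * (1 + ln (real X)) * sqrt (real X)"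
proof -
 obtain C where C: "1 \<le> C" "\<And>n. r2_square_sum n \<le> C * real n * (1 + ln (real n))"
  using r2_square_sum_le by blast
 show ?thesis
 proof (intro exI[of _ "2 * C"] conjI allI impI)
  show "0 \<le> 2 * C" using C by simp
  fix X :: nat assume X: "1 \<le> X"
  have "(\<Sum>n=1..X. (real (r2 n))\<^sup>2 / sqrt (real n)) \<le> 2 * (C * (1 + ln (real X))) * sqrt (real X)"
  proof (rule partial_sum_inverse_sqrt)
   have l: "0 \<le> ln (real X)" using X by simp
   then show "0 \<le> C * (1 + ln (real X))" using C(1) by (intro mult_nonneg_nonneg) auto
   fix k assume k: "k \<le> X"
   show "(\<Sum>j=1..k. (real (r2 j))\<^sup>2) \<le> C * (1 + ln (real X)) * real k"
   proof (cases "k = 0")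
    case False
    have "(\<Sum>j=1..k. (real (r2 j))\<^sup>2) \<le> (C * real k) * (1 + ln (real k))"
     using C(2)[of k] by (simp add: r2_square_sum_def)
    also have "\<dots> \<le> (C * real k) * (1 + ln (real X))" using C(1) k False
     by (intro mult_left_mono) auto
    finally show ?thesis by (simp add: mult_ac)
   qed auto
  qed
  then show "(\<Sum>n=1..X. (real (r2 n))\<^sup>2 / sqrt (real n)) \<le> 2 * C * (1 + ln (real X)) * sqrt (real X)"
   by (simp add: mult_ac)
 qed
qed

lemma one_plus_ln_le_powr:
 assumes "0 < (z::real)" shows "1 + ln z \<le> 4 * z powr (1 / 4)"
proof -
 have "ln (z powr (1/4)) \<le> z powr (1/4) - 1" using assms by (intro ln_le_minus_one) auto
 then show ?thesis using assms by (simp add: ln_powr)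
qed

text \<open>The growth exponent 5/4 lies strictly between 1, which leaves room for a logarithm, and
  3/2, which makes the tail converge. With p = n^(-1/4) all exponents become integers: the weight is
  p^6, the growth is A / p^5, and each step of the Abel summation is a difference of sixth powers
  bounded by 6 p^5 times the difference.\<close>

lemma tail_sum_powr:
 fixes f :: "nat \<Rightarrow> real"
 assumes F: "\<And>n. Y \<le> n \<Longrightarrow> (\<Sum>k=1..n. f k) \<le> A * real n powr (5 / 4)" and A: "0 \<le> A"
  and f0: "\<And>k. 0 \<le> f k" and Y: "1 \<le> Y" "Y \<le> N"
 shows "(\<Sum>n\<in>{Y<..N}. f n * real n powr (- 3 / 2)) \<le> 7 * A * real Y powr (- 1 / 4)"
proof -
 define S where "S n = (\<Sum>k=1..n. f k)" for n
 have S0: "0 \<le> S n" for n unfolding S_def using f0 by (intro sum_nonneg) auto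
 define p where "p n = real n powr (- 1 / 4)" for n
 have p6: "p n ^ 6 = real n powr (- 3 / 2)" and p5: "p n ^ 5 * real n powr (5 / 4) = 1"
  and p0: "0 < p n" if "1 \<le> n" for n
 proof -
  have "0 < real n" using that by simp
  then show "p n ^ 6 = real n powr (- 3 / 2)" "0 < p n" unfolding p_def
   by (auto simp: powr_realpow[symmetric] powr_powr)
  show "p n ^ 5 * real n powr (5 / 4) = 1" unfolding p_def using \<open>0 < real n\<close>
   by (auto simp: powr_realpow[symmetric] powr_powr powr_add[symmetric])
 qed
 have main: "(\<Sum>n\<in>{Y<..n}. f n * p n ^ 6) \<le> S n * p n ^ 6 + 6 * A * (p Y - p n)" if "Y \<le> n" for n
  using that
 proof (induction n rule: dec_induct)
  case base
  then show ?case using S0[of Y] p0[OF Y(1)] by simp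
 next
  case (step n)
  have n: "1 \<le> n" using step Y by simp
  have q: "0 < p n" "0 < p (Suc n)" "p (Suc n) \<le> p n"
   using p0[OF n] p0[of "Suc n"] n unfolding p_def by (auto intro!: powr_mono2')
  have "{Y<..Suc n} = insert (Suc n) {Y<..n}" using step by auto
  then have "(\<Sum>k\<in>{Y<..Suc n}. f k * p k ^ 6) \<le> S n * p n ^ 6 + 6 * A * (p Y - p n) + f (Suc n) * p (Suc n) ^ 6"
   using step.IH by simp
  moreover have "S n * p n ^ 6 \<le> S n * p (Suc n) ^ 6 + 6 * A * (p n - p (Suc n))"
  proof -
   define a b where "a = p n" and "b = p (Suc n)"
   have ab: "0 < b" "b \<le> a" using q by (auto simp: a_def b_def)
   have "a ^ 6 - b ^ 6 = (a - b) * (a^5 + a^4*b + a^3*b^2 + a^2*b^3 + a*b^4 + b^5)"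
    by (simp add: algebra_simps eval_nat_numeral)
   also have "\<dots> \<le> (a - b) * (6 * a ^ 5)"
   proof (rule mult_left_mono)
    have "a^4*b \<le> a^4*a" "a^3*b^2 \<le> a^3*a^2" "a^2*b^3 \<le> a^2*a^3" "a*b^4 \<le> a*a^4" "b^5 \<le> a^5"
     using ab by (intro mult_left_mono power_mono; simp)+
    then show "a^5 + a^4*b + a^3*b^2 + a^2*b^3 + a*b^4 + b^5 \<le> 6 * a ^ 5"
     by (simp add: eval_nat_numeral)
   qed (use ab in auto)
   finally have d: "a ^ 6 - b ^ 6 \<le> (a - b) * (6 * a ^ 5)" .
   have "S n * (a ^ 6 - b ^ 6) \<le> (A * real n powr (5 / 4)) * ((a - b) * (6 * a ^ 5))"
   proof (rule mult_mono)
    show "S n \<le> A * real n powr (5 / 4)" using F[of n] step unfolding S_def by simp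
    show "0 \<le> a ^ 6 - b ^ 6" using ab power_mono[of b a 6] by simp
   qed (use d A in auto)
   also have "\<dots> = 6 * A * (a - b) * (a ^ 5 * real n powr (5 / 4))" by (simp add: mult_ac)
   also have "\<dots> = 6 * A * (a - b)" using p5[OF n] by (simp add: a_def)
   finally show ?thesis by (simp add: a_def b_def algebra_simps)
  qed
  moreover have "S (Suc n) = S n + f (Suc n)" by (simp add: S_def)
  ultimately show ?case by (simp add: algebra_simps)
 qed
 have N: "1 \<le> N" using Y by simp
 have "(\<Sum>n\<in>{Y<..N}. f n * real n powr (- 3 / 2)) = (\<Sum>n\<in>{Y<..N}. f n * p n ^ 6)"
  by (intro sum.cong refl) (simp add: p6)
 also have "\<dots> \<le> S N * p N ^ 6 + 6 * A * (p Y - p N)" using main Y by simp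
 also have "S N * p N ^ 6 \<le> A * p N"
 proof -
  have "S N * p N ^ 6 \<le> (A * real N powr (5 / 4)) * p N ^ 6"
   using F[of N] Y p0[OF N] unfolding S_def by (intro mult_right_mono) auto
  also have "\<dots> = A * p N * (p N ^ 5 * real N powr (5 / 4))" by (simp add: eval_nat_numeral)
  finally show ?thesis using p5[OF N] by simp
 qed
 also have "A * p N + 6 * A * (p Y - p N) \<le> 7 * A * p Y"
 proof -
  have "0 \<le> A * p N" using A p0[OF N] by simp
  moreover have "A * p N \<le> A * p Y" using A Y unfolding p_def
   by (intro mult_left_mono powr_mono2') auto
  ultimately show ?thesis by (simp add: algebra_simps)
 qed
 finally show ?thesis by (simp add: p_def)
qed

text \<open>The logarithm is split at Y: 1 + ln n is at most (1 + ln Y)(1 + ln(n / Y)), and the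
  second factor is at most 4 (n / Y)^(1/4). So beyond Y the partial sums satisfy a pure power bound
  with exponent 5/4, and only the logarithm of Y survives, with no loss of a power.\<close>

lemma r2_square_high_sum:
 "\<exists>C\<ge>0. \<forall>Y\<ge>1. \<forall>N. (\<Sum>n\<in>{Y<..N}. (real (r2 n))\<^sup>2 * real n powr (- 3 / 2)) \<le> C * (1 + ln (real Y)) / sqrt (real Y)"
proof -
 obtain C where C: "1 \<le> C" "\<And>n. r2_square_sum n \<le> C * real n * (1 + ln (real n))"
  using r2_square_sum_le by blast
 show ?thesis
 proof (intro exI[of _ "28 * C"] conjI allI impI)
  show "0 \<le> 28 * C" using C by simp
  fix Y N :: nat assume Y: "1 \<le> Y"
  have l: "0 \<le> ln (real Y)" using Y by simp
  define A where "A = 4 * C * (1 + ln (real Y)) * real Y powr (- 1 / 4)"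
  have A0: "0 \<le> A" unfolding A_def using C l by (intro mult_nonneg_nonneg) auto
  show "(\<Sum>n\<in>{Y<..N}. (real (r2 n))\<^sup>2 * real n powr (- 3 / 2)) \<le> 28 * C * (1 + ln (real Y)) / sqrt (real Y)"
  proof (cases "Y \<le> N")
   case True
   have "(\<Sum>n\<in>{Y<..N}. (real (r2 n))\<^sup>2 * real n powr (- 3 / 2)) \<le> 7 * A * real Y powr (- 1 / 4)"
   proof (rule tail_sum_powr[OF _ A0 _ Y True])
    fix n assume n: "Y \<le> n"
    have n0: "0 < real n" "0 < real Y" using n Y by auto
    have z: "0 < real n / real Y" using n0 by simp
    have ln: "ln (real n) = ln (real Y) + ln (real n / real Y)" using n0 by (simp add: ln_div)
    have lz: "0 \<le> ln (real n / real Y)" using n n0 by simp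
    have "1 + ln (real n) \<le> (1 + ln (real Y)) * (1 + ln (real n / real Y))"
     unfolding ln using l lz by (simp add: algebra_simps)
    also have "\<dots> \<le> (1 + ln (real Y)) * (4 * (real n / real Y) powr (1 / 4))"
     using one_plus_ln_le_powr[OF z] l by (intro mult_left_mono) auto
    finally have le: "1 + ln (real n) \<le> (1 + ln (real Y)) * (4 * (real n / real Y) powr (1 / 4))" .
    have "r2_square_sum n \<le> (C * real n) * (1 + ln (real n))" using C(2)[of n] .
    also have "\<dots> \<le> (C * real n) * ((1 + ln (real Y)) * (4 * (real n / real Y) powr (1 / 4)))"
     using le C(1) by (intro mult_left_mono) auto
    also have "\<dots> = 4 * C * (1 + ln (real Y)) * (real n * (real n / real Y) powr (1 / 4))"
     by (simp add: mult_ac)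
    also have "real n * (real n / real Y) powr (1 / 4) = real Y powr (- 1 / 4) * real n powr (5 / 4)"
    proof -
     have "real n powr (5 / 4) = real n powr (1 + 1 / 4)" by simp
     also have "\<dots> = real n * real n powr (1 / 4)" unfolding powr_add using n0 by simp
     finally have "real n powr (5 / 4) = real n * real n powr (1 / 4)" .
     moreover have "(real n / real Y) powr (1 / 4) = real n powr (1 / 4) * real Y powr (- 1 / 4)"
      using n0 by (simp add: powr_divide powr_minus_divide)
     ultimately show ?thesis by simp
    qed
    finally show "(\<Sum>k=1..n. (real (r2 k))\<^sup>2) \<le> A * real n powr (5 / 4)"
     by (simp add: r2_square_sum_def A_def mult_ac)
   qed auto
   also have "\<dots> = 28 * C * (1 + ln (real Y)) * (real Y powr (- 1 / 4) * real Y powr (- 1 / 4))"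
    by (simp add: A_def)
   also have "real Y powr (- 1 / 4) * real Y powr (- 1 / 4) = 1 / sqrt (real Y)"
    using Y by (simp add: powr_add[symmetric] powr_minus_divide powr_half_sqrt)
   finally show ?thesis by simp
  next
   case False
   then have "{Y<..N} = {}" by auto
   then show ?thesis using C l by simp
  qed
 qed
qed

subsection \<open>Asymptotics of window sums\<close>

lemma sum_window_split:
 fixes x :: "nat \<Rightarrow> real" and g :: "nat \<Rightarrow> real"
 assumes "incseq x" "0 \<le> N"
 shows "(\<Sum>n | x 0 * N < real n \<and> real n \<le> x J * N. g n) =
  (\<Sum>i<J. \<Sum>n | x i * N < real n \<and> real n \<le> x (Suc i) * N. g n)"
proof (induction J)
 case (Suc J)
 have fin: "finite {n. a < real n \<and> real n \<le> b}" for a b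
  by (rule finite_subset[of _ "{..nat \<lfloor>b\<rfloor>}"]) (auto simp: le_nat_floor)
 have m: "x 0 * N \<le> x J * N" "x J * N \<le> x (Suc J) * N"
  using assms by (auto intro!: mult_right_mono simp: incseq_def)
 have "{n. x 0 * N < real n \<and> real n \<le> x (Suc J) * N} =
   {n. x 0 * N < real n \<and> real n \<le> x J * N} \<union> {n. x J * N < real n \<and> real n \<le> x (Suc J) * N}"
  using m by auto
 then have "(\<Sum>n | x 0 * N < real n \<and> real n \<le> x (Suc J) * N. g n) =
   (\<Sum>n | x 0 * N < real n \<and> real n \<le> x J * N. g n) + (\<Sum>n | x J * N < real n \<and> real n \<le> x (Suc J) * N. g n)"
  by (simp only:) (intro sum.union_disjoint fin, auto)
 then show ?case using Suc by simp
next
 case 0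
 have "{n. x 0 * N < real n \<and> real n \<le> x 0 * N} = {}" by auto
 then show ?case by (simp only: sum.empty lessThan_0)
qed

lemma integral_split:
 fixes x :: "nat \<Rightarrow> real" and f :: "real \<Rightarrow> real"
 assumes "incseq x" "f integrable_on {x 0..x J}"
 shows "integral {x 0..x J} f = (\<Sum>i<J. integral {x i..x (Suc i)} f)"
 using assms(2)
proof (induction J)
 case (Suc J)
 have m: "x 0 \<le> x J" "x J \<le> x (Suc J)" using assms by (auto simp: incseq_def)
 have i: "f integrable_on {x 0..x J}" by (rule integrable_on_subinterval[OF Suc.prems]) (use m in auto)
 have "integral {x 0..x (Suc J)} f = integral {x 0..x J} f + integral {x J..x (Suc J)} f"
  using Henstock_Kurzweil_Integration.integral_combine[OF m Suc.prems] by simp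
 then show ?case using Suc.IH[OF i] by simp
qed auto

lemma r2_square_sum_scaled:
 assumes "0 < y"
 shows "((\<lambda>N. r2_square_sum (nat \<lfloor>y * N\<rfloor>) / (N * ln N)) \<longlongrightarrow> 4 * y) at_top"
proof -
 let ?m = "\<lambda>N. nat \<lfloor>y * N\<rfloor>"
 let ?p = "\<lambda>N. real (nat \<lfloor>y * N\<rfloor>) * ln (real (nat \<lfloor>y * N\<rfloor>))"
 have lim: "filterlim (\<lambda>N. ?m N) at_top at_top"
  using assms by (intro filterlim_compose[OF filterlim_nat_sequentially]
   filterlim_compose[OF filterlim_floor_sequentially] filterlim_tendsto_pos_mult_at_top[OF tendsto_const _ filterlim_ident])
 have 1: "((\<lambda>N. r2_square_sum (?m N) / (?p N)) \<longlongrightarrow> 4) at_top"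
  by (rule filterlim_compose[OF r2_square_sum_asymp lim])
 have 2: "((\<lambda>N. (?p N) / (N * ln N)) \<longlongrightarrow> y) at_top"
  using assms by real_asymp
 have "((\<lambda>N. r2_square_sum (?m N) / (?p N)
   * ((?p N) / (N * ln N))) \<longlongrightarrow> 4 * y) at_top"
  by (intro tendsto_mult 1 2)
 then show ?thesis
 proof (rule Lim_transform_eventually)
  have "eventually (\<lambda>n::nat. 2 \<le> n) sequentially" by (rule eventually_ge_at_top)
  then have "\<forall>\<^sub>F N in at_top. 2 \<le> ?m N" using lim by (rule eventually_compose_filterlim)
  then show "\<forall>\<^sub>F N in at_top. r2_square_sum (?m N) / (?p N)
   * ((?p N) / (N * ln N)) = r2_square_sum (?m N) / (N * ln N)"
  proof eventually_elim
   case (elim N)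
   then have "1 < real (?m N)" by linarith
   then have "0 < real (?m N)" "0 < ln (real (?m N))"
    by (linarith, rule ln_gt_zero)
   then have P: "0 < ?p N" by (rule mult_pos_pos)
   have "A / P * (P / D) = A / D" if "0 < P" for A P D :: real using that by simp
   from this[OF P] show ?case .
  qed
 qed
qed

lemma r2_square_window:
 assumes "0 < N" "0 \<le> a" "a \<le> b"
 shows "(\<Sum>n | a * N < real n \<and> real n \<le> b * N. (real (r2 n))\<^sup>2) =
  r2_square_sum (nat \<lfloor>b * N\<rfloor>) - r2_square_sum (nat \<lfloor>a * N\<rfloor>)"
proof -
 have m: "a * N \<le> b * N" "0 \<le> a * N" using assms by (auto intro!: mult_right_mono)
 have fl: "real n \<le> c \<longleftrightarrow> n \<le> nat \<lfloor>c\<rfloor>" if "0 \<le> c" for c n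
  using that by (metis le_nat_floor of_nat_floor of_nat_le_iff order_trans)
 have "{n. a * N < real n \<and> real n \<le> b * N} = {nat \<lfloor>a * N\<rfloor><..nat \<lfloor>b * N\<rfloor>}"
  using fl[OF m(2)] fl[of "b * N"] m by (auto simp: not_le[symmetric])
 moreover have "{1..nat \<lfloor>b * N\<rfloor>} = {1..nat \<lfloor>a * N\<rfloor>} \<union> {nat \<lfloor>a * N\<rfloor><..nat \<lfloor>b * N\<rfloor>}"
 proof -
  have "nat \<lfloor>a * N\<rfloor> \<le> nat \<lfloor>b * N\<rfloor>" using m by (intro nat_mono floor_mono)
  then show ?thesis by auto
 qed
 then have "r2_square_sum (nat \<lfloor>b * N\<rfloor>) = r2_square_sum (nat \<lfloor>a * N\<rfloor>) + (\<Sum>n\<in>{nat \<lfloor>a * N\<rfloor><..nat \<lfloor>b * N\<rfloor>}. (real (r2 n))\<^sup>2)"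
  unfolding r2_square_sum_def by (simp only:) (intro sum.union_disjoint, auto)
 ultimately show ?thesis by simp
qed

text \<open>On a window bounded away from 0 and infinity ln n is asymptotic to ln N, so the masses
  r(n)^2 / (N ln N) placed at n / N converge to four times Lebesgue measure. Cutting the window into
  cells on which \<phi> varies by at most d reduces the claim to the asymptotics at finitely many
  points.\<close>

lemma window_sum_tendsto:
 fixes \<phi> :: "real \<Rightarrow> real"
 assumes a: "0 < a" "a < b" and cont: "continuous_on {a..b} \<phi>"
 shows "((\<lambda>N. (\<Sum>n | a * N < real n \<and> real n \<le> b * N. (real (r2 n))\<^sup>2 * \<phi> (real n / N)) / (N * ln N))
  \<longlongrightarrow> 4 * integral {a..b} \<phi>) at_top"
proof (rule tendstoI)
 fix e :: real assume e: "0 < e"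
 \<comment> \<open>The errors add up to d (4 (b - a) + 1) for replacing \<phi> by a step function, d
   for the convergence of the step sum, and 4 d (b - a) for the Riemann sum; the denominator exceeds
   the total coefficient of d.\<close>
 define d where "d = e / (12 * (b - a) + 4)"
 have d0: "0 < d" using e a by (simp add: d_def)
 have "uniformly_continuous_on {a..b} \<phi>" by (rule compact_uniformly_continuous[OF cont]) simp
 then obtain h where h: "0 < h" "\<And>x y. x \<in> {a..b} \<Longrightarrow> y \<in> {a..b} \<Longrightarrow> dist y x < h \<Longrightarrow> dist (\<phi> y) (\<phi> x) < d"
  unfolding uniformly_continuous_on_def using d0 by meson
 obtain J :: nat where J: "(b - a) / h < real J" using reals_Archimedean2 by blast
 have J0: "0 < real J" using J h a by (metis diff_gt_0_iff_gt divide_pos_pos less_trans)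
 define w where "w = (b - a) / real J"
 have w: "0 < w" "w < h" using J J0 h a by (auto simp: w_def field_simps)
 define x where "x i = a + real i * w" for i
 have inc: "incseq x" using w by (auto simp: incseq_def x_def intro!: mult_right_mono)
 have x0: "x 0 = a" "x J = b" using J0 by (auto simp: x_def w_def)
 have xw: "x (Suc i) - x i = w" for i by (simp add: x_def algebra_simps)
 have xin: "x i \<in> {a..b}" if "i \<le> J" for i
  using incseqD[OF inc, of 0 i] incseqD[OF inc that] x0 by auto
 define I where "I i N = {n. x i * N < real n \<and> real n \<le> x (Suc i) * N}" for i N
 define f where "f n = (real (r2 n))\<^sup>2" for n
 define m where "m i N = (\<Sum>n\<in>I i N. f n) / (N * ln N)" for i N
 have near: "\<bar>\<phi> y - \<phi> (x (Suc i))\<bar> \<le> d" if "i < J" "x i \<le> y" "y \<le> x (Suc i)" for i y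
 proof -
  have "y \<in> {a..b}" using that xin[of i] xin[of "Suc i"] by auto
  moreover have "dist y (x (Suc i)) < h" using that xw[of i] w by (auto simp: dist_real_def)
  ultimately show ?thesis using h(2)[of "x (Suc i)" y] xin[of "Suc i"] that by (auto simp: dist_real_def)
 qed
 have int: "\<phi> integrable_on {a..b}" by (rule integrable_continuous_interval[OF cont])
 have m_lim: "((\<lambda>N. m i N) \<longlongrightarrow> 4 * w) at_top" for i
 proof -
  have xi: "0 < x i" "0 < x (Suc i)" "x i \<le> x (Suc i)" using a w by (auto simp: x_def add_pos_nonneg algebra_simps)
  have "((\<lambda>N. r2_square_sum (nat \<lfloor>x (Suc i) * N\<rfloor>) / (N * ln N) - r2_square_sum (nat \<lfloor>x i * N\<rfloor>) / (N * ln N))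
    \<longlongrightarrow> 4 * x (Suc i) - 4 * x i) at_top"
   by (intro tendsto_diff r2_square_sum_scaled xi)
  moreover have "4 * x (Suc i) - 4 * x i = 4 * w" using xw[of i] by linarith
  ultimately have "((\<lambda>N. r2_square_sum (nat \<lfloor>x (Suc i) * N\<rfloor>) / (N * ln N) - r2_square_sum (nat \<lfloor>x i * N\<rfloor>) / (N * ln N))
    \<longlongrightarrow> 4 * w) at_top" by simp
  then show ?thesis
  proof (rule Lim_transform_eventually)
   show "\<forall>\<^sub>F N in at_top. r2_square_sum (nat \<lfloor>x (Suc i) * N\<rfloor>) / (N * ln N) - r2_square_sum (nat \<lfloor>x i * N\<rfloor>) / (N * ln N) = m i N"
    using eventually_gt_at_top[of 0]
    by eventually_elim (use xi in \<open>simp add: m_def I_def f_def r2_square_window diff_divide_distrib\<close>)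
  qed
 qed
 define M where "M N = (\<Sum>i<J. m i N)" for N
 define T where "T N = (\<Sum>i<J. \<phi> (x (Suc i)) * m i N)" for N
 define R where "R = (\<Sum>i<J. \<phi> (x (Suc i)) * (4 * w))"
 have "(M \<longlongrightarrow> (\<Sum>i<J. 4 * w)) at_top" unfolding M_def by (intro tendsto_sum m_lim)
 moreover have "(\<Sum>i<J. 4 * w) = 4 * (b - a)" using J0 by (simp add: w_def)
 ultimately have evM: "\<forall>\<^sub>F N in at_top. M N < 4 * (b - a) + 1" by (intro order_tendstoD(2)) auto
 have "(T \<longlongrightarrow> R) at_top" unfolding T_def R_def by (intro tendsto_intros m_lim)
 then have evT: "\<forall>\<^sub>F N in at_top. dist (T N) R < d" using d0 by (rule tendstoD)
 have RI: "\<bar>R - 4 * integral {a..b} \<phi>\<bar> \<le> 4 * d * (b - a)"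
 proof -
  have "\<bar>\<phi> (x (Suc i)) * w - integral {x i..x (Suc i)} \<phi>\<bar> \<le> d * w" if "i < J" for i
  proof -
   have sub: "\<phi> integrable_on {x i..x (Suc i)}"
    using xin[of i] xin[of "Suc i"] that by (intro integrable_on_subinterval[OF int]) auto
   have "\<phi> (x (Suc i)) * w - integral {x i..x (Suc i)} \<phi> = integral {x i..x (Suc i)} (\<lambda>y. \<phi> (x (Suc i)) - \<phi> y)"
    using sub xw[of i] w by (subst integral_diff) (auto simp: mult_ac)
   also have "norm \<dots> \<le> integral {x i..x (Suc i)} (\<lambda>y. d)"
    using sub near[OF that] by (intro integral_norm_bound_integral integrable_diff) (auto simp: abs_minus_commute)
   also have "\<dots> = d * w" using xw[of i] w by simp
   finally show ?thesis by simp
  qed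
  then have "(\<Sum>i<J. \<bar>\<phi> (x (Suc i)) * w - integral {x i..x (Suc i)} \<phi>\<bar>) \<le> (\<Sum>i<J. d * w)"
   by (intro sum_mono) auto
  also have "\<dots> = d * (b - a)" using J0 by (simp add: w_def)
  finally have *: "(\<Sum>i<J. \<bar>\<phi> (x (Suc i)) * w - integral {x i..x (Suc i)} \<phi>\<bar>) \<le> d * (b - a)" .
  have "\<bar>\<Sum>i<J. (\<phi> (x (Suc i)) * w - integral {x i..x (Suc i)} \<phi>)\<bar> \<le> d * (b - a)"
   by (rule order_trans[OF sum_abs *])
  moreover have "integral {a..b} \<phi> = (\<Sum>i<J. integral {x i..x (Suc i)} \<phi>)"
   using integral_split[OF inc, of \<phi> J] int x0 by simp
  ultimately have "\<bar>R / 4 - integral {a..b} \<phi>\<bar> \<le> d * (b - a)"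
   by (simp add: R_def sum_subtractf sum_distrib_left mult_ac sum_divide_distrib)
  then show ?thesis by linarith
 qed
 have WT: "\<bar>(\<Sum>n | a * N < real n \<and> real n \<le> b * N. f n * \<phi> (real n / N)) / (N * ln N) - T N\<bar> \<le> d * M N" if N: "1 < N" for N
 proof -
  have D: "0 < N * ln N" using N by simp
  have "(\<Sum>n | a * N < real n \<and> real n \<le> b * N. f n * \<phi> (real n / N)) = (\<Sum>i<J. \<Sum>n\<in>I i N. f n * \<phi> (real n / N))"
   using sum_window_split[OF inc, of N "\<lambda>n. f n * \<phi> (real n / N)" J] N unfolding x0 I_def by simp
  then have "(\<Sum>n | a * N < real n \<and> real n \<le> b * N. f n * \<phi> (real n / N)) / (N * ln N) - T N
    = (\<Sum>i<J. \<Sum>n\<in>I i N. (\<phi> (real n / N) - \<phi> (x (Suc i))) * f n / (N * ln N))"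
   by (simp add: T_def m_def sum_divide_distrib sum_subtractf[symmetric] sum_distrib_left algebra_simps diff_divide_distrib)
  also have "\<bar>\<dots>\<bar> \<le> (\<Sum>i<J. \<Sum>n\<in>I i N. \<bar>(\<phi> (real n / N) - \<phi> (x (Suc i))) * f n / (N * ln N)\<bar>)"
   by (intro order_trans[OF sum_abs] sum_mono sum_abs)
  also have "\<dots> \<le> (\<Sum>i<J. \<Sum>n\<in>I i N. d * f n / (N * ln N))"
  proof (intro sum_mono)
   fix i n assume i: "i \<in> {..<J}" and n: "n \<in> I i N"
   have "x i \<le> real n / N" "real n / N \<le> x (Suc i)" using n N by (auto simp: I_def field_simps)
   then have "\<bar>\<phi> (real n / N) - \<phi> (x (Suc i))\<bar> \<le> d" using near i by simp
   then have "\<bar>\<phi> (real n / N) - \<phi> (x (Suc i))\<bar> * f n / (N * ln N) \<le> d * f n / (N * ln N)"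
    using D by (intro divide_right_mono mult_right_mono) (auto simp: f_def)
   then show "\<bar>(\<phi> (real n / N) - \<phi> (x (Suc i))) * f n / (N * ln N)\<bar> \<le> d * f n / (N * ln N)"
    using D N by (simp add: abs_mult f_def)
  qed
  also have "\<dots> = d * M N" by (simp add: M_def m_def sum_distrib_left sum_divide_distrib)
  finally show ?thesis .
 qed
 show "\<forall>\<^sub>F N in at_top. dist ((\<Sum>n | a * N < real n \<and> real n \<le> b * N. (real (r2 n))\<^sup>2 * \<phi> (real n / N)) / (N * ln N)) (4 * integral {a..b} \<phi>) < e"
  using evM evT eventually_gt_at_top[of 1]
 proof eventually_elim
  case (elim N)
  define W where "W = (\<Sum>n | a * N < real n \<and> real n \<le> b * N. f n * \<phi> (real n / N)) / (N * ln N)"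
  have "\<bar>W - T N\<bar> \<le> d * M N" unfolding W_def using WT elim by simp
  also have "\<dots> \<le> d * (4 * (b - a) + 1)" using elim d0 by (intro mult_left_mono) auto
  finally have "\<bar>W - 4 * integral {a..b} \<phi>\<bar> < d * (4 * (b - a) + 1) + d + 4 * d * (b - a)"
   using RI elim(2) unfolding dist_real_def by linarith
  also have "\<dots> \<le> d * (12 * (b - a) + 4)"
  proof -
   have "d * (12 * (b - a) + 4) - (d * (4 * (b - a) + 1) + d + 4 * d * (b - a)) = d * (4 * (b - a) + 2)"
    by (simp add: algebra_simps)
   moreover have "0 \<le> d * (4 * (b - a) + 2)" using d0 a by (intro mult_nonneg_nonneg) auto
   ultimately show ?thesis by linarith
  qed
  also have "\<dots> = e" using a by (simp add: d_def)
  finally show ?case by (simp add: W_def f_def dist_real_def)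
 qed
qed

subsection \<open>The limiting variance\<close>

text \<open>The squared coefficient r(n)^2 n^(-3/2) sin(pi sqrt n \<rho>)^2 without r(n)^2, in the
  variable y = n / N = n \<rho>^2.\<close>

definition var_density :: "real \<Rightarrow> real" where
 "var_density y = (sin (pi * sqrt y))\<^sup>2 * y powr (- 3 / 2)"

text \<open>With y = u^2 the integrand becomes 2 sin(pi u)^2 / u^2; integrating by parts leaves the
  sine integral of 2 pi u and a boundary term that vanishes at both ends of the half line.\<close>

lemma has_integral_var_density:
 assumes "0 < a" "a \<le> b"
 defines "G \<equiv> \<lambda>y. 2 * (pi * Si (2 * pi * sqrt y) - (sin (pi * sqrt y))\<^sup>2 / sqrt y)"
 shows "(var_density has_integral (G b - G a)) {a..b}"
proof (rule fundamental_theorem_of_calculus[OF assms(2)])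
 fix y assume "y \<in> {a..b}"
 then have y: "0 < y" using assms by auto
 define u where "u = sqrt y"
 have u: "0 < u" "u * u = y" using y by (auto simp: u_def)
 have sc: "sinc (2 * pi * u) = sin (2 * pi * u) / (2 * pi * u)" using u by simp
 have y32: "y powr (- 3 / 2) = 1 / (u * u * u)"
 proof -
  have "y powr (- 3 / 2) = y powr (- 1 - 1 / 2)" by simp
  also have "\<dots> = 1 / (y * sqrt y)" unfolding powr_diff using y by (simp add: powr_minus_divide powr_half_sqrt)
  finally show ?thesis using u by (simp add: u_def)
 qed
 have "(G has_real_derivative
   2 * (pi * (sinc (2 * pi * u) * (2 * pi * (1 / (2 * u)))) -
    (2 * sin (pi * u) * (cos (pi * u) * (pi * (1 / (2 * u)))) * u - (sin (pi * u))\<^sup>2 * (1 / (2 * u))) / (u * u))) (at y)"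
  unfolding G_def u_def using y
  by (auto intro!: derivative_eq_intros DERIV_chain2[OF DERIV_Si] simp: power2_eq_square field_simps)
 moreover have "2 * (pi * (sinc (2 * pi * u) * (2 * pi * (1 / (2 * u)))) -
    (2 * sin (pi * u) * (cos (pi * u) * (pi * (1 / (2 * u)))) * u - (sin (pi * u))\<^sup>2 * (1 / (2 * u))) / (u * u)) = var_density y"
 proof -
  have "sin (2 * pi * u) = 2 * sin (pi * u) * cos (pi * u)" using sin_double[of "pi * u"] by (simp add: mult_ac)
  then show ?thesis unfolding var_density_def y32 sc u_def[symmetric] using u(1)
   by (simp add: power2_eq_square field_simps)
 qed
 ultimately have "(G has_real_derivative var_density y) (at y within {a..b})"
  using DERIV_subset by fastforce
 then show "(G has_vector_derivative var_density y) (at y within {a..b})"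
  by (simp add: has_real_derivative_iff_has_vector_derivative)
qed

lemma integral_var_density_tendsto:
 "((\<lambda>K. integral {1 / K..K} var_density) \<longlongrightarrow> pi\<^sup>2) at_top"
proof -
 define G where "G y = 2 * (pi * Si (2 * pi * sqrt y) - (sin (pi * sqrt y))\<^sup>2 / sqrt y)" for y
 have eq: "\<forall>\<^sub>F K in at_top. G K - G (1 / K) = integral {1 / K..K} var_density"
  using eventually_ge_at_top[of 1]
 proof eventually_elim
  case (elim K)
  have "1 / K \<le> K" using elim by (simp add: divide_le_eq) (metis mult_mono' mult_1 zero_le_one le_numeral_extra(3) order_trans)
  then show ?case using has_integral_var_density[of "1 / K" K] elim unfolding G_def
   by (simp add: integral_unique)
 qed
 have Si0: "isCont Si 0" by (rule isCont_Si)
 have Si00: "Si 0 = 0" unfolding Si_def by (simp add: zero_ereal_def)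
 have 1: "(G \<longlongrightarrow> 2 * (pi * (pi / 2) - 0)) at_top"
  unfolding G_def
 proof (intro tendsto_mult tendsto_diff tendsto_const)
  show "((\<lambda>y. Si (2 * pi * sqrt y)) \<longlongrightarrow> pi / 2) at_top"
   by (rule filterlim_compose[OF Si_at_top]) real_asymp
  show "((\<lambda>y. (sin (pi * sqrt y))\<^sup>2 / sqrt y) \<longlongrightarrow> 0) at_top"
  proof (rule Lim_null_comparison)
   show "((\<lambda>y. 1 / sqrt y) \<longlongrightarrow> 0) at_top" by real_asymp
   show "\<forall>\<^sub>F y in at_top. norm ((sin (pi * sqrt y))\<^sup>2 / sqrt y) \<le> 1 / sqrt y"
    using eventually_gt_at_top[of 0]
    by eventually_elim (auto simp: abs_square_le_1 intro!: divide_right_mono)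
  qed
 qed
 have 2: "((\<lambda>K. G (1 / K)) \<longlongrightarrow> 2 * (pi * 0 - 0)) at_top"
  unfolding G_def
 proof (intro tendsto_mult tendsto_diff tendsto_const)
  have "((\<lambda>K. Si (2 * pi * sqrt (1 / K))) \<longlongrightarrow> Si 0) at_top"
   by (rule isCont_tendsto_compose[OF Si0]) real_asymp
  then show "((\<lambda>K. Si (2 * pi * sqrt (1 / K))) \<longlongrightarrow> 0) at_top" using Si00 by simp
  show "((\<lambda>K. (sin (pi * sqrt (1 / K)))\<^sup>2 / sqrt (1 / K)) \<longlongrightarrow> 0) at_top" by real_asymp
 qed
 have "((\<lambda>K. G K - G (1 / K)) \<longlongrightarrow> 2 * (pi * (pi / 2) - 0) - 2 * (pi * 0 - 0)) at_top"
  by (intro tendsto_diff 1 2)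
 then have "((\<lambda>K. G K - G (1 / K)) \<longlongrightarrow> pi\<^sup>2) at_top" by (simp add: power2_eq_square)
 then show ?thesis using eq by (rule Lim_transform_eventually)
qed

section \<open>Trigonometric polynomials with frequencies \<open>sqrt n\<close>\<close>

abbreviation unif :: "real \<Rightarrow> real measure" where "unif T \<equiv> uniform_measure lborel {T..2 * T}"

lemma prob_space_unif: "0 < T \<Longrightarrow> prob_space (unif T)"
 by (rule prob_space_uniform_measure) auto

lemma integral_unif:
 fixes f :: "real \<Rightarrow> 'b :: {banach, second_countable_topology}"
 assumes T: "0 < T" and f: "f \<in> borel_measurable borel"
 shows "integral\<^sup>L (unif T) f = (1 / T) *\<^sub>R (\<integral>t. indicator {T..2 * T} t *\<^sub>R f t \<partial>lborel)"
proof -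
 have "1 / ennreal T = ennreal (1 / T)" using divide_ennreal[of 1 T] T by simp
 then have "unif T = density lborel (\<lambda>t. ennreal (indicator {T..2 * T} t / T))"
  unfolding uniform_measure_def
  using T by (intro arg_cong[of _ _ "density lborel"] ext) (auto simp: indicator_def divide_ennreal)
 then have "integral\<^sup>L (unif T) f = (\<integral>t. (indicator {T..2 * T} t / T) *\<^sub>R f t \<partial>lborel)"
  using f T by (simp add: integral_density)
 also have "\<dots> = (\<integral>t. (1 / T) *\<^sub>R (indicator {T..2 * T} t *\<^sub>R f t) \<partial>lborel)" by simp
 finally show ?thesis by (simp only: integral_scaleR_right)
qed

lemma norm_integral_cis:
 assumes T: "0 < T" and l: "l \<noteq> 0"
 shows "norm (\<integral>t. cis (l * t) \<partial>unif T) \<le> 2 / (T * \<bar>l\<bar>)"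
proof -
 define F where "F t = cis (l * t) / (\<i> * of_real l)" for t
 have "(F has_vector_derivative cis (l * t)) (at t within {T..2 * T})" for t
 proof -
  have "((\<lambda>t. cis (l * t)) has_vector_derivative \<i> * of_real l * cis (l * t)) (at t within {T..2 * T})"
  proof -
   have "((\<lambda>z. exp (\<i> * of_real l * z)) has_field_derivative \<i> * of_real l * exp (\<i> * of_real l * of_real t)) (at (of_real t))"
    by (auto intro!: derivative_eq_intros)
   from has_vector_derivative_real_field[OF this] show ?thesis
    by (simp add: cis_conv_exp mult_ac)
  qed
  from has_vector_derivative_divide[OF this, of "\<i> * of_real l"] show ?thesis
   unfolding F_def using l by simp
 qed
 then have "(\<integral>t. indicator {T..2 * T} t *\<^sub>R cis (l * t) \<partial>lborel) = F (2 * T) - F T"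
  using T by (intro integral_FTC_Icc continuous_intros) auto
 then have "(\<integral>t. cis (l * t) \<partial>unif T) = (1 / T) *\<^sub>R (F (2 * T) - F T)"
  using T by (subst integral_unif) (auto intro!: borel_measurable_continuous_onI continuous_intros)
 also have "norm \<dots> = (1 / T) * norm (F (2 * T) - F T)" using T by simp
 also have "\<dots> \<le> (1 / T) * (norm (F (2 * T)) + norm (F T))"
  using T by (intro mult_left_mono norm_triangle_ineq4) auto
 also have "\<dots> = 2 / (T * \<bar>l\<bar>)" unfolding F_def using T by (simp add: norm_divide norm_mult)
 finally show ?thesis .
qed

lemma integrable_unif_bounded:
 fixes f :: "real \<Rightarrow> 'b :: {banach, second_countable_topology}"
 assumes "0 < T" "f \<in> borel_measurable borel" "\<And>t. norm (f t) \<le> B"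
 shows "integrable (unif T) f"
proof -
 interpret prob_space "unif T" by (rule prob_space_unif) fact
 show ?thesis using assms by (intro integrable_const_bound[of _ B]) auto
qed

definition trig :: "nat set \<Rightarrow> (nat \<Rightarrow> complex) \<Rightarrow> real \<Rightarrow> complex" where
 "trig S c t = (\<Sum>n\<in>S. c n * cis (2 * pi * sqrt (real n) * t))"

lemma norm_trig_le: "norm (trig S c t) \<le> (\<Sum>n\<in>S. norm (c n))"
 unfolding trig_def by (rule order_trans[OF norm_sum]) (simp add: norm_mult)

lemma measurable_trig [measurable]: "trig S c \<in> borel_measurable borel"
 unfolding trig_def by (intro borel_measurable_continuous_onI continuous_intros)

text \<open>Off the diagonal each oscillating integral is bounded in absolute value by 1 / (pi T)
  over the distance of the roots, with no cancellation. That loses only logarithms and small powers,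
  which is affordable for the frequencies outside the window.\<close>

lemma mean_square_trig:
 assumes T: "0 < T" and fin: "finite S"
 shows "(\<integral>t. (norm (trig S c t))\<^sup>2 \<partial>unif T) \<le> (\<Sum>n\<in>S. (norm (c n))\<^sup>2) +
  (\<Sum>m\<in>S. \<Sum>n\<in>S - {m}. norm (c m) * norm (c n) / \<bar>sqrt (real m) - sqrt (real n)\<bar>) / (pi * T)"
proof -
 interpret prob_space "unif T" by (rule prob_space_unif) fact
 define l where "l m n = 2 * pi * (sqrt (real m) - sqrt (real n))" for m n
 let ?I = "\<lambda>m n. \<integral>t. cis (l m n * t) \<partial>unif T"
 have sq: "of_real ((norm (trig S c t))\<^sup>2) = (\<Sum>m\<in>S. \<Sum>n\<in>S. (c m * cnj (c n)) * cis (l m n * t))" for t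
 proof -
  have "of_real ((norm (trig S c t))\<^sup>2) = trig S c t * cnj (trig S c t)" by (rule complex_norm_square)
  also have "\<dots> = (\<Sum>m\<in>S. \<Sum>n\<in>S. (c m * cis (2 * pi * sqrt (real m) * t)) * cnj (c n * cis (2 * pi * sqrt (real n) * t)))"
   unfolding trig_def by (simp add: sum_product)
  also have "\<dots> = (\<Sum>m\<in>S. \<Sum>n\<in>S. (c m * cnj (c n)) * cis (l m n * t))"
  proof (intro sum.cong refl)
   fix m n
   have "cis (2 * pi * sqrt (real m) * t) * cnj (cis (2 * pi * sqrt (real n) * t)) = cis (l m n * t)"
    unfolding cis_cnj cis_mult l_def by (rule arg_cong[of _ _ cis]) (simp add: algebra_simps)
   then show "(c m * cis (2 * pi * sqrt (real m) * t)) * cnj (c n * cis (2 * pi * sqrt (real n) * t)) = (c m * cnj (c n)) * cis (l m n * t)"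
    by (simp add: mult_ac)
  qed
  finally show ?thesis .
 qed
 have int: "integrable (unif T) (\<lambda>t. cis (l m n * t))" for m n
  by (rule integrable_unif_bounded[OF T, of _ 1]) (auto intro!: borel_measurable_continuous_onI continuous_intros)
 have "complex_of_real (\<integral>t. (norm (trig S c t))\<^sup>2 \<partial>unif T) = (\<integral>t. complex_of_real ((norm (trig S c t))\<^sup>2) \<partial>unif T)"
  by (rule integral_complex_of_real[symmetric])
 also have "\<dots> = (\<integral>t. (\<Sum>m\<in>S. \<Sum>n\<in>S. (c m * cnj (c n)) * cis (l m n * t)) \<partial>unif T)"
  unfolding sq ..
 also have "\<dots> = (\<Sum>m\<in>S. \<Sum>n\<in>S. (c m * cnj (c n)) * (?I m n))"
  using int by simp
 finally have eq: "complex_of_real (\<integral>t. (norm (trig S c t))\<^sup>2 \<partial>unif T) = (\<Sum>m\<in>S. \<Sum>n\<in>S. (c m * cnj (c n)) * (?I m n))" .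
 have "(\<integral>t. (norm (trig S c t))\<^sup>2 \<partial>unif T) \<le> norm (of_real (\<integral>t. (norm (trig S c t))\<^sup>2 \<partial>unif T) :: complex)"
  by simp
 also have "\<dots> \<le> (\<Sum>m\<in>S. \<Sum>n\<in>S. norm (c m) * norm (c n) * norm (?I m n))"
  unfolding eq by (intro order_trans[OF norm_sum] sum_mono) (simp add: norm_mult)
 also have "\<dots> \<le> (\<Sum>m\<in>S. (norm (c m))\<^sup>2 + (\<Sum>n\<in>S - {m}. norm (c m) * norm (c n) / \<bar>sqrt (real m) - sqrt (real n)\<bar>) / (pi * T))"
 proof (rule sum_mono)
  fix m assume m: "m \<in> S"
  have "(\<Sum>n\<in>S. norm (c m) * norm (c n) * norm (?I m n)) =
   norm (c m) * norm (c m) * norm (\<integral>t. cis (l m m * t) \<partial>unif T) +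
   (\<Sum>n\<in>S - {m}. norm (c m) * norm (c n) * norm (?I m n))"
   by (rule sum.remove[OF fin m])
  also have "norm (\<integral>t. cis (l m m * t) \<partial>unif T) = 1" using prob_space by (simp add: l_def)
  also have "(\<Sum>n\<in>S - {m}. norm (c m) * norm (c n) * norm (?I m n))
   \<le> (\<Sum>n\<in>S - {m}. norm (c m) * norm (c n) / \<bar>sqrt (real m) - sqrt (real n)\<bar> / (pi * T))"
  proof (rule sum_mono)
   fix n assume "n \<in> S - {m}"
   then have ne: "sqrt (real m) - sqrt (real n) \<noteq> 0" by auto
   then have "norm (?I m n) \<le> 2 / (T * \<bar>l m n\<bar>)"
    using T by (intro norm_integral_cis) (auto simp: l_def)
   also have "\<dots> = 1 / \<bar>sqrt (real m) - sqrt (real n)\<bar> / (pi * T)" by (simp add: l_def abs_mult)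
   finally have "norm (c m) * norm (c n) * norm (?I m n)
    \<le> norm (c m) * norm (c n) * (1 / \<bar>sqrt (real m) - sqrt (real n)\<bar> / (pi * T))"
    by (intro mult_left_mono) auto
   then show "norm (c m) * norm (c n) * norm (?I m n)
    \<le> norm (c m) * norm (c n) / \<bar>sqrt (real m) - sqrt (real n)\<bar> / (pi * T)" by simp
  qed
  finally show "(\<Sum>n\<in>S. norm (c m) * norm (c n) * norm (?I m n)) \<le>
   (norm (c m))\<^sup>2 + (\<Sum>n\<in>S - {m}. norm (c m) * norm (c n) / \<bar>sqrt (real m) - sqrt (real n)\<bar>) / (pi * T)"
   by (simp add: power2_eq_square sum_divide_distrib)
 qed
 finally show ?thesis by (simp add: sum.distrib sum_divide_distrib)
qed

subsection \<open>The model: independent phases for the square roots of squarefree numbers\<close>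

text \<open>The phases are uniform on the \<open>L\<close>-th roots of unity, with \<open>L\<close> so large that the
 moments in question do not see the difference to the circle.\<close>

definition sqf_parts :: "nat set \<Rightarrow> nat set" where "sqf_parts S = squarefree_part ` S"

definition phases :: "nat set \<Rightarrow> nat \<Rightarrow> (nat \<Rightarrow> nat) set" where
 "phases S L = PiE (sqf_parts S) (\<lambda>_. {..<L})"

text \<open>All n with the same squarefree part q share one phase, and n = q m^2 turns m times as
  fast, because sqrt n = m sqrt q. Different blocks are independent, so the block and not the single
  term is the unit of the central limit theorem.\<close>

definition block :: "nat set \<Rightarrow> (nat \<Rightarrow> complex) \<Rightarrow> nat \<Rightarrow> nat \<Rightarrow> nat \<Rightarrow> real" where
 "block S c L q x = Re (\<Sum>n | n \<in> S \<and> squarefree_part n = q. c n * cis (2 * pi * real (square_part n) * real x / real L))"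

definition model :: "nat set \<Rightarrow> (nat \<Rightarrow> complex) \<Rightarrow> nat \<Rightarrow> (nat \<Rightarrow> nat) \<Rightarrow> real" where
 "model S c L \<theta> = (\<Sum>q\<in>sqf_parts S. block S c L q (\<theta> q))"

definition avg :: "nat set \<Rightarrow> nat \<Rightarrow> ((nat \<Rightarrow> nat) \<Rightarrow> 'b :: real_normed_field) \<Rightarrow> 'b" where
 "avg S L f = (\<Sum>\<theta>\<in>phases S L. f \<theta>) / of_nat L ^ card (sqf_parts S)"

lemma avg_prod:
 assumes "finite S"
 shows "avg S L (\<lambda>\<theta>. \<Prod>q\<in>sqf_parts S. h q (\<theta> q)) = (\<Prod>q\<in>sqf_parts S. (\<Sum>x<L. h q x) / of_nat L)"
proof -
 have "(\<Prod>q\<in>sqf_parts S. \<Sum>x\<in>{..<L}. h q x) = (\<Sum>\<theta>\<in>phases S L. \<Prod>q\<in>sqf_parts S. h q (\<theta> q))"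
  unfolding phases_def using assms by (intro prod_sum_PiE) (auto simp: sqf_parts_def)
 then show ?thesis by (simp add: avg_def prod_dividef)
qed

lemma avg_sum: "avg S L (\<lambda>\<theta>. \<Sum>i\<in>I. f i \<theta>) = (\<Sum>i\<in>I. avg S L (f i))"
 unfolding avg_def by (subst sum.swap) (simp add: sum_divide_distrib)

lemma avg_cmult: "avg S L (\<lambda>\<theta>. a * f \<theta>) = a * avg S L f"
 unfolding avg_def by (simp add: sum_distrib_left[symmetric])

lemma avg_add: "avg S L (\<lambda>\<theta>. f \<theta> + g \<theta>) = avg S L f + avg S L g"
 unfolding avg_def by (simp add: sum.distrib add_divide_distrib)

lemma avg_of_real: "avg S L (\<lambda>\<theta>. complex_of_real (f \<theta>)) = of_real (avg S L f)"
 unfolding avg_def by simp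

lemma avg_mono: "(\<And>\<theta>. \<theta> \<in> phases S L \<Longrightarrow> f \<theta> \<le> g \<theta>) \<Longrightarrow> avg S L f \<le> (avg S L g :: real)"
 unfolding avg_def by (intro divide_right_mono sum_mono) auto

lemma norm_avg_le: "norm (avg S L f) \<le> avg S L (\<lambda>\<theta>. norm (f \<theta>))"
 unfolding avg_def by (simp add: norm_divide norm_power divide_right_mono norm_sum)

section \<open>Expansion of moments into monomials\<close>

lemma sum_roots_of_unity:
 fixes a :: int
 assumes "\<bar>a\<bar> < int L"
 shows "(\<Sum>x<L. cis (2 * pi * of_int a * real x / real L)) = (if a = 0 then of_nat L else 0)"
proof (cases "a = 0")
 case False
 define w where "w = cis (2 * pi * of_int a / real L)"
 have L: "0 < real L" using assms by auto
 have pw: "cis (2 * pi * of_int a * real x / real L) = w ^ x" for x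
  unfolding w_def Complex.DeMoivre by (simp add: mult_ac)
 have "w ^ L = cis (2 * pi * of_int a)" unfolding w_def Complex.DeMoivre using L by simp
 then have wL: "w ^ L = 1" by simp
 have "w \<noteq> 1"
 proof
  assume "w = 1"
  then obtain k :: int where "2 * pi * of_int a / real L = of_int k * (2 * pi)"
   unfolding w_def cis_eq_1_iff by blast
  then have "real_of_int a = of_int k * real L" using L by (simp add: field_simps)
  then have "real_of_int a = real_of_int (k * int L)" by simp
  then have ak: "a = k * int L" by (simp only: of_int_eq_iff)
  then have "k \<noteq> 0" using False by auto
  then have "int L * 1 \<le> int L * \<bar>k\<bar>" by (intro mult_left_mono) auto
  then show False using assms ak by (simp add: abs_mult mult.commute)
 qed
 then have "(\<Sum>x<L. w ^ x) = 0" using wL by (simp add: geometric_sum)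
 then show ?thesis using False by (simp add: pw)
qed auto

lemma cis_sum: "finite A \<Longrightarrow> cis (\<Sum>x\<in>A. f x) = (\<Prod>x\<in>A. cis (f x))"
 by (induction A rule: finite_induct) (auto simp: cis_mult[symmetric])

text \<open>An index is a pair (n, b), where the Boolean selects the term of n or its conjugate.
  Powers of a real part then expand into plain products of exponentials.\<close>

definition sgn_of :: "nat \<times> bool \<Rightarrow> int" where "sgn_of k = (if snd k then 1 else - 1)"

definition coef_of :: "(nat \<Rightarrow> complex) \<Rightarrow> nat \<times> bool \<Rightarrow> complex" where
 "coef_of c k = (if snd k then c (fst k) else cnj (c (fst k)))"

lemma Re_sum_eq:
 assumes "finite S"
 shows "complex_of_real (Re (\<Sum>n\<in>S. c n * cis (h n))) =
  (\<Sum>k\<in>S \<times> UNIV. coef_of c k * cis (of_int (sgn_of k) * h (fst k))) / 2"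
proof -
 have "(\<Sum>k\<in>S \<times> UNIV. coef_of c k * cis (of_int (sgn_of k) * h (fst k))) =
   (\<Sum>n\<in>S. \<Sum>b\<in>UNIV. coef_of c (n, b) * cis (of_int (sgn_of (n, b)) * h n))"
  by (simp add: sum.cartesian_product case_prod_unfold)
 also have "\<dots> = (\<Sum>n\<in>S. c n * cis (h n) + cnj (c n * cis (h n)))"
  by (intro sum.cong refl) (simp add: UNIV_bool coef_of_def sgn_of_def cis_cnj)
 also have "\<dots> = (\<Sum>n\<in>S. c n * cis (h n)) + cnj (\<Sum>n\<in>S. c n * cis (h n))"
  by (simp add: sum.distrib)
 also have "\<dots> = of_real (2 * Re (\<Sum>n\<in>S. c n * cis (h n)))" by (rule complex_add_cnj)
 finally show ?thesis by simp
qed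

lemma Re_sum_power:
 assumes "finite S"
 shows "complex_of_real (Re (\<Sum>n\<in>S. c n * cis (h n)) ^ j) =
  (\<Sum>g\<in>PiE {..<j} (\<lambda>_. S \<times> UNIV). (\<Prod>i<j. coef_of c (g i)) * cis (\<Sum>i<j. of_int (sgn_of (g i)) * h (fst (g i)))) / 2 ^ j"
proof -
 define f where "f k = coef_of c k * cis (of_int (sgn_of k) * h (fst k))" for k
 have "complex_of_real (Re (\<Sum>n\<in>S. c n * cis (h n)) ^ j) = ((\<Sum>k\<in>S \<times> UNIV. f k) / 2) ^ j"
  unfolding of_real_power Re_sum_eq[OF assms] f_def ..
 also have "\<dots> = (\<Prod>i<j. \<Sum>k\<in>S \<times> UNIV. f k) / 2 ^ j" by (simp add: power_divide)
 also have "(\<Prod>i<j. \<Sum>k\<in>S \<times> UNIV. f k) = (\<Sum>g\<in>PiE {..<j} (\<lambda>_. S \<times> UNIV). \<Prod>i<j. f (g i))"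
  using assms by (intro prod_sum_PiE) auto
 finally show ?thesis by (simp add: f_def prod.distrib cis_sum)
qed

lemma model_eq:
 assumes "finite S"
 shows "model S c L \<theta> = Re (\<Sum>n\<in>S. c n * cis (2 * pi * real (square_part n) * real (\<theta> (squarefree_part n)) / real L))"
proof -
 have "(\<Sum>n\<in>S. c n * cis (2 * pi * real (square_part n) * real (\<theta> (squarefree_part n)) / real L)) =
  (\<Sum>q\<in>sqf_parts S. \<Sum>n | n \<in> S \<and> squarefree_part n = q. c n * cis (2 * pi * real (square_part n) * real (\<theta> (squarefree_part n)) / real L))"
  unfolding sqf_parts_def by (rule sum.image_gen[OF assms])
 also have "\<dots> = (\<Sum>q\<in>sqf_parts S. \<Sum>n | n \<in> S \<and> squarefree_part n = q. c n * cis (2 * pi * real (square_part n) * real (\<theta> q) / real L))"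
  by (intro sum.cong) auto
 finally show ?thesis by (simp add: model_def block_def)
qed

lemma square_part_le: "0 < (n::nat) \<Longrightarrow> square_part n \<le> n"
proof -
 assume n: "0 < n"
 have "square_part n ^ 2 \<le> n" using n by (intro dvd_imp_le) auto
 moreover have "square_part n \<le> square_part n ^ 2" by (simp add: power2_eq_square)
 ultimately show ?thesis by linarith
qed

text \<open>A monomial has the same mean on \<open>[T, 2T]\<close> and in the model up to \<open>O(M ^ E / T)\<close>:
 resonances are the same by linear independence, and a non-resonant frequency is not too small.\<close>

lemma monomial_compare:
 "\<exists>E. \<forall>S M (T::real) L g. finite S \<longrightarrow> (\<forall>n\<in>S. 1 \<le> n \<and> real n \<le> M) \<longrightarrow> 1 \<le> M \<longrightarrow> real j * M < real L \<longrightarrow> 0 < T \<longrightarrow>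
  g \<in> PiE {..<j} (\<lambda>_. S \<times> (UNIV :: bool set)) \<longrightarrow>
  norm ((\<integral>t. cis (\<Sum>i<j. of_int (sgn_of (g i)) * (2 * pi * sqrt (real (fst (g i))) * t)) \<partial>unif T) -
   avg S L (\<lambda>\<theta>. cis (\<Sum>i<j. of_int (sgn_of (g i)) *
    (2 * pi * real (square_part (fst (g i))) * real (\<theta> (squarefree_part (fst (g i)))) / real L))))
  \<le> (1 + M) ^ E / T"
proof -
 obtain E where E: "\<And>M e n. 1 \<le> M \<Longrightarrow> (\<forall>i<j. \<bar>e i\<bar> \<le> (1::int)) \<Longrightarrow> (\<forall>i<j. real (n i) \<le> M) \<Longrightarrow>
   (\<Sum>i<j. of_int (e i) * sqrt (real (n i))) \<noteq> 0 \<Longrightarrow>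
   1 \<le> \<bar>\<Sum>i<j. of_int (e i) * sqrt (real (n i))\<bar> * (1 + M) ^ E"
  using sum_sqrt_lower[of j] by blast
 show ?thesis
 proof (intro exI[of _ E] allI impI)
  fix S and M T :: real and L g
  assume fin: "finite S" and S: "\<forall>n\<in>S. 1 \<le> n \<and> real n \<le> M" and M: "1 \<le> M" and L: "real j * M < real L"
   and T: "0 < T" and g: "g \<in> PiE {..<j} (\<lambda>_. S \<times> (UNIV :: bool set))"
  define n where "n i = fst (g i)" for i
  define e where "e i = sgn_of (g i)" for i
  have nS: "n i \<in> S" if "i < j" for i using g that by (auto simp: n_def PiE_iff mem_Times_iff)
  have n1: "0 < n i" "real (n i) \<le> M" if "i < j" for i using nS[OF that] S by force+
  have e1: "\<bar>e i\<bar> \<le> 1" for i by (simp add: e_def sgn_of_def)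
  define s where "s = (\<Sum>i<j. of_int (e i) * sqrt (real (n i)))"
  define a where "a q = (\<Sum>i | i < j \<and> squarefree_part (n i) = q. e i * int (square_part (n i)))" for q
  have s_iff: "s = 0 \<longleftrightarrow> (\<forall>q. a q = 0)" unfolding s_def a_def using n1 by (intro sum_sqrt_eq_0_iff) auto
  have "0 \<le> real j * M" using M by simp
  then have L0: "0 < L" using L by linarith
  \<comment> \<open>The assumption \<open>real j * M < real L\<close> acts here: a nonzero
    coefficient of a phase cannot be a multiple of L, so averaging over L-th roots of unity detects
    exactly whether it vanishes.\<close>
  have aL: "\<bar>a q\<bar> < int L" for q
  proof -
   have "\<bar>a q\<bar> \<le> (\<Sum>i | i < j \<and> squarefree_part (n i) = q. \<bar>e i * int (square_part (n i))\<bar>)"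
    unfolding a_def by (rule sum_abs)
   also have "\<dots> \<le> (\<Sum>i\<in>{..<j}. int (n i))"
   proof (rule sum_le_included[where i = "\<lambda>x. x"])
    show "\<forall>x\<in>{i. i < j \<and> squarefree_part (n i) = q}. \<exists>y\<in>{..<j}. y = x \<and> \<bar>e x * int (square_part (n x))\<bar> \<le> int (n y)"
    proof
     fix x assume "x \<in> {i. i < j \<and> squarefree_part (n i) = q}"
     then have x: "x < j" by simp
     have "\<bar>e x * int (square_part (n x))\<bar> \<le> 1 * int (n x)"
      unfolding abs_mult using e1[of x] square_part_le[OF n1(1)[OF x]] by (intro mult_mono) auto
     then show "\<exists>y\<in>{..<j}. y = x \<and> \<bar>e x * int (square_part (n x))\<bar> \<le> int (n y)" using x by auto
    qed
   qed auto
   finally have "real_of_int \<bar>a q\<bar> \<le> (\<Sum>i<j. real (n i))" by (metis (mono_tags, lifting) of_int_le_iff of_int_of_nat_eq of_int_sum sum.cong)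
   also have "\<dots> \<le> (\<Sum>i<j. M)" using n1 by (intro sum_mono) auto
   also have "\<dots> < real L" using L by simp
   finally show ?thesis by linarith
  qed
  have mod: "avg S L (\<lambda>\<theta>. cis (\<Sum>i<j. of_int (e i) * (2 * pi * real (square_part (n i)) * real (\<theta> (squarefree_part (n i))) / real L)))
    = (\<Prod>q\<in>sqf_parts S. if a q = 0 then 1 else 0)"
  proof -
   have "(\<Sum>i<j. of_int (e i) * (2 * pi * real (square_part (n i)) * real (\<theta> (squarefree_part (n i))) / real L))
     = (\<Sum>q\<in>sqf_parts S. 2 * pi * of_int (a q) * real (\<theta> q) / real L)" for \<theta> :: "nat \<Rightarrow> nat"
   proof -
    have "(\<Sum>i<j. of_int (e i) * (2 * pi * real (square_part (n i)) * real (\<theta> (squarefree_part (n i))) / real L))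
     = (\<Sum>q\<in>sqf_parts S. \<Sum>i | i \<in> {..<j} \<and> squarefree_part (n i) = q.
       of_int (e i) * (2 * pi * real (square_part (n i)) * real (\<theta> (squarefree_part (n i))) / real L))"
     by (rule sum.group[symmetric]) (use fin nS in \<open>auto simp: sqf_parts_def\<close>)
    also have "\<dots> = (\<Sum>q\<in>sqf_parts S. 2 * pi * of_int (a q) * real (\<theta> q) / real L)"
     unfolding a_def by (intro sum.cong refl) (auto simp: sum_distrib_left sum_distrib_right sum_divide_distrib mult_ac intro!: sum.cong)
    finally show ?thesis .
   qed
   then have "avg S L (\<lambda>\<theta>. cis (\<Sum>i<j. of_int (e i) * (2 * pi * real (square_part (n i)) * real (\<theta> (squarefree_part (n i))) / real L)))
    = avg S L (\<lambda>\<theta>. \<Prod>q\<in>sqf_parts S. cis (2 * pi * of_int (a q) * real (\<theta> q) / real L))"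
    using fin by (simp add: cis_sum sqf_parts_def)
   also have "\<dots> = (\<Prod>q\<in>sqf_parts S. (\<Sum>x<L. cis (2 * pi * of_int (a q) * real x / real L)) / of_nat L)"
    by (rule avg_prod[OF fin])
   also have "\<dots> = (\<Prod>q\<in>sqf_parts S. if a q = 0 then 1 else 0)"
    using sum_roots_of_unity[OF aL] L0 by (intro prod.cong) auto
   finally show ?thesis .
  qed
  have fr: "(\<Sum>i<j. of_int (e i) * (2 * pi * sqrt (real (n i)) * t)) = (2 * pi * s) * t" for t
   unfolding s_def by (simp add: sum_distrib_left sum_distrib_right mult_ac)
  interpret prob_space "unif T" by (rule prob_space_unif) fact
  have "norm ((\<integral>t. cis ((2 * pi * s) * t) \<partial>unif T) - (\<Prod>q\<in>sqf_parts S. if a q = 0 then 1 else 0)) \<le> (1 + M) ^ E / T"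
  proof (cases "s = 0")
   case True
   then have "\<And>q. a q = 0" using s_iff by simp
   then show ?thesis using True T M by (simp add: prob_space)
  next
   case False
   then obtain q where q: "a q \<noteq> 0" using s_iff by blast
   have "q \<in> sqf_parts S"
   proof (rule ccontr)
    assume "q \<notin> sqf_parts S"
    then have "{i. i < j \<and> squarefree_part (n i) = q} = {}" using nS by (auto simp: sqf_parts_def)
    then have "a q = 0" unfolding a_def by (simp only: sum.empty)
    then show False using q by simp
   qed
   then have p0: "(\<Prod>q\<in>sqf_parts S. if a q = 0 then 1 else 0) = (0 :: complex)"
    using q fin by (intro prod_zero) (auto simp: sqf_parts_def)
   have "1 \<le> \<bar>s\<bar> * (1 + M) ^ E" unfolding s_def using E[OF M, of e n] e1 n1 False by (auto simp: s_def)
   then have inv: "1 / \<bar>s\<bar> \<le> (1 + M) ^ E" using False by (simp add: divide_le_eq mult.commute)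
   have "norm (\<integral>t. cis ((2 * pi * s) * t) \<partial>unif T) \<le> 2 / (T * \<bar>2 * pi * s\<bar>)"
    using False T by (intro norm_integral_cis) auto
   also have "\<dots> = (1 / \<bar>s\<bar>) / T * (1 / pi)" by (simp add: abs_mult)
   also have "\<dots> \<le> (1 / \<bar>s\<bar>) / T * 1" using T pi_ge_two by (intro mult_left_mono) auto
   also have "\<dots> \<le> (1 + M) ^ E / T" using divide_right_mono[OF inv, of T] T by simp
   finally show ?thesis unfolding p0 by simp
  qed
  then show "norm ((\<integral>t. cis (\<Sum>i<j. of_int (sgn_of (g i)) * (2 * pi * sqrt (real (fst (g i))) * t)) \<partial>unif T) -
   avg S L (\<lambda>\<theta>. cis (\<Sum>i<j. of_int (sgn_of (g i)) *
    (2 * pi * real (square_part (fst (g i))) * real (\<theta> (squarefree_part (fst (g i)))) / real L))))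
   \<le> (1 + M) ^ E / T"
   unfolding mod[symmetric] fr[symmetric] unfolding e_def n_def .
 qed
qed

text \<open>The j-th power of the real part has two sign choices per factor, and the resulting 2^j
  cancels the denominator of Re w = (w + conj w) / 2. What remains is the j-th power of the sum of
  the coefficient norms times the error of one monomial, with an exponent depending on j
  alone.\<close>

lemma moment_compare:
 "\<exists>E. \<forall>S c M (T::real) L. finite S \<longrightarrow> (\<forall>n\<in>S. 1 \<le> n \<and> real n \<le> M) \<longrightarrow> 1 \<le> M \<longrightarrow> real j * M < real L \<longrightarrow> 0 < T \<longrightarrow>
  \<bar>(\<integral>t. Re (trig S c t) ^ j \<partial>unif T) - avg S L (\<lambda>\<theta>. model S c L \<theta> ^ j)\<bar>
  \<le> (\<Sum>n\<in>S. norm (c n)) ^ j * ((1 + M) ^ E / T)"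
proof -
 obtain E where E: "\<And>S M (T::real) L g. finite S \<Longrightarrow> (\<forall>n\<in>S. 1 \<le> n \<and> real n \<le> M) \<Longrightarrow> 1 \<le> M \<Longrightarrow> real j * M < real L \<Longrightarrow> 0 < T \<Longrightarrow>
  g \<in> PiE {..<j} (\<lambda>_. S \<times> (UNIV :: bool set)) \<Longrightarrow>
  norm ((\<integral>t. cis (\<Sum>i<j. of_int (sgn_of (g i)) * (2 * pi * sqrt (real (fst (g i))) * t)) \<partial>unif T) -
   avg S L (\<lambda>\<theta>. cis (\<Sum>i<j. of_int (sgn_of (g i)) *
    (2 * pi * real (square_part (fst (g i))) * real (\<theta> (squarefree_part (fst (g i)))) / real L))))
  \<le> (1 + M) ^ E / T"
  using monomial_compare[of j] by blast
 show ?thesis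
 proof (intro exI[of _ E] allI impI)
  fix S c and M T :: real and L
  assume fin: "finite S" and S: "\<forall>n\<in>S. 1 \<le> n \<and> real n \<le> M" and M: "1 \<le> M" and L: "real j * M < real L" and T: "0 < T"
  define G where "G = PiE {..<j} (\<lambda>_. S \<times> (UNIV :: bool set))"
  define K where "K g = (\<Prod>i<j. coef_of c (g i))" for g
  define u where "u g t = cis (\<Sum>i<j. of_int (sgn_of (g i)) * (2 * pi * sqrt (real (fst (g i))) * t))" for g t
  define v where "v g \<theta> = cis (\<Sum>i<j. of_int (sgn_of (g i)) *
    (2 * pi * real (square_part (fst (g i))) * real (\<theta> (squarefree_part (fst (g i)))) / real L))" for g and \<theta> :: "nat \<Rightarrow> nat"
  have X: "complex_of_real (Re (trig S c t) ^ j) = (\<Sum>g\<in>G. K g * u g t) / 2 ^ j" for t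
   unfolding trig_def Re_sum_power[OF fin] G_def K_def u_def ..
  have Y: "complex_of_real (model S c L \<theta> ^ j) = (\<Sum>g\<in>G. K g * v g \<theta>) / 2 ^ j" for \<theta>
   unfolding model_eq[OF fin] Re_sum_power[OF fin] G_def K_def v_def ..
  have int: "integrable (unif T) (u g)" for g
   unfolding u_def by (rule integrable_unif_bounded[OF T, of _ 1]) (auto intro!: borel_measurable_continuous_onI continuous_intros)
  have 1: "complex_of_real (\<integral>t. Re (trig S c t) ^ j \<partial>unif T) = (\<Sum>g\<in>G. K g * (\<integral>t. u g t \<partial>unif T)) / 2 ^ j"
  proof -
   have "complex_of_real (\<integral>t. Re (trig S c t) ^ j \<partial>unif T) = (\<integral>t. complex_of_real (Re (trig S c t) ^ j) \<partial>unif T)"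
    by (rule integral_complex_of_real[symmetric])
   also have "\<dots> = (\<integral>t. (\<Sum>g\<in>G. K g * u g t) / 2 ^ j \<partial>unif T)" unfolding X ..
   also have "\<dots> = (\<Sum>g\<in>G. K g * (\<integral>t. u g t \<partial>unif T)) / 2 ^ j" using int by simp
   finally show ?thesis .
  qed
  have 2: "complex_of_real (avg S L (\<lambda>\<theta>. model S c L \<theta> ^ j)) = (\<Sum>g\<in>G. K g * avg S L (v g)) / 2 ^ j"
  proof -
   have "complex_of_real (avg S L (\<lambda>\<theta>. model S c L \<theta> ^ j)) = avg S L (\<lambda>\<theta>. (1 / 2 ^ j) * (\<Sum>g\<in>G. K g * v g \<theta>))"
    unfolding avg_of_real[symmetric] Y by simp
   also have "\<dots> = (1 / 2 ^ j) * (\<Sum>g\<in>G. K g * avg S L (v g))"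
    unfolding avg_cmult avg_sum ..
   finally show ?thesis by simp
  qed
  have "\<bar>(\<integral>t. Re (trig S c t) ^ j \<partial>unif T) - avg S L (\<lambda>\<theta>. model S c L \<theta> ^ j)\<bar>
   = norm (complex_of_real (\<integral>t. Re (trig S c t) ^ j \<partial>unif T) - complex_of_real (avg S L (\<lambda>\<theta>. model S c L \<theta> ^ j)))"
   unfolding of_real_diff[symmetric] norm_of_real ..
  also have "\<dots> = norm (\<Sum>g\<in>G. K g * ((\<integral>t. u g t \<partial>unif T) - avg S L (v g))) / 2 ^ j"
   unfolding 1 2 by (simp add: diff_divide_distrib[symmetric] sum_subtractf[symmetric] right_diff_distrib norm_divide norm_power)
  also have "\<dots> \<le> (\<Sum>g\<in>G. norm (K g) * ((1 + M) ^ E / T)) / 2 ^ j"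
  proof (intro divide_right_mono order_trans[OF norm_sum] sum_mono)
   fix g assume "g \<in> G"
   then have "norm ((\<integral>t. u g t \<partial>unif T) - avg S L (v g)) \<le> (1 + M) ^ E / T"
    unfolding u_def v_def G_def by (intro E[OF fin S M L T]) auto
   then show "norm (K g * ((\<integral>t. u g t \<partial>unif T) - avg S L (v g))) \<le> norm (K g) * ((1 + M) ^ E / T)"
    unfolding norm_mult by (rule mult_left_mono) auto
  qed auto
  also have "\<dots> = ((\<Sum>g\<in>G. norm (K g)) / 2 ^ j) * ((1 + M) ^ E / T)" unfolding sum_distrib_right[symmetric] by simp
  also have "(\<Sum>g\<in>G. norm (K g)) = (\<Prod>i<j. \<Sum>k\<in>S \<times> (UNIV :: bool set). norm (coef_of c k))"
   unfolding G_def K_def prod_norm[symmetric] using fin by (intro prod_sum_PiE[symmetric]) auto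
  also have "(\<Sum>k\<in>S \<times> (UNIV :: bool set). norm (coef_of c k)) = 2 * (\<Sum>n\<in>S. norm (c n))"
  proof -
   have "(\<Sum>k\<in>S \<times> (UNIV :: bool set). norm (coef_of c k)) = (\<Sum>n\<in>S. \<Sum>b\<in>(UNIV :: bool set). norm (coef_of c (n, b)))"
    by (simp add: sum.cartesian_product case_prod_unfold)
   also have "\<dots> = (\<Sum>n\<in>S. 2 * norm (c n))" by (intro sum.cong refl) (simp add: UNIV_bool coef_of_def)
   finally show ?thesis by (simp add: sum_distrib_left)
  qed
  also have "(\<Prod>i<j. 2 * (\<Sum>n\<in>S. norm (c n))) / 2 ^ j = (\<Sum>n\<in>S. norm (c n)) ^ j"
   by (simp add: power_mult_distrib)
  finally show "\<bar>(\<integral>t. Re (trig S c t) ^ j \<partial>unif T) - avg S L (\<lambda>\<theta>. model S c L \<theta> ^ j)\<bar>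
   \<le> (\<Sum>n\<in>S. norm (c n)) ^ j * ((1 + M) ^ E / T)" .
 qed
qed

subsection \<open>The exponential moments of the model\<close>

text \<open>The product of two real parts contains the frequencies f + g and f - g. The bound f + g
  < L prevents the first from being an L-th period, so only f = g contributes.\<close>

lemma cis_orthogonal:
 fixes f g L :: nat
 assumes "1 \<le> f" "1 \<le> g" "f + g < L"
 shows "(\<Sum>x<L. Re (a * cis (2 * pi * real f * real x / real L)) * Re (b * cis (2 * pi * real g * real x / real L)))
  = (if f = g then real L * Re (a * cnj b) / 2 else 0)"
proof -
 let ?c = "\<lambda>y x. cis (2 * pi * y * real x / real L)"
 have e: "Re u * Re v = Re (u * v + u * cnj v) / 2" for u v :: complex by simp
 have p: "(a * ?c (real f) x) * (b * ?c (real g) x) =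
   (a * b) * ?c (of_int (int f + int g)) x" for x
 proof -
  have "?c (real f) x * ?c (real g) x =
   ?c (of_int (int f + int g)) x"
   unfolding cis_mult by (rule arg_cong[of _ _ cis]) (simp add: add_divide_distrib algebra_simps)
  then show ?thesis by (metis mult.assoc mult.left_commute)
 qed
 have m: "(a * ?c (real f) x) * cnj (b * ?c (real g) x) =
   (a * cnj b) * ?c (of_int (int f - int g)) x" for x
 proof -
  have "?c (real f) x * cnj (?c (real g) x) =
   ?c (of_int (int f - int g)) x"
   unfolding cis_cnj cis_mult by (rule arg_cong[of _ _ cis]) (simp add: diff_divide_distrib algebra_simps)
  then show ?thesis unfolding complex_cnj_mult by (metis mult.assoc mult.left_commute)
 qed
 have "(\<Sum>x<L. Re (a * ?c (real f) x) * Re (b * ?c (real g) x)) =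
   Re ((a * b) * (\<Sum>x<L. ?c (of_int (int f + int g)) x) +
    (a * cnj b) * (\<Sum>x<L. ?c (of_int (int f - int g)) x)) / 2"
  unfolding e p m by (simp only: sum_divide_distrib[symmetric] Re_sum[symmetric] sum.distrib sum_distrib_left[symmetric])
 also have "(\<Sum>x<L. ?c (of_int (int f + int g)) x) = 0"
  using assms by (subst sum_roots_of_unity) auto
 also have "(\<Sum>x<L. ?c (of_int (int f - int g)) x) = (if f = g then of_nat L else 0)"
  using assms by (subst sum_roots_of_unity) auto
 finally show ?thesis by (cases "f = g") simp_all
qed

lemma square_part_pos: "0 < (n::nat) \<Longrightarrow> 1 \<le> square_part n"
 by (metis One_nat_def Suc_leI neq0_conv square_part_0_iff)

lemma exp_le_quadratic: "\<bar>y\<bar> \<le> 1 \<Longrightarrow> exp (y::real) \<le> 1 + y + y\<^sup>2"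
proof (cases "0 \<le> y")
 case False
 assume "\<bar>y\<bar> \<le> 1"
 define w where "w = - y"
 have w: "0 \<le> w" using False by (simp add: w_def)
 have "1 + w + w\<^sup>2 / 2 \<le> exp w" using exp_lower_Taylor_quadratic[OF w] .
 moreover have q: "0 < 1 - w + w\<^sup>2"
 proof -
  have "1 - w + w\<^sup>2 = (w - 1/2)\<^sup>2 + 3/4" by (simp add: power2_eq_square algebra_simps)
  then show ?thesis using zero_le_power2[of "w - 1/2"] by linarith
 qed
 ultimately have "(1 - w + w\<^sup>2) * (1 + w + w\<^sup>2 / 2) \<le> (1 - w + w\<^sup>2) * exp w"
  by (intro mult_left_mono) auto
 moreover have "(1 - w + w\<^sup>2) * (1 + w + w\<^sup>2 / 2) = 1 + w\<^sup>2 / 2 + w ^ 3 / 2 + w ^ 4 / 2"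
  by (simp add: field_simps eval_nat_numeral)
 moreover have "0 \<le> w\<^sup>2" "0 \<le> w ^ 3" "0 \<le> w ^ 4" using w by auto
 ultimately have "1 \<le> (1 - w + w\<^sup>2) * exp w" by linarith
 then have "1 / exp w \<le> 1 - w + w\<^sup>2" by (simp add: divide_le_eq)
 moreover have "exp y = 1 / exp w" by (simp add: w_def exp_minus divide_inverse)
 ultimately show ?thesis by (simp add: w_def)
qed (use exp_bound in auto)

lemma power_le_exp: "0 \<le> y \<Longrightarrow> y ^ n / fact n \<le> exp (y::real)"
proof -
 assume y: "0 \<le> y"
 have "(\<Sum>k\<in>{n}. y ^ k /\<^sub>R fact k) \<le> (\<Sum>k. y ^ k /\<^sub>R fact k)"
  using y by (intro sum_le_suminf summable_exp_generic) auto
 then show ?thesis by (simp add: exp_def divide_inverse mult.commute)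
qed

text \<open>B bounds every block in absolute value and acts as the Lyapunov parameter: the errors of
  the Gaussian approximation are B and B^2 times the total variance. The requirement 2 M < L makes
  the terms inside one block orthogonal.\<close>

context
 fixes S :: "nat set" and c :: "nat \<Rightarrow> complex" and L :: nat and M :: real and B :: real
 assumes fin: "finite S" and S: "\<And>n. n \<in> S \<Longrightarrow> 1 \<le> n \<and> real n \<le> M" and L: "2 * M < real L" and M: "1 \<le> M"
  and B: "\<And>q. (\<Sum>n | n \<in> S \<and> squarefree_part n = q. norm (c n)) \<le> B"
begin

lemma L_pos: "0 < L" using L M by (cases L) auto

lemma B_nonneg: "0 \<le> B"
 by (rule order_trans[OF _ B[of 0]]) (auto intro: sum_nonneg)

lemma abs_block_le: "\<bar>block S c L q x\<bar> \<le> B"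
proof -
 have "\<bar>block S c L q x\<bar> \<le> norm (\<Sum>n | n \<in> S \<and> squarefree_part n = q. c n * cis (2 * pi * real (square_part n) * real x / real L))"
  unfolding block_def by (rule abs_Re_le_cmod)
 also have "\<dots> \<le> (\<Sum>n | n \<in> S \<and> squarefree_part n = q. norm (c n))"
  by (rule order_trans[OF norm_sum]) (simp add: norm_mult)
 also have "\<dots> \<le> B" by (rule B)
 finally show ?thesis .
qed

lemma mean_block: "(\<Sum>x<L. block S c L q x) = 0"
proof -
 have "(\<Sum>x<L. block S c L q x) = Re (\<Sum>n | n \<in> S \<and> squarefree_part n = q. c n * (\<Sum>x<L. cis (2 * pi * of_int (int (square_part n)) * real x / real L)))"
  unfolding block_def Re_sum[symmetric] by (subst sum.swap) (simp add: sum_distrib_left)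
 also have "(\<Sum>n | n \<in> S \<and> squarefree_part n = q. c n * (\<Sum>x<L. cis (2 * pi * of_int (int (square_part n)) * real x / real L))) = 0"
 proof (rule sum.neutral, rule ballI)
  fix n assume "n \<in> {n. n \<in> S \<and> squarefree_part n = q}"
  then have n: "1 \<le> n" "real n \<le> M" using S by auto
  then have sp: "1 \<le> square_part n" "square_part n \<le> n" using square_part_pos square_part_le by auto
  then have "real (square_part n) < real L" using n L M by linarith
  then show "c n * (\<Sum>x<L. cis (2 * pi * of_int (int (square_part n)) * real x / real L)) = 0"
   using sp by (subst sum_roots_of_unity) auto
 qed
 finally show ?thesis by simp
qed

definition bvar :: "nat \<Rightarrow> real" where
 "bvar q = (\<Sum>n | n \<in> S \<and> squarefree_part n = q. (norm (c n))\<^sup>2) / 2"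

lemma var_block: "(\<Sum>x<L. (block S c L q x)\<^sup>2) / real L = bvar q"
proof -
 define A where "A = {n. n \<in> S \<and> squarefree_part n = q}"
 have finA: "finite A" using fin by (simp add: A_def)
 have "(\<Sum>x<L. (block S c L q x)\<^sup>2) =
  (\<Sum>x<L. \<Sum>m\<in>A. \<Sum>n\<in>A. Re (c m * cis (2 * pi * real (square_part m) * real x / real L)) * Re (c n * cis (2 * pi * real (square_part n) * real x / real L)))"
  unfolding block_def A_def[symmetric] power2_eq_square Re_sum sum_product ..
 also have "\<dots> = (\<Sum>m\<in>A. \<Sum>n\<in>A. \<Sum>x<L. Re (c m * cis (2 * pi * real (square_part m) * real x / real L)) * Re (c n * cis (2 * pi * real (square_part n) * real x / real L)))"
  by (rule trans[OF sum.swap], rule sum.cong[OF refl], rule sum.swap)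
 also have "\<dots> = (\<Sum>m\<in>A. \<Sum>n\<in>A. if m = n then real L * (norm (c m))\<^sup>2 / 2 else 0)"
 proof (intro sum.cong refl)
  fix m n assume mn: "m \<in> A" "n \<in> A"
  have s: "1 \<le> square_part k" "real (square_part k) \<le> M" if "k \<in> A" for k
  proof -
   have k: "1 \<le> k" "real k \<le> M" using S that by (auto simp: A_def)
   then show "1 \<le> square_part k" "real (square_part k) \<le> M"
    using square_part_pos[of k] square_part_le[of k] by auto
  qed
  have "square_part m = square_part n \<longleftrightarrow> m = n"
   using mn squarefree_decompose[of m] squarefree_decompose[of n] unfolding A_def
   by (metis (mono_tags, lifting) mem_Collect_eq)
  moreover have "real (square_part m + square_part n) < real L" using s(2)[OF mn(1)] s(2)[OF mn(2)] L by simp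
  then have "square_part m + square_part n < L" by (simp only: of_nat_less_iff)
  ultimately show "(\<Sum>x<L. Re (c m * cis (2 * pi * real (square_part m) * real x / real L)) * Re (c n * cis (2 * pi * real (square_part n) * real x / real L)))
   = (if m = n then real L * (norm (c m))\<^sup>2 / 2 else 0)"
   using cis_orthogonal[OF s(1)[OF mn(1)] s(1)[OF mn(2)], of L "c m" "c n"]
   by (simp add: complex_norm_square[symmetric] del: complex_cnj_mult)
 qed
 also have "\<dots> = (\<Sum>m\<in>A. real L * (norm (c m))\<^sup>2 / 2)" using finA by (simp add: sum.delta')
 finally show ?thesis using L_pos
  by (simp add: bvar_def A_def[symmetric] sum_divide_distrib sum_distrib_left[symmetric])
qed

lemma bvar_nonneg: "0 \<le> bvar q"
 unfolding bvar_def by (intro divide_nonneg_nonneg sum_nonneg) auto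

lemma bvar_le: "bvar q \<le> B\<^sup>2"
proof -
 have "(\<Sum>x<L. (block S c L q x)\<^sup>2) \<le> (\<Sum>x<L. B\<^sup>2)"
  using abs_block_le B_nonneg by (intro sum_mono) (metis abs_le_square_iff abs_of_nonneg)
 then show ?thesis unfolding var_block[symmetric] using L_pos by (simp add: divide_le_eq mult.commute)
qed

lemma sum_bvar: "(\<Sum>q\<in>sqf_parts S. bvar q) = (\<Sum>n\<in>S. (norm (c n))\<^sup>2) / 2"
 unfolding bvar_def sum_divide_distrib[symmetric] sqf_parts_def
 by (subst sum.image_gen[OF fin, of _ squarefree_part]) simp

text \<open>Independence of the phases. The type is general so that one factorisation serves both
  the real exponential moments and the characteristic function.\<close>

lemma avg_exp_model:
 fixes z :: "'b :: {real_normed_field, banach}"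
 shows "avg S L (\<lambda>\<theta>. exp (z * of_real (model S c L \<theta>))) =
  (\<Prod>q\<in>sqf_parts S. (\<Sum>x<L. exp (z * of_real (block S c L q x))) / of_nat L)"
proof -
 have "exp (z * of_real (model S c L \<theta>)) = (\<Prod>q\<in>sqf_parts S. exp (z * of_real (block S c L q (\<theta> q))))" for \<theta>
  unfolding model_def of_real_sum sum_distrib_left using fin by (intro exp_sum) (simp add: sqf_parts_def)
 then show ?thesis using avg_prod[OF fin, of L "\<lambda>q x. exp (z * of_real (block S c L q x))"] by simp
qed

text \<open>The condition on l keeps l times each block in [-1, 1], where exp y <= 1 + y + y^2.
  Block means vanish, so a factor is at most 1 + l^2 times its variance, and the product is bounded
  by an exponential of the total variance.\<close>

lemma avg_exp_le:
 assumes "\<bar>l\<bar> * B \<le> 1"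
 shows "avg S L (\<lambda>\<theta>. exp (l * model S c L \<theta>)) \<le> exp (l\<^sup>2 * ((\<Sum>n\<in>S. (norm (c n))\<^sup>2) / 2))"
proof -
 have "avg S L (\<lambda>\<theta>. exp (l * model S c L \<theta>)) = (\<Prod>q\<in>sqf_parts S. (\<Sum>x<L. exp (l * block S c L q x)) / real L)"
  using avg_exp_model[of l] by simp
 also have "\<dots> \<le> (\<Prod>q\<in>sqf_parts S. exp (l\<^sup>2 * bvar q))"
 proof (rule prod_mono, rule conjI)
  fix q
  show "0 \<le> (\<Sum>x<L. exp (l * block S c L q x)) / real L" by (intro divide_nonneg_nonneg sum_nonneg) auto
  have "(\<Sum>x<L. exp (l * block S c L q x)) \<le> (\<Sum>x<L. 1 + l * block S c L q x + l\<^sup>2 * (block S c L q x)\<^sup>2)"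
  proof (rule sum_mono)
   fix x
   have "\<bar>l * block S c L q x\<bar> \<le> 1"
    unfolding abs_mult using assms mult_left_mono[OF abs_block_le[of q x], of "\<bar>l\<bar>"] by linarith
   from exp_le_quadratic[OF this] show "exp (l * block S c L q x) \<le> 1 + l * block S c L q x + l\<^sup>2 * (block S c L q x)\<^sup>2"
    by (simp add: power_mult_distrib)
  qed
  also have "\<dots> = real L + l * (\<Sum>x<L. block S c L q x) + l\<^sup>2 * (\<Sum>x<L. (block S c L q x)\<^sup>2)"
   by (simp add: sum.distrib sum_distrib_left)
  also have "\<dots> = real L * (1 + l\<^sup>2 * bvar q)"
   unfolding mean_block var_block[symmetric] using L_pos by (simp add: field_simps)
  finally have "(\<Sum>x<L. exp (l * block S c L q x)) / real L \<le> 1 + l\<^sup>2 * bvar q"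
   using L_pos by (simp add: divide_le_eq mult.commute)
  also have "\<dots> \<le> exp (l\<^sup>2 * bvar q)" by (rule exp_ge_add_one_self)
  finally show "(\<Sum>x<L. exp (l * block S c L q x)) / real L \<le> exp (l\<^sup>2 * bvar q)" .
 qed
 also have "\<dots> = exp (l\<^sup>2 * (\<Sum>q\<in>sqf_parts S. bvar q))"
  unfolding sum_distrib_left using fin by (intro exp_sum[symmetric]) (simp add: sqf_parts_def)
 finally show ?thesis unfolding sum_bvar .
qed

text \<open>Since y^(2k) / (2k)! <= exp |y|, even moments follow from the exponential moments at l
  and - l, and no combinatorics of pairings is needed.\<close>

lemma avg_even_moment_le:
 assumes l: "0 < l" "l * B \<le> 1"
 shows "avg S L (\<lambda>\<theta>. model S c L \<theta> ^ (2 * k)) \<le> fact (2 * k) / l ^ (2 * k) * (2 * exp (l\<^sup>2 * ((\<Sum>n\<in>S. (norm (c n))\<^sup>2) / 2)))"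
proof -
 have "model S c L \<theta> ^ (2 * k) \<le> fact (2 * k) / l ^ (2 * k) * (exp (l * model S c L \<theta>) + exp ((- l) * model S c L \<theta>))" for \<theta>
 proof -
  define x where "x = model S c L \<theta>"
  have "(\<bar>l * x\<bar>) ^ (2 * k) / fact (2 * k) \<le> exp \<bar>l * x\<bar>" by (rule power_le_exp) simp
  also have "\<dots> \<le> exp (l * x) + exp (- l * x)" by (auto simp: abs_if add_nonneg_nonneg)
  finally have "l ^ (2 * k) * x ^ (2 * k) / fact (2 * k) \<le> exp (l * x) + exp (- l * x)"
   by (simp add: power_mult_distrib abs_mult power_mult)
  then have "l ^ (2 * k) * x ^ (2 * k) \<le> (exp (l * x) + exp (- l * x)) * fact (2 * k)"
   by (simp add: divide_le_eq)
  then show ?thesis unfolding x_def[symmetric] using l(1) by (simp add: field_simps)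
 qed
 then have "avg S L (\<lambda>\<theta>. model S c L \<theta> ^ (2 * k)) \<le>
   avg S L (\<lambda>\<theta>. fact (2 * k) / l ^ (2 * k) * (exp (l * model S c L \<theta>) + exp ((- l) * model S c L \<theta>)))"
  by (intro avg_mono)
 also have "\<dots> = fact (2 * k) / l ^ (2 * k) * (avg S L (\<lambda>\<theta>. exp (l * model S c L \<theta>)) + avg S L (\<lambda>\<theta>. exp ((- l) * model S c L \<theta>)))"
  unfolding avg_cmult avg_add ..
 also have "\<dots> \<le> fact (2 * k) / l ^ (2 * k) * (2 * exp (l\<^sup>2 * ((\<Sum>n\<in>S. (norm (c n))\<^sup>2) / 2)))"
  using avg_exp_le[of l] avg_exp_le[of "- l"] l by (intro mult_left_mono) auto
 finally show ?thesis .
qed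

text \<open>Lindeberg's comparison: products of factors of norm at most 1 differ by at most the sum
  of the differences. For one block, Taylor expansion to second order costs |s|^3 B times its
  variance, and replacing 1 - u by exp(- u) costs u^2, which is at most s^4 B^2 times the variance
  because the block variance is at most B^2.\<close>

lemma avg_char_model:
 "norm (avg S L (\<lambda>\<theta>. exp (\<i> * of_real s * of_real (model S c L \<theta>))) - of_real (exp (- s\<^sup>2 * ((\<Sum>n\<in>S. (norm (c n))\<^sup>2) / 2) / 2)))
  \<le> (\<bar>s\<bar> ^ 3 * B + s ^ 4 * B\<^sup>2) * ((\<Sum>n\<in>S. (norm (c n))\<^sup>2) / 2)"
proof -
 let ?z = "\<lambda>u. \<i> * of_real (s * u)"
 define w where "w q = (\<Sum>x<L. exp (\<i> * of_real s * of_real (block S c L q x))) / of_nat L" for q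
 define z where "z q = complex_of_real (exp (- s\<^sup>2 * bvar q / 2))" for q
 have L0: "0 < real L" using L_pos by simp
 have w: "avg S L (\<lambda>\<theta>. exp (\<i> * of_real s * of_real (model S c L \<theta>))) = (\<Prod>q\<in>sqf_parts S. w q)"
  unfolding w_def by (rule avg_exp_model)
 have finQ: "finite (sqf_parts S)" using fin by (simp add: sqf_parts_def)
 have z: "complex_of_real (exp (- s\<^sup>2 * ((\<Sum>n\<in>S. (norm (c n))\<^sup>2) / 2) / 2)) = (\<Prod>q\<in>sqf_parts S. z q)"
 proof -
  have "- s\<^sup>2 * ((\<Sum>n\<in>S. (norm (c n))\<^sup>2) / 2) / 2 = (\<Sum>q\<in>sqf_parts S. - s\<^sup>2 * bvar q / 2)"
   unfolding sum_bvar[symmetric] by (simp add: sum_distrib_left sum_divide_distrib)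
  then have "exp (- s\<^sup>2 * ((\<Sum>n\<in>S. (norm (c n))\<^sup>2) / 2) / 2) = (\<Prod>q\<in>sqf_parts S. exp (- s\<^sup>2 * bvar q / 2))"
   using exp_sum[OF finQ] by simp
  then show ?thesis by (simp add: z_def)
 qed
 have nw: "norm (w q) \<le> 1" for q
 proof -
  have "norm (\<Sum>x<L. exp (\<i> * of_real s * of_real (block S c L q x))) \<le> (\<Sum>x<L. 1)"
   by (rule order_trans[OF norm_sum]) (simp add: norm_exp_eq_Re)
  then show ?thesis using L0 by (simp add: w_def norm_divide divide_le_eq)
 qed
 have nz: "norm (z q) \<le> 1" for q using bvar_nonneg[of q] by (simp add: z_def)
 have "norm ((\<Prod>q\<in>sqf_parts S. w q) - (\<Prod>q\<in>sqf_parts S. z q)) \<le> (\<Sum>q\<in>sqf_parts S. norm (w q - z q))"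
  using nw nz by (intro norm_prod_diff)
 also have "\<dots> \<le> (\<Sum>q\<in>sqf_parts S. (\<bar>s\<bar> ^ 3 * B + s ^ 4 * B\<^sup>2) * bvar q)"
 proof (rule sum_mono)
  fix q
  define b where "b x = block S c L q x" for x
  have "norm (w q - of_real (1 - s\<^sup>2 * bvar q / 2)) \<le> \<bar>s\<bar> ^ 3 * B * bvar q"
  proof -
   have "complex_of_real (1 - s\<^sup>2 * bvar q / 2) = (\<Sum>x<L. 1 + ?z (b x) + (?z (b x))\<^sup>2 / 2) / of_nat L"
   proof -
    have "(\<Sum>x<L. 1 + ?z (b x) + (?z (b x))\<^sup>2 / 2) =
     of_nat L + \<i> * of_real s * of_real (\<Sum>x<L. b x) - of_real (s\<^sup>2 * (\<Sum>x<L. (b x)\<^sup>2)) / 2"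
     by (simp add: sum.distrib sum_subtractf sum_distrib_left power_mult_distrib sum_divide_distrib mult_ac)
    also have "(\<Sum>x<L. b x) = 0" unfolding b_def by (rule mean_block)
    also have "(\<Sum>x<L. (b x)\<^sup>2) = real L * bvar q" unfolding b_def var_block[symmetric] using L0 by simp
    finally have "(\<Sum>x<L. 1 + ?z (b x) + (?z (b x))\<^sup>2 / 2) =
     of_nat L * complex_of_real (1 - s\<^sup>2 * bvar q / 2)" by (simp add: algebra_simps)
    then show ?thesis using L_pos by simp
   qed
   then have "w q - of_real (1 - s\<^sup>2 * bvar q / 2) =
     (\<Sum>x<L. exp (?z (b x)) - (1 + ?z (b x) + (?z (b x))\<^sup>2 / 2)) / of_nat L"
    by (simp add: w_def b_def sum_subtractf diff_divide_distrib mult_ac)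
   then have "norm (w q - of_real (1 - s\<^sup>2 * bvar q / 2)) =
     norm (\<Sum>x<L. exp (?z (b x)) - (1 + ?z (b x) + (?z (b x))\<^sup>2 / 2)) / real L"
    by (simp only: norm_divide norm_of_nat)
   also have "\<dots> \<le> (\<Sum>x<L. \<bar>s\<bar> ^ 3 * B * (b x)\<^sup>2) / real L"
   proof (intro divide_right_mono order_trans[OF norm_sum] sum_mono)
    fix x
    have "norm (exp (?z (b x)) - (\<Sum>k\<le>2. (?z (b x)) ^ k / fact k)) \<le> \<bar>s * b x\<bar> ^ Suc 2 / fact (Suc 2)"
     by (rule iexp_approx1)
    also have "(\<Sum>k\<le>2. (?z (b x)) ^ k / fact k) = 1 + ?z (b x) + (?z (b x))\<^sup>2 / 2"
     by (simp add: eval_nat_numeral)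
    also have "\<bar>s * b x\<bar> ^ Suc 2 / fact (Suc 2) \<le> \<bar>s * b x\<bar> ^ Suc 2 / 1"
     by (intro divide_left_mono) auto
    also have "\<dots> = \<bar>s\<bar> ^ 3 * \<bar>b x\<bar> * (b x)\<^sup>2"
     unfolding power2_abs[of "b x", symmetric] abs_mult power_mult_distrib by (simp add: eval_nat_numeral)
    also have "\<dots> \<le> \<bar>s\<bar> ^ 3 * B * (b x)\<^sup>2"
     unfolding b_def using abs_block_le by (intro mult_right_mono mult_left_mono) auto
    finally show "norm (exp (?z (b x)) - (1 + ?z (b x) + (?z (b x))\<^sup>2 / 2)) \<le> \<bar>s\<bar> ^ 3 * B * (b x)\<^sup>2" .
   qed auto
   also have "\<dots> = \<bar>s\<bar> ^ 3 * B * bvar q"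
    unfolding b_def var_block[symmetric] by (simp add: sum_distrib_left sum_divide_distrib)
   finally show ?thesis .
  qed
  moreover have "norm (of_real (1 - s\<^sup>2 * bvar q / 2) - z q) \<le> s ^ 4 * B\<^sup>2 * bvar q"
  proof -
   define u where "u = s\<^sup>2 * bvar q / 2"
   have u0: "0 \<le> u" using bvar_nonneg by (simp add: u_def)
   have l: "1 - u \<le> exp (- u)" using exp_ge_add_one_self[of "- u"] by simp
   have "exp (- u) \<le> 1 - u + u\<^sup>2"
   proof (cases "u \<le> 1")
    case True
    then show ?thesis using exp_le_quadratic[of "- u"] u0 by simp
   next
    case False
    then have "u * 1 \<le> u * u" using u0 by (intro mult_left_mono) auto
    moreover have "exp (- u) \<le> 1" using u0 by simp
    ultimately show ?thesis unfolding power2_eq_square by linarith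
   qed
   then have "\<bar>1 - u - exp (- u)\<bar> \<le> u\<^sup>2" using l by simp
   also have "u\<^sup>2 = s ^ 4 * bvar q * bvar q / 4" by (simp add: u_def power2_eq_square eval_nat_numeral)
   also have "\<dots> \<le> s ^ 4 * bvar q * bvar q" using bvar_nonneg[of q] by (simp add: zero_le_even_power)
   also have "\<dots> \<le> s ^ 4 * B\<^sup>2 * bvar q" using bvar_le[of q] bvar_nonneg[of q]
    by (intro mult_right_mono mult_left_mono) (auto simp: zero_le_even_power)
   finally have "\<bar>1 - u - exp (- u)\<bar> \<le> s ^ 4 * B\<^sup>2 * bvar q" .
   moreover have "of_real (1 - s\<^sup>2 * bvar q / 2) - z q = of_real (1 - u - exp (- u))"
    by (simp add: z_def u_def)
   ultimately show ?thesis by (simp only: norm_of_real)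
  qed
  ultimately have "norm (w q - z q) \<le> \<bar>s\<bar> ^ 3 * B * bvar q + s ^ 4 * B\<^sup>2 * bvar q"
   using norm_triangle_ineq[of "w q - of_real (1 - s\<^sup>2 * bvar q / 2)" "of_real (1 - s\<^sup>2 * bvar q / 2) - z q"] by simp
  then show "norm (w q - z q) \<le> (\<bar>s\<bar> ^ 3 * B + s ^ 4 * B\<^sup>2) * bvar q" by (simp add: algebra_simps)
 qed
 also have "\<dots> = (\<bar>s\<bar> ^ 3 * B + s ^ 4 * B\<^sup>2) * ((\<Sum>n\<in>S. (norm (c n))\<^sup>2) / 2)"
  unfolding sum_distrib_left[symmetric] sum_bvar ..
 finally show ?thesis unfolding w z .
qed

end

subsection \<open>A central limit theorem for trigonometric polynomials\<close>

text \<open>Expand the exponential to the odd degree 2 k - 1. The Taylor remainder then has the even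
  exponent 2 k, so it is bounded by a genuine moment rather than an absolute one and can itself be
  transferred to the model. Polynomial parts differ by at most d per degree.\<close>

lemma char_compare:
 fixes Y :: "(nat \<Rightarrow> nat) \<Rightarrow> real" and X :: "real \<Rightarrow> real"
 assumes T: "0 < T" and X: "X \<in> borel_measurable borel" "\<And>t. \<bar>X t\<bar> \<le> C"
  and d: "\<And>j. j \<le> 2 * k \<Longrightarrow> \<bar>(\<integral>t. X t ^ j \<partial>unif T) - avg S L (\<lambda>\<theta>. Y \<theta> ^ j)\<bar> \<le> d" and k: "1 \<le> k"
 shows "norm ((\<integral>t. exp (\<i> * of_real s * of_real (X t)) \<partial>unif T) - avg S L (\<lambda>\<theta>. exp (\<i> * of_real s * of_real (Y \<theta>))))
  \<le> d * (\<Sum>j\<le>2 * k. \<bar>s\<bar> ^ j / fact j) + 2 * (s ^ (2 * k) / fact (2 * k)) * avg S L (\<lambda>\<theta>. Y \<theta> ^ (2 * k))"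
proof -
 define n where "n = 2 * k - 1"
 have n: "Suc n = 2 * k" using k by (simp add: n_def)
 define P where "P y = (\<Sum>j\<le>n. (\<i> * of_real (s * y)) ^ j / fact j)" for y :: real
 define e where "e y = exp (\<i> * complex_of_real (s * y))" for y
 define a where "a = s ^ (2 * k) / fact (2 * k)"
 have a0: "0 \<le> a" by (simp add: a_def zero_le_even_power)
 have tay: "norm (e y - P y) \<le> a * y ^ (2 * k)" for y
 proof -
  have "norm (e y - P y) \<le> \<bar>s * y\<bar> ^ Suc n / fact (Suc n)" unfolding e_def P_def by (rule iexp_approx1)
  also have "\<bar>s * y\<bar> ^ Suc n = s ^ (2 * k) * y ^ (2 * k)" unfolding n by (simp add: power_mult_distrib abs_mult power_even_abs)
  finally show ?thesis unfolding n a_def by simp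
 qed
 have C0: "0 \<le> C" using X(2)[of 0] by linarith
 have intj: "integrable (unif T) (\<lambda>t. X t ^ j)" for j
  using X C0 by (intro integrable_unif_bounded[OF T, of _ "C ^ j"]) (auto simp: power_abs intro!: power_mono)
 have inte: "integrable (unif T) (\<lambda>t. e (X t))"
  unfolding e_def using X by (intro integrable_unif_bounded[OF T, of _ 1]) auto
 have Pj: "P y = (\<Sum>j\<le>n. ((\<i> * of_real s) ^ j / fact j) * of_real (y ^ j))" for y
  unfolding P_def by (intro sum.cong refl) (simp add: power_mult_distrib)
 have intP: "integrable (unif T) (\<lambda>t. P (X t))"
  unfolding Pj using intj by (intro Bochner_Integration.integrable_sum integrable_mult_right integrable_of_real)
 have IP: "(\<integral>t. P (X t) \<partial>unif T) = (\<Sum>j\<le>n. ((\<i> * of_real s) ^ j / fact j) * of_real (\<integral>t. X t ^ j \<partial>unif T))"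
 proof -
  have "(\<integral>t. P (X t) \<partial>unif T) = (\<Sum>j\<le>n. (\<integral>t. ((\<i> * of_real s) ^ j / fact j) * of_real (X t ^ j) \<partial>unif T))"
   unfolding Pj using intj by (intro Bochner_Integration.integral_sum integrable_mult_right integrable_of_real)
  then show ?thesis by (simp only: integral_mult_right_zero integral_complex_of_real)
 qed
 have AP: "avg S L (\<lambda>\<theta>. P (Y \<theta>)) = (\<Sum>j\<le>n. ((\<i> * of_real s) ^ j / fact j) * of_real (avg S L (\<lambda>\<theta>. Y \<theta> ^ j)))"
  unfolding Pj avg_sum avg_cmult avg_of_real ..
 have 1: "norm ((\<integral>t. e (X t) \<partial>unif T) - (\<integral>t. P (X t) \<partial>unif T)) \<le> a * (\<integral>t. X t ^ (2 * k) \<partial>unif T)"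
 proof -
  have "norm ((\<integral>t. e (X t) \<partial>unif T) - (\<integral>t. P (X t) \<partial>unif T)) = norm (\<integral>t. e (X t) - P (X t) \<partial>unif T)"
   using inte intP by simp
  also have "\<dots> \<le> (\<integral>t. norm (e (X t) - P (X t)) \<partial>unif T)" by (rule integral_norm_bound)
  also have "\<dots> \<le> (\<integral>t. a * X t ^ (2 * k) \<partial>unif T)"
   using inte intP intj tay by (intro integral_mono integrable_norm Bochner_Integration.integrable_diff integrable_mult_right) auto
  finally show ?thesis by simp
 qed
 have 2: "norm (avg S L (\<lambda>\<theta>. e (Y \<theta>)) - avg S L (\<lambda>\<theta>. P (Y \<theta>))) \<le> a * avg S L (\<lambda>\<theta>. Y \<theta> ^ (2 * k))"
 proof -
  have "avg S L (\<lambda>\<theta>. e (Y \<theta>)) - avg S L (\<lambda>\<theta>. P (Y \<theta>)) = avg S L (\<lambda>\<theta>. e (Y \<theta>) - P (Y \<theta>))"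
   unfolding avg_def by (simp add: sum_subtractf diff_divide_distrib)
  then have "norm (avg S L (\<lambda>\<theta>. e (Y \<theta>)) - avg S L (\<lambda>\<theta>. P (Y \<theta>))) \<le> avg S L (\<lambda>\<theta>. norm (e (Y \<theta>) - P (Y \<theta>)))"
   by (simp only: norm_avg_le)
  also have "\<dots> \<le> avg S L (\<lambda>\<theta>. a * Y \<theta> ^ (2 * k))" using tay by (intro avg_mono)
  finally show ?thesis unfolding avg_cmult .
 qed
 have 3: "norm ((\<integral>t. P (X t) \<partial>unif T) - avg S L (\<lambda>\<theta>. P (Y \<theta>))) \<le> (\<Sum>j\<le>n. \<bar>s\<bar> ^ j / fact j * d)"
  unfolding IP AP sum_subtractf[symmetric] right_diff_distrib[symmetric]
 proof (intro order_trans[OF norm_sum] sum_mono)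
  fix j assume "j \<in> {..n}"
  then have j: "j \<le> 2 * k" using n by simp
  have "norm ((\<i> * complex_of_real s) ^ j / fact j) = \<bar>s\<bar> ^ j / fact j"
   by (simp add: norm_divide norm_power norm_mult)
  then show "norm ((\<i> * complex_of_real s) ^ j / fact j * (of_real (\<integral>t. X t ^ j \<partial>unif T) - of_real (avg S L (\<lambda>\<theta>. Y \<theta> ^ j))))
   \<le> \<bar>s\<bar> ^ j / fact j * d"
   unfolding norm_mult of_real_diff[symmetric] norm_of_real using d[OF j] by (simp add: mult_left_mono divide_right_mono)
 qed
 have 4: "a * (\<integral>t. X t ^ (2 * k) \<partial>unif T) \<le> a * d + a * avg S L (\<lambda>\<theta>. Y \<theta> ^ (2 * k))"
 proof -
  have "(\<integral>t. X t ^ (2 * k) \<partial>unif T) \<le> d + avg S L (\<lambda>\<theta>. Y \<theta> ^ (2 * k))" using d[of "2 * k"] by linarith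
  then have "a * (\<integral>t. X t ^ (2 * k) \<partial>unif T) \<le> a * (d + avg S L (\<lambda>\<theta>. Y \<theta> ^ (2 * k)))" using a0 by (rule mult_left_mono)
  then show ?thesis by (simp add: algebra_simps)
 qed
 have 5: "(\<Sum>j\<le>n. \<bar>s\<bar> ^ j / fact j * d) + a * d = d * (\<Sum>j\<le>2 * k. \<bar>s\<bar> ^ j / fact j)"
  unfolding n[symmetric] sum.atMost_Suc a_def
  by (simp only: n power_even_abs even_mult_iff even_numeral simp_thms) (simp add: sum_distrib_left sum_distrib_right algebra_simps)
 define I1 where "I1 = (\<integral>t. e (X t) \<partial>unif T)"
 define I2 where "I2 = (\<integral>t. P (X t) \<partial>unif T)"
 define I3 where "I3 = avg S L (\<lambda>\<theta>. P (Y \<theta>))"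
 define I4 where "I4 = avg S L (\<lambda>\<theta>. e (Y \<theta>))"
 have "norm (I1 - I4) \<le> norm (I1 - I2) + norm (I2 - I3) + norm (I4 - I3)"
  using norm_triangle_ineq4[of "I1 - I3" "I4 - I3"] norm_triangle_ineq[of "I1 - I2" "I2 - I3"] by simp
 also have "\<dots> \<le> (\<Sum>j\<le>n. \<bar>s\<bar> ^ j / fact j * d) + a * d + 2 * a * avg S L (\<lambda>\<theta>. Y \<theta> ^ (2 * k))"
  using 1 2 3 4 unfolding I1_def I2_def I3_def I4_def by linarith
 finally show ?thesis unfolding 5 unfolding I1_def I4_def e_def a_def by (simp add: mult_ac)
qed

text \<open>The degree of the Taylor expansion is fixed before T. This is possible because the
  exponential moments of the model are bounded uniformly in T, so the remainder is geometrically
  small in k. Only finitely many moments then have to be compared, and for each the error is a fixed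
  power of M T over T.\<close>

theorem trig_clt:
 fixes S :: "real \<Rightarrow> nat set" and c :: "real \<Rightarrow> nat \<Rightarrow> complex" and M B :: "real \<Rightarrow> real"
 assumes ev: "\<forall>\<^sub>F T in at_top. finite (S T) \<and> (\<forall>n\<in>S T. 1 \<le> n \<and> real n \<le> M T) \<and> 1 \<le> M T \<and> (\<Sum>n\<in>S T. norm (c T n)) \<le> M T"
  and M: "\<And>j. ((\<lambda>T. M T ^ j / T) \<longlongrightarrow> 0) at_top"
  and B: "\<forall>\<^sub>F T in at_top. \<forall>q. (\<Sum>n | n \<in> S T \<and> squarefree_part n = q. norm (c T n)) \<le> B T" "(B \<longlongrightarrow> 0) at_top"
  and v: "((\<lambda>T. (\<Sum>n\<in>S T. (norm (c T n))\<^sup>2) / 2) \<longlongrightarrow> v) at_top"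
 shows "((\<lambda>T. \<integral>t. exp (\<i> * of_real s * of_real (Re (trig (S T) (c T) t))) \<partial>unif T) \<longlongrightarrow> of_real (exp (- s\<^sup>2 * v / 2))) at_top"
proof (rule tendstoI)
 fix e :: real assume e: "0 < e"
 define V where "V T = (\<Sum>n\<in>S T. (norm (c T n))\<^sup>2) / 2" for T
 let ?g = "\<lambda>u. exp (- s\<^sup>2 * u / 2)"
 \<comment> \<open>Any l >= 2 |s| makes s^2 / l^2 <= 1/4, so the Taylor remainder is at most 4 W
   (1/4)^k; the summand 1 keeps l positive at s = 0.\<close>
 define l where "l = 2 * \<bar>s\<bar> + 1"
 have l: "0 < l" "2 * \<bar>s\<bar> \<le> l" by (auto simp: l_def)
 define W where "W = exp (l\<^sup>2 * (v + 1))"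
 have W0: "0 < W" by (simp add: W_def)
 have "((\<lambda>k. 4 * W * (1 / 4) ^ k) \<longlongrightarrow> 4 * W * 0) sequentially"
  by (intro tendsto_intros LIMSEQ_power_zero) auto
 then have "\<forall>\<^sub>F k in sequentially. 4 * W * (1 / 4) ^ k < e / 4" using e by (intro order_tendstoD(2)) auto
 then have "\<forall>\<^sub>F k in sequentially. 4 * W * (1 / 4) ^ k < e / 4 \<and> 1 \<le> k" using eventually_ge_at_top[of 1] by eventually_elim auto
 then obtain k where k: "4 * W * (1 / 4) ^ k < e / 4" "1 \<le> k" by (metis (mono_tags, lifting) eventually_happens' sequentially_bot)
 have "\<exists>E. \<forall>j. \<forall>S c M (T::real) L. finite S \<longrightarrow> (\<forall>n\<in>S. 1 \<le> n \<and> real n \<le> M) \<longrightarrow> 1 \<le> M \<longrightarrow> real j * M < real L \<longrightarrow> 0 < T \<longrightarrow>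
  \<bar>(\<integral>t. Re (trig S c t) ^ j \<partial>unif T) - avg S L (\<lambda>\<theta>. model S c L \<theta> ^ j)\<bar>
  \<le> (\<Sum>n\<in>S. norm (c n)) ^ j * ((1 + M) ^ E j / T)"
  using moment_compare by (intro choice) auto
 then obtain E where E: "\<And>j S c M (T::real) L. finite S \<Longrightarrow> (\<forall>n\<in>S. 1 \<le> n \<and> real n \<le> M) \<Longrightarrow> 1 \<le> M \<Longrightarrow> real j * M < real L \<Longrightarrow> 0 < T \<Longrightarrow>
  \<bar>(\<integral>t. Re (trig S c t) ^ j \<partial>unif T) - avg S L (\<lambda>\<theta>. model S c L \<theta> ^ j)\<bar>
  \<le> (\<Sum>n\<in>S. norm (c n)) ^ j * ((1 + M) ^ E j / T)" by blast
 \<comment> \<open>A single exponent dominating j + E j for all degrees j <= 2 k.\<close>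
 define F where "F = 2 * k + (\<Sum>j\<le>2 * k. E j)"
 define D where "D T = 2 ^ F * (M T ^ F / T)" for T
 define G where "G = (\<Sum>j\<le>2 * k. \<bar>s\<bar> ^ j / fact j)"
 have "((\<lambda>T. D T * G) \<longlongrightarrow> 2 ^ F * 0 * G) at_top" unfolding D_def by (intro tendsto_intros M)
 then have evD: "\<forall>\<^sub>F T in at_top. D T * G < e / 4" using e by (intro order_tendstoD(2)) auto
 have evV: "\<forall>\<^sub>F T in at_top. V T < v + 1" using v unfolding V_def by (intro order_tendstoD(2)) auto
 have "((\<lambda>T. l * B T) \<longlongrightarrow> l * 0) at_top" by (intro tendsto_intros B)
 then have evB: "\<forall>\<^sub>F T in at_top. l * B T < 1" by (intro order_tendstoD(2)) auto
 have "((\<lambda>T. (\<bar>s\<bar> ^ 3 * B T + s ^ 4 * (B T)\<^sup>2) * V T) \<longlongrightarrow> (\<bar>s\<bar> ^ 3 * 0 + s ^ 4 * 0\<^sup>2) * v) at_top"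
  using v unfolding V_def[symmetric] by (intro tendsto_intros B)
 then have evB2: "\<forall>\<^sub>F T in at_top. (\<bar>s\<bar> ^ 3 * B T + s ^ 4 * (B T)\<^sup>2) * V T < e / 4" using e by (intro order_tendstoD(2)) auto
 have "((\<lambda>T. complex_of_real (?g (V T))) \<longlongrightarrow> of_real (?g v)) at_top"
  using v unfolding V_def[symmetric] by (intro tendsto_intros) auto
 then have evE: "\<forall>\<^sub>F T in at_top. dist (complex_of_real (?g (V T))) (of_real (?g v)) < e / 4"
  using e by (intro tendstoD) auto
 show "\<forall>\<^sub>F T in at_top. dist (\<integral>t. exp (\<i> * of_real s * of_real (Re (trig (S T) (c T) t))) \<partial>unif T) (of_real (?g v)) < e"
  using ev B(1) evD evV evB evB2 evE eventually_gt_at_top[of 0]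
 proof eventually_elim
  case (elim T)
  have fin: "finite (S T)" and SM: "\<And>n. n \<in> S T \<Longrightarrow> 1 \<le> n \<and> real n \<le> M T" and M1: "1 \<le> M T"
   and cM: "(\<Sum>n\<in>S T. norm (c T n)) \<le> M T" using elim(1) by auto
  have T: "0 < T" using elim by simp
  obtain L :: nat where L: "2 * real k * M T < real L" using reals_Archimedean2 by blast
  have L2: "2 * M T < real L"
  proof -
   have "1 * (2 * M T) \<le> real k * (2 * M T)" using k(2) M1 by (intro mult_right_mono) auto
   then show ?thesis using L by (simp add: mult_ac)
  qed
  have BT: "\<And>q. (\<Sum>n | n \<in> S T \<and> squarefree_part n = q. norm (c T n)) \<le> B T" using elim by simp
  note ctx = fin SM L2 M1 BT
  have dj: "\<bar>(\<integral>t. Re (trig (S T) (c T) t) ^ j \<partial>unif T) - avg (S T) L (\<lambda>\<theta>. model (S T) (c T) L \<theta> ^ j)\<bar> \<le> D T" if j: "j \<le> 2 * k" for j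
  proof -
   have "real j * M T \<le> real (2 * k) * M T" using j M1 by (intro mult_right_mono) auto
   then have jL: "real j * M T < real L" using L by simp
   have "\<bar>(\<integral>t. Re (trig (S T) (c T) t) ^ j \<partial>unif T) - avg (S T) L (\<lambda>\<theta>. model (S T) (c T) L \<theta> ^ j)\<bar>
    \<le> (\<Sum>n\<in>S T. norm (c T n)) ^ j * ((1 + M T) ^ E j / T)"
    using E[OF fin _ M1 jL T] SM by blast
   also have "\<dots> \<le> (2 * M T) ^ j * ((2 * M T) ^ E j / T)"
    using cM M1 T by (intro mult_mono power_mono divide_right_mono) (auto intro: sum_nonneg)
   also have "\<dots> = (2 * M T) ^ (j + E j) / T" by (simp add: power_add)
   also have "\<dots> \<le> (2 * M T) ^ F / T"
   proof -
    have "E j \<le> (\<Sum>j\<le>2 * k. E j)" using j by (intro member_le_sum) auto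
    then have "j + E j \<le> F" using j by (simp add: F_def)
    then show ?thesis using M1 T by (intro divide_right_mono power_increasing) auto
   qed
   finally show ?thesis by (simp add: D_def power_mult_distrib)
  qed
  define I1 where "I1 = (\<integral>t. exp (\<i> * of_real s * of_real (Re (trig (S T) (c T) t))) \<partial>unif T)"
  define I2 where "I2 = avg (S T) L (\<lambda>\<theta>. exp (\<i> * of_real s * of_real (model (S T) (c T) L \<theta>)))"
  define a where "a = s ^ (2 * k) / fact (2 * k)"
  have a0: "0 \<le> a" by (simp add: a_def zero_le_even_power)
  have bd: "\<bar>Re (trig (S T) (c T) t)\<bar> \<le> M T" for t
   using abs_Re_le_cmod[of "trig (S T) (c T) t"] norm_trig_le[of "S T" "c T" t] cM by linarith
  have "norm (I1 - I2) \<le> D T * G + 2 * a * avg (S T) L (\<lambda>\<theta>. model (S T) (c T) L \<theta> ^ (2 * k))"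
   unfolding I1_def I2_def G_def a_def by (rule char_compare[OF T _ bd dj k(2)]) auto
  also have "2 * a * avg (S T) L (\<lambda>\<theta>. model (S T) (c T) L \<theta> ^ (2 * k)) \<le> 2 * a * (fact (2 * k) / l ^ (2 * k) * (2 * exp (l\<^sup>2 * V T)))"
   unfolding V_def using a0 elim l by (intro mult_left_mono avg_even_moment_le[OF ctx]) auto
  also have "\<dots> \<le> 2 * a * (fact (2 * k) / l ^ (2 * k) * (2 * W))"
   using a0 l elim unfolding W_def by (intro mult_left_mono) auto
  also have "\<dots> = 4 * W * (s\<^sup>2 / l\<^sup>2) ^ k"
   by (simp add: a_def power_mult power_divide)
  also have "\<dots> \<le> 4 * W * (1 / 4) ^ k"
  proof -
   have "(2 * \<bar>s\<bar>)\<^sup>2 \<le> l\<^sup>2" using l by (intro power_mono) auto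
   then have "s\<^sup>2 / l\<^sup>2 \<le> 1 / 4" using l by (simp add: divide_le_eq power_mult_distrib)
   then show ?thesis using W0 by (intro mult_left_mono power_mono) auto
  qed
  finally have 1: "norm (I1 - I2) < e / 4 + e / 4" using elim k by linarith
  have 2: "norm (I2 - of_real (?g (V T))) < e / 4"
   using avg_char_model[OF ctx, of s] elim unfolding I2_def V_def by linarith
  have 3: "norm (of_real (?g (V T)) - complex_of_real (?g v)) < e / 4"
   using elim by (simp add: dist_norm)
  have "norm (I1 - of_real (?g v)) \<le> norm (I1 - I2) + norm (I2 - of_real (?g (V T)))
   + norm (of_real (?g (V T)) - complex_of_real (?g v))"
   using norm_triangle_ineq[of "I1 - I2" "I2 - of_real (?g (V T))"]
    norm_triangle_ineq[of "I1 - of_real (?g (V T))" "of_real (?g (V T)) - complex_of_real (?g v)"]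
   by simp
  then show ?case using 1 2 3 unfolding I1_def dist_norm by linarith
 qed
qed

section \<open>The Fourier transform of a disc\<close>

text \<open>The closed half plane contains the branch point 0. It is attained by 1 - z and 1 + z at
  the corners 1 and -1 of the contour used below, so continuity is needed there and not only off the
  cut.\<close>

lemma continuous_csqrt_right_half_plane: "continuous_on {z. 0 \<le> Re z} csqrt"
 unfolding continuous_on_eq_continuous_within
proof
 fix z :: complex assume z: "z \<in> {z. 0 \<le> Re z}"
 show "continuous (at z within {z. 0 \<le> Re z}) csqrt"
 proof (cases "z = 0")
  case False
  have "z \<notin> \<real>\<^sub>\<le>\<^sub>0" using z False by (auto simp: complex_nonpos_Reals_iff complex_eq_iff)
  then have "isCont csqrt z"
   using continuous_on_csqrt continuous_on_eq_continuous_at[of "- \<real>\<^sub>\<le>\<^sub>0" csqrt] by (auto simp: open_Compl)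
  then show ?thesis by (rule continuous_at_imp_continuous_at_within)
 next
  case True
  have "((\<lambda>w. csqrt w) \<longlongrightarrow> 0) (at 0 within {z. 0 \<le> Re z})"
  proof (rule tendsto_norm_zero_cancel)
   have "((\<lambda>w. sqrt (norm w)) \<longlongrightarrow> sqrt (norm (0::complex))) (at 0 within {z. 0 \<le> Re z})"
    by (intro tendsto_intros)
   then show "((\<lambda>w. norm (csqrt w)) \<longlongrightarrow> 0) (at 0 within {z. 0 \<le> Re z})" by simp
  qed
  then show ?thesis using True by (simp add: continuous_within)
 qed
qed

section \<open>Laplace integrals with a power singularity at the endpoint\<close>

lemma integral_power_exp_scaled:
 assumes w: "0 < w" and a: "1 < (a::real)"
 shows "integral {0..1} (\<lambda>y. y powr (a - 1) * exp (- (w * y))) = w powr (- a) * integral {0..w} (\<lambda>u. u powr (a - 1) * exp (- u))"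
  "(\<lambda>u. u powr (a - 1) * exp (- u)) integrable_on {0..w}"
proof -
 define f where "f u = u powr (a - 1) * exp (- u)" for u :: real
 have cont: "continuous_on {0..w} f" unfolding f_def using a by (auto intro!: continuous_intros continuous_on_powr')
 then show int: "(\<lambda>u. u powr (a - 1) * exp (- u)) integrable_on {0..w}"
  unfolding f_def by (rule integrable_continuous_interval)
 then have "(f has_integral integral {0..w} f) {0..w}" unfolding f_def by (simp add: integrable_integral)
 from has_integral_stretch_real[OF this, of w] w
 have "((\<lambda>x. f (w * x)) has_integral (1 / w) * integral {0..w} f) ((\<lambda>x. x / w) ` {0..w})" by simp
 also have "(\<lambda>x. x / w) ` {0..w} = {0..1}"
 proof (intro equalityI subsetI)
  fix y assume "y \<in> {0..1::real}"
  then have "y = (w * y) / w" "w * y \<in> {0..w}" using w by (auto simp: mult_left_le)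
  then show "y \<in> (\<lambda>x. x / w) ` {0..w}" by blast
 qed (use w in auto)
 finally have 1: "((\<lambda>x. w powr (1 - a) * f (w * x)) has_integral w powr (1 - a) * ((1 / w) * integral {0..w} f)) {0..1}"
  by (rule has_integral_mult_right)
 have "w powr (1 - a) * f (w * x) = x powr (a - 1) * exp (- (w * x))" if "x \<in> {0..1}" for x
 proof -
  have "w powr (1 - a) * w powr (a - 1) = 1" using w by (simp add: powr_add[symmetric])
  then show ?thesis using that w unfolding f_def by (simp add: powr_mult)
 qed
 then have "((\<lambda>x. x powr (a - 1) * exp (- (w * x))) has_integral w powr (1 - a) * ((1 / w) * integral {0..w} f)) {0..1}"
  using has_integral_eq[OF _ 1] by simp
 moreover have "w powr (1 - a) * ((1 / w) * integral {0..w} f) = w powr (- a) * integral {0..w} f"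
 proof -
  have "w powr (- a) = w powr (1 - a - 1)" by simp
  also have "\<dots> = w powr (1 - a) / w" unfolding powr_diff using w by simp
  finally show ?thesis by simp
 qed
 ultimately have "integral {0..1} (\<lambda>y. y powr (a - 1) * exp (- (w * y))) = w powr (- a) * integral {0..w} f"
  by (simp add: integral_unique)
 moreover have "f = (\<lambda>u. u powr (a - 1) * exp (- u))" by (rule ext) (simp add: f_def)
 ultimately show "integral {0..1} (\<lambda>y. y powr (a - 1) * exp (- (w * y))) = w powr (- a) * integral {0..w} (\<lambda>u. u powr (a - 1) * exp (- u))"
  by simp
qed

lemma Gamma_integrable: "0 < (a::real) \<Longrightarrow> ((\<lambda>u. u powr (a - 1) * exp (- u)) has_integral Gamma a) {0..}"
 using Gamma_integral_real[of a] by (simp add: exp_minus field_simps)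

lemma integral_power_exp_le:
 assumes w: "0 < w" and a: "1 < (a::real)"
 shows "integral {0..1} (\<lambda>y. y powr (a - 1) * exp (- (w * y))) \<le> Gamma a * w powr (- a)"
proof -
 have "integral {0..w} (\<lambda>u. u powr (a - 1) * exp (- u)) \<le> integral {0..} (\<lambda>u. u powr (a - 1) * exp (- u))"
  using integral_power_exp_scaled(2)[OF w a] Gamma_integrable[of a] a
  by (intro integral_subset_le) (auto simp: has_integral_iff)
 also have "\<dots> = Gamma a" using Gamma_integrable[of a] a by (simp add: has_integral_iff)
 finally have "w powr (- a) * integral {0..w} (\<lambda>u. u powr (a - 1) * exp (- u)) \<le> w powr (- a) * Gamma a"
  by (rule mult_left_mono) simp
 then show ?thesis unfolding integral_power_exp_scaled(1)[OF w a] by (simp only: mult.commute)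
qed

text \<open>The substitution u = w y leaves Gamma(3/2) minus the tail beyond w. On that tail 1 <= u
  / w, so it is at most Gamma(5/2) / w, one power of w smaller.\<close>

lemma integral_sqrt_exp:
 assumes w: "1 \<le> w"
 shows "\<bar>integral {0..1} (\<lambda>y. y powr (1/2) * exp (- (w * y))) - sqrt pi / 2 * w powr (- 3 / 2)\<bar> \<le> Gamma (5 / 2) * w powr (- 5 / 2)"
proof -
 have w0: "0 < w" using w by simp
 define f where "f u = u powr (1/2) * exp (- u)" for u :: real
 define g where "g u = u powr (3/2) * exp (- u)" for u :: real
 have f: "(f has_integral Gamma (3/2)) {0..}" unfolding f_def using Gamma_integrable[of "3/2"] by simp
 have g: "(g has_integral Gamma (5/2)) {0..}" unfolding g_def using Gamma_integrable[of "5/2"] by simp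
 have G: "Gamma (3 / 2) = sqrt pi / 2"
 proof -
  have "Gamma ((1/2) + 1) = (1/2) * Gamma (1/2 :: real)" by (rule Gamma_plus1) auto
  then show ?thesis by (simp add: Gamma_one_half_real)
 qed
 have fw: "f integrable_on {0..w}" unfolding f_def using integral_power_exp_scaled(2)[of w "3/2"] w0 by simp
 have f0: "(f has_integral integral {0..w} f) {0..w}" using fw by (simp add: integrable_integral)
 then have f1: "((\<lambda>u. if u \<in> {0..w} then f u else 0) has_integral integral {0..w} f) {0..}"
  by (subst has_integral_restrict) auto
 have up: "Gamma (3/2) \<le> integral {0..w} f + Gamma (5/2) * (1 / w)"
 proof (rule has_integral_le[OF f has_integral_add[OF f1 has_integral_mult_left[OF g]]])
  fix u :: real assume u: "u \<in> {0..}"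
  show "f u \<le> (if u \<in> {0..w} then f u else 0) + g u * (1 / w)"
  proof (cases "u \<le> w")
   case True then show ?thesis using u w0 by (simp add: g_def)
  next
   case False
   have "u powr (3/2) = u powr (1 + 1/2)" by simp
   also have "\<dots> = u * u powr (1/2)" unfolding powr_add using False w0 by simp
   finally have "g u * (1 / w) = (u / w) * f u" by (simp add: f_def g_def)
   moreover have "1 * f u \<le> (u / w) * f u" using False w0 by (intro mult_right_mono) (auto simp: f_def)
   ultimately show ?thesis using False w0 by simp
  qed
 qed
 have low: "integral {0..w} f \<le> Gamma (3/2)"
  by (rule has_integral_subset_le[OF _ f0 f]) (auto simp: f_def)
 have "w powr (- 5 / 2) = w powr (- 3 / 2 - 1)" by simp
 also have "\<dots> = w powr (- 3 / 2) / w" unfolding powr_diff using w0 by simp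
 finally have w5: "w powr (- 5 / 2) = w powr (- 3 / 2) / w" .
 have "integral {0..1} (\<lambda>y. y powr (1/2) * exp (- (w * y))) = w powr (- 3 / 2) * integral {0..w} f"
  unfolding f_def using integral_power_exp_scaled(1)[of w "3/2"] w0 by simp
 then have "integral {0..1} (\<lambda>y. y powr (1/2) * exp (- (w * y))) - sqrt pi / 2 * w powr (- 3 / 2)
   = w powr (- 3 / 2) * (integral {0..w} f - Gamma (3/2))"
  unfolding G by (simp add: algebra_simps)
 moreover have "\<bar>integral {0..w} f - Gamma (3/2)\<bar> \<le> Gamma (5/2) * (1 / w)" using up low by linarith
 then have "w powr (- 3 / 2) * \<bar>integral {0..w} f - Gamma (3/2)\<bar> \<le> w powr (- 3 / 2) * (Gamma (5/2) * (1 / w))"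
  by (rule mult_left_mono) simp
 ultimately show ?thesis unfolding w5 by (simp add: abs_mult mult.commute)
qed

lemma csqrt_imaginary:
 assumes "0 \<le> y"
 shows "csqrt (Complex 0 y) = of_real (sqrt y) * cis (pi / 4)" "csqrt (Complex 0 (- y)) = of_real (sqrt y) * cis (- (pi / 4))"
proof -
 have e: "(of_real (sqrt y) * cis (pi / 4))\<^sup>2 = Complex 0 y" "(of_real (sqrt y) * cis (- (pi / 4)))\<^sup>2 = Complex 0 (- y)"
  using assms unfolding power_mult_distrib Complex.DeMoivre of_real_power[symmetric]
  by (simp_all add: complex_eq_iff)
 have c: "0 < Re (of_real (sqrt y) * cis (pi / 4)) \<or> Re (of_real (sqrt y) * cis (pi / 4)) = 0 \<and> 0 \<le> Im (of_real (sqrt y) * cis (pi / 4))"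
  "0 < Re (of_real (sqrt y) * cis (- (pi / 4))) \<or> Re (of_real (sqrt y) * cis (- (pi / 4))) = 0 \<and> 0 \<le> Im (of_real (sqrt y) * cis (- (pi / 4)))"
  using assms by (cases "y = 0"; simp add: cos_45)+
 show "csqrt (Complex 0 y) = of_real (sqrt y) * cis (pi / 4)" by (rule csqrt_unique[OF e(1) c(1)])
 show "csqrt (Complex 0 (- y)) = of_real (sqrt y) * cis (- (pi / 4))" by (rule csqrt_unique[OF e(2) c(2)])
qed

lemma csqrt_near_2: "norm (csqrt (Complex 2 y) - of_real (sqrt 2)) \<le> \<bar>y\<bar>"
proof -
 define a where "a = csqrt (Complex 2 y)"
 have "(a - of_real (sqrt 2)) * (a + of_real (sqrt 2)) = a\<^sup>2 - (of_real (sqrt 2))\<^sup>2"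
  by (simp add: power2_eq_square algebra_simps)
 also have "\<dots> = Complex 0 y" unfolding a_def by (simp add: of_real_power[symmetric] complex_eq_iff del: of_real_power)
 finally have "norm (a - of_real (sqrt 2)) * norm (a + of_real (sqrt 2)) = \<bar>y\<bar>"
  unfolding norm_mult[symmetric] by (simp add: cmod_def)
 moreover have "1 \<le> norm (a + of_real (sqrt 2))"
 proof -
  have "1 \<le> sqrt 2" by simp
  also have "\<dots> \<le> Re (a + of_real (sqrt 2))" using Re_csqrt[of "Complex 2 y"] unfolding a_def by (simp del: csqrt.simps)
  also have "\<dots> \<le> norm (a + of_real (sqrt 2))" by (rule complex_Re_le_cmod)
  finally show ?thesis .
 qed
 then have "norm (a - of_real (sqrt 2)) * 1 \<le> norm (a - of_real (sqrt 2)) * norm (a + of_real (sqrt 2))"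
  by (intro mult_left_mono) auto
 ultimately show ?thesis unfolding a_def by simp
qed

text \<open>Shift the path of integration from \<open>[-1, 1]\<close> to the other three sides of the rectangle with
 corners \<open>-1\<close> and \<open>1 + \<i>\<close>: the vertical sides give Laplace integrals.\<close>

lemma half_disc_cos_integral:
 "\<exists>C. \<forall>w\<ge>1. \<bar>integral {-1..1} (\<lambda>x. sqrt (1 - x\<^sup>2) * cos (w * x)) - sqrt (2 * pi) * w powr (- 3 / 2) * cos (w - 3 * pi / 4)\<bar>
  \<le> C * w powr (- 5 / 2)"
\<comment> \<open>The three terms of the constant come from the two vertical sides, from the top
  side (6 exp(- w) with exp(- w) <= 6 w^(-5/2)), and from the error in the Laplace integral A
  multiplied by 2 sqrt 2.\<close>
proof (intro exI[of _ "2 * Gamma (5/2) + 36 + 2 * sqrt 2 * Gamma (5/2)"] allI impI)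
 fix w :: real assume w: "1 \<le> w"
 define F where "F z = csqrt (1 - z) * csqrt (1 + z) * exp (\<i> * of_real w * z)" for z
 define S where "S = cbox (-1) (1 + \<i>)"
 have S: "z \<in> S \<longleftrightarrow> -1 \<le> Re z \<and> Re z \<le> 1 \<and> 0 \<le> Im z \<and> Im z \<le> 1" for z
  by (auto simp: S_def in_cbox_complex_iff)
 have contF: "continuous_on S F" unfolding F_def
  by (intro continuous_intros continuous_on_compose2[OF continuous_csqrt_right_half_plane]) (auto simp: S)
 have cs: "continuous_on (closed_segment a b) F" if "a \<in> S" "b \<in> S" for a b
  by (rule continuous_on_subset[OF contF]) (use that in \<open>simp add: closed_segment_subset S_def\<close>)
 have hol: "F holomorphic_on box (-1) (1 + \<i>)" unfolding F_def
  by (intro holomorphic_intros holomorphic_on_csqrt') (auto simp: in_box_complex_iff complex_nonpos_Reals_iff)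
 have zero: "(F has_contour_integral 0) (rectpath (-1) (1 + \<i>))"
 proof (rule Cauchy_theorem_convex[OF contF _ finite.emptyI])
  show "convex S" by (simp add: S_def)
  show "F field_differentiable at x" if "x \<in> interior S - {}" for x
   using that hol by (auto simp: S_def interior_cbox intro: holomorphic_on_imp_differentiable_at)
  show "path_image (rectpath (-1) (1 + \<i>)) \<subseteq> S" unfolding S_def by (rule path_image_rectpath_subset_cbox) auto
 qed auto
 have corners: "Complex (Re (1 + \<i>)) (Im (-1)) = 1" "Complex (Re (-1)) (Im (1 + \<i>)) = -1 + \<i>"
  by (auto simp: complex_eq_iff)
 have inS: "-1 \<in> S" "1 \<in> S" "1 + \<i> \<in> S" "-1 + \<i> \<in> S" by (auto simp: S)
 define bot where "bot = contour_integral (linepath (-1) 1) F"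
 define rig where "rig = contour_integral (linepath 1 (1 + \<i>)) F"
 define tp where "tp = contour_integral (linepath (1 + \<i>) (-1 + \<i>)) F"
 define lef where "lef = contour_integral (linepath (-1 + \<i>) (-1)) F"
 have ci: "F contour_integrable_on linepath a b" if "a \<in> S" "b \<in> S" for a b
  by (rule contour_integrable_continuous_linepath[OF cs[OF that]])
 have "contour_integral (rectpath (-1) (1 + \<i>)) F = bot + (rig + (tp + lef))"
  unfolding rectpath_def Let_def corners bot_def rig_def tp_def lef_def using inS ci
  by (subst contour_integral_join; (intro valid_path_join contour_integrable_joinI)?; simp)+
 moreover have "contour_integral (rectpath (-1) (1 + \<i>)) F = 0" by (rule contour_integral_unique[OF zero])
 ultimately have "bot + (rig + (tp + lef)) = 0" by simp
 then have "bot = - (rig + (tp + lef))" by (simp only: eq_neg_iff_add_eq_0)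
 then have sum0: "bot = - rig - lef - tp" by simp
 have bot: "Re bot = integral {-1..1} (\<lambda>x. sqrt (1 - x\<^sup>2) * cos (w * x))"
 proof -
  have "bot = integral {-1..1} (\<lambda>x. F (of_real x))" unfolding bot_def
   by (subst contour_integral_linepath_Reals_eq) auto
  moreover have int: "(\<lambda>x. F (of_real x)) integrable_on {-1..1}"
   by (intro integrable_continuous_interval continuous_on_compose2[OF contF] continuous_intros) (auto simp: S)
  ultimately have "Re bot = integral {-1..1} (\<lambda>x. Re (F (of_real x)))"
   using has_integral_Re[OF integrable_integral[OF int]] by (simp add: integral_unique)
  also have "\<dots> = integral {-1..1} (\<lambda>x. sqrt (1 - x\<^sup>2) * cos (w * x))"
  proof (rule integral_cong)
   fix x :: real assume x: "x \<in> {-1..1}"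
   have "csqrt (1 - of_real x) = of_real (sqrt (1 - x))" "csqrt (1 + of_real x) = of_real (sqrt (1 + x))"
    using x of_real_sqrt[of "1 - x"] of_real_sqrt[of "1 + x"] by simp_all
   then have "F (of_real x) = of_real (sqrt (1 - x) * sqrt (1 + x)) * exp (\<i> * of_real (w * x))"
    by (simp add: F_def mult.assoc)
   also have "sqrt (1 - x) * sqrt (1 + x) = sqrt (1 - x\<^sup>2)"
    unfolding real_sqrt_mult[symmetric] by (simp add: power2_eq_square algebra_simps)
   finally show "Re (F (of_real x)) = sqrt (1 - x\<^sup>2) * cos (w * x)"
    unfolding cis_conv_exp[symmetric] by simp
  qed
  finally show ?thesis .
 qed
 define A where "A = integral {0..1} (\<lambda>y. y powr (1/2) * exp (- (w * y)))"
 let ?g = "\<lambda>y. y powr (1/2) * exp (- (w * y))"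
 define E where "E = integral {0..1} (\<lambda>y. y powr (3/2) * exp (- (w * y)))"
 have contA: "continuous_on {0..1} (\<lambda>y. y powr a * exp (- (w * y)))" if "0 < a" for a
  using that by (auto intro!: continuous_intros continuous_on_powr')
 \<comment> \<open>Near a corner one root vanishes like sqrt y and gives the Laplace weight, while
   the other stays within y of sqrt 2. Freezing it there leaves the integral A, and the error
   carries an extra factor y, hence one more power of 1 / w.\<close>
 have side: "norm (integral {0..1} G - of_real A * (of_real (sqrt 2) * k)) \<le> E"
  if G: "\<And>y. y \<in> {0..1} \<Longrightarrow> G y = of_real (?g y) * (h y * k)"
   and h: "\<And>y. y \<in> {0..1} \<Longrightarrow> norm (h y - of_real (sqrt 2)) \<le> y" and k: "norm k = 1"
   and int: "G integrable_on {0..1}" for G h :: "real \<Rightarrow> complex" and k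
 proof -
  have iA: "(\<lambda>y. complex_of_real (?g y) * (of_real (sqrt 2) * k)) integrable_on {0..1}"
   by (intro integrable_continuous_interval continuous_intros contA) auto
  have "((\<lambda>y. complex_of_real (?g y)) has_integral of_real A) {0..1}"
   unfolding A_def by (intro has_integral_of_real integrable_integral integrable_continuous_interval contA) auto
  from has_integral_mult_left[OF this, of "of_real (sqrt 2) * k"]
  have "of_real A * (of_real (sqrt 2) * k) = integral {0..1} (\<lambda>y. complex_of_real (?g y) * (of_real (sqrt 2) * k))"
   by (rule integral_unique[symmetric])
  then have "integral {0..1} G - of_real A * (of_real (sqrt 2) * k) =
    integral {0..1} (\<lambda>y. G y - complex_of_real (?g y) * (of_real (sqrt 2) * k))"
   using Henstock_Kurzweil_Integration.integral_diff[OF int iA] by simp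
  also have "norm \<dots> \<le> E" unfolding E_def
  proof (rule integral_norm_bound_integral)
   show "(\<lambda>y. G y - complex_of_real (?g y) * (of_real (sqrt 2) * k)) integrable_on {0..1}"
    by (rule integrable_diff[OF int iA])
   show "(\<lambda>y. y powr (3/2) * exp (- (w * y))) integrable_on {0..1}"
    by (intro integrable_continuous_interval contA) auto
   fix y :: real assume y: "y \<in> {0..1}"
   have "G y - complex_of_real (?g y) * (of_real (sqrt 2) * k) =
    of_real (?g y) * ((h y - of_real (sqrt 2)) * k)"
    unfolding G[OF y] by (simp add: algebra_simps)
   then have "norm (G y - complex_of_real (?g y) * (of_real (sqrt 2) * k)) =
     ?g y * norm (h y - of_real (sqrt 2))"
    by (simp only: norm_mult k norm_of_real) simp
   also have "\<dots> \<le> ?g y * y" using h[OF y] by (intro mult_left_mono) auto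
   also have "\<dots> = y powr (3/2) * exp (- (w * y))"
   proof -
    have "y powr (3/2) = y powr (1/2 + 1)" by simp
    also have "\<dots> = y powr (1/2) * y" unfolding powr_add using y by simp
    finally show ?thesis by simp
   qed
   finally show "norm (G y - complex_of_real (?g y) * (of_real (sqrt 2) * k)) \<le> y powr (3/2) * exp (- (w * y))" .
  qed
  finally show ?thesis .
 qed
 have intv: "(\<lambda>y. F (Complex a y)) integrable_on {0..1}" if "a \<in> {-1, 1}" for a
  by (intro integrable_continuous_interval continuous_on_compose2[OF contF])
   (use that in \<open>auto simp: S Complex_eq intro!: continuous_intros\<close>)
 have ex: "exp (\<i> * of_real w * Complex a y) = of_real (exp (- (w * y))) * cis (w * a)" for a y
 proof -
  have "\<i> * of_real w * Complex a y = of_real (- (w * y)) + \<i> * of_real (w * a)" by (simp add: complex_eq_iff)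
  then show ?thesis by (simp only: exp_add exp_of_real cis_conv_exp)
 qed
 have R: "norm (integral {0..1} (\<lambda>y. F (Complex 1 y)) - of_real A * (of_real (sqrt 2) * cis (w - pi / 4))) \<le> E"
 proof (rule side[where h = "\<lambda>y. csqrt (Complex 2 y)"])
  fix y :: real assume y: "y \<in> {0..1}"
  have "1 - Complex 1 y = Complex 0 (- y)" "1 + Complex 1 y = Complex 2 y" by (auto simp: complex_eq_iff)
  then have "F (Complex 1 y) = of_real (sqrt y) * cis (- (pi / 4)) * csqrt (Complex 2 y) * (of_real (exp (- (w * y))) * cis (w * 1))"
   unfolding F_def ex using csqrt_imaginary(2)[of y] y by simp
  also have "\<dots> = of_real (sqrt y * exp (- (w * y))) * (csqrt (Complex 2 y) * (cis (- (pi / 4)) * cis (w * 1)))"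
   by (simp only: of_real_mult mult_ac)
  also have "cis (- (pi / 4)) * cis (w * 1) = cis (w - pi / 4)" by (simp add: cis_mult)
  finally show "F (Complex 1 y) = of_real (?g y) * (csqrt (Complex 2 y) * cis (w - pi / 4))"
   using y by (simp add: powr_half_sqrt)
  show "norm (csqrt (Complex 2 y) - of_real (sqrt 2)) \<le> y" using csqrt_near_2[of y] y by simp
 qed (use intv in auto)
 have Lf: "norm (integral {0..1} (\<lambda>y. F (Complex (-1) y)) - of_real A * (of_real (sqrt 2) * cis (- (w - pi / 4)))) \<le> E"
 proof (rule side[where h = "\<lambda>y. csqrt (Complex 2 (- y))"])
  fix y :: real assume y: "y \<in> {0..1}"
  have "1 - Complex (-1) y = Complex 2 (- y)" "1 + Complex (-1) y = Complex 0 y" by (auto simp: complex_eq_iff)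
  then have "F (Complex (-1) y) = csqrt (Complex 2 (- y)) * (of_real (sqrt y) * cis (pi / 4)) * (of_real (exp (- (w * y))) * cis (w * (-1)))"
   unfolding F_def ex using csqrt_imaginary(1)[of y] y by simp
  also have "\<dots> = of_real (sqrt y * exp (- (w * y))) * (csqrt (Complex 2 (- y)) * (cis (pi / 4) * cis (w * (-1))))"
   by (simp only: of_real_mult mult_ac)
  also have "cis (pi / 4) * cis (w * (-1)) = cis (- (w - pi / 4))" by (simp add: cis_mult)
  finally show "F (Complex (-1) y) = of_real (?g y) * (csqrt (Complex 2 (- y)) * cis (- (w - pi / 4)))"
   using y by (simp add: powr_half_sqrt)
  show "norm (csqrt (Complex 2 (- y)) - of_real (sqrt 2)) \<le> y" using csqrt_near_2[of "- y"] y by simp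
 qed (use intv in auto)
 have rig: "rig = \<i> * integral {0..1} (\<lambda>y. F (Complex 1 y))"
  unfolding rig_def by (rule contour_integral_linepath_same_Re) auto
 have lef: "lef = - (\<i> * integral {0..1} (\<lambda>y. F (Complex (-1) y)))"
 proof -
  have "lef = - contour_integral (linepath (-1) (-1 + \<i>)) F"
   unfolding lef_def by (rule contour_integral_reverse_linepath[OF cs[OF inS(4) inS(1)]])
  also have "contour_integral (linepath (-1) (-1 + \<i>)) F = \<i> * integral {0..1} (\<lambda>y. F (Complex (-1) y))"
   by (rule contour_integral_linepath_same_Re) auto
  finally show ?thesis .
 qed
 \<comment> \<open>On the top side the exponential has modulus exp(- w), so a crude bound on the
   roots is enough.\<close>
 have tp: "norm tp \<le> 6 * exp (- w)"
 proof -
  have "norm tp \<le> (3 * exp (- w)) * norm ((-1 + \<i>) - (1 + \<i>))" unfolding tp_def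
  proof (rule contour_integral_bound_linepath[OF ci[OF inS(3) inS(4)]])
   fix z assume z: "z \<in> closed_segment (1 + \<i>) (-1 + \<i>)"
   then have Im: "Im z = 1" by (auto simp: closed_segment_def)
   have zS: "z \<in> S" using z inS closed_segment_subset[of "1 + \<i>" S "-1 + \<i>"] by (auto simp: S_def)
   have zn: "norm z \<le> 2" using cmod_le[of z] zS Im by (auto simp: S abs_le_iff)
   have "norm (1 - z) \<le> 3" "norm (1 + z) \<le> 3"
    using norm_triangle_ineq4[of 1 z] norm_triangle_ineq[of 1 z] zn by auto
   then have "sqrt (norm (1 - z)) * sqrt (norm (1 + z)) \<le> sqrt 3 * sqrt 3" by (intro mult_mono real_sqrt_le_mono) auto
   then have "sqrt (norm (1 - z)) * sqrt (norm (1 + z)) * exp (- w) \<le> 3 * exp (- w)" by (intro mult_right_mono) auto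
   moreover have "norm (exp (\<i> * of_real w * z)) = exp (- w)" using Im by (simp add: norm_exp_eq_Re)
   ultimately show "norm (F z) \<le> 3 * exp (- w)" by (simp only: F_def norm_mult norm_csqrt)
  qed auto
  also have "norm ((-1 + \<i>) - (1 + \<i>) :: complex) = 2" by simp
  finally show ?thesis by simp
 qed
 define th where "th = w - pi / 4"
 define u1 where "u1 = integral {0..1} (\<lambda>y. F (Complex 1 y)) - of_real A * (of_real (sqrt 2) * cis th)"
 define u2 where "u2 = integral {0..1} (\<lambda>y. F (Complex (-1) y)) - of_real A * (of_real (sqrt 2) * cis (- th))"
 \<comment> \<open>The sides contribute - i cis th and + i cis (- th), which add up to 2 sin
   th.\<close>
 have "bot = of_real (2 * sqrt 2 * A * sin th) - \<i> * u1 + \<i> * u2 - tp"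
  unfolding sum0 rig lef u1_def u2_def by (simp add: complex_eq_iff algebra_simps)
 then have "Re bot - 2 * sqrt 2 * A * sin th = Re (- \<i> * u1 + \<i> * u2 - tp)" by simp
 also have "\<bar>\<dots>\<bar> \<le> norm (- \<i> * u1 + \<i> * u2 - tp)" by (rule abs_Re_le_cmod)
 also have "\<dots> \<le> norm (- \<i> * u1 + \<i> * u2) + norm tp" by (rule norm_triangle_ineq4)
 also have "\<dots> \<le> norm (- \<i> * u1) + norm (\<i> * u2) + norm tp" using norm_triangle_ineq by (intro add_right_mono)
 also have "\<dots> \<le> 2 * E + 6 * exp (- w)" using R Lf tp by (simp add: norm_mult u1_def u2_def th_def)
 finally have b1: "\<bar>Re bot - 2 * sqrt 2 * A * sin th\<bar> \<le> 2 * E + 6 * exp (- w)" .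
 have E: "E \<le> Gamma (5/2) * w powr (- 5 / 2)" unfolding E_def using integral_power_exp_le[of w "5/2"] w by simp
 have expw: "exp (- w) \<le> 6 * w powr (- 5 / 2)"
 proof -
  have "w ^ 3 / fact 3 \<le> exp w" using w by (intro power_le_exp) auto
  then have "w ^ 3 \<le> 6 * exp w" by (simp add: fact_numeral)
  moreover have "w powr (5 / 2) \<le> w ^ 3" using powr_mono[of "5/2" 3 w] w by (simp add: powr_numeral)
  ultimately have "w powr (5 / 2) \<le> 6 * exp w" by linarith
  then have "1 \<le> 6 * exp w / w powr (5 / 2)" using w by (simp add: le_divide_eq)
  then have "exp (- w) * 1 \<le> exp (- w) * (6 * exp w / w powr (5 / 2))" by (intro mult_left_mono) auto
  also have "\<dots> = 6 * (exp (- w) * exp w) / w powr (5 / 2)" by simp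
  also have "exp (- w) * exp w = 1" by (simp add: exp_minus)
  finally show ?thesis using powr_minus_divide[of w "5/2"] by simp
 qed
 have A: "\<bar>A - sqrt pi / 2 * w powr (- 3 / 2)\<bar> \<le> Gamma (5 / 2) * w powr (- 5 / 2)"
  unfolding A_def using integral_sqrt_exp[OF w] .
 have sn: "sin th = cos (w - 3 * pi / 4)"
 proof -
  have "sin th = cos (pi / 2 - th)" by (simp add: cos_sin_eq)
  also have "pi / 2 - th = - (w - 3 * pi / 4)" by (simp add: th_def field_simps)
  finally show ?thesis by (simp only: cos_minus)
 qed
 have "2 * sqrt 2 * A * sin th - sqrt (2 * pi) * w powr (- 3 / 2) * cos (w - 3 * pi / 4)
  = (2 * sqrt 2 * sin th) * (A - sqrt pi / 2 * w powr (- 3 / 2))"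
  unfolding sn by (simp add: real_sqrt_mult algebra_simps)
 also have "\<bar>\<dots>\<bar> \<le> (2 * sqrt 2) * (Gamma (5 / 2) * w powr (- 5 / 2))"
 proof -
  have "\<bar>2 * sqrt 2 * sin th\<bar> \<le> 2 * sqrt 2" by (simp add: abs_mult)
  then show ?thesis unfolding abs_mult[of "2 * sqrt 2 * sin th"] using A by (intro mult_mono) auto
 qed
 finally have b2: "\<bar>2 * sqrt 2 * A * sin th - sqrt (2 * pi) * w powr (- 3 / 2) * cos (w - 3 * pi / 4)\<bar> \<le> 2 * sqrt 2 * (Gamma (5 / 2) * w powr (- 5 / 2))" .
 have "(2 * Gamma (5/2) + 36 + 2 * sqrt 2 * Gamma (5/2)) * w powr (- 5 / 2) =
  2 * (Gamma (5/2) * w powr (- 5 / 2)) + 36 * w powr (- 5 / 2) + 2 * sqrt 2 * (Gamma (5 / 2) * w powr (- 5 / 2))"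
  by (simp add: algebra_simps)
 then show "\<bar>integral {-1..1} (\<lambda>x. sqrt (1 - x\<^sup>2) * cos (w * x)) - sqrt (2 * pi) * w powr (- 3 / 2) * cos (w - 3 * pi / 4)\<bar>
  \<le> (2 * Gamma (5/2) + 36 + 2 * sqrt 2 * Gamma (5/2)) * w powr (- 5 / 2)"
  using b1 b2 E expw unfolding bot by linarith
qed

section \<open>Invariance of plane Lebesgue measure under shears and rotations\<close>

lemma distr_shear_fst: "distr lborel borel (\<lambda>p::real \<times> real. (fst p + a * snd p, snd p)) = lborel"
proof (rule measure_eqI)
 let ?f = "\<lambda>p::real \<times> real. (fst p + a * snd p, snd p)"
 fix A :: "(real \<times> real) set" assume "A \<in> sets (distr lborel borel ?f)"
 then have A[measurable]: "A \<in> sets borel" by simp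
 have f[measurable]: "?f \<in> borel \<rightarrow>\<^sub>M borel"
  by (intro borel_measurable_continuous_onI continuous_intros)
 define G where "G p = (indicator A p :: ennreal)" for p
 define F where "F p = G (fst p + a * snd p, snd p)" for p
 have G: "G \<in> borel_measurable borel" unfolding G_def by simp
 have F: "F \<in> borel_measurable (lborel \<Otimes>\<^sub>M lborel)"
  unfolding lborel_prod F_def using measurable_compose[OF f G] by simp
 have "emeasure (distr lborel borel ?f) A
  = (\<integral>\<^sup>+p. G p \<partial>distr lborel borel ?f)"
  unfolding G_def by simp
 also have "\<dots> = (\<integral>\<^sup>+p. F p \<partial>(lborel \<Otimes>\<^sub>M lborel))"
  unfolding lborel_prod F_def using f G by (intro nn_integral_distr) simp_all
 also have "\<dots> = (\<integral>\<^sup>+y. \<integral>\<^sup>+x. F (x, y) \<partial>lborel \<partial>lborel)"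
  by (rule lborel_pair.nn_integral_snd[OF F, symmetric])
 also have "\<dots> = (\<integral>\<^sup>+y. \<integral>\<^sup>+x. G (x, y) \<partial>lborel \<partial>lborel)"
 proof (rule nn_integral_cong)
  fix y :: real
  have "(\<lambda>x. (x, y)) \<in> borel \<rightarrow>\<^sub>M (borel :: (real \<times> real) measure)"
   by (intro borel_measurable_continuous_onI continuous_intros)
  from nn_integral_real_affine[OF measurable_compose[OF this G], of 1 "a * y"]
  show "(\<integral>\<^sup>+x. F (x, y) \<partial>lborel) = (\<integral>\<^sup>+x. G (x, y) \<partial>lborel)"
   unfolding F_def by (simp add: add.commute)
 qed
 also have "\<dots> = (\<integral>\<^sup>+p. G p \<partial>(lborel \<Otimes>\<^sub>M lborel))"
  by (rule lborel_pair.nn_integral_snd) (simp add: lborel_prod G)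
 also have "\<dots> = emeasure lborel A" unfolding lborel_prod G_def by simp
 finally show "emeasure (distr lborel borel ?f) A = emeasure lborel A" .
qed simp

lemma integral_shear_fst:
 fixes f :: "real \<times> real \<Rightarrow> real"
 assumes [measurable]: "f \<in> borel_measurable borel"
 shows "(\<integral>p. f (fst p + a * snd p, snd p) \<partial>lborel) = (\<integral>p. f p \<partial>lborel)"
proof -
 have "(\<lambda>p::real \<times> real. (fst p + a * snd p, snd p)) \<in> borel \<rightarrow>\<^sub>M borel"
  by (intro borel_measurable_continuous_onI continuous_intros)
 then have "(\<integral>p. f (fst p + a * snd p, snd p) \<partial>lborel) = (\<integral>p. f p \<partial>distr lborel borel (\<lambda>p::real \<times> real. (fst p + a * snd p, snd p)))"
  by (subst integral_distr) auto
 then show ?thesis unfolding distr_shear_fst .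
qed

lemma integral_swap_plane:
 fixes f :: "real \<times> real \<Rightarrow> real"
 assumes "f \<in> borel_measurable borel"
 shows "(\<integral>p. f (snd p, fst p) \<partial>lborel) = (\<integral>p. f p \<partial>lborel)"
proof -
 have "f \<in> borel_measurable (lborel \<Otimes>\<^sub>M lborel)" unfolding lborel_prod using assms by simp
 from lborel_pair.integral_product_swap[OF this] show ?thesis
  unfolding lborel_prod case_prod_unfold by simp
qed

lemma integral_shear_snd:
 fixes f :: "real \<times> real \<Rightarrow> real"
 assumes f: "f \<in> borel_measurable borel"
 shows "(\<integral>p. f (fst p, snd p + a * fst p) \<partial>lborel) = (\<integral>p. f p \<partial>lborel)"
proof -
 have sw: "(\<lambda>p::real \<times> real. (snd p, fst p)) \<in> borel \<rightarrow>\<^sub>M borel"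
  by (intro borel_measurable_continuous_onI continuous_intros)
 have sh: "(\<lambda>p::real \<times> real. (snd p, fst p + a * snd p)) \<in> borel \<rightarrow>\<^sub>M borel"
  by (intro borel_measurable_continuous_onI continuous_intros)
 have "(\<integral>p. f (fst p, snd p + a * fst p) \<partial>lborel) = (\<integral>p. f (snd p, fst p + a * snd p) \<partial>lborel)"
  using integral_swap_plane[OF measurable_compose[OF sh f]] by simp
 also have "\<dots> = (\<integral>p. f (snd p, fst p) \<partial>lborel)"
  using integral_shear_fst[OF measurable_compose[OF sw f]] by simp
 also have "\<dots> = (\<integral>p. f p \<partial>lborel)" by (rule integral_swap_plane[OF f])
 finally show ?thesis .
qed

text \<open>A rotation is a product of three shears.\<close>

lemma integral_rotation:
 fixes f :: "real \<times> real \<Rightarrow> real"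
 assumes f: "f \<in> borel_measurable borel" and cs: "c\<^sup>2 + s\<^sup>2 = 1" "s \<noteq> 0"
 shows "(\<integral>p. f (c * fst p - s * snd p, s * fst p + c * snd p) \<partial>lborel) = (\<integral>p. f p \<partial>lborel)"
proof -
 \<comment> \<open>The shear parameter is - tan(\<theta> / 2) for c = cos \<theta> and s = sin
   \<theta>; the rotation is the shear by b, then by s in the other coordinate, then by b
   again.\<close>
 define b where "b = (c - 1) / s"
 have b1: "1 + b * s = c" using cs by (simp add: b_def)
 have b2: "b * (c + 1) = - s"
 proof -
  have "b * (c + 1) = (c\<^sup>2 - 1) / s" by (simp add: b_def power2_eq_square algebra_simps)
  also have "c\<^sup>2 - 1 = - s * s" using cs by (simp add: power2_eq_square)
  finally show ?thesis using cs by simp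
 qed
 define f1 where "f1 p = f (fst p + b * snd p, snd p)" for p
 define f2 where "f2 p = f1 (fst p, snd p + s * fst p)" for p
 have sh: "(\<lambda>p::real \<times> real. (fst p + b * snd p, snd p)) \<in> borel \<rightarrow>\<^sub>M borel"
  "(\<lambda>p::real \<times> real. (fst p, snd p + s * fst p)) \<in> borel \<rightarrow>\<^sub>M borel"
  by (intro borel_measurable_continuous_onI continuous_intros)+
 have f1: "f1 \<in> borel_measurable borel" unfolding f1_def by (rule measurable_compose[OF sh(1) f])
 have f2: "f2 \<in> borel_measurable borel" unfolding f2_def by (rule measurable_compose[OF sh(2) f1])
 have "f (c * fst p - s * snd p, s * fst p + c * snd p) = f2 (fst p + b * snd p, snd p)" for p
 proof -
  have "s * fst p + c * snd p = snd p + s * (fst p + b * snd p)"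
  proof -
   have "snd p + s * (fst p + b * snd p) = s * fst p + (1 + b * s) * snd p" by (simp add: algebra_simps)
   then show ?thesis unfolding b1 by simp
  qed
  moreover have "c * fst p - s * snd p = (fst p + b * snd p) + b * (snd p + s * (fst p + b * snd p))"
  proof -
   have "(fst p + b * snd p) + b * (snd p + s * (fst p + b * snd p)) = (1 + b * s) * fst p + (b * ((1 + b * s) + 1)) * snd p"
    by (simp add: algebra_simps)
   then show ?thesis unfolding b1 b2 by simp
  qed
  ultimately show ?thesis unfolding f2_def f1_def by simp
 qed
 then have "(\<integral>p. f (c * fst p - s * snd p, s * fst p + c * snd p) \<partial>lborel) = (\<integral>p. f2 (fst p + b * snd p, snd p) \<partial>lborel)" by simp
 also have "\<dots> = (\<integral>p. f2 p \<partial>lborel)" by (rule integral_shear_fst[OF f2])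
 also have "\<dots> = (\<integral>p. f1 p \<partial>lborel)" unfolding f2_def by (rule integral_shear_snd[OF f1])
 also have "\<dots> = (\<integral>p. f p \<partial>lborel)" unfolding f1_def by (rule integral_shear_fst[OF f])
 finally show ?thesis .
qed

section \<open>The transform of the indicator of a disc\<close>

definition disc_ft :: "real \<Rightarrow> real \<Rightarrow> real \<Rightarrow> real" where
 "disc_ft a b t = (\<integral>p. indicator (cball 0 t) p * cos (2 * pi * (a * fst p + b * snd p)) \<partial>lborel)"

text \<open>Rotate (a, b) onto the first axis. The decomposition of a rotation into shears divides
  by its sine, so b = 0 is treated separately; there only the sign of a can change, and cosine is
  even.\<close>

lemma disc_ft_radial: "disc_ft a b t = disc_ft (sqrt (a\<^sup>2 + b\<^sup>2)) 0 t"
proof (cases "b = 0")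
 case True
 have "cos (2 * pi * (\<bar>a\<bar> * x)) = cos (2 * pi * (a * x))" for x by (cases "0 \<le> a") auto
 then show ?thesis using True by (simp add: disc_ft_def)
next
 case False
 define r where "r = sqrt (a\<^sup>2 + b\<^sup>2)"
 have r2: "r * r = a\<^sup>2 + b\<^sup>2" by (simp add: r_def)
 have r0: "0 < r" using False by (simp add: r_def sum_power2_gt_zero_iff)
 define c s where "c = a / r" and "s = b / r"
 have "c\<^sup>2 + s\<^sup>2 = (a\<^sup>2 + b\<^sup>2) / (r * r)"
  by (simp add: c_def s_def power_divide add_divide_distrib power2_eq_square[of r])
 then have cs: "c\<^sup>2 + s\<^sup>2 = 1" unfolding r2[symmetric] using r0 by simp
 have s0: "s \<noteq> 0" using False r0 by (simp add: s_def)
 define f where "f p = indicator (cball 0 t) p * cos (2 * pi * (a * fst p + b * snd p))" for p :: "real \<times> real"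
 have f: "f \<in> borel_measurable borel" unfolding f_def
  by (intro borel_measurable_times borel_measurable_indicator borel_measurable_continuous_onI continuous_intros) auto
 have "f (c * fst p - s * snd p, s * fst p + c * snd p) = indicator (cball 0 t) p * cos (2 * pi * (r * fst p + 0 * snd p))" for p
 proof -
  have "(c * fst p - s * snd p)\<^sup>2 + (s * fst p + c * snd p)\<^sup>2 = (c\<^sup>2 + s\<^sup>2) * ((fst p)\<^sup>2 + (snd p)\<^sup>2)"
   by (simp add: power2_eq_square algebra_simps)
  then have "norm (c * fst p - s * snd p, s * fst p + c * snd p) = norm p" unfolding cs by (simp add: norm_prod_def)
  moreover have "a * (c * fst p - s * snd p) + b * (s * fst p + c * snd p) = r * fst p"
  proof -
   have "a * (c * fst p - s * snd p) + b * (s * fst p + c * snd p) = (a * c + b * s) * fst p + (b * c - a * s) * snd p"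
    by (simp add: algebra_simps)
   moreover have "a * c + b * s = r"
   proof -
    have "a * c + b * s = (a\<^sup>2 + b\<^sup>2) / r" by (simp add: c_def s_def power2_eq_square add_divide_distrib)
    then show ?thesis unfolding r2[symmetric] using r0 by simp
   qed
   moreover have "b * c - a * s = 0" by (simp add: c_def s_def)
   ultimately show ?thesis by simp
  qed
  ultimately show ?thesis by (simp add: f_def indicator_def)
 qed
 then have "disc_ft r 0 t = (\<integral>p. f (c * fst p - s * snd p, s * fst p + c * snd p) \<partial>lborel)" by (simp add: disc_ft_def)
 also have "\<dots> = (\<integral>p. f p \<partial>lborel)" by (rule integral_rotation[OF f cs s0])
 finally show ?thesis by (simp add: disc_ft_def f_def r_def)
qed

lemma disc_ft_0: "0 \<le> t \<Longrightarrow> disc_ft 0 0 t = pi * t\<^sup>2"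
 using measure_cball_plane[of t] by (simp add: disc_ft_def)

lemma disc_ft_axis:
 assumes t: "0 < t"
 shows "disc_ft r 0 t = 2 * t\<^sup>2 * integral {-1..1} (\<lambda>u. sqrt (1 - u\<^sup>2) * cos (2 * pi * r * t * u))"
proof -
 define g where "g p = indicator (cball 0 t) p * cos (2 * pi * (r * fst p + 0 * snd p))" for p :: "real \<times> real"
 have geq: "g = (\<lambda>p. indicator (cball 0 t) p *\<^sub>R cos (2 * pi * (r * fst p + 0 * snd p)))"
  by (rule ext) (simp add: g_def)
 have int: "integrable (lborel \<Otimes>\<^sub>M lborel) g" unfolding lborel_prod geq
  by (intro borel_integrable_compact continuous_intros) auto
 define h where "h x = 2 * sqrt (t\<^sup>2 - x\<^sup>2) * cos (2 * pi * r * x)" for x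
 have inner: "(\<integral>y. g (x, y) \<partial>lborel) = indicator {-t..t} x *\<^sub>R h x" for x
 proof (cases "\<bar>x\<bar> \<le> t")
  case True
  define u where "u = sqrt (t\<^sup>2 - x\<^sup>2)"
  have u0: "0 \<le> t\<^sup>2 - x\<^sup>2" using True t abs_le_square_iff[of x t] by simp
  have "(x, y) \<in> cball 0 t \<longleftrightarrow> y \<in> {- u..u}" for y
  proof -
   have "(x, y) \<in> cball 0 t \<longleftrightarrow> sqrt (x\<^sup>2 + y\<^sup>2) \<le> sqrt (t\<^sup>2)" using t by (simp add: norm_Pair)
   also have "\<dots> \<longleftrightarrow> y\<^sup>2 \<le> u\<^sup>2" unfolding real_sqrt_le_iff using u0 by (simp add: u_def algebra_simps)
   also have "\<dots> \<longleftrightarrow> \<bar>y\<bar> \<le> \<bar>u\<bar>" by (rule abs_le_square_iff[symmetric])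
   also have "\<dots> \<longleftrightarrow> y \<in> {- u..u}" using u0 by (auto simp: u_def abs_le_iff)
   finally show ?thesis .
  qed
  then have "(\<integral>y. g (x, y) \<partial>lborel) = (\<integral>y. indicator {- u..u} y * cos (2 * pi * (r * x)) \<partial>lborel)"
   by (simp add: g_def indicator_def)
  also have "\<dots> = 2 * u * cos (2 * pi * (r * x))" using u0 by (simp add: u_def)
  finally show ?thesis using True by (simp add: h_def u_def mult_ac abs_le_iff)
 next
  case False
  have "(x, y) \<notin> cball 0 t" for y :: real
  proof
   assume "(x, y) \<in> cball 0 t"
   then have "sqrt (x\<^sup>2 + y\<^sup>2) \<le> t" by (simp add: norm_Pair)
   moreover have "\<bar>x\<bar> \<le> sqrt (x\<^sup>2 + y\<^sup>2)" by (rule real_le_rsqrt) simp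
   ultimately show False using False by simp
  qed
  then show ?thesis using False by (auto simp: g_def indicator_def abs_le_iff)
 qed
 have "disc_ft r 0 t = integral\<^sup>L (lborel \<Otimes>\<^sub>M lborel) g" unfolding disc_ft_def lborel_prod geq by simp
 also have "\<dots> = (\<integral>x. \<integral>y. g (x, y) \<partial>lborel \<partial>lborel)" using lborel_pair.integral_fst'[OF int] by (rule sym)
 also have "\<dots> = (LINT x:{-t..t}|lborel. h x)" unfolding inner set_lebesgue_integral_def ..
 also have "\<dots> = integral {-t..t} h"
 proof (rule set_borel_integral_eq_integral(2))
  have "continuous_on {-t..t} h" unfolding h_def by (intro continuous_intros)
  then show "set_integrable lborel {-t..t} h" by (rule borel_integrable_atLeastAtMost')
 qed
 also have "\<dots> = 2 * t\<^sup>2 * integral {-1..1} (\<lambda>u. sqrt (1 - u\<^sup>2) * cos (2 * pi * r * t * u))"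
 proof -
  have "continuous_on {-t..t} h" unfolding h_def by (intro continuous_intros)
  then have "(h has_integral integral {-t..t} h) {-t..t}" by (intro integrable_integral integrable_continuous_interval)
  from has_integral_stretch_real[OF this, of t] t
  have "((\<lambda>x. h (t * x)) has_integral (1 / t) * integral {-t..t} h) ((\<lambda>x. x / t) ` {-t..t})" by simp
  also have "(\<lambda>x. x / t) ` {-t..t} = {-1..1}"
  proof (intro equalityI subsetI)
   fix y assume y: "y \<in> {-1..1::real}"
   have "t * y \<le> t * 1" "t * (-1) \<le> t * y" using y t by (intro mult_left_mono; simp)+
   then have "y = (t * y) / t" "t * y \<in> {-t..t}" using t by auto
   then show "y \<in> (\<lambda>x. x / t) ` {-t..t}" by blast
  qed (use t in \<open>auto simp: field_simps\<close>)
  finally have "((\<lambda>x. t * h (t * x)) has_integral t * ((1 / t) * integral {-t..t} h)) {-1..1}" by (rule has_integral_mult_right)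
  moreover have "t * h (t * x) = 2 * t\<^sup>2 * (sqrt (1 - x\<^sup>2) * cos (2 * pi * r * t * x))" for x
  proof -
   have "t\<^sup>2 - (t * x)\<^sup>2 = t\<^sup>2 * (1 - x\<^sup>2)" by (simp add: power2_eq_square algebra_simps)
   then have "sqrt (t\<^sup>2 - (t * x)\<^sup>2) = t * sqrt (1 - x\<^sup>2)" using t by (simp add: real_sqrt_mult)
   then show ?thesis by (simp add: h_def power2_eq_square mult_ac)
  qed
  ultimately have "((\<lambda>x. 2 * t\<^sup>2 * (sqrt (1 - x\<^sup>2) * cos (2 * pi * r * t * x))) has_integral integral {-t..t} h) {-1..1}" using t by simp
  then have "integral {-1..1} (\<lambda>x. 2 * t\<^sup>2 * (sqrt (1 - x\<^sup>2) * cos (2 * pi * r * t * x))) = integral {-t..t} h" by (rule integral_unique)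
  then show ?thesis by simp
 qed
 finally show ?thesis .
qed

text \<open>Bessel asymptotics in disguise: \<open>disc_ft r 0 t\<close> is (t / r) J_1(2 pi r t),
  with 2 pi r t in the role of w. The factor 2 t^2 in front of the one-dimensional integral turns
  w^(-3/2) into sqrt t and w^(-5/2) into t^(-1/2).\<close>

lemma disc_ft_asymp:
 "\<exists>C\<ge>0. \<forall>t r. 0 < t \<longrightarrow> 1 \<le> 2 * pi * r * t \<longrightarrow>
  \<bar>disc_ft r 0 t - sqrt t / pi * r powr (- 3 / 2) * cos (2 * pi * r * t - 3 * pi / 4)\<bar> \<le> C * t powr (- 1 / 2) * r powr (- 5 / 2)"
proof -
 obtain C where C: "\<And>w. 1 \<le> w \<Longrightarrow> \<bar>integral {-1..1} (\<lambda>x. sqrt (1 - x\<^sup>2) * cos (w * x)) - sqrt (2 * pi) * w powr (- 3 / 2) * cos (w - 3 * pi / 4)\<bar>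
  \<le> C * w powr (- 5 / 2)" using half_disc_cos_integral by blast
 have C0: "0 \<le> C" using C[of 1] by simp
 show ?thesis
 proof (intro exI[of _ "2 * C"] conjI allI impI)
  show "0 \<le> 2 * C" using C0 by simp
  fix t r :: real assume t: "0 < t" and w1: "1 \<le> 2 * pi * r * t"
  define w where "w = 2 * pi * r * t"
  have r: "0 < r"
  proof (rule ccontr)
   assume "\<not> 0 < r"
   then have "2 * pi * r * t \<le> 0" using t by (simp add: mult_nonneg_nonpos mult_nonpos_nonneg)
   then show False using w1 by simp
  qed
  have t52: "t\<^sup>2 * t powr (- 3 / 2) = sqrt t" "t\<^sup>2 * t powr (- 5 / 2) = t powr (- 1 / 2)"
   using t by (simp_all add: powr_numeral[symmetric] powr_add[symmetric] powr_half_sqrt[symmetric] del: powr_numeral)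
  have p: "2 * sqrt (2 * pi) * (2 * pi) powr (- 3 / 2) = 1 / pi"
  proof -
   have "sqrt (2 * pi) * (2 * pi) powr (- 3 / 2) = (2 * pi) powr (1/2 + (- 3 / 2))"
    unfolding powr_add by (simp add: powr_half_sqrt)
   also have "\<dots> = 1 / (2 * pi)" by (simp add: powr_minus_divide)
   finally show ?thesis by simp
  qed
  have w3: "w powr (- 3 / 2) = (2 * pi) powr (- 3 / 2) * r powr (- 3 / 2) * t powr (- 3 / 2)"
   and w5: "w powr (- 5 / 2) = (2 * pi) powr (- 5 / 2) * r powr (- 5 / 2) * t powr (- 5 / 2)"
   unfolding w_def using r t by (simp_all add: powr_mult)
  have main: "2 * t\<^sup>2 * (sqrt (2 * pi) * w powr (- 3 / 2)) = sqrt t / pi * r powr (- 3 / 2)"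
  proof -
   have "2 * t\<^sup>2 * (sqrt (2 * pi) * w powr (- 3 / 2)) = (2 * sqrt (2 * pi) * (2 * pi) powr (- 3 / 2)) * r powr (- 3 / 2) * (t\<^sup>2 * t powr (- 3 / 2))"
    unfolding w3 by (simp only: mult_ac)
   then show ?thesis unfolding p t52 by simp
  qed
  have "disc_ft r 0 t - sqrt t / pi * r powr (- 3 / 2) * cos (w - 3 * pi / 4) =
   2 * t\<^sup>2 * (integral {-1..1} (\<lambda>x. sqrt (1 - x\<^sup>2) * cos (w * x)) - sqrt (2 * pi) * w powr (- 3 / 2) * cos (w - 3 * pi / 4))"
   unfolding disc_ft_axis[OF t] main[symmetric] w_def by (simp add: algebra_simps)
  also have "\<bar>\<dots>\<bar> \<le> 2 * t\<^sup>2 * (C * w powr (- 5 / 2))"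
   unfolding abs_mult[of "2 * t\<^sup>2"] using C[of w] w1 by (intro mult_mono) (auto simp: w_def)
  also have "\<dots> = 2 * C * (2 * pi) powr (- 5 / 2) * r powr (- 5 / 2) * (t\<^sup>2 * t powr (- 5 / 2))"
   unfolding w5 by (simp only: mult_ac)
  also have "\<dots> = (2 * C * t powr (- 1 / 2) * r powr (- 5 / 2)) * (2 * pi) powr (- 5 / 2)" unfolding t52 by (simp only: mult_ac)
  also have "\<dots> \<le> (2 * C * t powr (- 1 / 2) * r powr (- 5 / 2)) * 1"
  proof (rule mult_left_mono)
   have "(2 * pi) powr (- 5 / 2) \<le> (2 * pi) powr 0" using pi_ge_two by (intro powr_mono) auto
   then show "(2 * pi) powr (- 5 / 2) \<le> 1" by simp
  qed (use C0 in auto)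
  finally show "\<bar>disc_ft r 0 t - sqrt t / pi * r powr (- 3 / 2) * cos (2 * pi * r * t - 3 * pi / 4)\<bar> \<le> 2 * C * t powr (- 1 / 2) * r powr (- 5 / 2)"
   unfolding w_def by simp
 qed
qed

section \<open>Smoothing with the Fejer kernel\<close>

lemma lattice_count_eq: "lattice_count t = card {z. norm (emb z) \<le> t}"
 by (simp add: lattice_count_def emb_def)

lemma finite_norm_emb [simp]: "finite {z. norm (emb z) \<le> t}"
proof (rule finite_subset)
 show "{z. norm (emb z) \<le> t} \<subseteq> {z. real_of_int (gnorm z) \<le> t\<^sup>2}"
 proof
  fix z assume "z \<in> {z. norm (emb z) \<le> t}"
  then have "sqrt (real_of_int (gnorm z)) \<le> t" by (simp add: norm_emb)
  then show "z \<in> {z. real_of_int (gnorm z) \<le> t\<^sup>2}" by (simp add: sqrt_le_D)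
 qed
qed simp

lemma lattice_count_disc: "0 \<le> t \<Longrightarrow> lattice_count t = disc_count (t\<^sup>2)"
 unfolding lattice_count_eq disc_count_def norm_emb
 by (rule arg_cong[of _ _ card], rule Collect_cong) (metis real_sqrt_abs abs_of_nonneg real_sqrt_le_iff)

lemma lattice_count_gauss: "1 \<le> t \<Longrightarrow> \<bar>real (lattice_count t) - pi * t\<^sup>2\<bar> \<le> 8 * t"
 using disc_count_gauss[of "t\<^sup>2"] by (simp add: lattice_count_disc)

lemma lattice_count_mono: "s \<le> t \<Longrightarrow> lattice_count s \<le> lattice_count t"
 unfolding lattice_count_eq by (intro card_mono) auto

section \<open>The Fejer kernel and its concentration at the integers\<close>

lemma norm_sum_cis_square:
 assumes "finite I"
 shows "(norm (\<Sum>i\<in>I. cis (a i)))\<^sup>2 = (\<Sum>i\<in>I. \<Sum>j\<in>I. cos (a i - a j))"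
proof -
 have "(norm (\<Sum>i\<in>I. cis (a i)))\<^sup>2 = Re ((\<Sum>i\<in>I. cis (a i)) * cnj (\<Sum>i\<in>I. cis (a i)))"
  by (metis Re_complex_of_real complex_norm_square)
 also have "\<dots> = (\<Sum>i\<in>I. \<Sum>j\<in>I. Re (cis (a i) * cnj (cis (a j))))"
  by (simp only: cnj_sum sum_product Re_sum)
 also have "\<dots> = (\<Sum>i\<in>I. \<Sum>j\<in>I. cos (a i - a j))"
  by (intro sum.cong refl) (simp add: cos_diff)
 finally show ?thesis .
qed

text \<open>For H > 0 this is a nonnegative trigonometric polynomial of mass 1 on every unit
  interval. Nonnegativity allows comparisons by inclusion of sets, and finitely many frequencies
  spare every question of convergence.\<close>

definition fejer :: "nat \<Rightarrow> real \<Rightarrow> real" where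
 "fejer H x = (norm (\<Sum>m<H. cis (2 * pi * real m * x)))\<^sup>2 / real H"

lemma fejer_nonneg: "0 \<le> fejer H x"
 by (simp add: fejer_def)

lemma continuous_fejer: "continuous_on A (fejer H)"
 unfolding fejer_def[abs_def] divide_inverse by (intro continuous_intros)

lemma measurable_fejer [measurable]: "fejer H \<in> borel_measurable borel"
 by (rule borel_measurable_continuous_onI[OF continuous_fejer])

lemma nn_integral_fejer:
 assumes H: "0 < H"
 shows "(\<integral>\<^sup>+x. ennreal (fejer H x) * indicator {of_int a - 1/2..of_int a + 1/2} x \<partial>lborel) = 1"
proof -
 define g where "g m l x = (if m = l then x else sin (2 * pi * (real m - real l) * x) / (2 * pi * (real m - real l)))" for m l :: nat and x
 define G where "G x = (\<Sum>m<H. \<Sum>l<H. g m l x) / real H" for x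
 have f: "fejer H x = (\<Sum>m<H. \<Sum>l<H. cos (2 * pi * (real m - real l) * x)) / real H" for x
  unfolding fejer_def by (subst norm_sum_cis_square) (simp, simp add: algebra_simps)
 have g: "(g m l has_real_derivative cos (2 * pi * (real m - real l) * x)) (at x)" for m l x
 proof (cases "m = l")
  case True then show ?thesis by (simp add: g_def[abs_def])
 next
  case False
  then show ?thesis unfolding g_def[abs_def] by (auto intro!: derivative_eq_intros)
 qed
 have G: "(G has_real_derivative fejer H x) (at x)" for x
  unfolding f G_def[abs_def] using H by (auto intro!: derivative_eq_intros g)
 have per: "g m l (of_int a + 1/2) - g m l (of_int a - 1/2) = (if m = l then 1 else 0)" for m l
 proof (cases "m = l")
  case False
  have e: "2 * pi * (real m - real l) * (of_int a + 1/2) = 2 * pi * (real m - real l) * (of_int a - 1/2) + 2 * pi * of_int (int m - int l)"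
   by (simp add: algebra_simps)
  have "sin (2 * pi * (real m - real l) * (of_int a + 1/2)) = sin (2 * pi * (real m - real l) * (of_int a - 1/2))"
   unfolding e sin_add by (simp only: sin_int_2pin cos_int_2pin mult_1_right mult_zero_right add_0_right)
  then show ?thesis using False by (simp add: g_def)
 qed (simp add: g_def)
 have "(\<integral>\<^sup>+x. ennreal (fejer H x) * indicator {of_int a - 1/2..of_int a + 1/2} x \<partial>lborel) = ennreal (G (of_int a + 1/2) - G (of_int a - 1/2))"
  by (intro nn_integral_FTC_Icc measurable_fejer G fejer_nonneg) auto
 also have "G (of_int a + 1/2) - G (of_int a - 1/2) = (\<Sum>m<H. \<Sum>l<H. g m l (of_int a + 1/2) - g m l (of_int a - 1/2)) / real H"
  by (simp add: G_def sum_subtractf diff_divide_distrib)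
 also have "\<dots> = 1" unfolding per using H by simp
 finally show ?thesis by simp
qed

lemma abs_sin_pi_ge:
 assumes "\<bar>x\<bar> \<le> 1 / 2" shows "\<bar>x\<bar> \<le> \<bar>sin (pi * x)\<bar>"
proof -
 have pos: "y \<le> sin (pi * y)" if y: "0 \<le> y" "y \<le> 1 / 2" for y :: real
 proof (cases "y \<le> 1 / 3")
  case True
  show ?thesis
  proof (cases "y = 0")
   case False
   then have y0: "0 < pi * y" using y by simp
   obtain \<xi> where xi: "0 < \<xi>" "\<xi> < pi * y" "sin (pi * y) - sin 0 = (pi * y - 0) * cos \<xi>"
    using MVT2[OF y0, of sin cos] by auto
   have "pi * y \<le> pi * (1 / 3)" using True by (intro mult_left_mono) auto
   then have "\<xi> \<le> pi / 3" using xi by linarith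
   then have "cos (pi / 3) \<le> cos \<xi>" using xi by (intro cos_monotone_0_pi_le) auto
   then have "1 / 2 \<le> cos \<xi>" by (simp add: cos_60)
   then have "(pi * y) * (1 / 2) \<le> (pi * y) * cos \<xi>" using y0 by (intro mult_left_mono) auto
   moreover have "2 * y \<le> pi * y" using y pi_ge_two by (intro mult_right_mono) auto
   ultimately have "y \<le> (pi * y) * cos \<xi>" by linarith
   then show ?thesis using xi by simp
  qed simp
 next
  case False
  have "pi * (1 / 3) \<le> pi * y" "pi * y \<le> pi * (1 / 2)" using False y by (intro mult_left_mono; simp)+
  then have "sin (pi / 3) \<le> sin (pi * y)" by (intro sin_monotone_2pi_le) (use pi_gt_zero in linarith)+
  moreover have "1 \<le> sqrt 3" by simp
  then have "1 / 2 \<le> sin (pi / 3)" by (simp add: sin_60)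
  ultimately show ?thesis using y by linarith
 qed
 show ?thesis
 proof (cases "0 \<le> x")
  case True
  then show ?thesis using pos[of x] assms by simp
 next
  case False
  then show ?thesis using pos[of "- x"] assms by simp
 qed
qed

lemma fejer_le:
 assumes H: "0 < H" and x: "\<bar>x\<bar> \<le> 1 / 2" "Y \<le> \<bar>x\<bar>" "0 < Y"
 shows "fejer H (of_int a + x) \<le> 1 / (real H * Y\<^sup>2)"
proof -
 define w where "w = cis (2 * pi * x)"
 have c: "cis (2 * pi * real m * (of_int a + x)) = w ^ m" for m
 proof -
  have "2 * pi * real m * (of_int a + x) = 2 * pi * of_int (int m * a) + real m * (2 * pi * x)"
   by (simp add: algebra_simps)
  then have "cis (2 * pi * real m * (of_int a + x)) = cis (2 * pi * of_int (int m * a)) * cis (real m * (2 * pi * x))"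
   by (simp only: cis_mult)
  also have "cis (2 * pi * of_int (int m * a)) = 1" by (rule cis_multiple_2pi) simp
  finally show ?thesis unfolding w_def Complex.DeMoivre by (simp only: mult_1_left)
 qed
 have s: "Y \<le> \<bar>sin (pi * x)\<bar>" using abs_sin_pi_ge[OF x(1)] x(2) by linarith
 have "w - 1 = cis (pi * x) * (cis (pi * x) - cis (- (pi * x)))"
  unfolding right_diff_distrib cis_mult w_def by (simp add: mult.assoc)
 also have "cis (pi * x) - cis (- (pi * x)) = 2 * \<i> * of_real (sin (pi * x))" by (simp add: complex_eq_iff)
 finally have nw: "norm (w - 1) = 2 * \<bar>sin (pi * x)\<bar>" by (simp add: norm_mult)
 then have w1: "w \<noteq> 1" using s x(3) by auto
 have "norm (\<Sum>m<H. w ^ m) * norm (w - 1) = norm (w ^ H - 1)"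
  unfolding norm_mult[symmetric] using geometric_sum[OF w1, of H] w1 by simp
 also have "\<dots> \<le> norm (w ^ H) + norm (1 :: complex)" by (rule norm_triangle_ineq4)
 also have "\<dots> = 2" by (simp add: w_def norm_power)
 finally have "norm (\<Sum>m<H. w ^ m) * (2 * \<bar>sin (pi * x)\<bar>) \<le> 2" unfolding nw .
 moreover have "norm (\<Sum>m<H. w ^ m) * (2 * Y) \<le> norm (\<Sum>m<H. w ^ m) * (2 * \<bar>sin (pi * x)\<bar>)"
  using s by (intro mult_left_mono) auto
 ultimately have "norm (\<Sum>m<H. w ^ m) * (2 * Y) \<le> 2" by linarith
 then have "norm (\<Sum>m<H. w ^ m) \<le> 1 / Y" using x(3) by (simp add: le_divide_eq)
 then have "(norm (\<Sum>m<H. w ^ m))\<^sup>2 \<le> (1 / Y)\<^sup>2" by (intro power_mono) auto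
 then have "(norm (\<Sum>m<H. w ^ m))\<^sup>2 / real H \<le> (1 / Y)\<^sup>2 / real H" by (rule divide_right_mono) simp
 then show ?thesis unfolding fejer_def c by (simp add: power_divide mult.commute)
qed

definition fejer2 :: "nat \<Rightarrow> real \<times> real \<Rightarrow> real" where "fejer2 H p = fejer H (fst p) * fejer H (snd p)"

lemma fejer2_nonneg: "0 \<le> fejer2 H p"
 by (simp add: fejer2_def fejer_nonneg)

lemma continuous_fejer2: "continuous_on A (fejer2 H)"
 unfolding fejer2_def[abs_def]
 by (intro continuous_intros continuous_on_compose2[OF continuous_fejer[of UNIV]]) auto

lemma measurable_fejer2 [measurable]: "fejer2 H \<in> borel_measurable borel"
 by (rule borel_measurable_continuous_onI[OF continuous_fejer2])

text \<open>The periodic kernel replaces the unit masses at lattice points by narrow bumps, so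
  integrating it over the disc gives a smoothed lattice count. Expanding the same integrand into its
  finitely many frequencies gives transforms of the disc, which takes the place of Poisson
  summation.\<close>

definition smooth_count :: "nat \<Rightarrow> real \<Rightarrow> real" where
 "smooth_count H t = (\<integral>p. indicator (cball 0 t) p * fejer2 H p \<partial>lborel)"

definition fmeas :: "nat \<Rightarrow> real measure" where "fmeas H = density lborel (fejer H)"

definition fmeas2 :: "nat \<Rightarrow> (real \<times> real) measure" where "fmeas2 H = density lborel (fejer2 H)"

lemma sets_fmeas [simp]: "sets (fmeas H) = sets borel" "sets (fmeas2 H) = sets borel"
 by (simp_all add: fmeas_def fmeas2_def)

lemma emeasure_fmeas: "A \<in> sets borel \<Longrightarrow> emeasure (fmeas H) A = (\<integral>\<^sup>+x. ennreal (fejer H x) * indicator A x \<partial>lborel)"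
 unfolding fmeas_def by (subst emeasure_density) auto

lemma emeasure_fmeas2_Times:
 assumes [measurable]: "A \<in> sets borel" "B \<in> sets borel"
 shows "emeasure (fmeas2 H) (A \<times> B) = emeasure (fmeas H) A * emeasure (fmeas H) B"
proof -
 define f where "f A x = ennreal (fejer H x) * indicator A x" for A x
 have f[measurable]: "f A \<in> borel_measurable borel" if "A \<in> sets borel" for A
  unfolding f_def using that by measurable
 define g where "g p = f A (fst p) * f B (snd p)" for p
 have g: "g \<in> borel_measurable (lborel \<Otimes>\<^sub>M lborel)" unfolding g_def by measurable
 have AB: "A \<times> B \<in> sets (borel :: (real \<times> real) measure)"
  unfolding borel_prod[symmetric] by measurable
 have "emeasure (fmeas2 H) (A \<times> B) = (\<integral>\<^sup>+p. ennreal (fejer2 H p) * indicator (A \<times> B) p \<partial>lborel)"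
  unfolding fmeas2_def using AB by (subst emeasure_density) auto
 also have "\<dots> = (\<integral>\<^sup>+p. g p \<partial>(lborel \<Otimes>\<^sub>M lborel))" unfolding lborel_prod
  by (intro nn_integral_cong) (auto simp: g_def f_def fejer2_def indicator_def ennreal_mult fejer_nonneg)
 also have "\<dots> = (\<integral>\<^sup>+x. \<integral>\<^sup>+y. g (x, y) \<partial>lborel \<partial>lborel)"
  by (rule lborel.nn_integral_fst[OF g, symmetric])
 also have "\<dots> = (\<integral>\<^sup>+x. f A x * (\<integral>\<^sup>+y. f B y \<partial>lborel) \<partial>lborel)"
  unfolding g_def by (intro nn_integral_cong) (simp add: nn_integral_cmult)
 also have "\<dots> = (\<integral>\<^sup>+x. f A x \<partial>lborel) * (\<integral>\<^sup>+y. f B y \<partial>lborel)" by (simp add: nn_integral_multc)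
 finally show ?thesis by (simp add: emeasure_fmeas f_def)
qed

lemma emeasure_fmeas2_disc:
 "emeasure (fmeas2 H) (cball 0 t) = ennreal (smooth_count H t)"
proof -
 have int: "integrable lborel (\<lambda>p. indicator (cball 0 t) p * fejer2 H p)"
  using borel_integrable_compact[OF compact_cball continuous_fejer2, of 0 t H] by simp
 have "emeasure (fmeas2 H) (cball 0 t) = (\<integral>\<^sup>+p. ennreal (fejer2 H p) * indicator (cball 0 t) p \<partial>lborel)"
  unfolding fmeas2_def by (subst emeasure_density) auto
 also have "\<dots> = (\<integral>\<^sup>+p. ennreal (indicator (cball 0 t) p * fejer2 H p) \<partial>lborel)"
  by (intro nn_integral_cong) (auto simp: indicator_def)
 also have "\<dots> = ennreal (smooth_count H t)" unfolding smooth_count_def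
  using int fejer2_nonneg by (intro nn_integral_eq_integral) auto
 finally show ?thesis .
qed

context
 fixes H :: nat and Y \<eta> :: real
 assumes H: "0 < H" and Y: "0 < Y" "Y < 1 / 4" and eta: "\<eta> = 1 / (real H * Y\<^sup>2)" "\<eta> \<le> 1"
begin

definition cell :: "int \<Rightarrow> real set" where "cell a = {of_int a - 1/2..of_int a + 1/2}"
definition core :: "int \<Rightarrow> real set" where "core a = {of_int a - Y..of_int a + Y}"

lemma cell_sets [measurable]: "cell a \<in> sets borel" "core a \<in> sets borel"
 by (auto simp: cell_def core_def)

lemma eta_nonneg: "0 \<le> \<eta>" by (simp add: eta)

lemma fmeas_cell: "emeasure (fmeas H) (cell a) = 1"
 unfolding cell_def by (simp add: emeasure_fmeas nn_integral_fejer[OF H])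

lemma fmeas_cell_core: "emeasure (fmeas H) (cell a - core a) \<le> ennreal \<eta>"
proof -
 have "emeasure (fmeas H) (cell a - core a) = (\<integral>\<^sup>+x. ennreal (fejer H x) * indicator (cell a - core a) x \<partial>lborel)"
  by (rule emeasure_fmeas) measurable
 also have "\<dots> \<le> (\<integral>\<^sup>+x. ennreal \<eta> * indicator (cell a) x \<partial>lborel)"
 proof (rule nn_integral_mono)
  fix x
  show "ennreal (fejer H x) * indicator (cell a - core a) x \<le> ennreal \<eta> * indicator (cell a) x"
  proof (cases "x \<in> cell a - core a")
   case True
   then have "\<bar>x - of_int a\<bar> \<le> 1 / 2" "Y \<le> \<bar>x - of_int a\<bar>" by (auto simp: cell_def core_def abs_if)
   from fejer_le[OF H this Y(1), of a] have "fejer H x \<le> \<eta>" by (simp add: eta)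
   then show ?thesis using True by (simp add: ennreal_leI)
  qed simp
 qed
 also have "\<dots> = ennreal \<eta> * emeasure lborel (cell a)" by (subst nn_integral_cmult_indicator) auto
 also have "\<dots> = ennreal \<eta>" by (simp add: cell_def)
 finally show ?thesis .
qed

lemma fmeas_core: "ennreal (1 - \<eta>) \<le> emeasure (fmeas H) (core a)"
proof -
 have "1 = emeasure (fmeas H) (cell a)" by (simp add: fmeas_cell)
 also have "\<dots> \<le> emeasure (fmeas H) (core a \<union> (cell a - core a))" by (intro emeasure_mono) auto
 also have "\<dots> \<le> emeasure (fmeas H) (core a) + emeasure (fmeas H) (cell a - core a)"
  by (intro emeasure_subadditive) auto
 also have "\<dots> \<le> emeasure (fmeas H) (core a) + ennreal \<eta>" by (intro add_left_mono fmeas_cell_core)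
 finally have "1 \<le> emeasure (fmeas H) (core a) + ennreal \<eta>" .
 then have "1 - ennreal \<eta> \<le> emeasure (fmeas H) (core a)"
  by (simp add: ennreal_minus_le_iff add.commute)
 then show ?thesis using eta_nonneg by (simp add: ennreal_minus[symmetric])
qed

text \<open>Squares of half side Y around lattice points within radius t - 2 Y lie inside the disc,
  as the distance is at most the sum of the coordinate distances. They are disjoint, and each
  carries mass at least (1 - \<eta>)^2 >= 1 - 2 \<eta>.\<close>

lemma smooth_count_lower:
 "(1 - 2 * \<eta>) * real (lattice_count (t - 2 * Y)) \<le> smooth_count H t"
proof -
 define S where "S = {z. norm (emb z) \<le> t - 2 * Y}"
 have finS: "finite S" by (simp add: S_def)
 define B where "B z = core (fst z) \<times> core (snd z)" for z
 have Bs: "B z \<in> sets borel" for z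
  unfolding B_def borel_prod[symmetric] by measurable
 have inB: "p \<in> B z \<longleftrightarrow> \<bar>fst p - of_int (fst z)\<bar> \<le> Y \<and> \<bar>snd p - of_int (snd z)\<bar> \<le> Y" for p z
 proof -
  have "x \<in> core a \<longleftrightarrow> \<bar>x - of_int a\<bar> \<le> Y" for x a unfolding core_def by (auto simp: abs_if)
  then show ?thesis unfolding B_def mem_Times_iff by simp
 qed
 have one: "ennreal (1 - 2 * \<eta>) \<le> emeasure (fmeas2 H) (B z)" for z
 proof -
  have "ennreal (1 - 2 * \<eta>) \<le> ennreal ((1 - \<eta>) * (1 - \<eta>))" by (rule ennreal_leI) (simp add: algebra_simps)
  also have "\<dots> = ennreal (1 - \<eta>) * ennreal (1 - \<eta>)" using eta by (intro ennreal_mult) auto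
  also have "\<dots> \<le> emeasure (fmeas H) (core (fst z)) * emeasure (fmeas H) (core (snd z))"
   by (intro mult_mono fmeas_core) auto
  also have "\<dots> = emeasure (fmeas2 H) (B z)" unfolding B_def by (rule emeasure_fmeas2_Times[symmetric]) measurable
  finally show ?thesis .
 qed
 have "of_nat (card S) * ennreal (1 - 2 * \<eta>) = (\<Sum>z\<in>S. ennreal (1 - 2 * \<eta>))" by simp
 also have "\<dots> \<le> (\<Sum>z\<in>S. emeasure (fmeas2 H) (B z))" by (intro sum_mono one)
 also have "\<dots> = emeasure (fmeas2 H) (\<Union>z\<in>S. B z)"
 proof (rule sum_emeasure)
  show "disjoint_family_on B S"
  proof (unfold disjoint_family_on_def, intro ballI impI equalityI subsetI)
   fix z w p assume zw: "z \<noteq> w" and p: "p \<in> B z \<inter> B w"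
   have "\<bar>real_of_int (fst z) - of_int (fst w)\<bar> < 1" "\<bar>real_of_int (snd z) - of_int (snd w)\<bar> < 1"
    using p Y unfolding Int_iff inB by linarith+
   then have "z = w" by (auto simp: prod_eq_iff)
   then show "p \<in> {}" using zw by simp
  qed auto
 qed (use finS Bs in auto)
 also have "\<dots> \<le> emeasure (fmeas2 H) (cball 0 t)"
 proof (rule emeasure_mono)
  show "(\<Union>z\<in>S. B z) \<subseteq> cball 0 t"
  proof
   fix p assume "p \<in> (\<Union>z\<in>S. B z)"
   then obtain z where z: "z \<in> S" "p \<in> B z" by blast
   have "norm (p - emb z) \<le> \<bar>fst p - of_int (fst z)\<bar> + \<bar>snd p - of_int (snd z)\<bar>"
    using norm_Pair_le[of "fst (p - emb z)" "snd (p - emb z)"] unfolding prod.collapse by (simp add: emb_def)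
   then have "norm (p - emb z) \<le> 2 * Y" using z(2) unfolding inB by linarith
   moreover have "norm (emb z) \<le> t - 2 * Y" using z(1) by (simp add: S_def)
   ultimately have "norm p \<le> t" using norm_triangle_ineq2[of p "emb z"] by linarith
   then show "p \<in> cball 0 t" by simp
  qed
 qed auto
 also have "\<dots> = ennreal (smooth_count H t)" by (rule emeasure_fmeas2_disc)
 finally have le: "of_nat (card S) * ennreal (1 - 2 * \<eta>) \<le> ennreal (smooth_count H t)" .
 have s0: "0 \<le> smooth_count H t" unfolding smooth_count_def using fejer2_nonneg by (intro integral_nonneg_AE) auto
 show ?thesis
 proof (cases "0 \<le> 1 - 2 * \<eta>")
  case True
  then have "ennreal (real (card S) * (1 - 2 * \<eta>)) \<le> ennreal (smooth_count H t)"
   using le by (simp add: ennreal_mult ennreal_of_nat_eq_real_of_nat)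
  then have "real (card S) * (1 - 2 * \<eta>) \<le> smooth_count H t" using s0 by (simp add: ennreal_le_iff)
  then show ?thesis by (simp add: S_def lattice_count_eq mult.commute)
 next
  case False
  then have "(1 - 2 * \<eta>) * real (lattice_count (t - 2 * Y)) \<le> 0" by (intro mult_nonpos_nonneg) auto
  then show ?thesis using s0 by linarith
 qed
qed

text \<open>A point of the disc is rounded to the nearest lattice point. If both coordinates fall
  within Y of it, that lattice point has norm at most t + 2 Y and its whole cell of mass 1 is
  charged. Otherwise the point lies in the part of a cell outside the core, of mass at most 2
  \<eta>, and the lattice point has norm at most t + 1, rounding moving a point by at most
  3/4.\<close>

lemma smooth_count_upper:
 "smooth_count H t \<le> real (lattice_count (t + 2 * Y)) + 2 * \<eta> * real (lattice_count (t + 1))"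
proof -
 define S where "S = {z. norm (emb z) \<le> t + 2 * Y}"
 define S1 where "S1 = {z. norm (emb z) \<le> t + 1}"
 have finS: "finite S" "finite S1" by (simp_all add: S_def S1_def)
 define Q where "Q z = cell (fst z) \<times> cell (snd z)" for z
 define D where "D z = ((cell (fst z) - core (fst z)) \<times> cell (snd z)) \<union> (cell (fst z) \<times> (cell (snd z) - core (snd z)))" for z
 have Qs: "Q z \<in> sets borel" for z unfolding Q_def borel_prod[symmetric] by measurable
 have D1: "(cell (fst z) - core (fst z)) \<times> cell (snd z) \<in> sets (borel :: (real \<times> real) measure)"
  "cell (fst z) \<times> (cell (snd z) - core (snd z)) \<in> sets (borel :: (real \<times> real) measure)" for z
  unfolding borel_prod[symmetric] by measurable
 have Ds: "D z \<in> sets borel" for z unfolding D_def using D1 by (intro sets.Un) auto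
 have mQ: "emeasure (fmeas2 H) (Q z) = 1" for z
  unfolding Q_def by (subst emeasure_fmeas2_Times) (auto simp: fmeas_cell)
 have mD: "emeasure (fmeas2 H) (D z) \<le> ennreal (2 * \<eta>)" for z
 proof -
  have "emeasure (fmeas2 H) (D z) \<le> emeasure (fmeas2 H) ((cell (fst z) - core (fst z)) \<times> cell (snd z)) + emeasure (fmeas2 H) (cell (fst z) \<times> (cell (snd z) - core (snd z)))"
   unfolding D_def using D1 by (intro emeasure_subadditive) auto
  also have "\<dots> = emeasure (fmeas H) (cell (fst z) - core (fst z)) + emeasure (fmeas H) (cell (snd z) - core (snd z))"
   by (subst (1 2) emeasure_fmeas2_Times) (auto simp: fmeas_cell)
  also have "\<dots> \<le> ennreal \<eta> + ennreal \<eta>" by (intro add_mono fmeas_cell_core)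
  also have "\<dots> = ennreal (2 * \<eta>)" using eta_nonneg by (simp add: ennreal_plus[symmetric] del: ennreal_plus)
  finally show ?thesis .
 qed
 have cover: "cball 0 t \<subseteq> (\<Union>z\<in>S. Q z) \<union> (\<Union>z\<in>S1. D z)"
 proof
  fix p :: "real \<times> real" assume "p \<in> cball 0 t"
  then have p: "norm p \<le> t" by simp
  define z where "z = (round (fst p), round (snd p))"
  have d: "\<bar>fst p - of_int (fst z)\<bar> \<le> 1 / 2" "\<bar>snd p - of_int (snd z)\<bar> \<le> 1 / 2"
   using of_int_round_abs_le[of "fst p"] of_int_round_abs_le[of "snd p"]
   by (auto simp: z_def abs_minus_commute)
  have cell: "fst p \<in> cell (fst z)" "snd p \<in> cell (snd z)" using d unfolding cell_def by (auto simp: abs_if split: if_splits)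
  have nle: "norm (emb z) \<le> norm p + norm (p - emb z)" using norm_triangle_ineq2[of "emb z" p] by (simp add: norm_minus_commute)
  show "p \<in> (\<Union>z\<in>S. Q z) \<union> (\<Union>z\<in>S1. D z)"
  proof (cases "fst p \<in> core (fst z) \<and> snd p \<in> core (snd z)")
   case True
   then have "\<bar>fst p - of_int (fst z)\<bar> \<le> Y" "\<bar>snd p - of_int (snd z)\<bar> \<le> Y" unfolding core_def by (auto simp: abs_if)
   moreover have "norm (p - emb z) \<le> \<bar>fst p - of_int (fst z)\<bar> + \<bar>snd p - of_int (snd z)\<bar>"
    using norm_Pair_le[of "fst (p - emb z)" "snd (p - emb z)"] unfolding prod.collapse by (simp add: emb_def)
   ultimately have "norm (emb z) \<le> t + 2 * Y" using nle p by linarith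
   then have "z \<in> S" by (simp add: S_def)
   moreover have "p \<in> Q z" using cell by (simp add: Q_def mem_Times_iff)
   ultimately show ?thesis by blast
  next
   case False
   have "norm (p - emb z) \<le> 3 / 4" using d by (intro norm_pair_half) (auto simp: emb_def)
   then have "z \<in> S1" using nle p by (simp add: S1_def)
   moreover have "p \<in> D z" using False cell by (auto simp: D_def mem_Times_iff)
   ultimately show ?thesis by blast
  qed
 qed
 have "ennreal (smooth_count H t) = emeasure (fmeas2 H) (cball 0 t)" by (rule emeasure_fmeas2_disc[symmetric])
 also have "\<dots> \<le> emeasure (fmeas2 H) ((\<Union>z\<in>S. Q z) \<union> (\<Union>z\<in>S1. D z))"
  using cover finS Qs Ds by (intro emeasure_mono) auto
 also have "\<dots> \<le> emeasure (fmeas2 H) (\<Union>z\<in>S. Q z) + emeasure (fmeas2 H) (\<Union>z\<in>S1. D z)"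
  using finS Qs Ds by (intro emeasure_subadditive) auto
 also have "\<dots> \<le> (\<Sum>z\<in>S. emeasure (fmeas2 H) (Q z)) + (\<Sum>z\<in>S1. emeasure (fmeas2 H) (D z))"
  using finS Qs Ds by (intro add_mono emeasure_subadditive_finite) auto
 also have "\<dots> \<le> (\<Sum>z\<in>S. 1) + (\<Sum>z\<in>S1. ennreal (2 * \<eta>))" using mQ mD by (intro add_mono sum_mono) auto
 also have "\<dots> = ennreal (real (card S) + 2 * \<eta> * real (card S1))"
  using eta_nonneg by (simp add: ennreal_of_nat_eq_real_of_nat ennreal_mult[symmetric] ennreal_plus[symmetric] mult.commute del: ennreal_plus)
 finally have "smooth_count H t \<le> real (card S) + 2 * \<eta> * real (card S1)"
  using eta_nonneg by (subst (asm) ennreal_le_iff) auto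
 then show ?thesis by (simp add: S_def S1_def lattice_count_eq)
qed

end

section \<open>The smoothed count as a trigonometric sum\<close>

definition box :: "nat \<Rightarrow> (int \<times> int) set" where
 "box H = {0..<int H} \<times> {0..<int H}"

lemma finite_box [simp]: "finite (box H)"
 by (simp add: box_def)

lemma card_box: "card (box H) = H\<^sup>2"
 by (simp add: box_def power2_eq_square)

text \<open>The sum of the Fourier coefficients of the two-dimensional kernel over frequencies of
  norm n. Each coefficient, a product of two factors (1 - |a| / H) cut off at 0, is written as a
  normalised number of pairs in a box with given difference, so its bounds reduce to
  counting.\<close>

definition wt :: "nat \<Rightarrow> nat \<Rightarrow> real" where
 "wt H n = real (card {(q, q') \<in> box H \<times> box H. gnorm (q - q') = int n}) / (real H)\<^sup>2"

lemma wt_nonneg: "0 \<le> wt H n"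
 by (simp add: wt_def)

lemma card_wt_pairs:
 "card {(q, q') \<in> box H \<times> box H. gnorm (q - q') = int n} = (\<Sum>z | gnorm z = int n. card {q \<in> box H. q + z \<in> box H})"
proof -
 have "card {(q, q') \<in> box H \<times> box H. gnorm (q - q') = int n} = card (SIGMA z:{z. gnorm z = int n}. {q \<in> box H. q + z \<in> box H})"
  by (rule bij_betw_same_card[of "\<lambda>(q, q'). (q - q', q')"], rule bij_betw_byWitness[where f' = "\<lambda>(z, q). (q + z, q)"]) auto
 also have "\<dots> = (\<Sum>z | gnorm z = int n. card {q \<in> box H. q + z \<in> box H})"
  by (rule card_SigmaI) auto
 finally show ?thesis .
qed

lemma wt_le: assumes "0 < H" shows "wt H n \<le> real (r2 n)"
proof -
 have "card {q \<in> box H. q + z \<in> box H} \<le> H\<^sup>2" for z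
  unfolding card_box[symmetric] by (rule card_mono) auto
 then have "(\<Sum>z | gnorm z = int n. card {q \<in> box H. q + z \<in> box H}) \<le> r2 n * H\<^sup>2"
  unfolding r2_def using sum_bounded_above[of "{z. gnorm z = int n}" "\<lambda>z. card {q \<in> box H. q + z \<in> box H}" "H\<^sup>2"] by simp
 then have "real (\<Sum>z | gnorm z = int n. card {q \<in> box H. q + z \<in> box H}) \<le> real (r2 n * H\<^sup>2)" by (rule of_nat_mono)
 then show ?thesis unfolding wt_def card_wt_pairs using assms by (simp add: divide_le_eq)
qed

lemma card_shift_box_ge: "real H * (real H - (\<bar>of_int (fst z)\<bar> + \<bar>of_int (snd z)\<bar>)) \<le> real (card {q \<in> box H. q + z \<in> box H})"
proof -
 define P where "P a = {max 0 (- a)..<min (int H) (int H - a)}" for a :: int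
 have cP: "real H - \<bar>of_int a\<bar> \<le> real (card (P a))" "card (P a) \<le> H" for a
  unfolding P_def by (auto simp: max_def min_def)
 have "P (fst z) \<times> P (snd z) \<subseteq> {q \<in> box H. q + z \<in> box H}"
  unfolding P_def box_def by (cases z) auto
 then have "card (P (fst z)) * card (P (snd z)) \<le> card {q \<in> box H. q + z \<in> box H}"
  unfolding card_cartesian_product[symmetric] by (rule card_mono[rotated]) simp
 then have 1: "real (card (P (fst z))) * real (card (P (snd z))) \<le> real (card {q \<in> box H. q + z \<in> box H})"
  unfolding of_nat_mult[symmetric] of_nat_le_iff .
 define x y h where "x = real (card (P (fst z)))" and "y = real (card (P (snd z)))" and "h = real H"
 have "0 \<le> (h - x) * (h - y)" using cP(2) unfolding x_def y_def h_def by (intro mult_nonneg_nonneg) auto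
 then have "h * (x + y - h) \<le> x * y" by (simp add: algebra_simps)
 moreover have "h * (h - (\<bar>of_int (fst z)\<bar> + \<bar>of_int (snd z)\<bar>)) \<le> h * (x + y - h)"
  using cP(1)[of "fst z"] cP(1)[of "snd z"] unfolding x_def y_def h_def by (intro mult_left_mono) auto
 ultimately show ?thesis using 1 unfolding x_def y_def h_def by linarith
qed

lemma wt_ge: assumes "0 < H" shows "real (r2 n) * (1 - 2 * sqrt (real n) / real H) \<le> wt H n"
proof -
 have "real H * (real H - 2 * sqrt (real n)) \<le> real (card {q \<in> box H. q + z \<in> box H})" if "gnorm z = int n" for z
 proof -
  have n: "real n = (of_int (fst z))\<^sup>2 + (of_int (snd z))\<^sup>2" using arg_cong[OF that, of real_of_int] by (simp add: gnorm_def)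
  have "\<bar>of_int (fst z)\<bar> \<le> sqrt (real n)" "\<bar>of_int (snd z)\<bar> \<le> sqrt (real n)"
   unfolding n by (simp_all add: real_le_rsqrt)
  then have "real H * (real H - 2 * sqrt (real n)) \<le> real H * (real H - (\<bar>of_int (fst z)\<bar> + \<bar>of_int (snd z)\<bar>))"
   by (intro mult_left_mono) auto
  then show ?thesis using card_shift_box_ge[of H z] by linarith
 qed
 then have "real (r2 n) * (real H * (real H - 2 * sqrt (real n))) \<le> (\<Sum>z | gnorm z = int n. real (card {q \<in> box H. q + z \<in> box H}))"
  unfolding r2_def using sum_bounded_below[of "{z. gnorm z = int n}" "real H * (real H - 2 * sqrt (real n))" "\<lambda>z. real (card {q \<in> box H. q + z \<in> box H})"] by simp
 moreover have "real (r2 n) * (1 - 2 * sqrt (real n) / real H) = real (r2 n) * (real H * (real H - 2 * sqrt (real n))) / (real H)\<^sup>2"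
  using assms by (simp add: field_simps power2_eq_square)
 ultimately show ?thesis unfolding wt_def card_wt_pairs by (simp add: divide_right_mono)
qed

lemma wt_0: assumes "0 < H" shows "wt H 0 = 1"
proof -
 have "{z. gnorm z = int 0} = {0}" by auto
 then show ?thesis unfolding wt_def card_wt_pairs using assms by (simp add: card_box)
qed

lemma sum_lessThan_int: "(\<Sum>m<H. f (int m)) = (\<Sum>m\<in>{0..<int H}. f m)"
 by (rule sum.reindex_bij_witness[of _ nat int]) auto

lemma fejer2_eq:
 "fejer2 H p = (\<Sum>(q, q')\<in>box H \<times> box H. cos (2 * pi * (of_int (fst (q - q')) * fst p + of_int (snd (q - q')) * snd p))) / (real H)\<^sup>2"
proof -
 define e where "e q = 2 * pi * (of_int (fst q) * fst p + of_int (snd q) * snd p)" for q :: "int \<times> int"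
 have "(\<Sum>m<H. cis (2 * pi * real m * fst p)) * (\<Sum>m<H. cis (2 * pi * real m * snd p)) =
  (\<Sum>m\<in>{0..<int H}. cis (2 * pi * of_int m * fst p)) * (\<Sum>m\<in>{0..<int H}. cis (2 * pi * of_int m * snd p))"
  using sum_lessThan_int[of "\<lambda>m. cis (2 * pi * of_int m * fst p)" H] sum_lessThan_int[of "\<lambda>m. cis (2 * pi * of_int m * snd p)" H]
  by simp
 also have "\<dots> = (\<Sum>q\<in>box H. cis (e q))"
  unfolding sum_product box_def sum.cartesian_product
  by (intro sum.cong refl) (auto simp: cis_mult e_def algebra_simps)
 finally have "(norm (\<Sum>m<H. cis (2 * pi * real m * fst p)))\<^sup>2 * (norm (\<Sum>m<H. cis (2 * pi * real m * snd p)))\<^sup>2 =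
  (norm (\<Sum>q\<in>box H. cis (e q)))\<^sup>2"
  unfolding power_mult_distrib[symmetric] norm_mult[symmetric] by (rule arg_cong)
 also have "\<dots> = (\<Sum>(q, q')\<in>box H \<times> box H. cos (e q - e q'))"
  by (simp add: norm_sum_cis_square sum.cartesian_product)
 also have "\<dots> = (\<Sum>(q, q')\<in>box H \<times> box H. cos (2 * pi * (of_int (fst (q - q')) * fst p + of_int (snd (q - q')) * snd p)))"
  by (intro sum.cong refl) (auto simp: e_def algebra_simps)
 finally show ?thesis unfolding fejer2_def fejer_def by (simp add: power2_eq_square)
qed

lemma integrable_disc_cos: "integrable lborel (\<lambda>p. indicator (cball 0 t) p * cos (2 * pi * (a * fst p + b * snd p)) :: real)"
proof -
 have "continuous_on (cball 0 t) (\<lambda>p :: real \<times> real. cos (2 * pi * (a * fst p + b * snd p)))" by (intro continuous_intros)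
 from borel_integrable_compact[OF compact_cball this] show ?thesis by simp
qed

lemma gnorm_box_le:
 assumes "q \<in> box H" "q' \<in> box H" shows "0 \<le> gnorm (q - q')" "gnorm (q - q') \<le> int (2 * H\<^sup>2)"
proof -
 have "\<bar>fst (q - q')\<bar> \<le> int H" "\<bar>snd (q - q')\<bar> \<le> int H" using assms by (auto simp: box_def)
 then have "(fst (q - q'))\<^sup>2 \<le> (int H)\<^sup>2" "(snd (q - q'))\<^sup>2 \<le> (int H)\<^sup>2"
  by (simp_all add: abs_le_square_iff[symmetric])
 then show "gnorm (q - q') \<le> int (2 * H\<^sup>2)" unfolding gnorm_def by simp
qed (simp add: gnorm_def)

text \<open>The transform of the disc depends on a frequency only through its norm, so equal norms
  are collected; differences of points of the box have norm at most 2 H^2.\<close>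

lemma smooth_count_eq:
 "smooth_count H t = (\<Sum>n\<le>2 * H\<^sup>2. wt H n * disc_ft (sqrt (real n)) 0 t)"
proof -
 define g where "g x = nat (gnorm (fst x - snd x))" for x :: "(int \<times> int) \<times> (int \<times> int)"
 define D where "D n = disc_ft (sqrt (real n)) 0 t" for n
 define I where "I = box H \<times> box H"
 have fI: "finite I" by (simp add: I_def)
 have d: "disc_ft (of_int (fst (fst x - snd x))) (of_int (snd (fst x - snd x))) t = D (g x)" if "x \<in> I" for x
 proof -
  have "real (g x) = real_of_int (gnorm (fst x - snd x))"
   using gnorm_box_le[of "fst x" H "snd x"] that by (auto simp: g_def I_def)
  then show ?thesis unfolding D_def by (subst disc_ft_radial) (simp add: gnorm_def)
 qed
 have "smooth_count H t = (\<integral>p. (\<Sum>x\<in>I. indicator (cball 0 t) p * cos (2 * pi * (of_int (fst (fst x - snd x)) * fst p + of_int (snd (fst x - snd x)) * snd p))) / (real H)\<^sup>2 \<partial>lborel)"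
  unfolding smooth_count_def fejer2_eq I_def by (simp add: sum_distrib_left case_prod_beta)
 also have "\<dots> = (\<Sum>x\<in>I. disc_ft (of_int (fst (fst x - snd x))) (of_int (snd (fst x - snd x))) t) / (real H)\<^sup>2"
  unfolding disc_ft_def by (simp add: integrable_disc_cos)
 also have "\<dots> = (\<Sum>x\<in>I. D (g x)) / (real H)\<^sup>2" using d by simp
 also have "(\<Sum>x\<in>I. D (g x)) = (\<Sum>n\<le>2 * H\<^sup>2. \<Sum>x | x \<in> I \<and> g x = n. D (g x))"
 proof (rule sum.group[symmetric, OF fI])
  show "g ` I \<subseteq> {..2 * H\<^sup>2}" using gnorm_box_le by (force simp: I_def g_def nat_le_iff)
 qed simp
 also have "\<dots> = (\<Sum>n\<le>2 * H\<^sup>2. real (card {(q, q') \<in> box H \<times> box H. gnorm (q - q') = int n}) * D n)"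
 proof (rule sum.cong[OF refl])
  fix n
  have "{x. x \<in> I \<and> g x = n} = {(q, q') \<in> box H \<times> box H. gnorm (q - q') = int n}"
   using gnorm_box_le(1) by (force simp: I_def g_def)
  moreover have "(\<Sum>x | x \<in> I \<and> g x = n. D (g x)) = (\<Sum>x | x \<in> I \<and> g x = n. D n)"
   by (rule sum.cong) auto
  ultimately show "(\<Sum>x | x \<in> I \<and> g x = n. D (g x)) = real (card {(q, q') \<in> box H \<times> box H. gnorm (q - q') = int n}) * D n"
   by simp
 qed
 finally show ?thesis unfolding wt_def D_def by (simp add: sum_divide_distrib)
qed

definition osc_sum :: "nat \<Rightarrow> real \<Rightarrow> real" where
 "osc_sum H t = (\<Sum>n=1..2 * H\<^sup>2. wt H n / pi * real n powr (- 3 / 4) * cos (2 * pi * sqrt (real n) * t - 3 * pi / 4))"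

lemma sum_powr_neg_le:
 assumes "1 < (a::real)" shows "\<exists>C. \<forall>N. (\<Sum>n=1..N. real n powr (- a)) \<le> C"
proof (intro exI allI)
 fix N :: nat
 have s: "summable (\<lambda>n. real n powr (- a))" using assms by (simp add: summable_real_powr_iff)
 show "(\<Sum>n=1..N. real n powr (- a)) \<le> (\<Sum>n. real n powr (- a))" by (rule sum_le_suminf[OF s]) auto
qed

text \<open>Frequency zero gives the area. The remainder of the Bessel asymptotics is O(t^(-1/2)
  n^(-5/4)), and r(n) = O(n^(1/8)) leaves the summable n^(-9/8); hence the error is uniform in
  H.\<close>

lemma smooth_count_asymp:
 "\<exists>C\<ge>0. \<forall>H t. 0 < H \<longrightarrow> 1 \<le> t \<longrightarrow> \<bar>smooth_count H t - pi * t\<^sup>2 - sqrt t * osc_sum H t\<bar> \<le> C * t powr (- 1 / 2)"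
proof -
 obtain C where C: "C \<ge> 0" "\<And>t r. 0 < t \<Longrightarrow> 1 \<le> 2 * pi * r * t \<Longrightarrow>
  \<bar>disc_ft r 0 t - sqrt t / pi * r powr (- 3 / 2) * cos (2 * pi * r * t - 3 * pi / 4)\<bar> \<le> C * t powr (- 1 / 2) * r powr (- 5 / 2)"
  using disc_ft_asymp by blast
 obtain D where D: "D \<ge> 1" "\<And>n. 1 \<le> n \<Longrightarrow> real (r2 n) \<le> D * real n powr (1 / 8)" using r2_bound[of "1/8"] by auto
 obtain E where E: "\<And>N. (\<Sum>n=1..N. real n powr (- (9 / 8))) \<le> E" using sum_powr_neg_le[of "9/8"] by auto
 have E0: "0 \<le> E" using E[of 0] by simp
 show ?thesis
 proof (intro exI[of _ "C * D * E"] conjI allI impI)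
  show "0 \<le> C * D * E" using C(1) D(1) E0 by simp
  fix H :: nat and t :: real assume H: "0 < H" and t: "1 \<le> t"
  have ins: "{..2 * H\<^sup>2} = insert 0 {1..2 * H\<^sup>2}" by auto
  have "smooth_count H t - pi * t\<^sup>2 = (\<Sum>n=1..2 * H\<^sup>2. wt H n * disc_ft (sqrt (real n)) 0 t)"
   unfolding smooth_count_eq ins by (subst sum.insert) (use t in \<open>auto simp: wt_0[OF H] disc_ft_0\<close>)
  then have eq: "smooth_count H t - pi * t\<^sup>2 - sqrt t * osc_sum H t =
   (\<Sum>n=1..2 * H\<^sup>2. wt H n * (disc_ft (sqrt (real n)) 0 t - sqrt t / pi * real n powr (- 3 / 4) * cos (2 * pi * sqrt (real n) * t - 3 * pi / 4)))"
   unfolding osc_sum_def sum_distrib_left right_diff_distrib sum_subtractf by (simp add: mult_ac)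
  have "\<bar>smooth_count H t - pi * t\<^sup>2 - sqrt t * osc_sum H t\<bar> \<le> (\<Sum>n=1..2 * H\<^sup>2. (C * D * t powr (- 1 / 2)) * real n powr (- (9 / 8)))"
   unfolding eq
  proof (rule order_trans[OF sum_abs sum_mono])
   fix n assume "n \<in> {1..2 * H\<^sup>2}"
   then have n: "1 \<le> n" by simp
   have s: "sqrt (real n) powr a = real n powr (a / 2)" for a
    by (simp add: powr_half_sqrt[symmetric] powr_powr)
   have "1 * 1 \<le> sqrt (real n) * t" using n t by (intro mult_mono) auto
   moreover have "1 * (sqrt (real n) * t) \<le> (2 * pi) * (sqrt (real n) * t)" using t pi_gt3 by (intro mult_right_mono) auto
   ultimately have "1 \<le> 2 * pi * sqrt (real n) * t" by (simp add: mult.assoc)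
   from C(2)[OF _ this] t
   have b: "\<bar>disc_ft (sqrt (real n)) 0 t - sqrt t / pi * real n powr (- 3 / 4) * cos (2 * pi * sqrt (real n) * t - 3 * pi / 4)\<bar> \<le> C * t powr (- 1 / 2) * real n powr (- 5 / 4)"
    by (simp add: s)
   have "\<bar>wt H n * (disc_ft (sqrt (real n)) 0 t - sqrt t / pi * real n powr (- 3 / 4) * cos (2 * pi * sqrt (real n) * t - 3 * pi / 4))\<bar>
    \<le> (D * real n powr (1 / 8)) * (C * t powr (- 1 / 2) * real n powr (- 5 / 4))"
    unfolding abs_mult abs_of_nonneg[OF wt_nonneg]
    using wt_le[OF H, of n] D(2)[OF n] D(1) by (intro mult_mono b) auto
   also have "\<dots> = (C * D * t powr (- 1 / 2)) * (real n powr (1 / 8) * real n powr (- 5 / 4))" by (simp add: mult_ac)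
   also have "real n powr (1 / 8) * real n powr (- 5 / 4) = real n powr (- (9 / 8))" by (simp add: powr_add[symmetric])
   finally show "\<bar>wt H n * (disc_ft (sqrt (real n)) 0 t - sqrt t / pi * real n powr (- 3 / 4) * cos (2 * pi * sqrt (real n) * t - 3 * pi / 4))\<bar>
    \<le> (C * D * t powr (- 1 / 2)) * real n powr (- (9 / 8))" .
  qed
  also have "\<dots> \<le> (C * D * t powr (- 1 / 2)) * E"
   unfolding sum_distrib_left[symmetric] using C(1) D(1) by (intro mult_left_mono E mult_nonneg_nonneg powr_ge_zero; linarith)
  finally show "\<bar>smooth_count H t - pi * t\<^sup>2 - sqrt t * osc_sum H t\<bar> \<le> C * D * E * t powr (- 1 / 2)" by (simp add: mult_ac)
 qed
qed

section \<open>Off a small set the remainder is a trigonometric sum\<close>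

lemma lattice_count_jump:
 assumes "lattice_count s \<noteq> lattice_count u" "s \<le> u" "0 \<le> u"
 shows "\<exists>m. real m \<le> u\<^sup>2 \<and> s < sqrt (real m) \<and> sqrt (real m) \<le> u"
proof -
 have "\<exists>z. s < norm (emb z) \<and> norm (emb z) \<le> u"
 proof (rule ccontr)
  assume "\<not> ?thesis"
  then have "{z. norm (emb z) \<le> s} = {z. norm (emb z) \<le> u}" using assms(2) by (auto simp: not_less)
  then show False using assms(1) by (simp add: lattice_count_eq)
 qed
 then obtain z where z: "s < norm (emb z)" "norm (emb z) \<le> u" by blast
 have g: "real_of_int (gnorm z) = real (nat (gnorm z))" by (simp add: gnorm_def)
 have "real (nat (gnorm z)) \<le> u\<^sup>2" using z(2) unfolding norm_emb g by (rule sqrt_le_D)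
 then show ?thesis using z unfolding norm_emb g by blast
qed

text \<open>Neighbourhoods of the radii at which the count can jump. The bound 9 T^2 covers all
  radii up to 3 T, which contains the shifted radii that occur for t <= 2 T + 1.\<close>

definition jump_set :: "real \<Rightarrow> real \<Rightarrow> real set" where
 "jump_set T Y = (\<Union>m\<in>{m. real m \<le> 9 * T\<^sup>2}. {sqrt (real m) - Y..sqrt (real m) + Y})"

lemma finite_nat_le_real [simp]: "finite {m. real m \<le> x}"
 by (rule finite_subset[of _ "{..nat \<lfloor>x\<rfloor>}"]) (auto simp: le_nat_floor)

lemma jump_set_sets [measurable]: "jump_set T Y \<in> sets borel"
 unfolding jump_set_def by (intro sets.finite_UN) auto

lemma measure_jump_set_le:
 assumes "1 \<le> T" "0 \<le> Y"
 shows "emeasure lborel (jump_set T Y) \<le> ennreal (20 * T\<^sup>2 * Y)"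
proof -
 define M where "M = {m. real m \<le> 9 * T\<^sup>2}"
 have T2: "1 \<le> T\<^sup>2" using assms by simp
 have "card M \<le> card {..nat \<lfloor>9 * T\<^sup>2\<rfloor>}" unfolding M_def by (rule card_mono) (auto simp: le_nat_floor)
 also have "\<dots> = nat \<lfloor>9 * T\<^sup>2\<rfloor> + 1" by simp
 finally have "real (card M) \<le> real (nat \<lfloor>9 * T\<^sup>2\<rfloor>) + 1" by linarith
 also have "real (nat \<lfloor>9 * T\<^sup>2\<rfloor>) \<le> 9 * T\<^sup>2" by (rule of_nat_floor) simp
 finally have cM: "real (card M) \<le> 10 * T\<^sup>2" using T2 by linarith
 have "emeasure lborel (jump_set T Y) \<le> (\<Sum>m\<in>M. emeasure lborel {sqrt (real m) - Y..sqrt (real m) + Y})"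
  unfolding jump_set_def M_def by (intro emeasure_subadditive_finite) auto
 also have "\<dots> = (\<Sum>m\<in>M. ennreal (2 * Y))" using assms by simp
 also have "\<dots> = ennreal (real (card M) * (2 * Y))" using assms by (simp add: ennreal_of_nat_eq_real_of_nat ennreal_mult)
 also have "\<dots> \<le> ennreal (20 * T\<^sup>2 * Y)" using mult_right_mono[OF cM, of "2 * Y"] assms by (intro ennreal_leI) simp
 finally show ?thesis .
qed

text \<open>Away from the jumps the counts at t - 2 Y, t and t + 2 Y coincide, so smoothing in the
  radius costs nothing. What is left is the kernel mass outside the cores, at most 2 \<eta> per
  lattice point.\<close>

lemma lattice_count_osc_sum:
 "\<exists>C\<ge>0. \<forall>T t H. 4 \<le> T \<longrightarrow> T \<le> t \<longrightarrow> t \<le> 2 * T + 1 \<longrightarrow> T ^ 8 \<le> real H \<longrightarrow> t \<notin> jump_set T (2 / T\<^sup>2) \<longrightarrow>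
   \<bar>real (lattice_count t) - pi * t\<^sup>2 - sqrt t * osc_sum H t\<bar> \<le> C * T powr (- 1 / 2)"
proof -
 obtain C where C: "C \<ge> 0" "\<And>H t. 0 < H \<Longrightarrow> 1 \<le> t \<Longrightarrow> \<bar>smooth_count H t - pi * t\<^sup>2 - sqrt t * osc_sum H t\<bar> \<le> C * t powr (- 1 / 2)"
  using smooth_count_asymp by blast
 show ?thesis
 proof (intro exI[of _ "C + 1000"] conjI allI impI)
  show "0 \<le> C + 1000" using C by simp
  fix T t :: real and H :: nat
  assume T: "4 \<le> T" and t: "T \<le> t" "t \<le> 2 * T + 1" and HT: "T ^ 8 \<le> real H" and nj: "t \<notin> jump_set T (2 / T\<^sup>2)"
  have T0: "0 < T" and T1: "1 \<le> T" using T by simp_all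
  have H: "0 < H" using HT zero_less_power[OF T0, of 8] by (cases "H = 0") auto
  \<comment> \<open>With O(T^2) possible jumps, width O(T^(-2)) keeps the excluded measure bounded.
    A kernel degree of at least T^8 then makes \<eta> <= T^(-4), so that \<eta> times the number of
    lattice points is O(T^(-2)).\<close>
  define Y where "Y = 1 / T\<^sup>2"
  define \<eta> where "\<eta> = 1 / (real H * Y\<^sup>2)"
  have T2: "16 \<le> T\<^sup>2" using power_mono[of 4 T 2] T by simp
  have Y: "0 < Y" "Y < 1 / 4" using T2 T0 by (simp_all add: Y_def divide_less_eq)
  have T48: "T ^ 8 = T ^ 4 * T ^ 4" "T ^ 4 = T\<^sup>2 * T\<^sup>2" by (simp_all only: power_add[symmetric]) simp_all
  have "\<eta> = T ^ 4 / real H" unfolding \<eta>_def Y_def T48(2) by (simp add: power2_eq_square)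
  also have "\<dots> \<le> T ^ 4 / T ^ 8" using HT T0 by (intro divide_left_mono mult_pos_pos) (use H in auto)
  also have "\<dots> = 1 / T ^ 4" unfolding T48(1) by (rule nonzero_divide_mult_cancel_left) (use T0 in simp)
  finally have e4: "\<eta> \<le> 1 / T ^ 4" .
  have "1 \<le> T ^ 4" using T1 by simp
  then have e1: "\<eta> \<le> 1" using e4 order_trans[of \<eta> "1 / T ^ 4" 1] T0 by (simp add: divide_le_eq)
  have e0: "0 \<le> \<eta>" by (simp add: \<eta>_def)
  have eqc: "lattice_count (t - 2 * Y) = lattice_count (t + 2 * Y)"
  proof (rule ccontr)
   assume "lattice_count (t - 2 * Y) \<noteq> lattice_count (t + 2 * Y)"
   from lattice_count_jump[OF this] Y t T0 obtain m where m: "real m \<le> (t + 2 * Y)\<^sup>2" "t - 2 * Y < sqrt (real m)" "sqrt (real m) \<le> t + 2 * Y"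
    by auto
   have "(t + 2 * Y)\<^sup>2 \<le> (3 * T)\<^sup>2" using t Y T by (intro power_mono) auto
   then have "real m \<le> 9 * T\<^sup>2" using m(1) by (simp add: power_mult_distrib)
   moreover have "t \<in> {sqrt (real m) - 2 / T\<^sup>2..sqrt (real m) + 2 / T\<^sup>2}" using m by (simp add: Y_def)
   ultimately show False using nj unfolding jump_set_def by blast
  qed
  have "lattice_count (t - 2 * Y) \<le> lattice_count t" "lattice_count t \<le> lattice_count (t + 2 * Y)"
   using Y by (auto intro!: lattice_count_mono)
  then have N: "lattice_count (t - 2 * Y) = lattice_count t" "lattice_count (t + 2 * Y) = lattice_count t" using eqc by auto
  define N1 where "N1 = real (lattice_count (t + 1))"
  have low: "(1 - 2 * \<eta>) * real (lattice_count t) \<le> smooth_count H t"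
   using smooth_count_lower[OF H Y \<eta>_def e1, of t] by (simp only: N)
  have up: "smooth_count H t \<le> real (lattice_count t) + 2 * \<eta> * N1"
   using smooth_count_upper[OF H Y \<eta>_def e1, of t] by (simp only: N N1_def)
  have NN: "real (lattice_count t) \<le> N1" unfolding N1_def by (simp add: lattice_count_mono)
  have "\<eta> * real (lattice_count t) \<le> \<eta> * N1" using NN e0 by (rule mult_left_mono)
  then have 1: "\<bar>smooth_count H t - real (lattice_count t)\<bar> \<le> 2 * (\<eta> * N1)"
   using low up by (simp add: algebra_simps abs_le_iff)
  have "N1 \<le> pi * (t + 1)\<^sup>2 + 8 * (t + 1)" unfolding N1_def using lattice_count_gauss[of "t + 1"] t T by simp
  also have "\<dots> \<le> 4 * (3 * T)\<^sup>2 + 8 * (3 * T)"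
   using t T pi_less_4 by (intro add_mono mult_mono power_mono) auto
  also have "\<dots> \<le> 60 * T\<^sup>2" using mult_right_mono[OF T1, of T] T0 by (simp add: power2_eq_square)
  finally have N1: "N1 \<le> 60 * T\<^sup>2" .
  have "\<eta> * N1 \<le> 1 / T ^ 4 * (60 * T\<^sup>2)" using e4 N1 T0 by (intro mult_mono) (auto simp: N1_def)
  also have "\<dots> = 60 * (1 / T\<^sup>2)" unfolding T48(2) using T0 by (simp add: divide_simps)
  also have "1 / T\<^sup>2 = T powr (- 2)" using T0 by (simp add: powr_minus powr_numeral divide_inverse)
  also have "T powr (- 2) \<le> T powr (- 1 / 2)" using T1 by (intro powr_mono) auto
  finally have 2: "\<eta> * N1 \<le> 60 * T powr (- 1 / 2)" by simp
  have "t powr (- 1 / 2) \<le> T powr (- 1 / 2)" using t T0 by (intro powr_mono2') auto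
  then have "C * t powr (- 1 / 2) \<le> C * T powr (- 1 / 2)" using C(1) by (rule mult_left_mono)
  then have 3: "\<bar>smooth_count H t - pi * t\<^sup>2 - sqrt t * osc_sum H t\<bar> \<le> C * T powr (- 1 / 2)"
   using C(2)[OF H, of t] t T by linarith
  have "0 \<le> T powr (- 1 / 2)" by simp
  then show "\<bar>real (lattice_count t) - pi * t\<^sup>2 - sqrt t * osc_sum H t\<bar> \<le> (C + 1000) * T powr (- 1 / 2)"
   using 1 2 3 unfolding distrib_right abs_le_iff by linarith
 qed
qed

lemma sqrt_ratio_le: "0 < t \<Longrightarrow> 0 \<le> r \<Longrightarrow> sqrt (t + r) - sqrt t \<le> r / sqrt (t::real)"
proof -
 assume t: "0 < t" "0 \<le> r"
 have "(sqrt (t + r) - sqrt t) * sqrt t \<le> (sqrt (t + r) - sqrt t) * (sqrt (t + r) + sqrt t)"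
  using t by (intro mult_left_mono) auto
 also have "\<dots> = r" using t by (simp add: algebra_simps)
 finally show ?thesis using t by (simp add: le_divide_eq)
qed

text \<open>W consists of the jump neighbourhoods and their translate by r, each of measure at most
  20 T^2 (2 / T^2) = 40; it is fixed before H and t. The count at t + r carries the factor sqrt(t +
  r) whereas the remainder is normalised by sqrt t, which leaves a term (sqrt(t + r) - sqrt t) F1 to
  be bounded.\<close>

lemma annulus_remainder_osc_sum:
 "\<exists>C\<ge>0. \<forall>T r. 4 \<le> T \<longrightarrow> 0 < r \<longrightarrow> r < 1 \<longrightarrow> (\<exists>W \<in> sets borel. emeasure lborel W \<le> 80 \<and>
   (\<forall>H t. T ^ 8 \<le> real H \<longrightarrow> t \<in> {T..2 * T} - W \<longrightarrow> \<bar>annulus_remainder t r - (osc_sum H (t + r) - osc_sum H t)\<bar> \<le> C * T powr (- 1 / 2)))"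
proof -
 obtain C where C: "C \<ge> 0" "\<And>T t H. 4 \<le> T \<Longrightarrow> T \<le> t \<Longrightarrow> t \<le> 2 * T + 1 \<Longrightarrow> T ^ 8 \<le> real H \<Longrightarrow> t \<notin> jump_set T (2 / T\<^sup>2) \<Longrightarrow>
   \<bar>real (lattice_count t) - pi * t\<^sup>2 - sqrt t * osc_sum H t\<bar> \<le> C * T powr (- 1 / 2)"
  using lattice_count_osc_sum by blast
 show ?thesis
 proof (intro exI[of _ "2 * C + (32 + C)"] conjI allI impI)
  show "0 \<le> 2 * C + (32 + C)" using C by simp
  fix T r :: real assume T: "4 \<le> T" and r: "0 < r" "r < 1"
  define J where "J = jump_set T (2 / T\<^sup>2)"
  define W where "W = J \<union> (\<lambda>t. t + r) -` J"
  have T0: "0 < T" and T1: "1 \<le> T" using T by simp_all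
  have Js [measurable]: "J \<in> sets borel" by (simp add: J_def)
  have mt: "(\<lambda>t. t + r) \<in> measurable borel borel" by measurable
  have sh: "(\<lambda>t. t + r) -` J \<in> sets borel" using measurable_sets[OF mt Js] by simp
  have eJ: "emeasure lborel J \<le> ennreal 40"
   unfolding J_def using measure_jump_set_le[OF T1, of "2 / T\<^sup>2"] T0 by simp
  have pl: "(\<lambda>t. t + r) = (+) r" by (auto simp: add.commute)
  have "emeasure lborel ((\<lambda>t. t + r) -` J) = emeasure (distr lborel borel (\<lambda>t. t + r)) J"
   by (subst emeasure_distr) auto
  also have "distr lborel borel (\<lambda>t. t + r) = lborel"
   unfolding pl by (rule lborel_distr_plus)
  finally have eJ2: "emeasure lborel ((\<lambda>t. t + r) -` J) \<le> ennreal 40" using eJ by simp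
  have "emeasure lborel W \<le> emeasure lborel J + emeasure lborel ((\<lambda>t. t + r) -` J)"
   unfolding W_def using sh by (intro emeasure_subadditive) auto
  also have "\<dots> \<le> ennreal 40 + ennreal 40" by (intro add_mono eJ eJ2)
  finally have eW: "emeasure lborel W \<le> 80" by (simp flip: ennreal_plus)
  show "\<exists>W \<in> sets borel. emeasure lborel W \<le> 80 \<and>
   (\<forall>H t. T ^ 8 \<le> real H \<longrightarrow> t \<in> {T..2 * T} - W \<longrightarrow> \<bar>annulus_remainder t r - (osc_sum H (t + r) - osc_sum H t)\<bar> \<le> (2 * C + (32 + C)) * T powr (- 1 / 2))"
  proof (intro bexI[of _ W] conjI allI impI eW)
   show "W \<in> sets borel" unfolding W_def using sh by simp
   fix H t assume H: "T ^ 8 \<le> real H" and t: "t \<in> {T..2 * T} - W"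
   define F0 F1 u where "F0 = osc_sum H t" and "F1 = osc_sum H (t + r)" and "u = t + r"
   have tT: "T \<le> t" "t \<le> 2 * T" "1 \<le> t" using t T by auto
   define e where "e = C * T powr (- 1 / 2)"
   define N0 N1 where "N0 = real (lattice_count t)" and "N1 = real (lattice_count u)"
   have e0: "0 \<le> e" using C by (simp add: e_def)
   have b0: "\<bar>N0 - pi * t\<^sup>2 - sqrt t * F0\<bar> \<le> e"
    unfolding F0_def e_def N0_def by (rule C(2)[OF T]) (use t H r in \<open>auto simp: W_def J_def\<close>)
   have b1: "\<bar>N1 - pi * u\<^sup>2 - sqrt u * F1\<bar> \<le> e"
    unfolding F1_def e_def N1_def u_def by (rule C(2)[OF T]) (use t H r in \<open>auto simp: W_def J_def\<close>)
   have s1: "1 \<le> sqrt t" using tT by simp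
   have u: "1 \<le> u" "u \<le> 2 * t" using tT r by (auto simp: u_def)
   have g1: "\<bar>N1 - pi * u\<^sup>2\<bar> \<le> 8 * u" unfolding N1_def using u(1) by (rule lattice_count_gauss)
   have eC: "e \<le> C" using C(1) powr_mono[of "-1/2" 0 T] T1 mult_left_mono[of "T powr (-1/2)" 1 C] by (simp add: e_def)
   \<comment> \<open>Gauss's bound for the count is enough: it gives F1 = O(sqrt t), the difference
     of the roots is at most 1 / sqrt t, and their product O(1) is still divided by sqrt t.\<close>
   have "\<bar>sqrt u * F1\<bar> \<le> 8 * u + e" using b1 g1 by linarith
   also have "\<dots> \<le> 16 * t + C * t" using u eC mult_left_mono[OF tT(3) C(1)] by simp
   finally have sF: "\<bar>sqrt u * F1\<bar> \<le> (16 + C) * t" by (simp add: algebra_simps)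
   have "sqrt t * \<bar>F1\<bar> \<le> sqrt u * \<bar>F1\<bar>" using r by (intro mult_right_mono) (auto simp: u_def)
   also have "\<dots> = \<bar>sqrt u * F1\<bar>" using u by (simp add: abs_mult)
   also note sF
   also have "(16 + C) * t = sqrt t * ((16 + C) * sqrt t)" using tT by simp
   finally have F1: "\<bar>F1\<bar> \<le> (16 + C) * sqrt t" using s1 by simp
   have d: "0 \<le> sqrt u - sqrt t" "sqrt u - sqrt t \<le> 1 / sqrt t"
   proof -
    show "0 \<le> sqrt u - sqrt t" using r by (simp add: u_def)
    have "sqrt u - sqrt t \<le> r / sqrt t" unfolding u_def using tT r by (intro sqrt_ratio_le) auto
    also have "\<dots> \<le> 1 / sqrt t" using r s1 by (intro divide_right_mono) auto
    finally show "sqrt u - sqrt t \<le> 1 / sqrt t" .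
   qed
   have "\<bar>(sqrt u - sqrt t) * F1\<bar> \<le> 1 / sqrt t * ((16 + C) * sqrt t)"
    unfolding abs_mult using d F1 s1 by (intro mult_mono) auto
   also have "\<dots> = 16 + C" using s1 by simp
   finally have x: "\<bar>(sqrt u - sqrt t) * F1\<bar> \<le> 16 + C" .
   have "annulus_remainder t r * sqrt t = N1 - N0 - pi * (2 * t * r + r\<^sup>2)"
    using s1 by (simp add: annulus_remainder_def N1_def N0_def u_def)
   also have "\<dots> = (N1 - pi * u\<^sup>2) - (N0 - pi * t\<^sup>2)" by (simp add: u_def power2_eq_square algebra_simps)
   finally have "(annulus_remainder t r - (F1 - F0)) * sqrt t =
     (N1 - pi * u\<^sup>2 - sqrt u * F1) - (N0 - pi * t\<^sup>2 - sqrt t * F0) + (sqrt u - sqrt t) * F1"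
    by (simp add: algebra_simps)
   then have "\<bar>(annulus_remainder t r - (F1 - F0)) * sqrt t\<bar> \<le> 2 * e + (16 + C)" using b0 b1 x by linarith
   then have "\<bar>annulus_remainder t r - (F1 - F0)\<bar> \<le> (2 * e + (16 + C)) / sqrt t"
    using s1 by (simp add: abs_mult le_divide_eq)
   also have "\<dots> \<le> (2 * C + (32 + C)) / sqrt T" using eC tT T0 e0 C(1) by (intro frac_le) auto
   also have "\<dots> = (2 * C + (32 + C)) * T powr (- 1 / 2)" using T0 by (simp add: powr_minus_divide powr_half_sqrt[symmetric])
   finally show "\<bar>annulus_remainder t r - (osc_sum H (t + r) - osc_sum H t)\<bar> \<le> (2 * C + (32 + C)) * T powr (- 1 / 2)"
    by (simp only: F0_def F1_def)
  qed
 qed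
qed

definition osc_coeff :: "nat \<Rightarrow> real \<Rightarrow> nat \<Rightarrow> complex" where
 "osc_coeff H r n = of_real (wt H n / pi * real n powr (- 3 / 4)) * (cis (- 3 * pi / 4) * (cis (2 * pi * sqrt (real n) * r) - 1))"

lemma osc_sum_diff: "osc_sum H (t + r) - osc_sum H t = Re (trig {1..2 * H\<^sup>2} (osc_coeff H r) t)"
proof -
 have "wt H n / pi * real n powr (- 3 / 4) * cos (2 * pi * sqrt (real n) * (t + r) - 3 * pi / 4)
   - wt H n / pi * real n powr (- 3 / 4) * cos (2 * pi * sqrt (real n) * t - 3 * pi / 4)
   = Re (osc_coeff H r n * cis (2 * pi * sqrt (real n) * t))" for n
 proof -
  define a x y z where "a = wt H n / pi * real n powr (- 3 / 4)" and "x = - 3 * pi / 4"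
   and "y = 2 * pi * sqrt (real n) * r" and "z = 2 * pi * sqrt (real n) * t"
  have e: "2 * pi * sqrt (real n) * (t + r) - 3 * pi / 4 = x + y + z" "z - 3 * pi / 4 = x + z"
   by (simp_all add: x_def y_def z_def distrib_left)
  have "of_real a * (cis x * (cis y - 1)) * cis z = of_real a * (cis x * cis y * cis z - cis x * cis z)"
   by (simp only: ring_distribs mult_1_right mult.assoc)
  then have "of_real a * (cis x * (cis y - 1)) * cis z = of_real a * (cis (x + y + z) - cis (x + z))"
   by (simp only: cis_mult)
  then have "Re (of_real a * (cis x * (cis y - 1)) * cis z) = a * cos (x + y + z) - a * cos (x + z)"
   by (simp add: right_diff_distrib)
  then have "a * cos (2 * pi * sqrt (real n) * (t + r) - 3 * pi / 4) - a * cos (z - 3 * pi / 4) = Re (of_real a * (cis x * (cis y - 1)) * cis z)"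
   by (simp only: e)
  then show ?thesis by (simp only: osc_coeff_def a_def x_def y_def z_def)
 qed
 then have "(\<Sum>n=1..2 * H\<^sup>2. wt H n / pi * real n powr (- 3 / 4) * cos (2 * pi * sqrt (real n) * (t + r) - 3 * pi / 4)
   - wt H n / pi * real n powr (- 3 / 4) * cos (2 * pi * sqrt (real n) * t - 3 * pi / 4))
   = (\<Sum>n=1..2 * H\<^sup>2. Re (osc_coeff H r n * cis (2 * pi * sqrt (real n) * t)))"
  by (rule sum.cong[OF refl])
 then show ?thesis unfolding osc_sum_def trig_def Re_sum by (rule trans[OF sum_subtractf[symmetric]])
qed

lemma norm_osc_coeff: "norm (osc_coeff H r n) = 2 * wt H n / pi * real n powr (- 3 / 4) * \<bar>sin (pi * sqrt (real n) * r)\<bar>"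
proof -
 define x where "x = pi * sqrt (real n) * r"
 have "cis (2 * x) - 1 = cis x * (cis x - cis (- x))"
  unfolding right_diff_distrib cis_mult by simp
 also have "cis x - cis (- x) = 2 * \<i> * of_real (sin x)" by (simp add: complex_eq_iff)
 finally have "norm (cis (2 * x) - 1) = 2 * \<bar>sin x\<bar>" by (simp add: norm_mult)
 moreover have "2 * pi * sqrt (real n) * r = 2 * x" by (simp add: x_def)
 ultimately have "norm (cis (2 * pi * sqrt (real n) * r) - 1) = 2 * \<bar>sin x\<bar>" by (simp only:)
 then have "norm (osc_coeff H r n) = \<bar>wt H n / pi * real n powr (- 3 / 4)\<bar> * (1 * (2 * \<bar>sin x\<bar>))"
  by (simp only: osc_coeff_def norm_mult norm_of_real norm_cis)
 also have "\<bar>wt H n / pi * real n powr (- 3 / 4)\<bar> = wt H n / pi * real n powr (- 3 / 4)"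
  using wt_nonneg by (intro abs_of_nonneg) simp
 finally show ?thesis by (simp add: x_def mult_ac)
qed

section \<open>Estimates for the normalised coefficients\<close>

text \<open>Throughout, \<open>N\<close> stands for \<open>\<rho> powr (- 2)\<close>; in this parameter \<open>\<sigma>\<close> equals \<open>sg N\<close>.\<close>

definition sg :: "real \<Rightarrow> real" where "sg N = sqrt (8 * ln N / sqrt N)"

definition cf :: "nat \<Rightarrow> real \<Rightarrow> nat \<Rightarrow> complex" where
 "cf H N n = osc_coeff H (1 / sqrt N) n / of_real (sg N)"

lemma ln_ge_1: "3 \<le> x \<Longrightarrow> 1 \<le> ln (x::real)"
 using exp_le by (simp add: ln_ge_iff)

lemma sg_pos: "1 < N \<Longrightarrow> 0 < sg N"
 by (simp add: sg_def)

lemma var_density_nonneg: "0 \<le> var_density y"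
 by (simp add: var_density_def)

lemma var_density_le: "var_density y \<le> y powr (- 3 / 2)"
 unfolding var_density_def by (rule mult_left_le_one_le) (auto simp: abs_square_le_1)

lemma var_density_le_near_0:
 assumes y: "0 < y" shows "var_density y \<le> pi\<^sup>2 * y powr (- 1 / 2)"
proof -
 have "\<bar>sin (pi * sqrt y)\<bar> \<le> \<bar>pi * sqrt y\<bar>" by (rule abs_sin_x_le_abs_x)
 then have "(sin (pi * sqrt y))\<^sup>2 \<le> (pi * sqrt y)\<^sup>2" by (simp only: abs_le_square_iff)
 also have "\<dots> = pi\<^sup>2 * y" using y by (simp add: power_mult_distrib)
 finally have "var_density y \<le> (pi\<^sup>2 * y) * y powr (- 3 / 2)" unfolding var_density_def by (rule mult_right_mono) simp
 also have "\<dots> = pi\<^sup>2 * (y powr 1 * y powr (- 3 / 2))" using y by simp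
 also have "y powr 1 * y powr (- 3 / 2) = y powr (- 1 / 2)" unfolding powr_add[symmetric] by simp
 finally show ?thesis .
qed

lemma norm_cf: "1 < N \<Longrightarrow> norm (cf H N n) = 2 * wt H n / pi * real n powr (- 3 / 4) * \<bar>sin (pi * sqrt (real n / N))\<bar> / sg N"
 using sg_pos[of N] by (simp add: cf_def norm_divide norm_osc_coeff real_sqrt_divide)

lemma norm_cf_square:
 assumes N: "1 < N" and n: "1 \<le> n"
 shows "(norm (cf H N n))\<^sup>2 = (wt H n)\<^sup>2 * var_density (real n / N) / (2 * pi\<^sup>2 * (N * ln N))"
proof -
 define s where "s = sin (pi * sqrt (real n / N))"
 have "(real n powr (- 3 / 4))\<^sup>2 = real n powr (- 3 / 2)" by (simp add: power2_eq_square powr_add[symmetric])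
 moreover have "(sg N)\<^sup>2 = 8 * ln N / sqrt N" using N by (simp add: sg_def)
 ultimately have "(norm (cf H N n))\<^sup>2 = 4 * (wt H n)\<^sup>2 / pi\<^sup>2 * real n powr (- 3 / 2) * s\<^sup>2 / (8 * ln N / sqrt N)"
  unfolding norm_cf[OF N] s_def by (simp only: power_mult_distrib power_divide power2_abs) simp
 moreover have "var_density (real n / N) = s\<^sup>2 * (real n powr (- 3 / 2) * (N * sqrt N))"
 proof -
  have "N powr (- 3 / 2) = 1 / N powr (1 + 1 / 2)" by (simp add: powr_minus_divide[symmetric])
  also have "N powr (1 + 1 / 2) = N * sqrt N" unfolding powr_add using N by (simp add: powr_half_sqrt)
  finally have "(real n / N) powr (- 3 / 2) = real n powr (- 3 / 2) * (N * sqrt N)"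
   using N by (simp add: powr_divide)
  then show ?thesis by (simp add: var_density_def s_def)
 qed
 moreover have "0 < ln N" "0 < sqrt N" "0 < N" using N by auto
 ultimately show ?thesis by (simp add: field_simps)
qed

lemma norm_cf_le:
 assumes N: "3 \<le> N" and H: "0 < H"
 shows "norm (cf H N n) \<le> real (r2 n) * real n powr (- 3 / 4) * N powr (1 / 4)"
proof -
 define x where "x = wt H n * real n powr (- 3 / 4)"
 have x0: "0 \<le> x" by (simp add: x_def wt_nonneg)
 have N1: "1 < N" using N by simp
 have "1 / sqrt N \<le> 8 * ln N / sqrt N" using ln_ge_1[OF N] N by (intro divide_right_mono) auto
 then have "sqrt (1 / sqrt N) \<le> sg N" unfolding sg_def by (rule real_sqrt_le_mono)
 moreover have "sqrt (1 / sqrt N) = 1 / N powr (1 / 4)"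
  using N by (simp add: real_sqrt_divide powr_half_sqrt[symmetric] powr_powr)
 ultimately have sg: "1 / N powr (1 / 4) \<le> sg N" by simp
 then have sg': "1 / sg N \<le> N powr (1 / 4)" using sg_pos[OF N1] N by (simp add: field_simps)
 have "norm (cf H N n) = (x * (2 / pi)) * \<bar>sin (pi * sqrt (real n / N))\<bar> * (1 / sg N)"
  unfolding norm_cf[OF N1] x_def by simp
 also have "\<dots> \<le> (x * 1) * 1 * N powr (1 / 4)"
  using x0 sg' sg_pos[OF N1] pi_ge_two by (intro mult_mono mult_left_mono) auto
 also have "\<dots> \<le> (real (r2 n) * real n powr (- 3 / 4)) * N powr (1 / 4)"
  unfolding x_def using wt_le[OF H, of n] by (simp add: mult_right_mono)
 finally show ?thesis .
qed

text \<open>The squared coefficient with r(n) in place of the kernel weight, up to the factor 2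
  pi^2. The scaling by N ln N matches the asymptotics 4 x ln x of the sums of r(n)^2.\<close>

definition energy :: "real \<Rightarrow> nat \<Rightarrow> real" where
 "energy N n = (real (r2 n))\<^sup>2 * var_density (real n / N) / (N * ln N)"

lemma energy_nonneg: "1 \<le> N \<Longrightarrow> 0 \<le> energy N n"
 by (simp add: energy_def var_density_nonneg)

text \<open>For small n the bound sin(x)^2 <= x^2 applies. The sum of r(n)^2 / sqrt n up to N / K is
  O(ln N sqrt(N / K)), and division by sqrt N ln N leaves 1 / sqrt K. The condition K <= N keeps the
  range from being empty.\<close>

lemma energy_low:
 "\<exists>C\<ge>0. \<forall>K\<ge>1. \<forall>N\<ge>3. K \<le> N \<longrightarrow> (\<forall>S. finite S \<longrightarrow> (\<forall>n\<in>S. 1 \<le> n \<and> real n \<le> N / K) \<longrightarrow>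
   (\<Sum>n\<in>S. energy N n) \<le> C / sqrt K)"
proof -
 obtain C where C: "C \<ge> 0" "\<And>X. 1 \<le> X \<Longrightarrow> (\<Sum>n=1..X. (real (r2 n))\<^sup>2 / sqrt (real n)) \<le> C * (1 + ln (real X)) * sqrt (real X)"
  using r2_square_low_sum by blast
 show ?thesis
 proof (intro exI[of _ "2 * pi\<^sup>2 * C"] conjI allI impI)
  show "0 \<le> 2 * pi\<^sup>2 * C" using C(1) by simp
  fix K N :: real and S :: "nat set"
  assume K: "1 \<le> K" and N: "3 \<le> N" and KN: "K \<le> N" and S: "finite S" "\<forall>n\<in>S. 1 \<le> n \<and> real n \<le> N / K"
  define X where "X = nat \<lfloor>N / K\<rfloor>"
  define L where "L = ln N"
  have L: "1 \<le> L" using ln_ge_1[OF N] by (simp add: L_def)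
  have "1 \<le> N / K" using K KN by (simp add: le_divide_eq)
  then have X: "1 \<le> X" "real X \<le> N / K" unfolding X_def by (simp_all add: le_nat_iff)
  have "N / K \<le> N / 1" using K N by (intro divide_left_mono) auto
  then have "real X \<le> N" using X by simp
  then have lX: "ln (real X) \<le> L" unfolding L_def using X N by (subst ln_le_cancel_iff) auto
  have sub: "S \<subseteq> {1..X}" using S by (auto simp: X_def le_nat_floor)
  have e: "energy N n \<le> pi\<^sup>2 / (sqrt N * L) * ((real (r2 n))\<^sup>2 / sqrt (real n))" if n: "1 \<le> n" for n
  proof -
   have "var_density (real n / N) \<le> pi\<^sup>2 * (real n / N) powr (- 1 / 2)" using n N by (intro var_density_le_near_0) auto
   also have "(real n / N) powr (- 1 / 2) = sqrt N / sqrt (real n)"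
    using n N by (simp add: powr_minus_divide powr_half_sqrt real_sqrt_divide)
   finally have "energy N n \<le> (real (r2 n))\<^sup>2 * (pi\<^sup>2 * (sqrt N / sqrt (real n))) / (N * L)"
    unfolding energy_def L_def[symmetric] using N L by (intro divide_right_mono mult_left_mono) auto
   also have "\<dots> = pi\<^sup>2 * (real (r2 n))\<^sup>2 / (sqrt (real n) * L) * (sqrt N / N)" by (simp add: mult_ac)
   also have "sqrt N / N = 1 / sqrt N" using N by (simp add: real_sqrt_divide[symmetric] real_div_sqrt field_simps)
   finally show ?thesis by (simp add: mult_ac)
  qed
  have "(\<Sum>n\<in>S. energy N n) \<le> (\<Sum>n=1..X. energy N n)"
   using sub N by (intro sum_mono2) (auto intro: energy_nonneg)
  also have "\<dots> \<le> (\<Sum>n=1..X. pi\<^sup>2 / (sqrt N * L) * ((real (r2 n))\<^sup>2 / sqrt (real n)))" by (intro sum_mono e) auto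
  also have "\<dots> = pi\<^sup>2 / (sqrt N * L) * (\<Sum>n=1..X. (real (r2 n))\<^sup>2 / sqrt (real n))" by (rule sum_distrib_left[symmetric])
  also have "\<dots> \<le> pi\<^sup>2 / (sqrt N * L) * (C * (2 * L) * (sqrt N / sqrt K))"
  proof (rule mult_left_mono)
   have "sqrt (real X) \<le> sqrt N / sqrt K" using X(2) by (simp add: real_sqrt_divide[symmetric])
   then have "C * (1 + ln (real X)) * sqrt (real X) \<le> C * (2 * L) * (sqrt N / sqrt K)"
    using C(1) L lX X by (intro mult_mono mult_left_mono) auto
   then show "(\<Sum>n=1..X. (real (r2 n))\<^sup>2 / sqrt (real n)) \<le> C * (2 * L) * (sqrt N / sqrt K)" using C(2)[OF X(1)] by linarith
  qed (use N L in simp)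
  also have "\<dots> = 2 * pi\<^sup>2 * C / sqrt K" using N L by simp
  finally show "(\<Sum>n\<in>S. energy N n) \<le> 2 * pi\<^sup>2 * C / sqrt K" .
 qed
qed

text \<open>For large n the sine is bounded by 1, and the tail of r(n)^2 n^(-3/2) beyond K N is of
  order ln(K N) / sqrt(K N). Here K <= N ensures ln(K N) <= 2 ln N, so that the constant does not
  depend on K.\<close>

lemma energy_high:
 "\<exists>C\<ge>0. \<forall>K\<ge>1. \<forall>N\<ge>3. K \<le> N \<longrightarrow> (\<forall>S. finite S \<longrightarrow> (\<forall>n\<in>S. K * N < real n) \<longrightarrow>
   (\<Sum>n\<in>S. energy N n) \<le> C / sqrt K)"
proof -
 obtain C where C: "C \<ge> 0" "\<And>Y N. 1 \<le> Y \<Longrightarrow> (\<Sum>n\<in>{Y<..N}. (real (r2 n))\<^sup>2 * real n powr (- 3 / 2)) \<le> C * (1 + ln (real Y)) / sqrt (real Y)"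
  using r2_square_high_sum by blast
 show ?thesis
 proof (intro exI[of _ "6 * C"] conjI allI impI)
  show "0 \<le> 6 * C" using C(1) by simp
  fix K N :: real and S :: "nat set"
  assume K: "1 \<le> K" and N: "3 \<le> N" and KN: "K \<le> N" and S: "finite S" "\<forall>n\<in>S. K * N < real n"
  define Y where "Y = nat \<lfloor>K * N\<rfloor>"
  define L where "L = ln N"
  have L: "1 \<le> L" using ln_ge_1[OF N] by (simp add: L_def)
  have KN3: "3 \<le> K * N" using mult_mono[of 1 K 3 N] K N by simp
  then have Y: "1 \<le> Y" "real Y \<le> K * N" "K * N < real Y + 1" unfolding Y_def by linarith+
  have "ln (real Y) \<le> ln (K * N)" using Y KN3 by (subst ln_le_cancel_iff) auto
  also have "\<dots> = ln K + ln N" using K N by (simp add: ln_mult)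
  also have "\<dots> \<le> 2 * L" unfolding L_def using K KN by (simp add: ln_le_cancel_iff)
  finally have lY: "ln (real Y) \<le> 2 * L" .
  have "K * N / 4 \<le> real Y" using Y by linarith
  then have "sqrt (K * N / 4) \<le> sqrt (real Y)" by (rule real_sqrt_le_mono)
  then have sY: "sqrt K * sqrt N / 2 \<le> sqrt (real Y)" by (simp add: real_sqrt_mult real_sqrt_divide)
  have sub: "S \<subseteq> {Y<..Max S}"
  proof
   fix n assume n: "n \<in> S"
   then have "real Y < real n" using S(2) Y(2) by force
   then show "n \<in> {Y<..Max S}" using n S(1) by simp
  qed
  have e: "energy N n \<le> sqrt N / L * ((real (r2 n))\<^sup>2 * real n powr (- 3 / 2))" for n
  proof -
   have "var_density (real n / N) \<le> (real n / N) powr (- 3 / 2)" by (rule var_density_le)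
   also have "N powr (- 3 / 2) = 1 / N powr (1 + 1 / 2)" by (simp add: powr_minus_divide[symmetric])
   then have "(real n / N) powr (- 3 / 2) = real n powr (- 3 / 2) * (N * sqrt N)"
    unfolding powr_add using N by (simp add: powr_divide powr_half_sqrt)
   finally have "energy N n \<le> (real (r2 n))\<^sup>2 * (real n powr (- 3 / 2) * (N * sqrt N)) / (N * L)"
    unfolding energy_def L_def[symmetric] using N L by (intro divide_right_mono mult_left_mono) auto
   also have "\<dots> = sqrt N / L * ((real (r2 n))\<^sup>2 * real n powr (- 3 / 2))" using N by simp
   finally show ?thesis .
  qed
  have "(\<Sum>n\<in>S. energy N n) \<le> (\<Sum>n\<in>{Y<..Max S}. energy N n)"
   using sub N by (intro sum_mono2) (auto intro: energy_nonneg)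
  also have "\<dots> \<le> (\<Sum>n\<in>{Y<..Max S}. sqrt N / L * ((real (r2 n))\<^sup>2 * real n powr (- 3 / 2)))" by (intro sum_mono e)
  also have "\<dots> = sqrt N / L * (\<Sum>n\<in>{Y<..Max S}. (real (r2 n))\<^sup>2 * real n powr (- 3 / 2))" by (rule sum_distrib_left[symmetric])
  also have "\<dots> \<le> sqrt N / L * (C * (3 * L) / (sqrt K * sqrt N / 2))"
  proof (rule mult_left_mono)
   have "C * (1 + ln (real Y)) / sqrt (real Y) \<le> C * (3 * L) / (sqrt K * sqrt N / 2)"
    using C(1) L lY sY K N by (intro frac_le mult_left_mono) auto
   then show "(\<Sum>n\<in>{Y<..Max S}. (real (r2 n))\<^sup>2 * real n powr (- 3 / 2)) \<le> C * (3 * L) / (sqrt K * sqrt N / 2)"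
    using C(2)[OF Y(1), of "Max S"] by linarith
  qed (use N L in simp)
  also have "\<dots> = 6 * C / sqrt K" using N L K by simp
  finally show "(\<Sum>n\<in>S. energy N n) \<le> 6 * C / sqrt K" .
 qed
qed

lemma powr_inverse_base: "0 < (x::real) \<Longrightarrow> (1 / x) powr (- a) = x powr a"
 using powr_powr[of x "-1" "- a"] by (simp add: powr_minus_divide)

lemma card_nat_le: "0 \<le> x \<Longrightarrow> real (card {m. real m \<le> x}) \<le> x + 1"
proof -
 assume x: "0 \<le> x"
 have "card {m. real m \<le> x} \<le> card {..nat \<lfloor>x\<rfloor>}" by (rule card_mono) (auto simp: le_nat_floor)
 then have "real (card {m. real m \<le> x}) \<le> real (nat \<lfloor>x\<rfloor>) + 1" by simp
 then show ?thesis using of_nat_floor[OF x] by linarith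
qed

section \<open>The frequency window and its square classes\<close>

definition window :: "real \<Rightarrow> real \<Rightarrow> nat set" where
 "window K N = {n. 1 / K * N < real n \<and> real n \<le> K * N}"

text \<open>The class of q in the window has O(sqrt(N / q)) members, with coefficients of order
  N^(-1/2) up to N^\<epsilon>, so the bound for a block is small only if q grows. The threshold
  N^(1/4) makes all remaining blocks small and discards only O(N^(3/4)) numbers.\<close>

definition main_window :: "real \<Rightarrow> real \<Rightarrow> nat set" where
 "main_window K N = {n \<in> window K N. N powr (1 / 4) \<le> real (squarefree_part n)}"

lemma finite_window [simp]: "finite (window K N)"
 unfolding window_def by (rule finite_subset[OF _ finite_nat_le_real[of "K * N"]]) auto

lemma finite_main_window [simp]: "finite (main_window K N)"
 unfolding main_window_def by simp

lemma window_pos: "1 \<le> K \<Longrightarrow> 0 < N \<Longrightarrow> n \<in> window K N \<Longrightarrow> 1 \<le> n"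
proof -
 assume "1 \<le> K" "0 < N" "n \<in> window K N"
 then have "0 < 1 / K * N" "1 / K * N < real n" by (simp_all add: window_def)
 then have "0 < real n" by linarith
 then show "1 \<le> n" by simp
qed

lemma card_window_le: "1 \<le> K \<Longrightarrow> 1 \<le> N \<Longrightarrow> real (card (window K N)) \<le> 2 * K * N"
proof -
 assume K: "1 \<le> K" "1 \<le> N"
 have "card (window K N) \<le> card {n. real n \<le> K * N}" unfolding window_def by (rule card_mono) auto
 moreover have "1 \<le> K * N" using mult_mono[of 1 K 1 N] K by simp
 moreover from this have "real (card {n. real n \<le> K * N}) \<le> K * N + 1" by (intro card_nat_le) auto
 ultimately show ?thesis by simp
qed

text \<open>A discarded n is q m^2 with q <= N^(1/4) and m <= sqrt(K N), so there are O(N^(3/4)) of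
  them. Each has energy O(N^(1/8 - 1)) by the divisor-type bound on r, and the total is
  O(N^(-1/8)).\<close>

lemma energy_square_part:
 assumes K: "1 \<le> K"
 shows "((\<lambda>N. \<Sum>n\<in>window K N - main_window K N. energy N n) \<longlongrightarrow> 0) at_top"
proof -
 obtain C where C: "C \<ge> 1" "\<And>n. 1 \<le> n \<Longrightarrow> real (r2 n) \<le> C * real n powr (1 / 16)" using r2_bound[of "1/16"] by auto
 define D where "D = 4 * sqrt K * (C\<^sup>2 * K powr (1 / 8) * K powr (3 / 2))"
 have ub: "(\<Sum>n\<in>window K N - main_window K N. energy N n) \<le> D * N powr (- 1 / 8)" if N: "3 \<le> N" for N
 proof -
  define L where "L = ln N"
  have L: "1 \<le> L" using ln_ge_1[OF N] by (simp add: L_def)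
  define S where "S = window K N - main_window K N"
  let ?A = "{q. real q \<le> N powr (1 / 4)}"
  let ?B = "{m. real m \<le> sqrt (K * N)}"
  have "1 \<le> K * N" using mult_mono[of 1 K 1 N] K N by simp
  then have sKN: "1 \<le> sqrt (K * N)" by simp
  have "S \<subseteq> (\<lambda>(q, m). q * m\<^sup>2) ` (?A \<times> ?B)"
  proof
   fix n assume n: "n \<in> S"
   then have nw: "n \<in> window K N" "1 \<le> n" "real n \<le> K * N" using window_pos[OF K, of N n] N by (auto simp: S_def window_def)
   have dec: "n = squarefree_part n * (square_part n)\<^sup>2" by (rule squarefree_decompose)
   have "1 \<le> squarefree_part n" using nw(2) by (metis One_nat_def Suc_leI gr0I mult_is_0 not_one_le_zero dec)
   then have "(square_part n)\<^sup>2 \<le> n" using dec by (metis mult_le_mono1 mult_1)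
   then have "(real (square_part n))\<^sup>2 \<le> real n" by (metis of_nat_le_iff of_nat_power)
   then have "real (square_part n) \<le> sqrt (K * N)" using nw(3) by (intro real_le_rsqrt) linarith
   moreover have "real (squarefree_part n) \<le> N powr (1 / 4)" using n nw(1) by (auto simp: S_def main_window_def)
   ultimately show "n \<in> (\<lambda>(q, m). q * m\<^sup>2) ` (?A \<times> ?B)"
    by (intro image_eqI[of _ _ "(squarefree_part n, square_part n)"]) (use dec in auto)
  qed
  then have "card S \<le> card ((\<lambda>(q, m). q * m\<^sup>2) ` (?A \<times> ?B))"
   by (intro card_mono) auto
  also have "\<dots> \<le> card (?A \<times> ?B)" by (rule card_image_le) simp
  finally have "card S \<le> card ?A * card ?B" by (simp add: card_cartesian_product)
  then have "real (card S) \<le> real (card ?A) * real (card ?B)"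
   by (metis of_nat_le_iff of_nat_mult)
  also have "\<dots> \<le> (2 * N powr (1 / 4)) * (2 * sqrt (K * N))"
  proof (rule mult_mono)
   have "1 \<le> N powr (1 / 4)" using N by (intro ge_one_powr_ge_zero) auto
   then show "real (card ?A) \<le> 2 * N powr (1 / 4)" using card_nat_le[of "N powr (1 / 4)"] by simp
   show "real (card ?B) \<le> 2 * sqrt (K * N)" using card_nat_le[of "sqrt (K * N)"] sKN by linarith
  qed auto
  also have "\<dots> = 4 * sqrt K * (N powr (1 / 4) * N powr (1 / 2))" using N by (simp add: real_sqrt_mult powr_half_sqrt)
  also have "N powr (1 / 4) * N powr (1 / 2) = N powr (3 / 4)" by (simp add: powr_add[symmetric])
  finally have cS: "real (card S) \<le> 4 * sqrt K * N powr (3 / 4)" .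
  have e: "energy N n \<le> C\<^sup>2 * K powr (1 / 8) * K powr (3 / 2) * N powr (1 / 8) / N" if "n \<in> S" for n
  proof -
   have nw: "1 \<le> n" "real n \<le> K * N" "1 / K * N < real n" using that window_pos[OF K, of N n] N by (auto simp: S_def window_def)
   have "real (r2 n) \<le> C * real n powr (1 / 16)" by (rule C(2)[OF nw(1)])
   also have "\<dots> \<le> C * (K * N) powr (1 / 16)" using nw C(1) by (intro mult_left_mono powr_mono2) auto
   finally have "(real (r2 n))\<^sup>2 \<le> (C * (K * N) powr (1 / 16))\<^sup>2" by (intro power_mono) auto
   also have "\<dots> = C\<^sup>2 * (K * N) powr (1 / 8)" by (simp add: power_mult_distrib power2_eq_square powr_add[symmetric])
   also have "\<dots> = C\<^sup>2 * K powr (1 / 8) * N powr (1 / 8)" using K N by (simp add: powr_mult)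
   finally have a: "(real (r2 n))\<^sup>2 \<le> C\<^sup>2 * K powr (1 / 8) * N powr (1 / 8)" .
   have "1 / K \<le> real n / N" using nw(3) N by (simp add: le_divide_eq)
   then have "(real n / N) powr (- 3 / 2) \<le> (1 / K) powr (- 3 / 2)" using K by (intro powr_mono2') auto
   also have "(1 / K) powr (- 3 / 2) = K powr (3 / 2)" using powr_inverse_base[of K "3/2"] K by simp
   finally have b: "var_density (real n / N) \<le> K powr (3 / 2)" using var_density_le[of "real n / N"] by linarith
   have "energy N n \<le> (C\<^sup>2 * K powr (1 / 8) * N powr (1 / 8)) * K powr (3 / 2) / (N * L)"
    unfolding energy_def L_def[symmetric] using a b N L var_density_nonneg by (intro divide_right_mono mult_mono) auto
   also have "\<dots> \<le> (C\<^sup>2 * K powr (1 / 8) * N powr (1 / 8)) * K powr (3 / 2) / (N * 1)"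
    using N L by (intro divide_left_mono mult_left_mono) auto
   finally show ?thesis by (simp add: mult_ac)
  qed
  have "(\<Sum>n\<in>S. energy N n) \<le> real (card S) * (C\<^sup>2 * K powr (1 / 8) * K powr (3 / 2) * N powr (1 / 8) / N)"
   using e by (intro sum_bounded_above) auto
  also have "\<dots> \<le> (4 * sqrt K * N powr (3 / 4)) * (C\<^sup>2 * K powr (1 / 8) * K powr (3 / 2) * N powr (1 / 8) / N)"
   using cS N by (intro mult_right_mono) auto
  also have "\<dots> = D * (N powr (3 / 4) * N powr (1 / 8) * N powr (-1))"
  proof -
   have "1 / N = N powr (-1)" using N by (simp add: powr_minus_divide)
   then have "x * (y * z / N) = x * (y * (z * N powr (-1)))" for x y z :: real by (metis mult.right_neutral times_divide_eq_right)
   then show ?thesis unfolding D_def by (simp only: mult_ac)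
  qed
  also have "N powr (3 / 4) * N powr (1 / 8) * N powr (-1) = N powr (- 1 / 8)" unfolding powr_add[symmetric] by simp
  finally show ?thesis by (simp only: S_def)
 qed
 show ?thesis
 proof (rule tendsto_sandwich)
  show "\<forall>\<^sub>F N in at_top. 0 \<le> (\<Sum>n\<in>window K N - main_window K N. energy N n)"
   using eventually_ge_at_top[of 1] by eventually_elim (auto intro!: sum_nonneg energy_nonneg)
  show "\<forall>\<^sub>F N in at_top. (\<Sum>n\<in>window K N - main_window K N. energy N n) \<le> D * N powr (- 1 / 8)"
   using eventually_ge_at_top[of 3] by eventually_elim (rule ub)
  have "((\<lambda>N::real. N powr (- 1 / 8)) \<longlongrightarrow> 0) at_top" by (rule tendsto_neg_powr) (auto intro: filterlim_ident)
  from tendsto_mult_left[OF this, of D] show "((\<lambda>N. D * N powr (- 1 / 8)) \<longlongrightarrow> 0) at_top" by simp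
 qed simp
qed

lemma continuous_var_density: "0 < a \<Longrightarrow> continuous_on {a..b} var_density"
 unfolding var_density_def[abs_def] by (intro continuous_intros) auto

lemma energy_main_window:
 assumes K: "1 < K"
 shows "((\<lambda>N. \<Sum>n\<in>main_window K N. energy N n) \<longlongrightarrow> 4 * integral {1 / K..K} var_density) at_top"
proof -
 have K1: "1 / K < K" using K mult_strict_mono[of 1 K 1 K] by (simp add: divide_less_eq)
 have "((\<lambda>N. (\<Sum>n | 1 / K * N < real n \<and> real n \<le> K * N. (real (r2 n))\<^sup>2 * var_density (real n / N)) / (N * ln N))
  \<longlongrightarrow> 4 * integral {1 / K..K} var_density) at_top"
  using K K1 by (intro window_sum_tendsto continuous_var_density) auto
 then have "((\<lambda>N. \<Sum>n\<in>window K N. energy N n) \<longlongrightarrow> 4 * integral {1 / K..K} var_density) at_top"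
  unfolding window_def energy_def sum_divide_distrib .
 moreover have "((\<lambda>N. \<Sum>n\<in>window K N - main_window K N. energy N n) \<longlongrightarrow> 0) at_top"
  using K by (intro energy_square_part) auto
 ultimately have "((\<lambda>N. (\<Sum>n\<in>window K N. energy N n) - (\<Sum>n\<in>window K N - main_window K N. energy N n)) \<longlongrightarrow> 4 * integral {1 / K..K} var_density - 0) at_top"
  by (rule tendsto_diff)
 moreover have "(\<Sum>n\<in>window K N. energy N n) - (\<Sum>n\<in>window K N - main_window K N. energy N n) = (\<Sum>n\<in>main_window K N. energy N n)" for N
 proof -
  have "main_window K N \<subseteq> window K N" by (auto simp: main_window_def)
  then show ?thesis by (simp add: sum_diff)
 qed
 ultimately show ?thesis by simp
qed

text \<open>Members of a class are indexed by m with q m^2 <= K N, and q >= N^(1/4) leaves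
  O(N^(3/8)) of them. A coefficient is O(N^(1/4 - 11/16)), where n^(1/16) from the bound on r has
  been spent against n^(-3/4). The exponents add up to -1/16; this is the bound on blocks required
  by \<open>trig_clt\<close>.\<close>

lemma main_window_square_class:
 assumes K: "1 \<le> K"
 shows "\<exists>C. \<forall>N\<ge>3. \<forall>H>0. \<forall>q. (\<Sum>n | n \<in> main_window K N \<and> squarefree_part n = q. norm (cf H N n)) \<le> C * N powr (- 1 / 16)"
proof -
 obtain C where C: "C \<ge> 1" "\<And>n. 1 \<le> n \<Longrightarrow> real (r2 n) \<le> C * real n powr (1 / 16)" using r2_bound[of "1/16"] by auto
 define D where "D = 2 * sqrt K * (C * K powr (11 / 16))"
 have D0: "0 \<le> D" using C K by (simp add: D_def)
 show ?thesis
 proof (intro exI[of _ D] allI impI)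
  fix N :: real and H q :: nat assume N: "3 \<le> N" and H: "0 < H"
  define S where "S = {n. n \<in> main_window K N \<and> squarefree_part n = q}"
  show "(\<Sum>n | n \<in> main_window K N \<and> squarefree_part n = q. norm (cf H N n)) \<le> D * N powr (- 1 / 16)"
  proof (cases "N powr (1 / 4) \<le> real q")
   case False
   then have "S = {}" by (auto simp: S_def main_window_def)
   then show ?thesis using D0 by (simp add: S_def[symmetric])
  next
   case True
   have finS: "finite S" unfolding S_def by (rule finite_subset[OF _ finite_main_window[of K N]]) auto
   define x where "x = sqrt K * N powr (3 / 8)"
   have x1: "1 \<le> x" unfolding x_def using K N mult_mono[of 1 "sqrt K" 1 "N powr (3 / 8)"] ge_one_powr_ge_zero[of N "3/8"] by simp
   have x2: "x\<^sup>2 = K * N powr (3 / 4)"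
   proof -
    have "x\<^sup>2 = (sqrt K)\<^sup>2 * (N powr (3 / 8) * N powr (3 / 8))" unfolding x_def power2_eq_square by (simp add: mult_ac)
    then show ?thesis using K unfolding powr_add[symmetric] by simp
   qed
   have "inj_on square_part S"
   proof (rule inj_onI)
    fix m n assume "m \<in> S" "n \<in> S" "square_part m = square_part n"
    then show "m = n" using squarefree_decompose[of m] squarefree_decompose[of n] by (simp add: S_def)
   qed
   then have "card S = card (square_part ` S)" by (simp add: card_image)
   also have "\<dots> \<le> card {m. real m \<le> x}"
   proof (rule card_mono)
    show "square_part ` S \<subseteq> {m. real m \<le> x}"
    proof
     fix m assume "m \<in> square_part ` S"
     then obtain n where n: "n \<in> S" "m = square_part n" by blast
     have "n = q * m\<^sup>2" using squarefree_decompose[of n] n by (simp add: S_def)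
     then have rn: "real n = real q * (real m)\<^sup>2" by simp
     have "N powr (1 / 4) * (real m)\<^sup>2 \<le> real n" unfolding rn using True by (rule mult_right_mono) simp
     also have "\<dots> \<le> K * N" using n by (simp add: S_def main_window_def window_def)
     also have "\<dots> = N powr (1 / 4) * (K * N powr (3 / 4))"
     proof -
      have "N powr (1 / 4) * N powr (3 / 4) = N" using N by (simp add: powr_add[symmetric])
      then show ?thesis by (simp add: mult.left_commute)
     qed
     finally have "(real m)\<^sup>2 \<le> x\<^sup>2" unfolding x2 by (rule mult_left_le_imp_le) (use N in simp)
     from power2_le_imp_le[OF this] show "m \<in> {m. real m \<le> x}" using x1 by simp
    qed
   qed simp
   finally have "real (card S) \<le> real (card {m. real m \<le> x})" by simp
   also have "\<dots> \<le> 2 * x" using card_nat_le[of x] x1 by linarith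
   finally have cS: "real (card S) \<le> 2 * x" .
   have e: "norm (cf H N n) \<le> C * K powr (11 / 16) * (N powr (- 11 / 16) * N powr (1 / 4))" if "n \<in> S" for n
   proof -
    have nw: "1 \<le> n" "1 / K * N < real n" using that window_pos[OF K, of N n] N by (auto simp: S_def main_window_def window_def)
    have "norm (cf H N n) \<le> real (r2 n) * real n powr (- 3 / 4) * N powr (1 / 4)" using N H by (rule norm_cf_le)
    also have "\<dots> \<le> (C * real n powr (1 / 16)) * real n powr (- 3 / 4) * N powr (1 / 4)" using C(2)[OF nw(1)] by (intro mult_right_mono) auto
    also have "\<dots> = C * (real n powr (1 / 16) * real n powr (- 3 / 4)) * N powr (1 / 4)" by simp
    also have "real n powr (1 / 16) * real n powr (- 3 / 4) = real n powr (- 11 / 16)" by (simp add: powr_add[symmetric])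
    also have "C * real n powr (- 11 / 16) * N powr (1 / 4) \<le> C * (1 / K * N) powr (- 11 / 16) * N powr (1 / 4)"
     using C(1) K N nw by (intro mult_right_mono mult_left_mono powr_mono2') auto
    also have "(1 / K * N) powr (- 11 / 16) = K powr (11 / 16) * N powr (- 11 / 16)"
     using powr_inverse_base[of K "11/16"] K N by (subst powr_mult) auto
    finally show ?thesis by (simp add: mult_ac)
   qed
   have "(\<Sum>n\<in>S. norm (cf H N n)) \<le> real (card S) * (C * K powr (11 / 16) * (N powr (- 11 / 16) * N powr (1 / 4)))"
    using e by (intro sum_bounded_above) auto
   also have "\<dots> \<le> (2 * x) * (C * K powr (11 / 16) * (N powr (- 11 / 16) * N powr (1 / 4)))"
    using cS C(1) by (intro mult_right_mono) auto
   also have "\<dots> = D * (N powr (3 / 8) * (N powr (- 11 / 16) * N powr (1 / 4)))" by (simp add: D_def x_def mult_ac)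
   also have "N powr (3 / 8) * (N powr (- 11 / 16) * N powr (1 / 4)) = N powr (- 1 / 16)" by (simp add: powr_add[symmetric])
   finally show ?thesis by (simp add: S_def)
  qed
 qed
qed

text \<open>Any fixed power of N would do, since every power of N is o(T); the exponent 4 merely
  absorbs all constants depending on K.\<close>

lemma main_window_norm_sum:
 assumes K: "1 \<le> K"
 shows "\<forall>\<^sub>F N in at_top. \<forall>H>0. (\<Sum>n\<in>main_window K N. norm (cf H N n)) \<le> N ^ 4 \<and> (\<forall>n\<in>main_window K N. real n \<le> N ^ 4)"
proof -
 obtain C where C: "C \<ge> 1" "\<And>n. 1 \<le> n \<Longrightarrow> real (r2 n) \<le> C * real n powr 1" using r2_bound[of 1] by auto
 show ?thesis
  using eventually_ge_at_top[of 3] eventually_ge_at_top[of "2 * C * K\<^sup>2"] eventually_ge_at_top[of K]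
 proof eventually_elim
  case (elim N)
  show ?case
  proof (intro allI impI conjI ballI)
   fix n assume n: "n \<in> main_window K N"
   have "real n \<le> K * N" using n by (simp add: main_window_def window_def)
   also have "\<dots> \<le> N * N" using elim by (intro mult_right_mono) auto
   also have "\<dots> \<le> N ^ 4" using elim power_increasing[of 2 4 N] by (simp add: power2_eq_square)
   finally show "real n \<le> N ^ 4" .
  next
   fix H :: nat assume H: "0 < H"
   have e: "norm (cf H N n) \<le> C * (K * N) * N" if "n \<in> main_window K N" for n
   proof -
    have nw: "1 \<le> n" "real n \<le> K * N" using that window_pos[OF K, of N n] elim by (auto simp: main_window_def window_def)
    have "norm (cf H N n) \<le> real (r2 n) * real n powr (- 3 / 4) * N powr (1 / 4)" using elim(1) H by (rule norm_cf_le)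
    also have "\<dots> \<le> (C * (K * N)) * 1 * N"
    proof (intro mult_mono)
     have "real (r2 n) \<le> C * real n" using C(2)[OF nw(1)] by simp
     also have "\<dots> \<le> C * (K * N)" using nw C(1) by (intro mult_left_mono) auto
     finally show "real (r2 n) \<le> C * (K * N)" .
     show "real n powr (- 3 / 4) \<le> 1" using nw powr_mono[of "-3/4" 0 "real n"] by simp
     show "N powr (1 / 4) \<le> N" using elim powr_mono[of "1/4" 1 N] by simp
    qed (use elim C(1) K in auto)
    finally show ?thesis by simp
   qed
   have "(\<Sum>n\<in>main_window K N. norm (cf H N n)) \<le> real (card (main_window K N)) * (C * (K * N) * N)"
    using e by (intro sum_bounded_above) auto
   also have "\<dots> \<le> (2 * K * N) * (C * (K * N) * N)"
   proof (rule mult_right_mono)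
    have "card (main_window K N) \<le> card (window K N)" by (rule card_mono) (auto simp: main_window_def)
    then show "real (card (main_window K N)) \<le> 2 * K * N" using card_window_le[OF K, of N] elim by simp
   qed (use elim C(1) K in auto)
   also have "\<dots> = (2 * C * K\<^sup>2) * N ^ 3" by (simp add: power2_eq_square power3_eq_cube)
   also have "\<dots> \<le> N * N ^ 3" using elim by (intro mult_right_mono) auto
   also have "\<dots> = N ^ 4" by (simp add: power_Suc[symmetric] del: power_Suc)
   finally show "(\<Sum>n\<in>main_window K N. norm (cf H N n)) \<le> N ^ 4" .
  qed
 qed
qed

section \<open>The off-diagonal terms of the mean square\<close>

lemma sum_inverse_dist_le:
 assumes "m \<in> {1..L}"
 shows "(\<Sum>n\<in>{1..L} - {m}. 1 / \<bar>real m - real n\<bar>) \<le> 2 * harm L"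
proof -
 have "(\<Sum>n\<in>{1..L} - {m}. 1 / \<bar>real m - real n\<bar>) = (\<Sum>n\<in>{1..<m} \<union> {m<..L}. 1 / \<bar>real m - real n\<bar>)"
  using assms by (intro sum.cong) auto
 also have "\<dots> = (\<Sum>n\<in>{1..<m}. 1 / \<bar>real m - real n\<bar>) + (\<Sum>n\<in>{m<..L}. 1 / \<bar>real m - real n\<bar>)"
  by (rule sum.union_disjoint) auto
 also have "(\<Sum>n\<in>{1..<m}. 1 / \<bar>real m - real n\<bar>) = (\<Sum>d\<in>{1..<m}. inverse (real d))"
  by (rule sum.reindex_bij_witness[of _ "\<lambda>d. m - d" "\<lambda>n. m - n"]) (auto simp: of_nat_diff divide_inverse)
 also have "\<dots> \<le> harm L" unfolding harm_def using assms by (intro sum_mono2) auto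
 also have "(\<Sum>n\<in>{m<..L}. 1 / \<bar>real m - real n\<bar>) = (\<Sum>d\<in>{1..L - m}. inverse (real d))"
  by (rule sum.reindex_bij_witness[of _ "\<lambda>d. m + d" "\<lambda>n. n - m"]) (auto simp: of_nat_diff divide_inverse)
 also have "\<dots> \<le> harm L" unfolding harm_def by (intro sum_mono2) auto
 finally show ?thesis by simp
qed

lemma sum_hilbert_le:
 "(\<Sum>m\<in>{1..L}. \<Sum>n\<in>{1..L} - {m}. (1 / real m + 1 / real n) / \<bar>real m - real n\<bar>) \<le> 4 * (harm L)\<^sup>2"
proof -
 let ?A = "\<Sum>m\<in>{1..L}. \<Sum>n\<in>{1..L} - {m}. 1 / real m * (1 / \<bar>real m - real n\<bar>)"
 let ?B = "\<Sum>m\<in>{1..L}. \<Sum>n\<in>{1..L} - {m}. 1 / real n * (1 / \<bar>real m - real n\<bar>)"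
 have one: "?A \<le> 2 * (harm L)\<^sup>2"
 proof -
  have "?A \<le> (\<Sum>m\<in>{1..L}. 1 / real m * (2 * harm L))"
   unfolding sum_distrib_left[symmetric] by (intro sum_mono mult_left_mono sum_inverse_dist_le) auto
  also have "\<dots> = harm L * (2 * harm L)" unfolding sum_distrib_right[symmetric] by (simp add: harm_def divide_inverse)
  finally show ?thesis by (simp add: power2_eq_square)
 qed
 have eq: "{1..L} - {m} = {n. n \<in> {1..L} \<and> n \<noteq> m}" for m by auto
 have sw: "?B = ?A"
 proof -
  have "?B = (\<Sum>n\<in>{1..L}. \<Sum>m | m \<in> {1..L} \<and> n \<noteq> m. 1 / real n * (1 / \<bar>real m - real n\<bar>))"
   unfolding eq by (rule sum.swap_restrict) auto
  also have "\<dots> = (\<Sum>n\<in>{1..L}. \<Sum>m\<in>{1..L} - {n}. 1 / real n * (1 / \<bar>real n - real m\<bar>))"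
   by (intro sum.cong) (auto simp: abs_minus_commute)
  finally show ?thesis .
 qed
 have "(\<Sum>m\<in>{1..L}. \<Sum>n\<in>{1..L} - {m}. (1 / real m + 1 / real n) / \<bar>real m - real n\<bar>) =
  ?A + ?B"
  unfolding sum.distrib[symmetric] by (intro sum.cong refl) (simp add: add_divide_distrib)
 then show ?thesis using one unfolding sw by linarith
qed

lemma harm_le_powr:
 assumes "0 < e" "1 \<le> L" shows "harm L \<le> (1 + 1 / e) * real L powr e"
proof -
 have "harm (Suc (L - 1)) - ln (real (Suc (L - 1))) \<le> harm (Suc 0) - ln (real (Suc 0))"
  using decseq_harm_diff_ln by (rule decseqD) simp
 then have "harm L \<le> 1 + ln (real L)" using assms by (simp add: harm_def)
 moreover have "ln (real L) \<le> real L powr e / e" using assms by (intro ln_powr_bound) auto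
 moreover have "1 \<le> real L powr e" using assms by (intro ge_one_powr_ge_zero) auto
 ultimately show ?thesis by (simp add: algebra_simps)
qed

text \<open>Rationalising the difference of roots and using (sqrt m + sqrt n) / (m n)^(3/4) <= 2 (1
  / m + 1 / n) reduces the double sum to a Hilbert-type sum, bounded by harmonic numbers; with
  fourth roots a and b the inequality is polynomial. The bound on r and the harmonic numbers
  contribute four factors L^(1/128) in total. The exponent 1/32 is chosen for L of order T^16, where
  it costs only sqrt T against the gain T from averaging.\<close>

lemma off_diagonal_le:
 "\<exists>C\<ge>0. \<forall>L\<ge>1. \<forall>H>0. \<forall>N\<ge>3. \<forall>S\<subseteq>{1..L}.
   (\<Sum>m\<in>S. \<Sum>n\<in>S - {m}. norm (cf H N m) * norm (cf H N n) / \<bar>sqrt (real m) - sqrt (real n)\<bar>) \<le> C * real L powr (1 / 32) * sqrt N"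
proof -
 define e :: real where "e = 1 / 128"
 obtain C where C: "C \<ge> 1" "\<And>n. 1 \<le> n \<Longrightarrow> real (r2 n) \<le> C * real n powr e" using r2_bound[of e] by (auto simp: e_def)
 define D where "D = C\<^sup>2 * 2 * (4 * (1 + 1 / e)\<^sup>2)"
 show ?thesis
 proof (intro exI[of _ D] conjI allI impI)
  show "0 \<le> D" by (simp add: D_def)
  fix L H :: nat and N :: real and S assume L: "1 \<le> L" and H: "0 < H" and N: "3 \<le> N" and S: "S \<subseteq> {1..L}"
  define P where "P = C * real L powr e * N powr (1 / 4)"
  have P0: "0 \<le> P" using C(1) by (simp add: P_def)
  have cfl: "norm (cf H N n) \<le> P * real n powr (- 3 / 4)" if n: "n \<in> {1..L}" for n
  proof -
   have "norm (cf H N n) \<le> real (r2 n) * real n powr (- 3 / 4) * N powr (1 / 4)" using N H by (rule norm_cf_le)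
   also have "\<dots> \<le> (C * real L powr e) * real n powr (- 3 / 4) * N powr (1 / 4)"
   proof (intro mult_right_mono)
    have "real (r2 n) \<le> C * real n powr e" using n by (intro C(2)) auto
    also have "\<dots> \<le> C * real L powr e" using n C(1) by (intro mult_left_mono powr_mono2) (auto simp: e_def)
    finally show "real (r2 n) \<le> C * real L powr e" .
   qed auto
   finally show ?thesis by (simp add: P_def mult_ac)
  qed
  have bd: "norm (cf H N m) * norm (cf H N n) / \<bar>sqrt (real m) - sqrt (real n)\<bar> \<le> P\<^sup>2 * 2 * ((1 / real m + 1 / real n) / \<bar>real m - real n\<bar>)"
   if mn: "m \<in> {1..L}" "n \<in> {1..L}" "m \<noteq> n" for m n
  proof -
   define a b where "a = real m powr (1 / 4)" and "b = real n powr (1 / 4)"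
   have ab: "1 \<le> a" "1 \<le> b" using mn by (auto simp: a_def b_def intro!: ge_one_powr_ge_zero)
   have pw: "real m = a ^ 4" "real n = b ^ 4" "sqrt (real m) = a\<^sup>2" "sqrt (real n) = b\<^sup>2"
    "real m powr (- 3 / 4) = 1 / a ^ 3" "real n powr (- 3 / 4) = 1 / b ^ 3"
    using mn by (simp_all add: a_def b_def powr_power powr_half_sqrt[symmetric] powr_minus_divide)
   have ne: "a ^ 4 \<noteq> b ^ 4" using mn(3) pw(1,2) by (metis of_nat_eq_iff)
   have d4: "a ^ 4 - b ^ 4 = (a\<^sup>2 - b\<^sup>2) * (a\<^sup>2 + b\<^sup>2)" by (simp add: algebra_simps power2_eq_square power4_eq_xxxx)
   have ne2: "a\<^sup>2 - b\<^sup>2 \<noteq> 0" using ne d4 by auto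
   have s0: "0 < a\<^sup>2 + b\<^sup>2" using ab by (simp add: add_pos_pos)
   have "norm (cf H N m) * norm (cf H N n) \<le> (P * (1 / a ^ 3)) * (P * (1 / b ^ 3))"
    using cfl[OF mn(1), unfolded pw(5)] cfl[OF mn(2), unfolded pw(6)] P0 ab by (intro mult_mono) auto
   then have "norm (cf H N m) * norm (cf H N n) / \<bar>a\<^sup>2 - b\<^sup>2\<bar> \<le> (P * (1 / a ^ 3)) * (P * (1 / b ^ 3)) / \<bar>a\<^sup>2 - b\<^sup>2\<bar>"
    by (rule divide_right_mono) simp
   also have "\<dots> = P\<^sup>2 * ((a\<^sup>2 + b\<^sup>2) / (a ^ 3 * b ^ 3)) / \<bar>a ^ 4 - b ^ 4\<bar>"
    unfolding d4 abs_mult using s0 by (simp add: power2_eq_square)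
   also have "\<dots> \<le> P\<^sup>2 * (2 * (1 / a ^ 4 + 1 / b ^ 4)) / \<bar>a ^ 4 - b ^ 4\<bar>"
   proof (intro divide_right_mono mult_left_mono)
    have "(a\<^sup>2 + b\<^sup>2) * (a * b) \<le> 2 * (a ^ 4 + b ^ 4)"
    proof -
     have "2 * (a * b) \<le> a\<^sup>2 + b\<^sup>2" using sum_squares_bound[of a b] by simp
     then have "(a\<^sup>2 + b\<^sup>2) * (2 * (a * b)) \<le> (a\<^sup>2 + b\<^sup>2) * (a\<^sup>2 + b\<^sup>2)" using s0 by (intro mult_left_mono) auto
     moreover have "(a\<^sup>2 + b\<^sup>2) * (a\<^sup>2 + b\<^sup>2) \<le> 2 * (a ^ 4 + b ^ 4)"
      using sum_squares_bound[of "a\<^sup>2" "b\<^sup>2"] by (simp add: algebra_simps power2_eq_square power4_eq_xxxx)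
     moreover have "0 \<le> (a\<^sup>2 + b\<^sup>2) * (a * b)" using ab by simp
     ultimately show ?thesis by linarith
    qed
    then have "(a\<^sup>2 + b\<^sup>2) * (a * b) / (a ^ 4 * b ^ 4) \<le> 2 * (a ^ 4 + b ^ 4) / (a ^ 4 * b ^ 4)" using ab by (intro divide_right_mono) auto
    moreover have "(a\<^sup>2 + b\<^sup>2) * (a * b) / (a ^ 4 * b ^ 4) = (a\<^sup>2 + b\<^sup>2) / (a ^ 3 * b ^ 3)"
     using ab by (simp add: power4_eq_xxxx power3_eq_cube)
    moreover have "2 * (a ^ 4 + b ^ 4) / (a ^ 4 * b ^ 4) = 2 * (1 / a ^ 4 + 1 / b ^ 4)"
     using ab by (simp add: add_divide_distrib)
    ultimately show "(a\<^sup>2 + b\<^sup>2) / (a ^ 3 * b ^ 3) \<le> 2 * (1 / a ^ 4 + 1 / b ^ 4)" by simp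
   qed auto
   finally show ?thesis unfolding pw(3,4) unfolding pw(1,2) by (simp only: mult.assoc times_divide_eq_right)
  qed
  define f where "f m n = norm (cf H N m) * norm (cf H N n) / \<bar>sqrt (real m) - sqrt (real n)\<bar>" for m n
  have "(\<Sum>m\<in>S. \<Sum>n\<in>S - {m}. f m n) \<le> (\<Sum>m\<in>{1..L}. \<Sum>n\<in>{1..L} - {m}. f m n)"
  proof (rule order_trans[OF sum_mono sum_mono2])
   show "(\<Sum>n\<in>S - {m}. f m n) \<le> (\<Sum>n\<in>{1..L} - {m}. f m n)" for m
    using S by (intro sum_mono2) (auto simp: f_def)
  qed (use S in \<open>auto simp: f_def intro!: sum_nonneg\<close>)
  also have "\<dots> \<le> (\<Sum>m\<in>{1..L}. \<Sum>n\<in>{1..L} - {m}. P\<^sup>2 * 2 * ((1 / real m + 1 / real n) / \<bar>real m - real n\<bar>))"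
   unfolding f_def by (intro sum_mono bd) auto
  also have "\<dots> = P\<^sup>2 * 2 * (\<Sum>m\<in>{1..L}. \<Sum>n\<in>{1..L} - {m}. (1 / real m + 1 / real n) / \<bar>real m - real n\<bar>)"
   by (simp only: sum_distrib_left)
  also have "\<dots> \<le> P\<^sup>2 * 2 * (4 * (harm L)\<^sup>2)" by (intro mult_left_mono sum_hilbert_le) auto
  also have "\<dots> \<le> P\<^sup>2 * 2 * (4 * ((1 + 1 / e) * real L powr e)\<^sup>2)"
   using harm_le_powr[of e L] L harm_nonneg[where 'a = real, of L] by (intro mult_left_mono power_mono) (auto simp: e_def)
  also have "\<dots> = D * (real L powr e * real L powr e * (real L powr e * real L powr e)) * (N powr (1 / 4) * N powr (1 / 4))"
   by (simp add: D_def P_def power_mult_distrib power2_eq_square)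
  also have "N powr (1 / 4) * N powr (1 / 4) = sqrt N" using N by (simp add: powr_add[symmetric] powr_half_sqrt)
  also have "real L powr e * real L powr e * (real L powr e * real L powr e) = real L powr (1 / 32)"
   by (simp add: powr_add[symmetric] e_def)
  finally show "(\<Sum>m\<in>S. \<Sum>n\<in>S - {m}. norm (cf H N m) * norm (cf H N n) / \<bar>sqrt (real m) - sqrt (real n)\<bar>) \<le> D * real L powr (1 / 32) * sqrt N"
   by (simp only: f_def)
 qed
qed

section \<open>The central limit theorem\<close>

lemma norm_iexp_diff_le: "norm (iexp a - iexp b) \<le> \<bar>a - b\<bar>"
proof -
 have "iexp a - iexp b = iexp b * (iexp (a - b) - 1)"
  by (simp add: exp_diff algebra_simps)
 also have "norm \<dots> = norm (iexp (a - b) - 1)" by (simp add: norm_mult)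
 also have "\<dots> \<le> \<bar>a - b\<bar>" using iexp_approx1[of "a - b" 0] by simp
 finally show ?thesis .
qed

lemma measurable_iexp_compose: "f \<in> borel_measurable borel \<Longrightarrow> (\<lambda>t. iexp (s * f t)) \<in> borel_measurable borel"
 by measurable

lemma integral_iexp_diff_le:
 assumes T: "0 < T" and [measurable]: "f \<in> borel_measurable borel" "g \<in> borel_measurable borel" "W \<in> sets borel"
  and W: "emeasure lborel W \<le> ennreal w" "0 \<le> w" and e: "0 \<le> e" "\<And>t. t \<in> {T..2 * T} - W \<Longrightarrow> \<bar>f t - g t\<bar> \<le> e"
 shows "norm ((\<integral>t. iexp (s * f t) \<partial>unif T) - (\<integral>t. iexp (s * g t) \<partial>unif T)) \<le> 2 * w / T + \<bar>s\<bar> * e"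
proof -
 interpret prob_space "unif T" by (rule prob_space_unif) fact
 have int: "integrable (unif T) (\<lambda>t. iexp (s * f t))" "integrable (unif T) (\<lambda>t. iexp (s * g t))"
  using T by (intro integrable_unif_bounded[where B = 1] measurable_iexp_compose; simp)+
 have iW: "integrable (unif T) (indicator W :: real \<Rightarrow> real)"
  using T by (intro integrable_unif_bounded[where B = 1]) (auto simp: indicator_def)
 have mW: "measure (unif T) W \<le> w / T"
 proof -
  have "measure (unif T) W = measure lborel ({T..2 * T} \<inter> W) / T" using T by simp
  also have "\<dots> \<le> w / T"
  proof (rule divide_right_mono)
   have "emeasure lborel ({T..2 * T} \<inter> W) \<le> emeasure lborel W" by (rule emeasure_mono) auto
   then have "emeasure lborel ({T..2 * T} \<inter> W) \<le> ennreal w" using W(1) by (rule order_trans)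
   then show "measure lborel ({T..2 * T} \<inter> W) \<le> w" unfolding measure_def using W(2) by (simp add: enn2real_leI)
  qed (use T in simp)
  finally show ?thesis .
 qed
 have pu: "measure (unif T) UNIV = 1" using prob_space by simp
 have AE: "AE t in unif T. t \<in> {T..2 * T}" by (rule AE_uniform_measureI) auto
 have "norm ((\<integral>t. iexp (s * f t) \<partial>unif T) - (\<integral>t. iexp (s * g t) \<partial>unif T)) = norm (\<integral>t. iexp (s * f t) - iexp (s * g t) \<partial>unif T)"
  using int by simp
 also have "\<dots> \<le> (\<integral>t. norm (iexp (s * f t) - iexp (s * g t)) \<partial>unif T)" by (rule integral_norm_bound)
 also have "\<dots> \<le> (\<integral>t. 2 * indicator W t + \<bar>s\<bar> * e \<partial>unif T)"
 proof (rule integral_mono_AE)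
  show "integrable (unif T) (\<lambda>t. norm (iexp (s * f t) - iexp (s * g t)))" using int by (intro integrable_norm Bochner_Integration.integrable_diff)
  show "integrable (unif T) (\<lambda>t. 2 * indicator W t + \<bar>s\<bar> * e)" using iW by simp
  show "AE t in unif T. norm (iexp (s * f t) - iexp (s * g t)) \<le> 2 * indicator W t + \<bar>s\<bar> * e"
   using AE
  proof eventually_elim
   case (elim t)
   show ?case
   proof (cases "t \<in> W")
    case True
    have "norm (iexp (s * f t) - iexp (s * g t)) \<le> norm (iexp (s * f t)) + norm (iexp (s * g t))" by (rule norm_triangle_ineq4)
    then have "norm (iexp (s * f t) - iexp (s * g t)) \<le> 2" by simp
    moreover have "0 \<le> \<bar>s\<bar> * e" using e by simp
    ultimately show ?thesis using True by simp
   next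
    case False
    have "norm (iexp (s * f t) - iexp (s * g t)) \<le> \<bar>s * f t - s * g t\<bar>" by (rule norm_iexp_diff_le)
    also have "\<dots> = \<bar>s\<bar> * \<bar>f t - g t\<bar>" by (simp add: right_diff_distrib[symmetric] abs_mult)
    also have "\<dots> \<le> \<bar>s\<bar> * e" using e(2)[of t] elim False by (intro mult_left_mono) auto
    finally show ?thesis using False by simp
   qed
  qed
 qed
 also have "\<dots> = 2 * measure (unif T) W + \<bar>s\<bar> * e"
  using iW pu by simp
 also have "\<dots> \<le> 2 * (w / T) + \<bar>s\<bar> * e" using mW by simp
 finally show ?thesis by simp
qed

text \<open>The exponential is Lipschitz, so the difference is at most |s| times the mean of |Z|;
  nonnegativity of the variance bounds that mean by the root of the mean square. Discarded
  frequencies therefore need only a second moment.\<close>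

lemma integral_iexp_diff_L2:
 assumes T: "0 < T" and fin: "finite S"
  and [measurable]: "f \<in> borel_measurable borel" "g \<in> borel_measurable borel"
  and fg: "\<And>t. f t = g t + Re (trig S c t)" and v: "(\<integral>t. (norm (trig S c t))\<^sup>2 \<partial>unif T) \<le> v"
 shows "norm ((\<integral>t. iexp (s * f t) \<partial>unif T) - (\<integral>t. iexp (s * g t) \<partial>unif T)) \<le> \<bar>s\<bar> * sqrt v"
proof -
 interpret prob_space "unif T" by (rule prob_space_unif) fact
 have int: "integrable (unif T) (\<lambda>t. iexp (s * f t))" "integrable (unif T) (\<lambda>t. iexp (s * g t))"
  using T by (intro integrable_unif_bounded[where B = 1] measurable_iexp_compose; simp)+
 define Z where "Z t = norm (trig S c t)" for t
 have [measurable]: "Z \<in> borel_measurable borel" unfolding Z_def by measurable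
 define B where "B = (\<Sum>n\<in>S. norm (c n))"
 have ZB: "0 \<le> Z t" "Z t \<le> B" for t unfolding Z_def B_def by (auto simp: norm_trig_le)
 have iZ: "integrable (unif T) Z" using T ZB by (intro integrable_unif_bounded[where B = B]) auto
 have iZ2: "integrable (unif T) (\<lambda>t. (Z t)\<^sup>2)"
  using T ZB by (intro integrable_unif_bounded[where B = "B\<^sup>2"]) (auto intro!: power_mono)
 have "norm ((\<integral>t. iexp (s * f t) \<partial>unif T) - (\<integral>t. iexp (s * g t) \<partial>unif T)) = norm (\<integral>t. iexp (s * f t) - iexp (s * g t) \<partial>unif T)"
  using int by simp
 also have "\<dots> \<le> (\<integral>t. norm (iexp (s * f t) - iexp (s * g t)) \<partial>unif T)" by (rule integral_norm_bound)
 also have "\<dots> \<le> (\<integral>t. \<bar>s\<bar> * Z t \<partial>unif T)"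
 proof (rule integral_mono)
  show "integrable (unif T) (\<lambda>t. norm (iexp (s * f t) - iexp (s * g t)))" using int by (intro integrable_norm Bochner_Integration.integrable_diff)
  show "integrable (unif T) (\<lambda>t. \<bar>s\<bar> * Z t)" using iZ by simp
  fix t
  have "norm (iexp (s * f t) - iexp (s * g t)) \<le> \<bar>s * f t - s * g t\<bar>" by (rule norm_iexp_diff_le)
  also have "\<dots> = \<bar>s\<bar> * \<bar>Re (trig S c t)\<bar>" by (simp add: right_diff_distrib[symmetric] abs_mult fg)
  also have "\<dots> \<le> \<bar>s\<bar> * Z t" unfolding Z_def by (intro mult_left_mono abs_Re_le_cmod) auto
  finally show "norm (iexp (s * f t) - iexp (s * g t)) \<le> \<bar>s\<bar> * Z t" .
 qed
 also have "\<dots> = \<bar>s\<bar> * expectation Z" by simp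
 also have "\<dots> \<le> \<bar>s\<bar> * sqrt v"
 proof (rule mult_left_mono)
  have "0 \<le> variance Z" by (rule variance_positive)
  also have "variance Z = expectation (\<lambda>t. (Z t)\<^sup>2) - (expectation Z)\<^sup>2" by (rule variance_eq[OF iZ iZ2])
  finally have "(expectation Z)\<^sup>2 \<le> v" using v by (simp add: Z_def)
  then show "expectation Z \<le> sqrt v" by (rule real_le_rsqrt)
 qed simp
 finally show ?thesis .
qed

lemma measurable_annulus_remainder: "(\<lambda>t. annulus_remainder t r) \<in> borel_measurable borel"
proof -
 have "mono (\<lambda>t. real (lattice_count t))" by (intro monoI) (simp add: lattice_count_mono)
 then have [measurable]: "(\<lambda>t. real (lattice_count t)) \<in> borel_measurable borel" by (rule borel_measurable_mono)
 show ?thesis unfolding annulus_remainder_def by measurable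
qed

section \<open>The limit of the characteristic function of the annulus remainder\<close>

context
 fixes \<rho> \<sigma> :: "real \<Rightarrow> real"
 assumes rho_pos: "\<And>T. T > 0 \<Longrightarrow> \<rho> T > 0"
  and rho_tendsto_0: "(\<rho> \<longlongrightarrow> 0) at_top"
  and rho_lower: "\<And>\<delta>. \<delta> > 0 \<Longrightarrow> \<exists>c>0. \<forall>\<^sub>F T in at_top. \<rho> T \<ge> c * T powr (- \<delta>)"
  and sigma: "\<And>T. T > 0 \<Longrightarrow> \<rho> T < 1 \<Longrightarrow>
   \<sigma> T > 0 \<and> (\<sigma> T)\<^sup>2 = 16 * \<rho> T * ln (1 / \<rho> T)"
begin

definition NN :: "real \<Rightarrow> real" where "NN T = 1 / (\<rho> T)\<^sup>2"

definition HH :: "real \<Rightarrow> nat" where "HH T = nat \<lceil>T ^ 8\<rceil>"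

lemma rho_less_1: "\<forall>\<^sub>F T in at_top. 0 < T \<and> 0 < \<rho> T \<and> \<rho> T < 1"
 using order_tendstoD(2)[OF rho_tendsto_0, of 1] eventually_gt_at_top[of 0]
 by (auto elim!: eventually_elim2 simp: rho_pos)

lemma NN_at_top: "filterlim NN at_top at_top"
proof -
 have "((\<lambda>T. (\<rho> T)\<^sup>2) \<longlongrightarrow> 0\<^sup>2) at_top" by (intro tendsto_intros rho_tendsto_0)
 moreover have "\<forall>\<^sub>F T in at_top. 0 < (\<rho> T)\<^sup>2" using rho_less_1 by eventually_elim simp
 ultimately have "filterlim (\<lambda>T. inverse ((\<rho> T)\<^sup>2)) at_top at_top" by (intro filterlim_inverse_at_top) auto
 then show ?thesis by (simp add: NN_def[abs_def] inverse_eq_divide)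
qed

lemma sg_NN: "0 < T \<Longrightarrow> \<rho> T < 1 \<Longrightarrow> sg (NN T) = \<sigma> T \<and> 1 / sqrt (NN T) = \<rho> T \<and> 1 < NN T"
proof -
 assume T: "0 < T" "\<rho> T < 1"
 have r: "0 < \<rho> T" using rho_pos T by simp
 have s: "sqrt (NN T) = 1 / \<rho> T" using r by (simp add: NN_def real_sqrt_divide)
 have "ln (NN T) = 2 * ln (1 / \<rho> T)" using r by (simp add: NN_def ln_div ln_realpow)
 then have "8 * ln (NN T) / sqrt (NN T) = (\<sigma> T)\<^sup>2" unfolding s using sigma[OF T] by simp
 then have "sg (NN T) = \<bar>\<sigma> T\<bar>" unfolding sg_def by (simp only: real_sqrt_abs)
 then have "sg (NN T) = \<sigma> T" using sigma[OF T] by simp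
 moreover have "1 < NN T" using r T by (simp add: NN_def power_less_one_iff)
 ultimately show ?thesis using s by simp
qed

text \<open>Here the lower bound on \<open>\<rho>\<close> for every \<delta> enters: with \<delta> =
  1 / (4 (j + 1)) it gives N = O(T^(2 \<delta>)), and the j-th power is O(T^(1/2)). An arbitrary j
  is required because the resonance bound has an uncontrolled exponent.\<close>

lemma NN_power_small: "((\<lambda>T. NN T ^ j / T) \<longlongrightarrow> 0) at_top"
proof -
 define d :: real where "d = 1 / (4 * (real j + 1))"
 have d: "0 < d" "2 * d * real j \<le> 1 / 2" by (auto simp: d_def field_simps)
 obtain c where c: "0 < c" "\<forall>\<^sub>F T in at_top. \<rho> T \<ge> c * T powr (- d)" using rho_lower[OF d(1)] by blast
 have ub: "\<forall>\<^sub>F T in at_top. NN T ^ j / T \<le> (1 / c\<^sup>2) ^ j * T powr (- 1 / 2)"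
  using c(2) eventually_ge_at_top[of 1]
 proof eventually_elim
  case (elim T)
  have p: "0 < T powr (- d)" using elim by simp
  have "(c * T powr (- d))\<^sup>2 \<le> (\<rho> T)\<^sup>2" using elim c(1) by (intro power_mono) auto
  then have "NN T \<le> 1 / (c * T powr (- d))\<^sup>2" unfolding NN_def using c(1) p by (intro divide_left_mono mult_pos_pos) (auto simp: rho_pos elim intro: less_le_trans)
  also have "\<dots> = 1 / c\<^sup>2 * T powr (2 * d)"
  proof -
   have "(T powr (- d))\<^sup>2 = 1 / T powr (2 * d)" using elim by (simp add: power2_eq_square powr_add[symmetric] powr_minus_divide[symmetric])
   then show ?thesis by (simp add: power_mult_distrib)
  qed
  finally have "NN T ^ j \<le> (1 / c\<^sup>2 * T powr (2 * d)) ^ j" by (intro power_mono) (auto simp: NN_def)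
  also have "\<dots> = (1 / c\<^sup>2) ^ j * T powr (2 * d * real j)"
   using elim unfolding power_mult_distrib by (simp add: powr_power mult_ac)
  also have "\<dots> \<le> (1 / c\<^sup>2) ^ j * T powr (1 / 2)" using d elim by (intro mult_left_mono powr_mono) auto
  finally have "NN T ^ j / T \<le> (1 / c\<^sup>2) ^ j * T powr (1 / 2) / T" using elim by (intro divide_right_mono) auto
  also have "\<dots> = (1 / c\<^sup>2) ^ j * T powr (- 1 / 2)" using elim powr_diff[of T "1/2" 1] by simp
  finally show ?case .
 qed
 have "((\<lambda>T::real. T powr (- 1 / 2)) \<longlongrightarrow> 0) at_top" by (rule tendsto_neg_powr) (auto intro: filterlim_ident)
 from tendsto_mult_left[OF this, of "(1 / c\<^sup>2) ^ j"]
 have lim: "((\<lambda>T. (1 / c\<^sup>2) ^ j * T powr (- 1 / 2)) \<longlongrightarrow> 0) at_top" by simp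
 show ?thesis
 proof (rule tendsto_sandwich[OF _ ub tendsto_const lim])
  show "\<forall>\<^sub>F T in at_top. 0 \<le> NN T ^ j / T" using eventually_gt_at_top[of 0] by eventually_elim (simp add: NN_def)
 qed
qed

lemma NN_power_le: "\<forall>\<^sub>F T in at_top. NN T ^ j \<le> T"
proof -
 have "\<forall>\<^sub>F T in at_top. NN T ^ j / T < 1" by (rule order_tendstoD(2)[OF NN_power_small]) simp
 then show ?thesis using eventually_gt_at_top[of 0] by eventually_elim (simp add: divide_less_eq)
qed

lemma HH_bounds: "1 \<le> T \<Longrightarrow> T ^ 8 \<le> real (HH T) \<and> real (HH T) \<le> 2 * T ^ 8 \<and> 0 < HH T \<and> T \<le> real (HH T)"
proof -
 assume T: "1 \<le> T"
 have T8: "1 \<le> T ^ 8" "T \<le> T ^ 8" using T power_increasing[of 1 8 T] by auto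
 have "real (HH T) = of_int \<lceil>T ^ 8\<rceil>" unfolding HH_def using T8 by simp
 then have "T ^ 8 \<le> real (HH T)" "real (HH T) \<le> T ^ 8 + 1" by (simp_all add: of_int_ceiling_le_add_one)
 then show ?thesis using T8 by (auto intro: Nat.gr0I)
qed

abbreviation "UU T \<equiv> {1..2 * (HH T)\<^sup>2}"
abbreviation "CC T \<equiv> cf (HH T) (NN T)"
abbreviation "WW K T \<equiv> main_window K (NN T)"

lemma window_facts:
 assumes K: "1 \<le> K"
 shows "\<forall>\<^sub>F T in at_top. 3 \<le> NN T \<and> K \<le> NN T \<and> (\<forall>n\<in>WW K T. 1 \<le> n \<and> real n \<le> NN T ^ 4 \<and> real n \<le> T) \<and> WW K T \<subseteq> UU T
  \<and> (\<Sum>n\<in>WW K T. norm (CC T n)) \<le> NN T ^ 4"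
proof -
 have "\<forall>\<^sub>F T in at_top. 3 \<le> NN T \<and> K \<le> NN T"
  using NN_at_top unfolding filterlim_at_top by (auto intro: eventually_conj)
 moreover have "\<forall>\<^sub>F T in at_top. \<forall>H>0. (\<Sum>n\<in>WW K T. norm (cf H (NN T) n)) \<le> NN T ^ 4 \<and> (\<forall>n\<in>WW K T. real n \<le> NN T ^ 4)"
  by (rule eventually_compose_filterlim[OF main_window_norm_sum[OF K] NN_at_top])
 moreover have "\<forall>\<^sub>F T in at_top. NN T ^ 4 \<le> T" by (rule NN_power_le)
 ultimately show ?thesis using eventually_ge_at_top[of 1]
 proof eventually_elim
  case (elim T)
  have H: "0 < HH T" "T \<le> real (HH T)" using HH_bounds elim by auto
  have n: "1 \<le> n \<and> real n \<le> NN T ^ 4 \<and> real n \<le> T" if "n \<in> WW K T" for n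
   using that elim H window_pos[OF K, of "NN T" n] by (fastforce simp: main_window_def)
  moreover have "WW K T \<subseteq> UU T"
  proof
   fix n assume "n \<in> WW K T"
   then have "1 \<le> n" "real n \<le> real (HH T)" using n H by force+
   moreover have "HH T \<le> 2 * (HH T)\<^sup>2" by (simp add: power2_eq_square)
   ultimately show "n \<in> UU T" by simp
  qed
  ultimately show ?case using elim H by blast
 qed
qed

text \<open>Inside the window n <= T while the kernel degree is at least T^8, so the weights lie
  between r(n)(1 - 2 / T) and r(n). The sum is thus squeezed between multiples of the energy, whose
  limit is four times the integral of \<open>var_density\<close>; the factors 1 / (2 pi^2) and 1/2
  produce the stated value.\<close>

lemma window_variance:
 assumes K: "1 < K"
 shows "((\<lambda>T. (\<Sum>n\<in>WW K T. (norm (CC T n))\<^sup>2) / 2) \<longlongrightarrow> integral {1 / K..K} var_density / pi\<^sup>2) at_top"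
proof -
 define E where "E T = (\<Sum>n\<in>WW K T. energy (NN T) n) / (4 * pi\<^sup>2)" for T
 have "((\<lambda>T. \<Sum>n\<in>WW K T. energy (NN T) n) \<longlongrightarrow> 4 * integral {1 / K..K} var_density) at_top"
  by (rule filterlim_compose[OF energy_main_window[OF K] NN_at_top])
 then have "(E \<longlongrightarrow> 4 * integral {1 / K..K} var_density / (4 * pi\<^sup>2)) at_top"
  unfolding E_def[abs_def] by (intro tendsto_divide tendsto_const) auto
 then have E: "(E \<longlongrightarrow> integral {1 / K..K} var_density / pi\<^sup>2) at_top" by simp
 have sq: "(norm (CC T n))\<^sup>2 \<le> energy (NN T) n / (2 * pi\<^sup>2)" "(1 - 2 / T)\<^sup>2 * (energy (NN T) n / (2 * pi\<^sup>2)) \<le> (norm (CC T n))\<^sup>2"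
  if T: "2 \<le> T" and N: "1 < NN T" and n: "1 \<le> n" "real n \<le> T" for T n
 proof -
  define D where "D = var_density (real n / NN T) / (2 * pi\<^sup>2 * (NN T * ln (NN T)))"
  have D0: "0 \<le> D" using N by (simp add: D_def var_density_nonneg)
  have c: "(norm (CC T n))\<^sup>2 = (wt (HH T) n)\<^sup>2 * D" using norm_cf_square[OF N n(1)] by (simp add: D_def)
  have e: "energy (NN T) n / (2 * pi\<^sup>2) = (real (r2 n))\<^sup>2 * D" by (simp add: energy_def D_def)
  have H: "T ^ 8 \<le> real (HH T)" "0 < HH T" using HH_bounds[of T] T by auto
  have "(wt (HH T) n)\<^sup>2 \<le> (real (r2 n))\<^sup>2" using wt_le[OF H(2)] wt_nonneg by (intro power_mono) auto
  then show "(norm (CC T n))\<^sup>2 \<le> energy (NN T) n / (2 * pi\<^sup>2)" unfolding c e using D0 by (rule mult_right_mono)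
  have "sqrt (real n) \<le> real n" using n by (intro real_le_lsqrt) (auto simp: power2_eq_square)
  then have "2 * sqrt (real n) / real (HH T) \<le> 2 * T / T ^ 8" using n H T by (intro frac_le mult_left_mono) auto
  also have "\<dots> \<le> 2 * T / T ^ 2" using T power_increasing[of 2 8 T] by (intro divide_left_mono) auto
  also have "\<dots> = 2 / T" using T by (simp add: power2_eq_square)
  finally have "1 - 2 / T \<le> 1 - 2 * sqrt (real n) / real (HH T)" by simp
  then have "real (r2 n) * (1 - 2 / T) \<le> real (r2 n) * (1 - 2 * sqrt (real n) / real (HH T))" by (rule mult_left_mono) simp
  also have "\<dots> \<le> wt (HH T) n" by (rule wt_ge[OF H(2)])
  finally have "(real (r2 n) * (1 - 2 / T))\<^sup>2 \<le> (wt (HH T) n)\<^sup>2" using T by (intro power_mono) auto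
  from mult_right_mono[OF this D0] show "(1 - 2 / T)\<^sup>2 * (energy (NN T) n / (2 * pi\<^sup>2)) \<le> (norm (CC T n))\<^sup>2"
   unfolding c e by (simp add: power_mult_distrib mult_ac)
 qed
 have s: "(\<Sum>n\<in>WW K T. energy (NN T) n / (2 * pi\<^sup>2)) / 2 = E T" for T
  by (simp add: E_def sum_divide_distrib[symmetric])
 show ?thesis
 proof (rule tendsto_sandwich)
  show "\<forall>\<^sub>F T in at_top. (1 - 2 / T)\<^sup>2 * E T \<le> (\<Sum>n\<in>WW K T. (norm (CC T n))\<^sup>2) / 2"
   using window_facts[OF less_imp_le[OF K]] eventually_ge_at_top[of 2]
  proof eventually_elim
   case (elim T)
   have "(\<Sum>n\<in>WW K T. (1 - 2 / T)\<^sup>2 * (energy (NN T) n / (2 * pi\<^sup>2))) \<le> (\<Sum>n\<in>WW K T. (norm (CC T n))\<^sup>2)"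
    using elim by (intro sum_mono sq(2)) auto
   then show ?case unfolding sum_distrib_left[symmetric] s[symmetric] by simp
  qed
  show "\<forall>\<^sub>F T in at_top. (\<Sum>n\<in>WW K T. (norm (CC T n))\<^sup>2) / 2 \<le> E T"
   using window_facts[OF less_imp_le[OF K]] eventually_ge_at_top[of 2]
  proof eventually_elim
   case (elim T)
   have "(\<Sum>n\<in>WW K T. (norm (CC T n))\<^sup>2) \<le> (\<Sum>n\<in>WW K T. energy (NN T) n / (2 * pi\<^sup>2))"
    using elim by (intro sum_mono sq(1)) auto
   then show ?case unfolding s[symmetric] by simp
  qed
  have "((\<lambda>T::real. 2 / T) \<longlongrightarrow> 0) at_top" by real_asymp
  then have "((\<lambda>T. (1 - 2 / T)\<^sup>2 * E T) \<longlongrightarrow> (1 - 0)\<^sup>2 * (integral {1 / K..K} var_density / pi\<^sup>2)) at_top"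
   by (intro tendsto_intros E)
  then show "((\<lambda>T. (1 - 2 / T)\<^sup>2 * E T) \<longlongrightarrow> integral {1 / K..K} var_density / pi\<^sup>2) at_top" by simp
 qed (rule E)
qed

lemma window_clt:
 assumes K: "1 < K"
 shows "((\<lambda>T. \<integral>t. iexp (s * Re (trig (WW K T) (CC T) t)) \<partial>unif T) \<longlongrightarrow>
  of_real (exp (- s\<^sup>2 * (integral {1 / K..K} var_density / pi\<^sup>2) / 2))) at_top"
proof -
 have K1: "1 \<le> K" using K by simp
 obtain C where C: "\<And>N H q. 3 \<le> N \<Longrightarrow> 0 < H \<Longrightarrow> (\<Sum>n | n \<in> main_window K N \<and> squarefree_part n = q. norm (cf H N n)) \<le> C * N powr (- 1 / 16)"
  using main_window_square_class[OF K1] by blast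
 have "((\<lambda>N::real. N powr (- 1 / 16)) \<longlongrightarrow> 0) at_top" by (rule tendsto_neg_powr) (auto intro: filterlim_ident)
 from filterlim_compose[OF tendsto_mult_left[OF this, of C] NN_at_top]
 have B: "((\<lambda>T. C * NN T powr (- 1 / 16)) \<longlongrightarrow> 0) at_top" by simp
 have "((\<lambda>T. \<integral>t. exp (\<i> * of_real s * of_real (Re (trig (WW K T) (CC T) t))) \<partial>unif T) \<longlongrightarrow>
  of_real (exp (- s\<^sup>2 * (integral {1 / K..K} var_density / pi\<^sup>2) / 2))) at_top"
 proof (rule trig_clt[where M = "\<lambda>T. NN T ^ 4", OF _ _ _ B window_variance[OF K]])
  show "\<forall>\<^sub>F T in at_top. finite (WW K T) \<and> (\<forall>n\<in>WW K T. 1 \<le> n \<and> real n \<le> NN T ^ 4) \<and> 1 \<le> NN T ^ 4 \<and> (\<Sum>n\<in>WW K T. norm (CC T n)) \<le> NN T ^ 4"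
   using window_facts[OF K1] by eventually_elim (auto intro: one_le_power)
  show "((\<lambda>T. (NN T ^ 4) ^ j / T) \<longlongrightarrow> 0) at_top" for j unfolding power_mult[symmetric] by (rule NN_power_small)
  show "\<forall>\<^sub>F T in at_top. \<forall>q. (\<Sum>n | n \<in> WW K T \<and> squarefree_part n = q. norm (CC T n)) \<le> C * NN T powr (- 1 / 16)"
   using window_facts[OF K1] eventually_ge_at_top[of 1] by eventually_elim (use C HH_bounds in auto)
 qed
 then show ?thesis by (simp add: mult.assoc)
qed

text \<open>The constant is chosen before K, and T only has to be large depending on K. The diagonal
  splits into indices below the window, indices above it, and discarded squarefree parts. The first
  two give \<open>C1\<close> and \<open>C2\<close>; the third and the off-diagonal part tend to 0
  for fixed K and account for the summand 2.\<close>

lemma rest_mean_square: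
 "\<exists>C\<ge>0. \<forall>K>1. \<forall>\<^sub>F T in at_top. (\<integral>t. (norm (trig (UU T - WW K T) (CC T) t))\<^sup>2 \<partial>unif T) \<le> C / sqrt K"
proof -
 obtain C1 where C1: "C1 \<ge> 0" "\<And>K N S. 1 \<le> K \<Longrightarrow> 3 \<le> N \<Longrightarrow> K \<le> N \<Longrightarrow> finite S \<Longrightarrow> (\<forall>n\<in>S. 1 \<le> n \<and> real n \<le> N / K) \<Longrightarrow> (\<Sum>n\<in>S. energy N n) \<le> C1 / sqrt K"
  using energy_low by metis
 obtain C2 where C2: "C2 \<ge> 0" "\<And>K N S. 1 \<le> K \<Longrightarrow> 3 \<le> N \<Longrightarrow> K \<le> N \<Longrightarrow> finite S \<Longrightarrow> (\<forall>n\<in>S. K * N < real n) \<Longrightarrow> (\<Sum>n\<in>S. energy N n) \<le> C2 / sqrt K"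
  using energy_high by metis
 obtain C3 where C30: "C3 \<ge> 0" and C3all: "\<forall>L\<ge>1. \<forall>H>0. \<forall>N\<ge>3. \<forall>S\<subseteq>{1..L}.
   (\<Sum>m\<in>S. \<Sum>n\<in>S - {m}. norm (cf H N m) * norm (cf H N n) / \<bar>sqrt (real m) - sqrt (real n)\<bar>) \<le> C3 * real L powr (1 / 32) * sqrt N"
  using off_diagonal_le by (elim exE conjE) (rule that)
 note C3 = C30 C3all[rule_format]
 show ?thesis
 proof (intro exI[of _ "C1 + C2 + 2"] conjI allI impI)
  show "0 \<le> C1 + C2 + 2" using C1 C2 by simp
  fix K :: real assume K: "1 < K"
  then have K1: "1 \<le> K" "0 < 1 / sqrt K" by simp_all
  have "((\<lambda>T. \<Sum>n\<in>window K (NN T) - WW K T. energy (NN T) n) \<longlongrightarrow> 0) at_top"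
   by (rule filterlim_compose[OF energy_square_part[OF K1(1)] NN_at_top])
  from order_tendstoD(2)[OF this K1(2)]
  have sp: "\<forall>\<^sub>F T in at_top. (\<Sum>n\<in>window K (NN T) - WW K T. energy (NN T) n) < 1 / sqrt K" .
  have "((\<lambda>T. 8 * C3 * (sqrt (NN T ^ 1 / T))) \<longlongrightarrow> 8 * C3 * sqrt 0) at_top"
   by (intro tendsto_intros NN_power_small)
  then have "((\<lambda>T. 8 * C3 * (sqrt (NN T / T))) \<longlongrightarrow> 0) at_top" by simp
  from order_tendstoD(2)[OF this K1(2)]
  have od: "\<forall>\<^sub>F T in at_top. 8 * C3 * (sqrt (NN T / T)) < 1 / sqrt K" .
  show "\<forall>\<^sub>F T in at_top. (\<integral>t. (norm (trig (UU T - WW K T) (CC T) t))\<^sup>2 \<partial>unif T) \<le> (C1 + C2 + 2) / sqrt K"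
   using window_facts[OF K1(1)] sp od eventually_ge_at_top[of 1]
  proof eventually_elim
   case (elim T)
   define N where "N = NN T"
   define Z where "Z = UU T - WW K T"
   let ?O = "(\<Sum>m\<in>Z. \<Sum>n\<in>Z - {m}. norm (CC T m) * norm (CC T n) / \<bar>sqrt (real m) - sqrt (real n)\<bar>) / (pi * T)"
   have N: "3 \<le> N" "K \<le> N" "1 < N" "0 < N" using elim by (auto simp: N_def)
   have H: "0 < HH T" "real (HH T) \<le> 2 * T ^ 8" using HH_bounds elim by auto
   define Zl Zh where "Zl = {n \<in> Z. real n \<le> N / K}" and "Zh = {n \<in> Z. K * N < real n}"
   have fin: "finite Z" "finite Zl" "finite Zh" by (auto simp: Z_def Zl_def Zh_def)
   have sub: "Z \<subseteq> (Zl \<union> Zh) \<union> (window K N - WW K T)"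
    by (auto simp: Z_def Zl_def Zh_def window_def not_le)
   have en: "0 \<le> energy N n" for n using N by (intro energy_nonneg) simp
   have "(norm (CC T n))\<^sup>2 \<le> energy N n" if n: "n \<in> Z" for n
   proof -
    define D where "D = var_density (real n / N) / (N * ln N)"
    have D0: "0 \<le> D" using N by (simp add: D_def var_density_nonneg)
    have n1: "1 \<le> n" using n by (simp add: Z_def)
    have pi2: "1 \<le> 2 * pi\<^sup>2" using pi_ge_two power_mono[of 2 pi 2] by simp
    have "(norm (CC T n))\<^sup>2 = (wt (HH T) n)\<^sup>2 * D / (2 * pi\<^sup>2)"
     using norm_cf_square[of "NN T" n "HH T"] N n1 by (simp add: D_def N_def)
    also have "\<dots> \<le> (wt (HH T) n)\<^sup>2 * D / 1" using pi2 D0 by (intro divide_left_mono) auto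
    also have "\<dots> \<le> (real (r2 n))\<^sup>2 * D" using D0 wt_le[OF H(1), of n] wt_nonneg[of "HH T" n] by (simp add: mult_right_mono power_mono)
    finally show ?thesis by (simp add: energy_def D_def)
   qed
   then have "(\<Sum>n\<in>Z. (norm (CC T n))\<^sup>2) \<le> (\<Sum>n\<in>Z. energy N n)" by (rule sum_mono)
   also have "\<dots> \<le> (\<Sum>n\<in>(Zl \<union> Zh) \<union> (window K N - WW K T). energy N n)"
    using sub fin en by (intro sum_mono2) auto
   also have "\<dots> \<le> (\<Sum>n\<in>Zl \<union> Zh. energy N n) + (\<Sum>n\<in>window K N - WW K T. energy N n)"
    using fin en by (subst sum.union_inter[symmetric]) (auto intro!: sum_nonneg)
   also have "(\<Sum>n\<in>Zl \<union> Zh. energy N n) \<le> (\<Sum>n\<in>Zl. energy N n) + (\<Sum>n\<in>Zh. energy N n)"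
    using fin en by (subst sum.union_inter[symmetric]) (auto intro!: sum_nonneg)
   also have "(\<Sum>n\<in>Zl. energy N n) \<le> C1 / sqrt K"
    using fin N K1 by (intro C1(2)) (auto simp: Zl_def Z_def)
   also have "(\<Sum>n\<in>Zh. energy N n) \<le> C2 / sqrt K"
    using fin N K1 by (intro C2(2)) (auto simp: Zh_def)
   also have "(\<Sum>n\<in>window K N - WW K T. energy N n) \<le> 1 / sqrt K" using elim by (simp add: N_def)
   finally have diag: "(\<Sum>n\<in>Z. (norm (CC T n))\<^sup>2) \<le> (C1 + C2 + 1) / sqrt K" by (simp add: add_divide_distrib)
   have L1: "1 \<le> 2 * (HH T)\<^sup>2" using H by (simp add: Suc_le_eq)
   have "?O
    \<le> (C3 * real (2 * (HH T)\<^sup>2) powr (1 / 32) * sqrt N) / (1 * T)"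
    using elim pi_ge_two N unfolding N_def
    by (intro frac_le C3(2)[OF L1 H(1)] mult_right_mono mult_nonneg_nonneg C3(1)) (auto simp: Z_def)
   \<comment> \<open>All indices are at most 2 H^2 <= 8 T^16, whose power 1/32 is O(sqrt T).\<close>
   also have "real (2 * (HH T)\<^sup>2) powr (1 / 32) \<le> 8 * T powr (1 / 2)"
   proof -
    have "(real (HH T))\<^sup>2 \<le> (2 * T ^ 8)\<^sup>2" using H by (intro power_mono) auto
    then have "real (2 * (HH T)\<^sup>2) \<le> 8 * T ^ 16" by (simp add: power_mult_distrib flip: power_mult)
    then have "real (2 * (HH T)\<^sup>2) powr (1 / 32) \<le> (8 * T ^ 16) powr (1 / 32)" by (intro powr_mono2) auto
    also have "\<dots> = 8 powr (1 / 32) * (T powr 16) powr (1 / 32)" using elim by (simp add: powr_mult)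
    also have "\<dots> \<le> 8 powr 1 * T powr (1 / 2)" unfolding powr_powr using elim by (intro mult_mono powr_mono) auto
    finally show ?thesis by simp
   qed
   also have "C3 * (8 * T powr (1 / 2)) * sqrt N / (1 * T) = 8 * C3 * sqrt (N / T)"
   proof -
    have "T powr (1 / 2) / T = 1 / sqrt T" using elim by (simp add: powr_half_sqrt real_div_sqrt divide_eq_eq)
    have "C3 * (8 * T powr (1 / 2)) * sqrt N / (1 * T) = 8 * C3 * sqrt N * (T powr (1 / 2) / T)" by simp
    also have "\<dots> = 8 * C3 * sqrt N * (1 / sqrt T)" by (simp only: \<open>T powr (1 / 2) / T = 1 / sqrt T\<close>)
    finally show ?thesis by (simp add: real_sqrt_divide)
   qed
   finally have "?O \<le> 8 * C3 * sqrt (N / T)"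
    using C3(1) N elim by (simp add: divide_right_mono mult_left_mono mult_right_mono)
   also have "\<dots> \<le> 1 / sqrt K" using elim by (simp add: N_def)
   finally have off: "?O \<le> 1 / sqrt K" .
   have "(\<integral>t. (norm (trig Z (CC T) t))\<^sup>2 \<partial>unif T) \<le> (C1 + C2 + 1) / sqrt K + 1 / sqrt K"
    using mean_square_trig[of T Z "CC T"] diag off fin elim by linarith
   then show ?case by (simp add: Z_def add_divide_distrib)
  qed
 qed
qed

text \<open>K is chosen first, making the window variance close to 1 and the discarded mean square
  small; only then does T grow with K fixed. The uniform bound C / sqrt K makes this order of
  choices possible.\<close>

lemma trig_clt_limit:
 "((\<lambda>T. \<integral>t. iexp (s * Re (trig (UU T) (CC T) t)) \<partial>unif T) \<longlongrightarrow> of_real (exp (- s\<^sup>2 / 2))) at_top"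
proof (rule tendstoI)
 fix e :: real assume e: "0 < e"
 define v where "v K = integral {1 / K..K} var_density / pi\<^sup>2" for K
 obtain C where C: "C \<ge> 0" "\<And>K. 1 < K \<Longrightarrow> \<forall>\<^sub>F T in at_top. (\<integral>t. (norm (trig (UU T - WW K T) (CC T) t))\<^sup>2 \<partial>unif T) \<le> C / sqrt K"
  using rest_mean_square by blast
 have "(v \<longlongrightarrow> pi\<^sup>2 / pi\<^sup>2) at_top" unfolding v_def by (intro tendsto_divide integral_var_density_tendsto tendsto_const) simp
 then have v1: "(v \<longlongrightarrow> 1) at_top" by simp
 have "((\<lambda>K. exp (- s\<^sup>2 * v K / 2)) \<longlongrightarrow> exp (- s\<^sup>2 * 1 / 2)) at_top" by (intro tendsto_intros v1) simp
 then have "\<forall>\<^sub>F K in at_top. dist (exp (- s\<^sup>2 * v K / 2)) (exp (- s\<^sup>2 * 1 / 2)) < e / 3" using e by (intro tendstoD) auto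
 moreover have "((\<lambda>K. \<bar>s\<bar> * sqrt (C / sqrt K)) \<longlongrightarrow> \<bar>s\<bar> * sqrt 0) at_top"
 proof (intro tendsto_intros)
  show "((\<lambda>K. C / sqrt K) \<longlongrightarrow> 0) at_top" by real_asymp
 qed
 then have "\<forall>\<^sub>F K in at_top. \<bar>s\<bar> * sqrt (C / sqrt K) < e / 3" using e by (intro order_tendstoD(2)) auto
 ultimately have "\<forall>\<^sub>F K in at_top. dist (exp (- s\<^sup>2 * v K / 2)) (exp (- s\<^sup>2 * 1 / 2)) < e / 3 \<and> \<bar>s\<bar> * sqrt (C / sqrt K) < e / 3 \<and> 1 < K"
  using eventually_gt_at_top[of 1] by eventually_elim auto
 then obtain K where K: "dist (exp (- s\<^sup>2 * v K / 2)) (exp (- s\<^sup>2 / 2)) < e / 3" "\<bar>s\<bar> * sqrt (C / sqrt K) < e / 3" "1 < K"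
  unfolding eventually_at_top_linorder by auto
 have "\<forall>\<^sub>F T in at_top. dist (\<integral>t. iexp (s * Re (trig (WW K T) (CC T) t)) \<partial>unif T) (of_real (exp (- s\<^sup>2 * v K / 2))) < e / 3"
  unfolding v_def using e by (intro tendstoD window_clt K(3)) auto
 then show "\<forall>\<^sub>F T in at_top. dist (\<integral>t. iexp (s * Re (trig (UU T) (CC T) t)) \<partial>unif T) (of_real (exp (- s\<^sup>2 / 2))) < e"
  using C(2)[OF K(3)] window_facts[OF less_imp_le[OF K(3)]] eventually_gt_at_top[of 0]
 proof eventually_elim
  case (elim T)
  have [measurable]: "(\<lambda>t. Re (trig S c t)) \<in> borel_measurable borel" for S c
   by (rule measurable_compose[OF measurable_trig]) simp
  have sp: "Re (trig (UU T) (CC T) t) = Re (trig (WW K T) (CC T) t) + Re (trig (UU T - WW K T) (CC T) t)" for t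
  proof -
   have "trig (UU T) (CC T) t = trig (UU T - WW K T) (CC T) t + trig (WW K T) (CC T) t"
    unfolding trig_def using elim by (intro sum.subset_diff) auto
   then show ?thesis by simp
  qed
  have "norm ((\<integral>t. iexp (s * Re (trig (UU T) (CC T) t)) \<partial>unif T) - (\<integral>t. iexp (s * Re (trig (WW K T) (CC T) t)) \<partial>unif T)) \<le> \<bar>s\<bar> * sqrt (C / sqrt K)"
   by (rule integral_iexp_diff_L2[where S = "UU T - WW K T" and c = "CC T"]) (use elim sp in auto)
  then have 1: "dist (\<integral>t. iexp (s * Re (trig (UU T) (CC T) t)) \<partial>unif T) (\<integral>t. iexp (s * Re (trig (WW K T) (CC T) t)) \<partial>unif T) < e / 3"
   using K(2) by (simp add: dist_norm)
  have 2: "dist (of_real (exp (- s\<^sup>2 * v K / 2)) :: complex) (of_real (exp (- s\<^sup>2 / 2))) < e / 3" using K(1) by (simp only: dist_of_real)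
  from dist_triangle_third[OF 1 elim(1) 2] show ?case .
 qed
qed

text \<open>Since 1 / \<open>\<sigma>\<close> is at most N, the approximation error O(T^(-1/2))
  remains small after division by \<open>\<sigma>\<close>: it is O(sqrt(N^2 / T)). The exceptional
  set of measure at most 80 costs 160 / T, as two unimodular numbers differ by at most 2.\<close>

lemma annulus_char_limit:
 "((\<lambda>T. \<integral>t. iexp (s * (annulus_remainder t (\<rho> T) / \<sigma> T)) \<partial>unif T) \<longlongrightarrow> of_real (exp (- s\<^sup>2 / 2))) at_top"
proof -
 obtain C where C0: "C \<ge> 0" and Call: "\<forall>T r. 4 \<le> T \<longrightarrow> 0 < r \<longrightarrow> r < 1 \<longrightarrow> (\<exists>W \<in> sets borel. emeasure lborel W \<le> 80 \<and>
   (\<forall>H t. T ^ 8 \<le> real H \<longrightarrow> t \<in> {T..2 * T} - W \<longrightarrow> \<bar>annulus_remainder t r - (osc_sum H (t + r) - osc_sum H t)\<bar> \<le> C * T powr (- 1 / 2)))"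
  using annulus_remainder_osc_sum by (elim exE conjE) (rule that)
 define J where "J T = (\<integral>t. iexp (s * (annulus_remainder t (\<rho> T) / \<sigma> T)) \<partial>unif T)" for T
 define I where "I T = (\<integral>t. iexp (s * Re (trig (UU T) (CC T) t)) \<partial>unif T)" for T
 have bd: "\<forall>\<^sub>F T in at_top. norm (J T - I T) \<le> 2 * 80 / T + \<bar>s\<bar> * (C * sqrt (NN T ^ 2 / T))"
  using rho_less_1 window_facts[of 1, OF order_refl] eventually_ge_at_top[of 4]
 proof eventually_elim
  case (elim T)
  then have T: "0 < T" "4 \<le> T" "0 < \<rho> T" "\<rho> T < 1" by auto
  from Call[rule_format, OF T(2-4)] obtain W where W: "W \<in> sets borel" "emeasure lborel W \<le> 80"
   "\<And>H t. T ^ 8 \<le> real H \<Longrightarrow> t \<in> {T..2 * T} - W \<Longrightarrow> \<bar>annulus_remainder t (\<rho> T) - (osc_sum H (t + \<rho> T) - osc_sum H t)\<bar> \<le> C * T powr (- 1 / 2)"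
   by blast
  have N: "3 \<le> NN T" using elim by simp
  have sg: "sg (NN T) = \<sigma> T" "1 / sqrt (NN T) = \<rho> T" "0 < \<sigma> T" using sg_NN[OF T(1,4)] sigma[OF T(1,4)] by auto
  have X: "Re (trig (UU T) (CC T) t) = (osc_sum (HH T) (t + \<rho> T) - osc_sum (HH T) t) / \<sigma> T" for t
  proof -
   have "trig (UU T) (CC T) t = trig (UU T) (osc_coeff (HH T) (\<rho> T)) t / of_real (\<sigma> T)"
    unfolding trig_def cf_def sg sum_divide_distrib by simp
   then show ?thesis unfolding osc_sum_diff by (simp add: Re_divide_of_real)
  qed
  have [measurable]: "(\<lambda>t. Re (trig S c t)) \<in> borel_measurable borel" for S c
   by (rule measurable_compose[OF measurable_trig]) simp
  note [measurable] = measurable_annulus_remainder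
  have "1 / sqrt (NN T) \<le> 8 * ln (NN T) / sqrt (NN T)" using ln_ge_1[OF N] N by (intro divide_right_mono) auto
  then have "1 / NN T \<le> 8 * ln (NN T) / sqrt (NN T)"
  proof (rule order_trans[rotated])
   have "sqrt (NN T) \<le> NN T" using N by (intro real_le_lsqrt) (auto simp: power2_eq_square)
   then show "1 / NN T \<le> 1 / sqrt (NN T)" using N by (intro divide_left_mono) auto
  qed
  then have "sqrt (1 / NN T) \<le> sg (NN T)" unfolding sg_def by (rule real_sqrt_le_mono)
  then have "1 / sqrt (NN T) \<le> \<sigma> T" using sg by (simp add: real_sqrt_divide)
  then have "1 / \<sigma> T \<le> 1 / (1 / sqrt (NN T))" using N sg(3) by (intro divide_left_mono) auto
  also have "\<dots> = sqrt (NN T)" by simp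
  also have "\<dots> \<le> NN T" using N by (intro real_le_lsqrt) (auto simp: power2_eq_square)
  finally have s1: "1 / \<sigma> T \<le> NN T" .
  have "norm (J T - I T) \<le> 2 * 80 / T + \<bar>s\<bar> * (C * sqrt (NN T ^ 2 / T))"
   unfolding J_def I_def
  proof (rule integral_iexp_diff_le[OF T(1) _ _ W(1)])
   show "(\<lambda>t. annulus_remainder t (\<rho> T) / \<sigma> T) \<in> borel_measurable borel" by measurable
   show "(\<lambda>t. Re (trig (UU T) (CC T) t)) \<in> borel_measurable borel" by measurable
   show "emeasure lborel W \<le> ennreal 80" using W(2) by simp
   show "0 \<le> C * sqrt (NN T ^ 2 / T)" using C0 T by simp
   fix t assume t: "t \<in> {T..2 * T} - W"
   define R where "R = annulus_remainder t (\<rho> T) - (osc_sum (HH T) (t + \<rho> T) - osc_sum (HH T) t)"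
   have "T ^ 8 \<le> real (HH T)" using HH_bounds[of T] T by simp
   from W(3)[OF this t] have R: "\<bar>R\<bar> \<le> C * T powr (- 1 / 2)" by (simp only: R_def)
   have "\<bar>annulus_remainder t (\<rho> T) / \<sigma> T - Re (trig (UU T) (CC T) t)\<bar> = \<bar>R\<bar> * (1 / \<sigma> T)"
    unfolding X R_def using sg(3) by (simp add: diff_divide_distrib[symmetric] abs_divide)
   also have "\<dots> \<le> (C * T powr (- 1 / 2)) * NN T" using R s1 C0 sg(3) by (intro mult_mono) auto
   also have "\<dots> = C * sqrt (NN T ^ 2 / T)"
    using T N by (simp add: real_sqrt_divide powr_minus_divide powr_half_sqrt)
   finally show "\<bar>annulus_remainder t (\<rho> T) / \<sigma> T - Re (trig (UU T) (CC T) t)\<bar> \<le> C * sqrt (NN T ^ 2 / T)" .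
  qed simp
  then show ?case .
 qed
 have t0: "((\<lambda>T::real. 2 * 80 / T) \<longlongrightarrow> 0) at_top" by real_asymp
 have "((\<lambda>T. 2 * 80 / T + \<bar>s\<bar> * (C * sqrt (NN T ^ 2 / T))) \<longlongrightarrow> 0 + \<bar>s\<bar> * (C * sqrt 0)) at_top"
  by (intro tendsto_add[OF t0] tendsto_mult_left tendsto_real_sqrt NN_power_small)
 then have lim0: "((\<lambda>T. 2 * 80 / T + \<bar>s\<bar> * (C * sqrt (NN T ^ 2 / T))) \<longlongrightarrow> 0) at_top" by simp
 have "((\<lambda>T. J T - I T) \<longlongrightarrow> 0) at_top" by (rule Lim_null_comparison[OF bd lim0])
 moreover have "(I \<longlongrightarrow> of_real (exp (- s\<^sup>2 / 2))) at_top" unfolding I_def by (rule trig_clt_limit)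
 ultimately have "((\<lambda>T. (J T - I T) + I T) \<longlongrightarrow> 0 + of_real (exp (- s\<^sup>2 / 2))) at_top" by (rule tendsto_add)
 then show ?thesis by (simp add: J_def)
qed

end

text \<open>Endpoints carry no Gaussian mass, so every interval is a continuity set and weak
  convergence yields convergence of its measure.\<close>

lemma std_normal_distribution_frontier_interval:
 assumes "is_interval (A :: real set)" shows "emeasure std_normal_distribution (frontier A) = 0"
proof -
 have "negligible (frontier A)" using assms by (intro negligible_convex_frontier) (simp add: is_interval_convex_1)
 then have "frontier A \<in> null_sets lborel" by (simp add: negligible_iff_null_sets null_sets_completion_iff)
 moreover have "absolutely_continuous lborel std_normal_distribution" by (rule absolutely_continuousI_density) simp
 ultimately show ?thesis unfolding absolutely_continuous_def by auto
qed

lemma measure_std_normal_distribution: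
 assumes [measurable]: "A \<in> sets borel"
 shows "measure std_normal_distribution A = 1 / sqrt (2 * pi) * (LBINT x:A. exp (- x\<^sup>2 / 2))"
proof -
 have "measure std_normal_distribution A = (\<integral>x. indicator A x \<partial>std_normal_distribution)" by simp
 also have "\<dots> = (\<integral>x. std_normal_density x *\<^sub>R indicator A x \<partial>lborel)"
  by (rule integral_density) (auto simp: normal_density_nonneg)
 also have "\<dots> = (\<integral>x. 1 / sqrt (2 * pi) * (indicator A x *\<^sub>R exp (- x\<^sup>2 / 2)) \<partial>lborel)"
  by (intro Bochner_Integration.integral_cong refl) (simp add: std_normal_density_def)
 also have "\<dots> = 1 / sqrt (2 * pi) * (LBINT x:A. exp (- x\<^sup>2 / 2))"
  unfolding set_lebesgue_integral_def by (rule integral_mult_right_zero)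
 finally show ?thesis .
qed

theorem theorem1:
  fixes \<rho> \<sigma> :: "real \<Rightarrow> real" and A :: "real set"
  assumes rho_pos: "\<And>T. T > 0 \<Longrightarrow> \<rho> T > 0"
    and rho_tendsto_0: "(\<rho> \<longlongrightarrow> 0) at_top"
    and rho_lower: "\<And>\<delta>. \<delta> > 0 \<Longrightarrow> \<exists>c>0. \<forall>\<^sub>F T in at_top. \<rho> T \<ge> c * T powr (- \<delta>)"
    and sigma: "\<And>T. T > 0 \<Longrightarrow> \<rho> T < 1 \<Longrightarrow>
      \<sigma> T > 0 \<and> (\<sigma> T)\<^sup>2 = 16 * \<rho> T * ln (1 / \<rho> T)"
    and interval: "is_interval A"
  shows "((\<lambda>T. 1 / T * measure lebesgue {t \<in> {T..2 * T}. annulus_remainder t (\<rho> T) / \<sigma> T \<in> A})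
      \<longlongrightarrow> 1 / sqrt (2 * pi) * (LBINT x:A. exp (- x\<^sup>2 / 2))) at_top"
proof (rule tendsto_at_topI_sequentially)
 fix X :: "nat \<Rightarrow> real" assume X: "filterlim X at_top sequentially"
 have A [measurable]: "A \<in> sets borel" using interval by (rule real_interval_borel_measurable)
 note [measurable] = measurable_annulus_remainder
 define F where "F T t = annulus_remainder t (\<rho> T) / \<sigma> T" for T t
 have F [measurable]: "F T \<in> borel_measurable borel" for T unfolding F_def by measurable
 \<comment> \<open>Levy's theorem concerns sequences of probability distributions, so a sequence
   tending to infinity is fixed and cut off at 1: every member is then a probability measure, and
   finitely many values do not affect the limit.\<close>
 define M where "M n = distr (unif (max 1 (X n))) borel (F (max 1 (X n)))" for n
 have Xm: "filterlim (\<lambda>n. max 1 (X n)) at_top sequentially"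
  using X by (rule filterlim_at_top_mono) simp
 have rd: "real_distribution (M n)" for n
 proof -
  interpret prob_space "unif (max 1 (X n))" by (rule prob_space_unif) simp
  show ?thesis unfolding M_def by (rule real_distribution_distr) simp
 qed
 have "weak_conv_m M std_normal_distribution"
 proof (rule levy_continuity[OF rd real_dist_normal_dist])
  fix s :: real
  have "char (M n) s = (\<integral>t. iexp (s * F (max 1 (X n)) t) \<partial>unif (max 1 (X n)))" for n
   unfolding char_def M_def by (subst integral_distr) auto
  moreover have "((\<lambda>n. \<integral>t. iexp (s * F (max 1 (X n)) t) \<partial>unif (max 1 (X n))) \<longlongrightarrow> of_real (exp (- s\<^sup>2 / 2))) sequentially"
   unfolding F_def
   using filterlim_compose[OF annulus_char_limit[OF rho_pos rho_tendsto_0 rho_lower sigma] Xm] .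
  ultimately show "(\<lambda>n. char (M n) s) \<longlonglongrightarrow> char std_normal_distribution s"
   by (simp add: char_std_normal_distribution)
 qed
 from weak_conv_imp_continuity_set_conv[OF rd real_dist_normal_dist this A std_normal_distribution_frontier_interval[OF interval]]
 have lim: "(\<lambda>n. measure (M n) A) \<longlonglongrightarrow> 1 / sqrt (2 * pi) * (LBINT x:A. exp (- x\<^sup>2 / 2))"
  by (simp only: measure_std_normal_distribution[OF A])
 have eq: "measure (M n) A = 1 / X n * measure lebesgue {t \<in> {X n..2 * X n}. annulus_remainder t (\<rho> (X n)) / \<sigma> (X n) \<in> A}"
  if "1 \<le> X n" for n
 proof -
  define T where "T = X n"
  have T: "1 \<le> T" "max 1 (X n) = T" using that by (auto simp: T_def)
  have vs: "F T -` A \<in> sets borel" using measurable_sets[OF F A] by simp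
  have "measure (M n) A = measure (unif T) (F T -` A)" unfolding M_def T by (subst measure_distr) auto
  also have "\<dots> = measure lborel ({T..2 * T} \<inter> F T -` A) / T" using T vs by simp
  also have "{T..2 * T} \<inter> F T -` A = {t \<in> {T..2 * T}. F T t \<in> A}" by auto
  also have "measure lborel \<dots> = measure lebesgue {t \<in> {T..2 * T}. F T t \<in> A}"
  proof -
   have "{t \<in> {T..2 * T}. F T t \<in> A} = {T..2 * T} \<inter> F T -` A" by auto
   also have "\<dots> \<in> sets lborel" using vs by simp
   finally show ?thesis by (rule measure_completion[symmetric])
  qed
  finally show ?thesis by (simp add: T_def F_def)
 qed
 have "\<forall>\<^sub>F n in sequentially. 1 \<le> X n" using X unfolding filterlim_at_top by blast
 then have "\<forall>\<^sub>F n in sequentially. measure (M n) A = 1 / X n * measure lebesgue {t \<in> {X n..2 * X n}. annulus_remainder t (\<rho> (X n)) / \<sigma> (X n) \<in> A}"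
  by eventually_elim (rule eq)
 from Lim_transform_eventually[OF lim this]
 show "(\<lambda>n. 1 / X n * measure lebesgue {t \<in> {X n..2 * X n}. annulus_remainder t (\<rho> (X n)) / \<sigma> (X n) \<in> A})
   \<longlonglongrightarrow> 1 / sqrt (2 * pi) * (LBINT x:A. exp (- x\<^sup>2 / 2))" .
qed

end
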